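(* Let $\mathscr{J}$ be a system of arities in a symmetric monoidal closed category $\mathscr{V}$ such that $\mathscr{V}_0$ has pullbacks, and let $\mathscr{C}$ be a $\mathscr{J}$-admissible $\mathscr{V}$-category. The left face functor $L:\mathrm{BAlg}^{\mathrm{sc}}(\mathscr{C})\to\mathrm{Alg}^{\mathrm{s}}(\mathscr{C})$ has a fully faithful left adjoint $\mathsf{RCom}$, and the right face functor $R:\mathrm{BAlg}^{\mathrm{sc}}(\mathscr{C})\to\mathrm{Alg}^{\mathrm{s}}(\mathscr{C})^{\mathrm{op}}$ has a fully faithful right adjoint $\mathsf{LCom}$. The left adjoint $\mathsf{RCom}$ sends each algebra $(\mathscr{T},A)$ to a bifold algebra $\mathsf{RCom}(\mathscr{T},A)$ whose left face is $(\mathscr{T},A)$ and whose right face is the commutant $(\mathscr{T},A)^\perp=(\mathscr{T}^\perp_A,A^\perp)$ of $(\mathscr{T},A)$. The right adjoint $\mathsf{LCom}$ sends each algebra $(\mathscr{T},A)$ to a bifold algebra whose left face is $(\mathscr{T},A)^\perp$ and whose right face is $(\mathscr{T},A)$. Furthermore, the unit of $\mathsf{RCom}\dashv L$ and the counit of $R\dashv\mathsf{LCom}$ are identities, so $\mathsf{RCom}$ is a section of $L$ and $\mathsf{LCom}$ is a section of $R$. Also $$\bigcirc\circ\mathsf{RCom}=\mathsf{LCom}^{\mathrm{op}}\;:\;\mathrm{Alg}^{\mathrm{s}}(\mathscr{C})\to\mathrm{BAlg}^{\mathrm{sc}}(\mathscr{C})^{\mathrm{op}}.$$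
   Context: Base setting. $\mathscr{V}$ is a symmetric monoidal closed category with unit object $I$ and underlying ordinary category $\mathscr{V}_0$. By universe enlargement, $\mathscr{V}$ is a full subcategory of a symmetric monoidal closed category $\mathscr{V}'$ that is complete and cocomplete relative to a universe in which everything considered is small, with $\mathscr{V}\hookrightarrow\mathscr{V}'$ preserving all limits that exist in $\mathscr{V}$; $\mathscr{V}$-functor categories exist as $\mathscr{V}'$-categories. A system of arities is a fully faithful symmetric strong monoidal $\mathscr{V}$-functor $\mathscr{J}\to\mathscr{V}$, written as the inclusion of a full sub-$\mathscr{V}$-category containing $I$ and closed under $\otimes$ ($\mathscr{J}$ need not be small). A $\mathscr{J}$-cotensor in a $\mathscr{V}$-category is a cotensor $[J,C]$ with $J\in\mathrm{ob}\,\mathscr{J}$; $\mathscr{V}$-categories with $\mathscr{J}$-cotensors are equipped with designated ones, with $[I,C]=C$ (and identity counit). A $\mathscr{J}$-theory is a $\mathscr{V}$-category $\mathscr{T}$ equipped with an identity-on-objects $\mathscr{V}$-functor $\tau:\mathscr{J}^{\mathrm{op}}\to\mathscr{T}$ that preserves $\mathscr{J}$-cotensors; equivalently, $\mathrm{ob}\,\mathscr{T}=\mathrm{ob}\,\mathscr{J}$ and each object $J$ is equipped with a morphism $J\to\mathscr{T}(J,I)$ exhibiting $J$ as a cotensor $[J,I]$ in $\mathscr{T}$, which for $J=I$ is the identity on $I$. A morphism of $\mathscr{J}$-theories is a $\mathscr{V}$-functor commuting with the structure $\mathscr{V}$-functors $\tau$. For a $\mathscr{V}$-category $\mathscr{C}$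 with $\mathscr{J}$-cotensors, a $\mathscr{T}$-algebra in $\mathscr{C}$ is a $\mathscr{V}$-functor $A:\mathscr{T}\to\mathscr{C}$ preserving $\mathscr{J}$-cotensors; its carrier is $|A|=A(I)$. $\mathscr{T}\text{-}\mathrm{Alg}(\mathscr{C})$ is the full sub-$\mathscr{V}'$-category of $[\mathscr{T},\mathscr{C}]$ on the $\mathscr{T}$-algebras; for a morphism $f$ in it, $|f|=f_I$. $\mathscr{C}$ is $\mathscr{J}$-admissible if it has $\mathscr{J}$-cotensors and for every $\mathscr{J}$-theory $\mathscr{T}$ the ends defining the hom-objects of $\mathscr{T}\text{-}\mathrm{Alg}(\mathscr{C})$ exist in $\mathscr{V}$ (so it is a $\mathscr{V}$-category). $\mathscr{J}$-cotensors in $\mathscr{T}\text{-}\mathrm{Alg}(\mathscr{C})$ are pointwise, with designated ones chosen so that evaluation at $I$ sends them to the designated ones in $\mathscr{C}$. Strong morphisms. An algebra in $\mathscr{C}$ is a pair $(\mathscr{T},A)$ (also written $A$) with $\mathscr{T}$ a $\mathscr{J}$-theory and $A$ a $\mathscr{T}$-algebra in $\mathscr{C}$. $\mathrm{Alg}^{\mathrm{s}}(\mathscr{C})$ is the category of algebras, where a (strong) morphism $(M,f):(\mathscr{T},A)\to(\mathscr{U},B)$ consists of a morphism of $\mathscr{J}$-theories $M:\mathscr{T}\to\mathscr{U}$ and an isomorphism $f:A\to BM$ of $\mathscr{T}$-algebras; $(N,g)(M,f)=(NM,(gM)\cdot f)$. Commutants. The commutant of $(\mathscr{T},A)$ is the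 algebra $(\mathscr{T},A)^\perp=(\mathscr{T}^\perp_A,A^\perp)$, where $\mathscr{T}^\perp_A$ is the $\mathscr{J}$-theory with $\mathscr{T}^\perp_A(J,K)=\mathscr{T}\text{-}\mathrm{Alg}(\mathscr{C})([J,A],[K,A])$ for $J,K\in\mathrm{ob}\,\mathscr{J}$, with composition and identities as in $\mathscr{T}\text{-}\mathrm{Alg}(\mathscr{C})$ and structure morphisms $J\to\mathscr{T}\text{-}\mathrm{Alg}(\mathscr{C})([J,A],A)$ the cotensor counits, and $A^\perp:\mathscr{T}^\perp_A\to\mathscr{C}$ is the algebra on $|A|$ given on objects by $J\mapsto[J,|A|]$ and on homs by evaluation at $I$. Bifold algebras. For $\mathscr{J}$-theories $\mathscr{T},\mathscr{U}$, a $(\mathscr{T},\mathscr{U})$-algebra in $\mathscr{C}$ is a $\mathscr{V}$-functor $D:\mathscr{T}\otimes\mathscr{U}\to\mathscr{C}$ preserving $\mathscr{J}$-cotensors in each variable separately. A bifold algebra is a triple $(\mathscr{T},\mathscr{U},D)$ with $D$ such; its carrier is $|D|=D(I,I)$. Its left face is the algebra $(\mathscr{T},D_\ell)$ with $D_\ell=D(-,I)$, and its right face is $(\mathscr{U},D_r)$ with $D_r=D(I,-)$. $\mathrm{BAlg}^{\mathrm{sc}}(\mathscr{C})$ is the category of bifold algebras, where a (strong cross-)morphism $(M,N,f):(\mathscr{T},\mathscr{U},D)\to(\mathscr{T}',\mathscr{U}',D')$ consists of morphisms of $\mathscr{J}$-theories $M:\mathscr{T}\to\mathscr{T}'$ and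 $N:\mathscr{U}'\to\mathscr{U}$ and a $\mathscr{V}$-natural isomorphism $f_{JK}:D(J,NK)\to D'(MJ,K)$ ($J\in\mathscr{T}$, $K\in\mathscr{U}'$); the composite with $(M',N',f'):(\mathscr{T}',\mathscr{U}',D')\to(\mathscr{T}'',\mathscr{U}'',D'')$ is $(M'M,NN',g)$ with $g_{JK}=f'_{MJ,K}\cdot f_{J,N'K}$. Face functors. $L(\mathscr{T},\mathscr{U},D)=(\mathscr{T},D_\ell)$ and $L(M,N,f)=(M,f_{-,I})$; $R(\mathscr{T},\mathscr{U},D)=(\mathscr{U},D_r)$ and $R(M,N,f)=(N,(f_{I,-})^{-1}):(\mathscr{U}',D'_r)\to(\mathscr{U},D_r)$. For a $(\mathscr{T},\mathscr{U})$-algebra $D$, $D^\circ:\mathscr{U}\otimes\mathscr{T}\to\mathscr{C}$ is given by $D^\circ(K,J)=D(J,K)$. The isomorphism of categories $\bigcirc:\mathrm{BAlg}^{\mathrm{sc}}(\mathscr{C})\to\mathrm{BAlg}^{\mathrm{sc}}(\mathscr{C})^{\mathrm{op}}$ is given by $\bigcirc(\mathscr{T},\mathscr{U},D)=(\mathscr{U},\mathscr{T},D^\circ)$ and sends $(M,N,f):(\mathscr{T},\mathscr{U},D)\to(\mathscr{T}',\mathscr{U}',E)$ to $(N,M,(f^\circ)^{-1}):(\mathscr{U}',\mathscr{T}',E^\circ)\to(\mathscr{U},\mathscr{T},D^\circ)$, whose third component consists of the morphisms $f_{JK}^{-1}:E^\circ(K,MJ)=E(MJ,K)\to D(J,NK)=D^\circ(NK,J)$.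 *)

theory Defs
  imports "HOL-Library.FuncSet"
begin

section \<open>Ordinary categories, functors and adjunctions\<close>

record ('o, 'a) cat =
  Obj :: "'o set"
  Arr :: "'a set"
  Dom :: "'a \<Rightarrow> 'o"
  Cod :: "'a \<Rightarrow> 'o"
  Id :: "'o \<Rightarrow> 'a"
  Comp :: "'a \<Rightarrow> 'a \<Rightarrow> 'a" (infixr \<open>\<cdot>\<index>\<close> 65)

definition Hom :: "('o, 'a, 'x) cat_scheme \<Rightarrow> 'o \<Rightarrow> 'o \<Rightarrow> 'a set" where
  "Hom C X Y = {f \<in> Arr C. Dom C f = X \<and> Cod C f = Y}"

locale category =
  fixes C :: "('o, 'a, 'x) cat_scheme" (structure)
  assumes Dom_in: "f \<in> Arr C \<Longrightarrow> Dom C f \<in> Obj C"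
    and Cod_in: "f \<in> Arr C \<Longrightarrow> Cod C f \<in> Obj C"
    and Id_in: "X \<in> Obj C \<Longrightarrow> Id C X \<in> Hom C X X"
    and Comp_in: "\<lbrakk>f \<in> Hom C X Y; g \<in> Hom C Y Z\<rbrakk> \<Longrightarrow> g \<cdot> f \<in> Hom C X Z"
    and Id_left: "f \<in> Hom C X Y \<Longrightarrow> Id C Y \<cdot> f = f"
    and Id_right: "f \<in> Hom C X Y \<Longrightarrow> f \<cdot> Id C X = f"
    and Comp_assoc:
      "\<lbrakk>f \<in> Hom C W X; g \<in> Hom C X Y; h \<in> Hom C Y Z\<rbrakk> \<Longrightarrow> (h \<cdot> g) \<cdot> f = h \<cdot> (g \<cdot> f)"

definition inverse_pair :: "('o, 'a, 'x) cat_scheme \<Rightarrow> 'a \<Rightarrow> 'a \<Rightarrow> bool" where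
  "inverse_pair C f g \<longleftrightarrow> f \<in> Arr C \<and> g \<in> Hom C (Cod C f) (Dom C f) \<and>
     Comp C g f = Id C (Dom C f) \<and> Comp C f g = Id C (Cod C f)"

definition is_iso :: "('o, 'a, 'x) cat_scheme \<Rightarrow> 'a \<Rightarrow> bool" where
  "is_iso C f \<longleftrightarrow> (\<exists>g. inverse_pair C f g)"

definition inv_arr :: "('o, 'a, 'x) cat_scheme \<Rightarrow> 'a \<Rightarrow> 'a" where
  "inv_arr C f = (THE g. inverse_pair C f g)"

definition has_pullbacks :: "('o, 'a, 'x) cat_scheme \<Rightarrow> bool" where
  "has_pullbacks C \<longleftrightarrow> (\<forall>X Y Z. \<forall>f \<in> Hom C X Z. \<forall>g \<in> Hom C Y Z.
     \<exists>P. \<exists>p \<in> Hom C P X. \<exists>q \<in> Hom C P Y. Comp C f p = Comp C g q \<and>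
       (\<forall>Q. \<forall>u \<in> Hom C Q X. \<forall>v \<in> Hom C Q Y. Comp C f u = Comp C g v \<longrightarrow>
          (\<exists>!h. h \<in> Hom C Q P \<and> Comp C p h = u \<and> Comp C q h = v)))"

definition op_cat :: "('o, 'a) cat \<Rightarrow> ('o, 'a) cat" where
  "op_cat C = \<lparr>Obj = Obj C, Arr = Arr C, Dom = Cod C, Cod = Dom C, Id = Id C,
     Comp = (\<lambda>g f. Comp C f g)\<rparr>"

record ('o, 'a, 'p, 'b) fnctr =
  onObj :: "'o \<Rightarrow> 'p"
  onArr :: "'a \<Rightarrow> 'b"

definition is_functor ::
  "('o, 'a) cat \<Rightarrow> ('p, 'b) cat \<Rightarrow> ('o, 'a, 'p, 'b) fnctr \<Rightarrow> bool" where
  "is_functor A B F \<longleftrightarrow> category A \<and> category B \<and>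
     (\<forall>X \<in> Obj A. onObj F X \<in> Obj B) \<and>
     (\<forall>X Y. \<forall>f \<in> Hom A X Y. onArr F f \<in> Hom B (onObj F X) (onObj F Y)) \<and>
     (\<forall>X \<in> Obj A. onArr F (Id A X) = Id B (onObj F X)) \<and>
     (\<forall>X Y Z. \<forall>f \<in> Hom A X Y. \<forall>g \<in> Hom A Y Z.
        onArr F (Comp A g f) = Comp B (onArr F g) (onArr F f))"

definition id_fnctr :: "('o, 'a, 'o, 'a) fnctr" where
  "id_fnctr = \<lparr>onObj = (\<lambda>X. X), onArr = (\<lambda>f. f)\<rparr>"

definition comp_fnctr ::
  "('p, 'b, 'q, 'c) fnctr \<Rightarrow> ('o, 'a, 'p, 'b) fnctr \<Rightarrow> ('o, 'a, 'q, 'c) fnctr" where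
  "comp_fnctr G F = \<lparr>onObj = (\<lambda>X. onObj G (onObj F X)), onArr = (\<lambda>f. onArr G (onArr F f))\<rparr>"

text \<open>
  The functor \<open>F\<^sup>o\<^sup>p\<close> from \<open>op_cat A\<close> to \<open>op_cat B\<close> has the same underlying maps as \<open>F\<close>.
\<close>

definition op_fnctr :: "('o, 'a, 'p, 'b) fnctr \<Rightarrow> ('o, 'a, 'p, 'b) fnctr" where
  "op_fnctr F = F"

text \<open>
  Functors are total functions in HOL, so equality of functors from \<open>A\<close> to \<open>B\<close> is agreement on
  the objects and arrows of \<open>A\<close>.
\<close>

definition fnctr_eq ::
  "('o, 'a) cat \<Rightarrow> ('p, 'b) cat \<Rightarrow> ('o, 'a, 'p, 'b) fnctr \<Rightarrow> ('o, 'a, 'p, 'b) fnctr \<Rightarrow> bool" where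
  "fnctr_eq A B F G \<longleftrightarrow> is_functor A B F \<and> is_functor A B G \<and>
     (\<forall>X \<in> Obj A. onObj F X = onObj G X) \<and> (\<forall>f \<in> Arr A. onArr F f = onArr G f)"

definition is_nat_trans ::
  "('o, 'a) cat \<Rightarrow> ('p, 'b) cat \<Rightarrow> ('o, 'a, 'p, 'b) fnctr \<Rightarrow> ('o, 'a, 'p, 'b) fnctr \<Rightarrow>
   ('o \<Rightarrow> 'b) \<Rightarrow> bool" where
  "is_nat_trans A B F G \<alpha> \<longleftrightarrow>
     (\<forall>X \<in> Obj A. \<alpha> X \<in> Hom B (onObj F X) (onObj G X)) \<and>
     (\<forall>X Y. \<forall>f \<in> Hom A X Y. Comp B (\<alpha> Y) (onArr F f) = Comp B (onArr G f) (\<alpha> X))"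

text \<open>\<open>F : A \<rightarrow> B\<close> is left adjoint to \<open>G : B \<rightarrow> A\<close> with unit \<open>\<eta>\<close> and counit \<open>\<epsilon>\<close>.\<close>

definition adjunction ::
  "('o, 'a) cat \<Rightarrow> ('p, 'b) cat \<Rightarrow> ('o, 'a, 'p, 'b) fnctr \<Rightarrow> ('p, 'b, 'o, 'a) fnctr \<Rightarrow>
   ('o \<Rightarrow> 'a) \<Rightarrow> ('p \<Rightarrow> 'b) \<Rightarrow> bool" where
  "adjunction A B F G \<eta> \<epsilon> \<longleftrightarrow> is_functor A B F \<and> is_functor B A G \<and>
     is_nat_trans A A id_fnctr (comp_fnctr G F) \<eta> \<and>
     is_nat_trans B B (comp_fnctr F G) id_fnctr \<epsilon> \<and>
     (\<forall>X \<in> Obj A. Comp B (\<epsilon> (onObj F X)) (onArr F (\<eta> X)) = Id B (onObj F X)) \<and>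
     (\<forall>Y \<in> Obj B. Comp A (onArr G (\<epsilon> Y)) (\<eta> (onObj G Y)) = Id A (onObj G Y))"

definition fully_faithful ::
  "('o, 'a) cat \<Rightarrow> ('p, 'b) cat \<Rightarrow> ('o, 'a, 'p, 'b) fnctr \<Rightarrow> bool" where
  "fully_faithful A B F \<longleftrightarrow> is_functor A B F \<and>
     (\<forall>X \<in> Obj A. \<forall>Y \<in> Obj A.
        bij_betw (onArr F) (Hom A X Y) (Hom B (onObj F X) (onObj F Y)))"


section \<open>Symmetric monoidal closed categories\<close>

text \<open>
  \<open>TenO\<close> and \<open>TenA\<close> are the tensor product on objects and on arrows, \<open>Assoc X Y Z\<close> goes from
  \<open>(X \<otimes> Y) \<otimes> Z\<close> to \<open>X \<otimes> (Y \<otimes> Z)\<close>, and \<open>Ev X Y : [X,Y] \<otimes> X \<rightarrow> Y\<close>.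
\<close>

record ('v, 'm) smc = "('v, 'm) cat" +
  TenO :: "'v \<Rightarrow> 'v \<Rightarrow> 'v" (infixr \<open>\<otimes>\<index>\<close> 75)
  TenA :: "'m \<Rightarrow> 'm \<Rightarrow> 'm" (infixr \<open>\<boxtimes>\<index>\<close> 70)
  Unit :: "'v" (\<open>\<one>\<index>\<close>)
  Assoc :: "'v \<Rightarrow> 'v \<Rightarrow> 'v \<Rightarrow> 'm"
  Lun :: "'v \<Rightarrow> 'm"
  Run :: "'v \<Rightarrow> 'm"
  Sym :: "'v \<Rightarrow> 'v \<Rightarrow> 'm"
  Ihom :: "'v \<Rightarrow> 'v \<Rightarrow> 'v"
  Ev :: "'v \<Rightarrow> 'v \<Rightarrow> 'm"

locale symmetric_monoidal_closed = category V
  for V :: "('v, 'm) smc" (structure) +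
  assumes TenO_in: "\<lbrakk>X \<in> Obj V; Y \<in> Obj V\<rbrakk> \<Longrightarrow> X \<otimes> Y \<in> Obj V"
    and TenA_in: "\<lbrakk>f \<in> Hom V X X'; g \<in> Hom V Y Y'\<rbrakk> \<Longrightarrow> f \<boxtimes> g \<in> Hom V (X \<otimes> Y) (X' \<otimes> Y')"
    and TenA_Id: "\<lbrakk>X \<in> Obj V; Y \<in> Obj V\<rbrakk> \<Longrightarrow> Id V X \<boxtimes> Id V Y = Id V (X \<otimes> Y)"
    and TenA_Comp:
      "\<lbrakk>f \<in> Hom V X X'; f' \<in> Hom V X' X''; g \<in> Hom V Y Y'; g' \<in> Hom V Y' Y''\<rbrakk> \<Longrightarrow>
         (f' \<cdot> f) \<boxtimes> (g' \<cdot> g) = (f' \<boxtimes> g') \<cdot> (f \<boxtimes> g)"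
    and Unit_in: "\<one> \<in> Obj V"
    and Assoc_in: "\<lbrakk>X \<in> Obj V; Y \<in> Obj V; Z \<in> Obj V\<rbrakk> \<Longrightarrow>
         Assoc V X Y Z \<in> Hom V ((X \<otimes> Y) \<otimes> Z) (X \<otimes> (Y \<otimes> Z))"
    and Assoc_iso: "\<lbrakk>X \<in> Obj V; Y \<in> Obj V; Z \<in> Obj V\<rbrakk> \<Longrightarrow> is_iso V (Assoc V X Y Z)"
    and Assoc_natural: "\<lbrakk>f \<in> Hom V X X'; g \<in> Hom V Y Y'; h \<in> Hom V Z Z'\<rbrakk> \<Longrightarrow>
         Assoc V X' Y' Z' \<cdot> ((f \<boxtimes> g) \<boxtimes> h) = (f \<boxtimes> (g \<boxtimes> h)) \<cdot> Assoc V X Y Z"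
    and Lun_in: "X \<in> Obj V \<Longrightarrow> Lun V X \<in> Hom V (\<one> \<otimes> X) X"
    and Lun_iso: "X \<in> Obj V \<Longrightarrow> is_iso V (Lun V X)"
    and Lun_natural: "f \<in> Hom V X Y \<Longrightarrow> Lun V Y \<cdot> (Id V \<one> \<boxtimes> f) = f \<cdot> Lun V X"
    and Run_in: "X \<in> Obj V \<Longrightarrow> Run V X \<in> Hom V (X \<otimes> \<one>) X"
    and Run_iso: "X \<in> Obj V \<Longrightarrow> is_iso V (Run V X)"
    and Run_natural: "f \<in> Hom V X Y \<Longrightarrow> Run V Y \<cdot> (f \<boxtimes> Id V \<one>) = f \<cdot> Run V X"
    and Sym_in: "\<lbrakk>X \<in> Obj V; Y \<in> Obj V\<rbrakk> \<Longrightarrow> Sym V X Y \<in> Hom V (X \<otimes> Y) (Y \<otimes> X)"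
    and Sym_natural: "\<lbrakk>f \<in> Hom V X X'; g \<in> Hom V Y Y'\<rbrakk> \<Longrightarrow>
         Sym V X' Y' \<cdot> (f \<boxtimes> g) = (g \<boxtimes> f) \<cdot> Sym V X Y"
    and Sym_Sym: "\<lbrakk>X \<in> Obj V; Y \<in> Obj V\<rbrakk> \<Longrightarrow> Sym V Y X \<cdot> Sym V X Y = Id V (X \<otimes> Y)"
    and pentagon: "\<lbrakk>W \<in> Obj V; X \<in> Obj V; Y \<in> Obj V; Z \<in> Obj V\<rbrakk> \<Longrightarrow>
         (Id V W \<boxtimes> Assoc V X Y Z) \<cdot> Assoc V W (X \<otimes> Y) Z \<cdot> (Assoc V W X Y \<boxtimes> Id V Z)
           = Assoc V W X (Y \<otimes> Z) \<cdot> Assoc V (W \<otimes> X) Y Z"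
    and triangle: "\<lbrakk>X \<in> Obj V; Y \<in> Obj V\<rbrakk> \<Longrightarrow>
         (Id V X \<boxtimes> Lun V Y) \<cdot> Assoc V X \<one> Y = Run V X \<boxtimes> Id V Y"
    and hexagon: "\<lbrakk>X \<in> Obj V; Y \<in> Obj V; Z \<in> Obj V\<rbrakk> \<Longrightarrow>
         Assoc V Y Z X \<cdot> Sym V X (Y \<otimes> Z) \<cdot> Assoc V X Y Z
           = (Id V Y \<boxtimes> Sym V X Z) \<cdot> Assoc V Y X Z \<cdot> (Sym V X Y \<boxtimes> Id V Z)"
    and Ihom_in: "\<lbrakk>X \<in> Obj V; Y \<in> Obj V\<rbrakk> \<Longrightarrow> Ihom V X Y \<in> Obj V"
    and Ev_in: "\<lbrakk>X \<in> Obj V; Y \<in> Obj V\<rbrakk> \<Longrightarrow> Ev V X Y \<in> Hom V (Ihom V X Y \<otimes> X) Y"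
    and Ev_universal: "\<lbrakk>X \<in> Obj V; Y \<in> Obj V; Z \<in> Obj V; f \<in> Hom V (Z \<otimes> X) Y\<rbrakk> \<Longrightarrow>
         \<exists>!g. g \<in> Hom V Z (Ihom V X Y) \<and> Ev V X Y \<cdot> (g \<boxtimes> Id V X) = f"


section \<open>Enriched categories\<close>

text \<open>
  \<open>vcomp x y z : hom(y,z) \<otimes> hom(x,y) \<rightarrow> hom(x,z)\<close>.  The objects may be of any type, but all
  hom-objects lie in \<open>V\<close>.
\<close>

record ('v, 'm, 'b) vcat =
  vob :: "'b set"
  vhom :: "'b \<Rightarrow> 'b \<Rightarrow> 'v"
  vid :: "'b \<Rightarrow> 'm"
  vcomp :: "'b \<Rightarrow> 'b \<Rightarrow> 'b \<Rightarrow> 'm"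

record ('m, 'b, 'c) vfun =
  fob :: "'b \<Rightarrow> 'c"
  fhom :: "'b \<Rightarrow> 'b \<Rightarrow> 'm"

text \<open>
  Theories, algebras and their morphisms occur as objects and arrows of categories, so equality of
  such data must not see values outside the carriers: these are fixed to be \<^term>\<open>undefined\<close>.
\<close>

definition res2 :: "'b set \<Rightarrow> ('b \<Rightarrow> 'b \<Rightarrow> 'd) \<Rightarrow> 'b \<Rightarrow> 'b \<Rightarrow> 'd" where
  "res2 S f = (\<lambda>x y. if x \<in> S \<and> y \<in> S then f x y else undefined)"

definition res3 :: "'b set \<Rightarrow> ('b \<Rightarrow> 'b \<Rightarrow> 'b \<Rightarrow> 'd) \<Rightarrow> 'b \<Rightarrow> 'b \<Rightarrow> 'b \<Rightarrow> 'd" where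
  "res3 S f = (\<lambda>x y z. if x \<in> S \<and> y \<in> S \<and> z \<in> S then f x y z else undefined)"

definition vcat_extensional :: "('v, 'm, 'b) vcat \<Rightarrow> bool" where
  "vcat_extensional B \<longleftrightarrow> vhom B = res2 (vob B) (vhom B) \<and> vid B \<in> extensional (vob B) \<and>
     vcomp B = res3 (vob B) (vcomp B)"

context
  fixes V :: "('v, 'm) smc" (structure)
begin

definition vcategory :: "('v, 'm, 'b) vcat \<Rightarrow> bool" where
  "vcategory B \<longleftrightarrow>
     (\<forall>x \<in> vob B. \<forall>y \<in> vob B. vhom B x y \<in> Obj V) \<and>
     (\<forall>x \<in> vob B. vid B x \<in> Hom V \<one> (vhom B x x)) \<and>
     (\<forall>x \<in> vob B. \<forall>y \<in> vob B. \<forall>z \<in> vob B.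
        vcomp B x y z \<in> Hom V (vhom B y z \<otimes> vhom B x y) (vhom B x z)) \<and>
     (\<forall>w \<in> vob B. \<forall>x \<in> vob B. \<forall>y \<in> vob B. \<forall>z \<in> vob B.
        vcomp B w y z \<cdot> (Id V (vhom B y z) \<boxtimes> vcomp B w x y)
            \<cdot> Assoc V (vhom B y z) (vhom B x y) (vhom B w x)
          = vcomp B w x z \<cdot> (vcomp B x y z \<boxtimes> Id V (vhom B w x))) \<and>
     (\<forall>x \<in> vob B. \<forall>y \<in> vob B.
        vcomp B x y y \<cdot> (vid B y \<boxtimes> Id V (vhom B x y)) = Lun V (vhom B x y) \<and>
        vcomp B x x y \<cdot> (Id V (vhom B x y) \<boxtimes> vid B x) = Run V (vhom B x y))"

definition vfunctor :: "('v, 'm, 'b) vcat \<Rightarrow> ('v, 'm, 'c) vcat \<Rightarrow> ('m, 'b, 'c) vfun \<Rightarrow> bool" where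
  "vfunctor B C F \<longleftrightarrow>
     fob F \<in> vob B \<rightarrow>\<^sub>E vob C \<and> fhom F = res2 (vob B) (fhom F) \<and>
     (\<forall>x \<in> vob B. \<forall>y \<in> vob B. fhom F x y \<in> Hom V (vhom B x y) (vhom C (fob F x) (fob F y))) \<and>
     (\<forall>x \<in> vob B. fhom F x x \<cdot> vid B x = vid C (fob F x)) \<and>
     (\<forall>x \<in> vob B. \<forall>y \<in> vob B. \<forall>z \<in> vob B.
        fhom F x z \<cdot> vcomp B x y z
          = vcomp C (fob F x) (fob F y) (fob F z) \<cdot> (fhom F y z \<boxtimes> fhom F x y))"

definition id_vfun :: "('v, 'm, 'b) vcat \<Rightarrow> ('m, 'b, 'b) vfun" where
  "id_vfun B = \<lparr>fob = (\<lambda>x \<in> vob B. x), fhom = res2 (vob B) (\<lambda>x y. Id V (vhom B x y))\<rparr>"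

text \<open>The composite \<open>G \<circ> F\<close> of \<open>V\<close>-functors, where \<open>B\<close> is the domain of \<open>F\<close>.\<close>

definition comp_vfun ::
  "('v, 'm, 'b) vcat \<Rightarrow> ('m, 'c, 'd) vfun \<Rightarrow> ('m, 'b, 'c) vfun \<Rightarrow> ('m, 'b, 'd) vfun" where
  "comp_vfun B G F = \<lparr>fob = (\<lambda>x \<in> vob B. fob G (fob F x)),
     fhom = res2 (vob B) (\<lambda>x y. fhom G (fob F x) (fob F y) \<cdot> fhom F x y)\<rparr>"

text \<open>
  Composition and inverses in the underlying ordinary category of \<open>C\<close>, whose arrows from \<open>x\<close> to
  \<open>y\<close> are the arrows \<open>I \<rightarrow> hom(x,y)\<close> of \<open>V\<close>.
\<close>

definition ucomp :: "('v, 'm, 'c) vcat \<Rightarrow> 'c \<Rightarrow> 'c \<Rightarrow> 'c \<Rightarrow> 'm \<Rightarrow> 'm \<Rightarrow> 'm" where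
  "ucomp C x y z g f = vcomp C x y z \<cdot> (g \<boxtimes> f) \<cdot> inv_arr V (Lun V \<one>)"

definition uinv :: "('v, 'm, 'c) vcat \<Rightarrow> 'c \<Rightarrow> 'c \<Rightarrow> 'm \<Rightarrow> 'm" where
  "uinv C x y f = (THE g. g \<in> Hom V \<one> (vhom C y x) \<and>
     ucomp C x y x g f = vid C x \<and> ucomp C y x y f g = vid C y)"

definition vnat ::
  "('v, 'm, 'b) vcat \<Rightarrow> ('v, 'm, 'c) vcat \<Rightarrow> ('m, 'b, 'c) vfun \<Rightarrow> ('m, 'b, 'c) vfun \<Rightarrow>
   ('b \<Rightarrow> 'm) \<Rightarrow> bool" where
  "vnat B C F G \<alpha> \<longleftrightarrow> \<alpha> \<in> extensional (vob B) \<and>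
     (\<forall>x \<in> vob B. \<alpha> x \<in> Hom V \<one> (vhom C (fob F x) (fob G x))) \<and>
     (\<forall>x \<in> vob B. \<forall>y \<in> vob B.
        vcomp C (fob F x) (fob F y) (fob G y) \<cdot> (\<alpha> y \<boxtimes> fhom F x y) \<cdot> inv_arr V (Lun V (vhom B x y))
          = vcomp C (fob F x) (fob G x) (fob G y) \<cdot> (fhom G x y \<boxtimes> \<alpha> x)
              \<cdot> inv_arr V (Run V (vhom B x y)))"

definition vnat_iso ::
  "('v, 'm, 'b) vcat \<Rightarrow> ('v, 'm, 'c) vcat \<Rightarrow> ('m, 'b, 'c) vfun \<Rightarrow> ('m, 'b, 'c) vfun \<Rightarrow>
   ('b \<Rightarrow> 'm) \<Rightarrow> bool" where
  "vnat_iso B C F G \<alpha> \<longleftrightarrow> vnat B C F G \<alpha> \<and>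
     (\<exists>\<beta>. vnat B C G F \<beta> \<and> (\<forall>x \<in> vob B.
        ucomp C (fob F x) (fob G x) (fob F x) (\<beta> x) (\<alpha> x) = vid C (fob F x) \<and>
        ucomp C (fob G x) (fob F x) (fob G x) (\<alpha> x) (\<beta> x) = vid C (fob G x)))"

definition vop :: "('v, 'm, 'b) vcat \<Rightarrow> ('v, 'm, 'b) vcat" where
  "vop B = \<lparr>vob = vob B, vhom = (\<lambda>x y. vhom B y x), vid = vid B,
     vcomp = (\<lambda>x y z. vcomp B z y x \<cdot> Sym V (vhom B z y) (vhom B y x))\<rparr>"

definition curry_arr :: "'v \<Rightarrow> 'v \<Rightarrow> 'v \<Rightarrow> 'm \<Rightarrow> 'm" where
  "curry_arr Z X Y f = (THE g. g \<in> Hom V Z (Ihom V X Y) \<and> Ev V X Y \<cdot> (g \<boxtimes> Id V X) = f)"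

text \<open>The full sub-\<open>V\<close>-category of \<open>V\<close> on a set of objects.\<close>

definition vfull :: "'v set \<Rightarrow> ('v, 'm, 'v) vcat" where
  "vfull J = \<lparr>vob = J, vhom = Ihom V,
     vid = (\<lambda>X. curry_arr \<one> X X (Lun V X)),
     vcomp = (\<lambda>X Y Z. curry_arr (Ihom V Y Z \<otimes> Ihom V X Y) X Z
       (Ev V Y Z \<cdot> (Id V (Ihom V Y Z) \<boxtimes> Ev V X Y) \<cdot> Assoc V (Ihom V Y Z) (Ihom V X Y) X))\<rparr>"

text \<open>The middle interchange \<open>(A \<otimes> B) \<otimes> (C \<otimes> D) \<rightarrow> (A \<otimes> C) \<otimes> (B \<otimes> D)\<close>.\<close>

definition interchange :: "'v \<Rightarrow> 'v \<Rightarrow> 'v \<Rightarrow> 'v \<Rightarrow> 'm" where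
  "interchange A B C D = inv_arr V (Assoc V A C (B \<otimes> D)) \<cdot>
     (Id V A \<boxtimes> (Assoc V C B D \<cdot> (Sym V B C \<boxtimes> Id V D) \<cdot> inv_arr V (Assoc V B C D))) \<cdot>
     Assoc V A B (C \<otimes> D)"

definition vtensor :: "('v, 'm, 'b) vcat \<Rightarrow> ('v, 'm, 'c) vcat \<Rightarrow> ('v, 'm, 'b \<times> 'c) vcat" where
  "vtensor B C = \<lparr>vob = vob B \<times> vob C,
     vhom = (\<lambda>(x, x') (y, y'). vhom B x y \<otimes> vhom C x' y'),
     vid = (\<lambda>(x, x'). (vid B x \<boxtimes> vid C x') \<cdot> inv_arr V (Lun V \<one>)),
     vcomp = (\<lambda>(x, x') (y, y') (z, z'). (vcomp B x y z \<boxtimes> vcomp C x' y' z') \<cdot>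
       interchange (vhom B y z) (vhom C y' z') (vhom B x y) (vhom C x' y'))\<rparr>"

definition vfun_tensor ::
  "('v, 'm, 'b) vcat \<Rightarrow> ('v, 'm, 'c) vcat \<Rightarrow> ('m, 'b, 'd) vfun \<Rightarrow> ('m, 'c, 'e) vfun \<Rightarrow>
   ('m, 'b \<times> 'c, 'd \<times> 'e) vfun" where
  "vfun_tensor B C F G = \<lparr>fob = (\<lambda>(x, x') \<in> vob B \<times> vob C. (fob F x, fob G x')),
     fhom = res2 (vob B \<times> vob C) (\<lambda>(x, x') (y, y'). fhom F x y \<boxtimes> fhom G x' y')\<rparr>"

text \<open>The partial \<open>V\<close>-functors \<open>D(-,k) : B \<rightarrow> E\<close> and \<open>D(j,-) : C \<rightarrow> E\<close> of \<open>D : B \<otimes> C \<rightarrow> E\<close>.\<close>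

definition fix_right ::
  "('v, 'm, 'b) vcat \<Rightarrow> ('v, 'm, 'c) vcat \<Rightarrow> ('m, 'b \<times> 'c, 'e) vfun \<Rightarrow> 'c \<Rightarrow> ('m, 'b, 'e) vfun" where
  "fix_right B C D k = \<lparr>fob = (\<lambda>x \<in> vob B. fob D (x, k)),
     fhom = res2 (vob B) (\<lambda>x y. fhom D (x, k) (y, k) \<cdot> (Id V (vhom B x y) \<boxtimes> vid C k)
       \<cdot> inv_arr V (Run V (vhom B x y)))\<rparr>"

definition fix_left ::
  "('v, 'm, 'b) vcat \<Rightarrow> ('v, 'm, 'c) vcat \<Rightarrow> ('m, 'b \<times> 'c, 'e) vfun \<Rightarrow> 'b \<Rightarrow> ('m, 'c, 'e) vfun" where
  "fix_left B C D j = \<lparr>fob = (\<lambda>x \<in> vob C. fob D (j, x)),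
     fhom = res2 (vob C) (\<lambda>x y. fhom D (j, x) (j, y) \<cdot> (vid B j \<boxtimes> Id V (vhom C x y))
       \<cdot> inv_arr V (Lun V (vhom C x y)))\<rparr>"

definition swap_vfun ::
  "('v, 'm, 'b) vcat \<Rightarrow> ('v, 'm, 'c) vcat \<Rightarrow> ('m, 'b \<times> 'c, 'e) vfun \<Rightarrow> ('m, 'c \<times> 'b, 'e) vfun" where
  "swap_vfun B C D = \<lparr>fob = (\<lambda>(k, j) \<in> vob C \<times> vob B. fob D (j, k)),
     fhom = res2 (vob C \<times> vob B) (\<lambda>(k, j) (k', j').
       fhom D (j, k) (j', k') \<cdot> Sym V (vhom C k k') (vhom B j j'))\<rparr>"


section \<open>Cotensors\<close>

text \<open>
  \<open>\<gamma> : K \<rightarrow> C(P,c)\<close> exhibits \<open>P\<close> as a cotensor \<open>[K,c]\<close> if for every \<open>x\<close> the arrow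
  \<open>C(x,P) \<rightarrow> [K, C(x,c)]\<close> obtained by transposing
  \<open>C(x,P) \<otimes> K \<cong> K \<otimes> C(x,P) \<rightarrow> C(P,c) \<otimes> C(x,P) \<rightarrow> C(x,c)\<close> is invertible.
\<close>

definition is_cotensor :: "('v, 'm, 'c) vcat \<Rightarrow> 'v \<Rightarrow> 'c \<Rightarrow> 'c \<Rightarrow> 'm \<Rightarrow> bool" where
  "is_cotensor C K c P \<gamma> \<longleftrightarrow> P \<in> vob C \<and> \<gamma> \<in> Hom V K (vhom C P c) \<and>
     (\<forall>x \<in> vob C. is_iso V (curry_arr (vhom C x P) K (vhom C x c)
        (vcomp C x P c \<cdot> (\<gamma> \<boxtimes> Id V (vhom C x P)) \<cdot> Sym V (vhom C x P) K)))"

text \<open>Here and below \<open>J\<close> is the set of objects of a full sub-\<open>V\<close>-category of \<open>V\<close>.\<close>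

definition preserves_cotensors ::
  "'v set \<Rightarrow> ('v, 'm, 'b) vcat \<Rightarrow> ('v, 'm, 'c) vcat \<Rightarrow> ('m, 'b, 'c) vfun \<Rightarrow> bool" where
  "preserves_cotensors J B C F \<longleftrightarrow> (\<forall>K \<in> J. \<forall>b \<in> vob B. \<forall>P \<gamma>. is_cotensor B K b P \<gamma> \<longrightarrow>
     is_cotensor C K (fob F b) (fob F P) (fhom F P b \<cdot> \<gamma>))"

text \<open>\<open>ct K c\<close> is the designated cotensor \<open>[K,c]\<close> together with its counit.\<close>

definition designated_cotensors ::
  "'v set \<Rightarrow> ('v, 'm, 'c) vcat \<Rightarrow> ('v \<Rightarrow> 'c \<Rightarrow> 'c \<times> 'm) \<Rightarrow> bool" where
  "designated_cotensors J C ct \<longleftrightarrow> (\<forall>c \<in> vob C.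
     (\<forall>K \<in> J. is_cotensor C K c (fst (ct K c)) (snd (ct K c))) \<and> ct \<one> c = (c, vid C c))"

definition system_of_arities :: "'v set \<Rightarrow> bool" where
  "system_of_arities J \<longleftrightarrow> J \<subseteq> Obj V \<and> \<one> \<in> J \<and> (\<forall>X \<in> J. \<forall>Y \<in> J. X \<otimes> Y \<in> J)"

end


section \<open>Theories and algebras\<close>

record ('v, 'm) jtheory =
  tcat :: "('v, 'm, 'v) vcat"
  tstr :: "('m, 'v, 'v) vfun"

context
  fixes V :: "('v, 'm) smc" (structure)
    and J :: "'v set"
begin

definition is_jtheory :: "('v, 'm) jtheory \<Rightarrow> bool" where
  "is_jtheory T \<longleftrightarrow> vcategory V (tcat T) \<and> vcat_extensional (tcat T) \<and> vob (tcat T) = J \<and>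
     vfunctor V (vop V (vfull V J)) (tcat T) (tstr T) \<and> fob (tstr T) = (\<lambda>X \<in> J. X) \<and>
     preserves_cotensors V J (vop V (vfull V J)) (tcat T) (tstr T)"

definition jtheory_mor :: "('v, 'm) jtheory \<Rightarrow> ('v, 'm) jtheory \<Rightarrow> ('m, 'v, 'v) vfun \<Rightarrow> bool" where
  "jtheory_mor T U M \<longleftrightarrow> vfunctor V (tcat T) (tcat U) M \<and>
     comp_vfun V (vop V (vfull V J)) M (tstr T) = tstr U"

definition is_algebra ::
  "('v, 'm, 'c) vcat \<Rightarrow> ('v, 'm) jtheory \<Rightarrow> ('m, 'v, 'c) vfun \<Rightarrow> bool" where
  "is_algebra C T A \<longleftrightarrow> vfunctor V (tcat T) C A \<and> preserves_cotensors V J (tcat T) C A"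

definition is_bialgebra ::
  "('v, 'm, 'c) vcat \<Rightarrow> ('v, 'm) jtheory \<Rightarrow> ('v, 'm) jtheory \<Rightarrow> ('m, 'v \<times> 'v, 'c) vfun \<Rightarrow> bool" where
  "is_bialgebra C T U D \<longleftrightarrow> vfunctor V (vtensor V (tcat T) (tcat U)) C D \<and>
     (\<forall>K \<in> J. preserves_cotensors V J (tcat T) C (fix_right V (tcat T) (tcat U) D K)) \<and>
     (\<forall>K \<in> J. preserves_cotensors V J (tcat U) C (fix_left V (tcat T) (tcat U) D K))"

end

text \<open>
  The hom-object of the \<open>V\<close>-functor category \<open>[B,C]\<close> from \<open>F\<close> to \<open>G\<close> is the end of
  \<open>C(Fx,Gx)\<close>.  Since \<open>V\<close> is closed, its \<open>V\<close>-enriched universal property amounts to the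
  representability of the families below.
\<close>

context
  fixes V :: "('v, 'm) smc" (structure)
begin

definition is_wedge ::
  "('v, 'm, 'b) vcat \<Rightarrow> ('v, 'm, 'c) vcat \<Rightarrow> ('m, 'b, 'c) vfun \<Rightarrow> ('m, 'b, 'c) vfun \<Rightarrow>
   'v \<Rightarrow> ('b \<Rightarrow> 'm) \<Rightarrow> bool" where
  "is_wedge B C F G Z \<kappa> \<longleftrightarrow> Z \<in> Obj V \<and>
     (\<forall>x \<in> vob B. \<kappa> x \<in> Hom V Z (vhom C (fob F x) (fob G x))) \<and>
     (\<forall>x \<in> vob B. \<forall>y \<in> vob B.
        vcomp C (fob F x) (fob G x) (fob G y) \<cdot> (fhom G x y \<boxtimes> \<kappa> x)
          = vcomp C (fob F x) (fob F y) (fob G y) \<cdot> (\<kappa> y \<boxtimes> fhom F x y) \<cdot> Sym V (vhom B x y) Z)"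

definition is_hom_end ::
  "('v, 'm, 'b) vcat \<Rightarrow> ('v, 'm, 'c) vcat \<Rightarrow> ('m, 'b, 'c) vfun \<Rightarrow> ('m, 'b, 'c) vfun \<Rightarrow>
   'v \<Rightarrow> ('b \<Rightarrow> 'm) \<Rightarrow> bool" where
  "is_hom_end B C F G E \<pi> \<longleftrightarrow> is_wedge B C F G E \<pi> \<and>
     (\<forall>Z \<kappa>. is_wedge B C F G Z \<kappa> \<longrightarrow>
        (\<exists>!h. h \<in> Hom V Z E \<and> (\<forall>x \<in> vob B. \<pi> x \<cdot> h = \<kappa> x)))"

definition hom_end ::
  "('v, 'm, 'b) vcat \<Rightarrow> ('v, 'm, 'c) vcat \<Rightarrow> ('m, 'b, 'c) vfun \<Rightarrow> ('m, 'b, 'c) vfun \<Rightarrow>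
   'v \<times> ('b \<Rightarrow> 'm)" where
  "hom_end B C F G = (SOME (E, \<pi>). is_hom_end B C F G E \<pi>)"

definition end_ob where "end_ob B C F G = fst (hom_end B C F G)"
definition end_proj where "end_proj B C F G = snd (hom_end B C F G)"

end

context
  fixes V :: "('v, 'm) smc" (structure)
    and J :: "'v set"
    and C :: "('v, 'm, 'c) vcat"
begin

definition J_admissible :: "('v \<Rightarrow> 'c \<Rightarrow> 'c \<times> 'm) \<Rightarrow> bool" where
  "J_admissible ct \<longleftrightarrow> vcategory V C \<and> designated_cotensors V J C ct \<and>
     (\<forall>T A B. is_jtheory V J T \<longrightarrow> is_algebra V J C T A \<longrightarrow> is_algebra V J C T B \<longrightarrow>
        (\<exists>E \<pi>. is_hom_end V (tcat T) C A B E \<pi>))"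

text \<open>
  The full subcategory of \<open>[T,C]\<close> on the algebras; identities and composition are the unique
  arrows compatible with the evaluations \<open>end_proj\<close>.
\<close>

definition AlgV :: "('v, 'm) jtheory \<Rightarrow> ('v, 'm, ('m, 'v, 'c) vfun) vcat" where
  "AlgV T = \<lparr>vob = {A. is_algebra V J C T A}, vhom = end_ob V (tcat T) C,
     vid = (\<lambda>A. THE h. h \<in> Hom V \<one> (end_ob V (tcat T) C A A) \<and>
       (\<forall>x \<in> vob (tcat T). end_proj V (tcat T) C A A x \<cdot> h = vid C (fob A x))),
     vcomp = (\<lambda>A B D. THE h.
       h \<in> Hom V (end_ob V (tcat T) C B D \<otimes> end_ob V (tcat T) C A B) (end_ob V (tcat T) C A D) \<and>
       (\<forall>x \<in> vob (tcat T). end_proj V (tcat T) C A D x \<cdot> h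
          = vcomp C (fob A x) (fob B x) (fob D x)
              \<cdot> (end_proj V (tcat T) C B D x \<boxtimes> end_proj V (tcat T) C A B x)))\<rparr>"

end

section \<open>Commutants\<close>

context
  fixes V :: "('v, 'm) smc" (structure)
    and J :: "'v set"
    and C :: "('v, 'm, 'c) vcat"
    and ct :: "'v \<Rightarrow> 'c \<Rightarrow> 'c \<times> 'm"
begin

text \<open>
  Designated cotensors \<open>[K,A]\<close> of \<open>T\<close>-algebras, with their counits: any choice for which
  \<open>[I,A] = A\<close> with identity counit and for which evaluation at \<open>I\<close> sends \<open>[K,A]\<close> to the
  designated cotensor \<open>[K,A(I)]\<close> in \<open>C\<close>.
\<close>

definition alg_cotensor ::
  "('v, 'm) jtheory \<Rightarrow> 'v \<Rightarrow> ('m, 'v, 'c) vfun \<Rightarrow> ('m, 'v, 'c) vfun \<times> 'm" where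
  "alg_cotensor T K A = (SOME (P, \<gamma>).
     is_cotensor V (AlgV V J C T) K A P \<gamma> \<and>
     (fob P \<one>, end_proj V (tcat T) C P A \<one> \<cdot> \<gamma>) = ct K (fob A \<one>) \<and>
     (K = \<one> \<longrightarrow> (P, \<gamma>) = (A, vid (AlgV V J C T) A)))"

definition cot_alg :: "('v, 'm) jtheory \<Rightarrow> 'v \<Rightarrow> ('m, 'v, 'c) vfun \<Rightarrow> ('m, 'v, 'c) vfun" where
  "cot_alg T K A = fst (alg_cotensor T K A)"

definition cot_counit :: "('v, 'm) jtheory \<Rightarrow> 'v \<Rightarrow> ('m, 'v, 'c) vfun \<Rightarrow> 'm" where
  "cot_counit T K A = snd (alg_cotensor T K A)"

definition commutant_cat :: "('v, 'm) jtheory \<Rightarrow> ('m, 'v, 'c) vfun \<Rightarrow> ('v, 'm, 'v) vcat" where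
  "commutant_cat T A = \<lparr>vob = J,
     vhom = res2 J (\<lambda>X Y. vhom (AlgV V J C T) (cot_alg T X A) (cot_alg T Y A)),
     vid = (\<lambda>X \<in> J. vid (AlgV V J C T) (cot_alg T X A)),
     vcomp = res3 J (\<lambda>X Y Z.
       vcomp (AlgV V J C T) (cot_alg T X A) (cot_alg T Y A) (cot_alg T Z A))\<rparr>"

text \<open>
  A theory is determined by its structure morphisms \<open>X \<cong> [I,X] \<rightarrow> T(X,I)\<close>, here the cotensor
  counits \<open>\<gamma>\<close>: since \<open>\<gamma> Y\<close> exhibits \<open>Y\<close> as \<open>[Y,I]\<close>, the arrow \<open>[Y,X] \<rightarrow> T(X,Y)\<close> is the
  unique \<open>t\<close> for which \<open>[Y,X] \<otimes> Y \<cong> Y \<otimes> [Y,X] \<rightarrow> T(Y,I) \<otimes> T(X,Y) \<rightarrow> T(X,I)\<close>, formed with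
  \<open>\<gamma> Y \<otimes> t\<close>, equals \<open>\<gamma> X\<close> after evaluation \<open>[Y,X] \<otimes> Y \<rightarrow> X\<close>.
\<close>

definition commutant_theory :: "('v, 'm) jtheory \<Rightarrow> ('m, 'v, 'c) vfun \<Rightarrow> ('v, 'm) jtheory" where
  "commutant_theory T A = \<lparr>tcat = commutant_cat T A,
     tstr = \<lparr>fob = (\<lambda>X \<in> J. X),
       fhom = res2 J (\<lambda>X Y. THE t. t \<in> Hom V (Ihom V Y X) (vhom (commutant_cat T A) X Y) \<and>
         vcomp (commutant_cat T A) X Y \<one> \<cdot> (cot_counit T Y A \<boxtimes> t) \<cdot> Sym V (Ihom V Y X) Y
           = cot_counit T X A \<cdot> Ev V Y X)\<rparr>\<rparr>"

definition commutant_algebra :: "('v, 'm) jtheory \<Rightarrow> ('m, 'v, 'c) vfun \<Rightarrow> ('m, 'v, 'c) vfun" where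
  "commutant_algebra T A = \<lparr>fob = (\<lambda>X \<in> J. fst (ct X (fob A \<one>))),
     fhom = res2 J (\<lambda>X Y. end_proj V (tcat T) C (cot_alg T X A) (cot_alg T Y A) \<one>)\<rparr>"

definition commutant ::
  "('v, 'm) jtheory \<times> ('m, 'v, 'c) vfun \<Rightarrow> ('v, 'm) jtheory \<times> ('m, 'v, 'c) vfun" where
  "commutant = (\<lambda>(T, A). (commutant_theory T A, commutant_algebra T A))"

end


section \<open>The categories of algebras and of bifold algebras\<close>

record ('o, 'd) mor =
  src :: 'o
  tgt :: 'o
  dat :: 'd

type_synonym ('v, 'm, 'c) alg = "('v, 'm) jtheory \<times> ('m, 'v, 'c) vfun"
type_synonym ('v, 'm, 'c) alg_mor =
  "(('v, 'm, 'c) alg, ('m, 'v, 'v) vfun \<times> ('v \<Rightarrow> 'm)) mor"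
type_synonym ('v, 'm, 'c) balg =
  "('v, 'm) jtheory \<times> ('v, 'm) jtheory \<times> ('m, 'v \<times> 'v, 'c) vfun"
type_synonym ('v, 'm, 'c) balg_mor =
  "(('v, 'm, 'c) balg, ('m, 'v, 'v) vfun \<times> ('m, 'v, 'v) vfun \<times> ('v \<times> 'v \<Rightarrow> 'm)) mor"

context
  fixes V :: "('v, 'm) smc" (structure)
    and J :: "'v set"
    and C :: "('v, 'm, 'c) vcat"
begin

definition alg_obs :: "('v, 'm, 'c) alg set" where
  "alg_obs = {(T, A). is_jtheory V J T \<and> is_algebra V J C T A}"

definition strong_mor ::
  "('v, 'm, 'c) alg \<Rightarrow> ('v, 'm, 'c) alg \<Rightarrow> ('m, 'v, 'v) vfun \<times> ('v \<Rightarrow> 'm) \<Rightarrow> bool" where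
  "strong_mor = (\<lambda>(T, A) (U, B) (M, f). jtheory_mor V J T U M \<and>
     vnat_iso V (tcat T) C A (comp_vfun V (tcat T) B M) f)"

definition Alg_s :: "(('v, 'm, 'c) alg, ('v, 'm, 'c) alg_mor) cat" where
  "Alg_s = \<lparr>Obj = alg_obs,
     Arr = {m. src m \<in> alg_obs \<and> tgt m \<in> alg_obs \<and> strong_mor (src m) (tgt m) (dat m)},
     Dom = src, Cod = tgt,
     Id = (\<lambda>(T, A). \<lparr>src = (T, A), tgt = (T, A),
       dat = (id_vfun V (tcat T), \<lambda>X \<in> J. vid C (fob A X))\<rparr>),
     Comp = (\<lambda>n m. case (src m, tgt m, tgt n, dat n, dat m) of
       ((T, A), (U, B), (W, D), (N, g), (M, f)) \<Rightarrow> \<lparr>src = (T, A), tgt = (W, D),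
         dat = (comp_vfun V (tcat T) N M,
           \<lambda>X \<in> J. ucomp V C (fob A X) (fob B (fob M X)) (fob D (fob N (fob M X)))
             (g (fob M X)) (f X))\<rparr>)\<rparr>"

definition balg_obs :: "('v, 'm, 'c) balg set" where
  "balg_obs = {(T, U, D). is_jtheory V J T \<and> is_jtheory V J U \<and> is_bialgebra V J C T U D}"

definition strong_cross_mor ::
  "('v, 'm, 'c) balg \<Rightarrow> ('v, 'm, 'c) balg \<Rightarrow>
   ('m, 'v, 'v) vfun \<times> ('m, 'v, 'v) vfun \<times> ('v \<times> 'v \<Rightarrow> 'm) \<Rightarrow> bool" where
  "strong_cross_mor = (\<lambda>(T, U, D) (T', U', D') (M, N, f).
     jtheory_mor V J T T' M \<and> jtheory_mor V J U' U N \<and>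
     vnat_iso V (vtensor V (tcat T) (tcat U')) C
       (comp_vfun V (vtensor V (tcat T) (tcat U')) D
         (vfun_tensor V (tcat T) (tcat U') (id_vfun V (tcat T)) N))
       (comp_vfun V (vtensor V (tcat T) (tcat U')) D'
         (vfun_tensor V (tcat T) (tcat U') M (id_vfun V (tcat U'))))
       f)"

definition BAlg_sc :: "(('v, 'm, 'c) balg, ('v, 'm, 'c) balg_mor) cat" where
  "BAlg_sc = \<lparr>Obj = balg_obs,
     Arr = {m. src m \<in> balg_obs \<and> tgt m \<in> balg_obs \<and> strong_cross_mor (src m) (tgt m) (dat m)},
     Dom = src, Cod = tgt,
     Id = (\<lambda>(T, U, D). \<lparr>src = (T, U, D), tgt = (T, U, D),
       dat = (id_vfun V (tcat T), id_vfun V (tcat U), \<lambda>p \<in> J \<times> J. vid C (fob D p))\<rparr>),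
     Comp = (\<lambda>n m. case (src m, tgt m, tgt n, dat n, dat m) of
       ((T, U, D), (T', U', D'), (T'', U'', D''), (M', N', f'), (M, N, f)) \<Rightarrow>
       \<lparr>src = (T, U, D), tgt = (T'', U'', D''),
         dat = (comp_vfun V (tcat T) M' M, comp_vfun V (tcat U'') N N',
           \<lambda>(X, K) \<in> J \<times> J. ucomp V C (fob D (X, fob N (fob N' K))) (fob D' (fob M X, fob N' K))
             (fob D'' (fob M' (fob M X), K)) (f' (fob M X, K)) (f (X, fob N' K)))\<rparr>)\<rparr>"

definition left_face :: "('v, 'm, 'c) balg \<Rightarrow> ('v, 'm, 'c) alg" where
  "left_face = (\<lambda>(T, U, D). (T, fix_right V (tcat T) (tcat U) D \<one>))"

definition right_face :: "('v, 'm, 'c) balg \<Rightarrow> ('v, 'm, 'c) alg" where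
  "right_face = (\<lambda>(T, U, D). (U, fix_left V (tcat T) (tcat U) D \<one>))"

definition L_functor ::
  "(('v, 'm, 'c) balg, ('v, 'm, 'c) balg_mor, ('v, 'm, 'c) alg, ('v, 'm, 'c) alg_mor) fnctr" where
  "L_functor = \<lparr>onObj = left_face,
     onArr = (\<lambda>m. case dat m of (M, N, f) \<Rightarrow>
       \<lparr>src = left_face (src m), tgt = left_face (tgt m), dat = (M, \<lambda>X \<in> J. f (X, \<one>))\<rparr>)\<rparr>"

text \<open>A functor into \<^term>\<open>op_cat Alg_s\<close>: the arrow below points from the face of \<^term>\<open>tgt m\<close>.\<close>

definition R_functor ::
  "(('v, 'm, 'c) balg, ('v, 'm, 'c) balg_mor, ('v, 'm, 'c) alg, ('v, 'm, 'c) alg_mor) fnctr" where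
  "R_functor = \<lparr>onObj = right_face,
     onArr = (\<lambda>m. case (src m, tgt m, dat m) of ((T, U, D), (T', U', D'), (M, N, f)) \<Rightarrow>
       \<lparr>src = right_face (tgt m), tgt = right_face (src m),
         dat = (N, \<lambda>K \<in> J. uinv V C (fob D (\<one>, fob N K)) (fob D' (fob M \<one>, K)) (f (\<one>, K)))\<rparr>)\<rparr>"

definition swap_balg :: "('v, 'm, 'c) balg \<Rightarrow> ('v, 'm, 'c) balg" where
  "swap_balg = (\<lambda>(T, U, D). (U, T, swap_vfun V (tcat T) (tcat U) D))"

text \<open>The functor \<open>\<circle>\<close> from \<^term>\<open>BAlg_sc\<close> to \<^term>\<open>op_cat BAlg_sc\<close>.\<close>

definition circ_functor ::
  "(('v, 'm, 'c) balg, ('v, 'm, 'c) balg_mor, ('v, 'm, 'c) balg, ('v, 'm, 'c) balg_mor) fnctr" where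
  "circ_functor = \<lparr>onObj = swap_balg,
     onArr = (\<lambda>m. case (src m, tgt m, dat m) of ((T, U, D), (T', U', E), (M, N, f)) \<Rightarrow>
       \<lparr>src = swap_balg (tgt m), tgt = swap_balg (src m),
         dat = (N, M, \<lambda>(K, X) \<in> J \<times> J. uinv V C (fob D (X, fob N K)) (fob E (fob M X, K)) (f (X, K)))\<rparr>)\<rparr>"

end

end

(* A finite family of labelled objects and an arrow out of its tensor product act as a generalised
   element, so that equations in V can be checked as in a category of sets.  In these terms a J-theory T
   is a V-category on the objects of J with counits X -> T(X, I) that exhibit X as the cotensor [X, I].

   Cotensors of T-algebras are pointwise.  Therefore the homs T-Alg([J, A], [K, A]) form a theory, which
   acts on K in the bifold algebra RCom(T, A)(J, K) = [K, A](J).  Let (M, f) be a strong morphism from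
   (T, A) to the left face of (T', U', D).  An extension (M, N, g) of it to RCom(T, A) is forced:
   naturality at the counits K -> U'(K, I) determines g as a comparison of two cotensors by K, which is
   hence invertible, and naturality in K then says that N is conjugation by g.  Conversely this recipe
   defines an extension.  So every algebra has a universal arrow to L whose unit is the identity, and the
   involution that interchanges the two faces turns it into a universal arrow from R. *)

theory Submission
  imports Defs
begin

section \<open>Coherence for labelled tensor products\<close>

text \<open>Two obstacles shape the proof. \<open>V\<close> is neither strict nor concrete, so
  composites of enriched structure carry associators and symmetries. These are confined to
  \<open>tens\<close>, \<open>perm\<close> and \<open>mu\<close>; afterwards equations are checked
  on variables, elements whose arrow is invertible. Existence still needs arrows, and they come from
  a universal property: of exponentials, of cotensors or of ends. The second obstacle is strictness.
  Faces and units are claimed to be equal to given data, not isomorphic to it. This rests on how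
  designated cotensors are normalised: \<open>[\<one>, A]\<close> is \<open>A\<close> with identity
  counit, and \<open>[K, A]\<close> evaluated at \<open>\<one>\<close> is the designated
  \<open>[K, A(\<one>)]\<close>. At other objects only the universal property of
  \<open>[K, A]\<close> is known. Preservation of cotensors by a functor out of a theory is not
  tested on each cotensor: \<open>K \<otimes> X\<close> is \<open>[K, [X, \<one>]]\<close> there, so
  the counits \<open>X \<rightarrow> T(X, \<one>)\<close> suffice.\<close>

lemma in_Hom: "f \<in> Hom C X Y \<longleftrightarrow> f \<in> Arr C \<and> Dom C f = X \<and> Cod C f = Y"
  by (auto simp: Hom_def)

section \<open>Composition, inverses and cancellation in an ordinary category\<close>

context category
begin

lemma obj_Dom [simp]: "f \<in> Arr C \<Longrightarrow> Dom C f \<in> Obj C"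
  and obj_Cod [simp]: "f \<in> Arr C \<Longrightarrow> Cod C f \<in> Obj C"
  by (rule Dom_in Cod_in; assumption)+

lemma id_arr [simp]: "X \<in> Obj C \<Longrightarrow> Id C X \<in> Arr C"
    "X \<in> Obj C \<Longrightarrow> Dom C (Id C X) = X" "X \<in> Obj C \<Longrightarrow> Cod C (Id C X) = X"
  using Id_in by (auto simp: in_Hom)

lemma comp_arr [simp]:
  assumes "f \<in> Arr C" "g \<in> Arr C" "Dom C g = Cod C f"
  shows "g \<cdot> f \<in> Arr C" "Dom C (g \<cdot> f) = Dom C f" "Cod C (g \<cdot> f) = Cod C g"
  using Comp_in[of f "Dom C f" "Cod C f" g "Cod C g"] assms by (auto simp: in_Hom)

lemma comp_id [simp]:
  "f \<in> Arr C \<Longrightarrow> Cod C f = X \<Longrightarrow> Id C X \<cdot> f = f"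
  "f \<in> Arr C \<Longrightarrow> Dom C f = X \<Longrightarrow> f \<cdot> Id C X = f"
  using Id_left Id_right by (auto simp: in_Hom)

lemma comp_assoc [simp]:
  "\<lbrakk>f \<in> Arr C; g \<in> Arr C; h \<in> Arr C; Dom C g = Cod C f; Dom C h = Cod C g\<rbrakk> \<Longrightarrow>
    (h \<cdot> g) \<cdot> f = h \<cdot> (g \<cdot> f)"
  using Comp_assoc by (auto simp: in_Hom)

text \<open>Composites are kept right-associated, so \<open>g \<cdot> f\<close> is not a subterm of
  \<open>g \<cdot> f \<cdot> r\<close>. This lets an equation for two factors rewrite the head of a
  longer composite.\<close>

lemma comp_tail:
  assumes "g \<cdot> f = e" "f \<in> Arr C" "g \<in> Arr C" "Dom C g = Cod C f" "r \<in> Arr C" "Dom C f = Cod C r"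
  shows "g \<cdot> f \<cdot> r = e \<cdot> r"
  using assms comp_assoc[of r f g] by simp

lemma inverse_pair_unique:
  assumes "inverse_pair C f g" "inverse_pair C f h"
  shows "g = h"
proof -
  have "g = g \<cdot> (f \<cdot> h)" using assms by (auto simp: inverse_pair_def in_Hom)
  also have "\<dots> = (g \<cdot> f) \<cdot> h" using assms by (subst comp_assoc) (auto simp: inverse_pair_def in_Hom)
  also have "\<dots> = h" using assms by (auto simp: inverse_pair_def in_Hom)
  finally show ?thesis .
qed

lemma inverse_pair_inv: "is_iso C f \<Longrightarrow> inverse_pair C f (inv_arr C f)"
  unfolding is_iso_def inv_arr_def using inverse_pair_unique by (metis theI)

lemma iso_arr: "is_iso C f \<Longrightarrow> f \<in> Arr C"
  by (auto simp: is_iso_def inverse_pair_def)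

lemma inv_arr [simp]:
  assumes "is_iso C f"
  shows "inv_arr C f \<in> Arr C" "Dom C (inv_arr C f) = Cod C f" "Cod C (inv_arr C f) = Dom C f"
    "inv_arr C f \<cdot> f = Id C (Dom C f)" "f \<cdot> inv_arr C f = Id C (Cod C f)"
  using inverse_pair_inv[OF assms] by (auto simp: inverse_pair_def in_Hom)

lemma inv_tail [simp]:
  assumes "is_iso C f" "r \<in> Arr C"
  shows "Cod C r = Dom C f \<Longrightarrow> inv_arr C f \<cdot> f \<cdot> r = r" "Cod C r = Cod C f \<Longrightarrow> f \<cdot> inv_arr C f \<cdot> r = r"
  using comp_tail[OF inv_arr(4)[OF assms(1)]] comp_tail[OF inv_arr(5)[OF assms(1)]] assms
  by (auto simp: iso_arr)

lemma inverse_pairI: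
  assumes "f \<in> Arr C" "g \<in> Arr C" "Dom C g = Cod C f" "Cod C g = Dom C f"
    "g \<cdot> f = Id C (Dom C f)" "f \<cdot> g = Id C (Cod C f)"
  shows "is_iso C f" "inv_arr C f = g" "is_iso C g"
proof -
  have p: "inverse_pair C f g" using assms by (auto simp: inverse_pair_def in_Hom)
  then show "is_iso C f" by (auto simp: is_iso_def)
  then show "inv_arr C f = g" using inverse_pair_inv inverse_pair_unique p by blast
  show "is_iso C g" using assms by (auto simp: is_iso_def inverse_pair_def in_Hom intro!: exI[of _ f])
qed

lemma iso_inv [simp]: "is_iso C f \<Longrightarrow> is_iso C (inv_arr C f)"
  by (rule inverse_pairI(3)[of f]) (auto simp: iso_arr)

lemma iso_id [simp]: "X \<in> Obj C \<Longrightarrow> is_iso C (Id C X)"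
  by (rule inverse_pairI(1)[of _ "Id C X"]) auto

lemma iso_comp [simp]:
  assumes "is_iso C f" "is_iso C g" "Dom C g = Cod C f"
  shows "is_iso C (g \<cdot> f)"
  by (rule inverse_pairI(1)[of _ "inv_arr C f \<cdot> inv_arr C g"]) (use assms in \<open>auto simp: iso_arr\<close>)

lemma iso_epi:
  assumes "g \<cdot> f = h \<cdot> f" "is_iso C f" "g \<in> Arr C" "h \<in> Arr C" "Dom C g = Cod C f" "Dom C h = Cod C f"
  shows "g = h"
proof -
  have "(g \<cdot> f) \<cdot> inv_arr C f = (h \<cdot> f) \<cdot> inv_arr C f" using assms(1) by simp
  then show ?thesis using assms(2-) by (simp add: iso_arr)
qed

lemma iso_mono:
  assumes "f \<cdot> g = f \<cdot> h" "is_iso C f" "g \<in> Arr C" "h \<in> Arr C" "Dom C f = Cod C g" "Dom C f = Cod C h"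
  shows "g = h"
proof -
  have "inv_arr C f \<cdot> f \<cdot> g = inv_arr C f \<cdot> f \<cdot> h" using assms(1) by simp
  then show ?thesis using assms(2-) by simp
qed

end

section \<open>Unit laws that follow from the pentagon, triangle and hexagon\<close>

context symmetric_monoidal_closed
begin

lemma smc_obj [simp]: "X \<in> Obj V \<Longrightarrow> Y \<in> Obj V \<Longrightarrow> X \<otimes> Y \<in> Obj V" "\<one> \<in> Obj V"
    "X \<in> Obj V \<Longrightarrow> Y \<in> Obj V \<Longrightarrow> Ihom V X Y \<in> Obj V"
  by (simp_all add: TenO_in Unit_in Ihom_in)

lemma ten_arr [simp]:
  assumes "f \<in> Arr V" "g \<in> Arr V"
  shows "f \<boxtimes> g \<in> Arr V" "Dom V (f \<boxtimes> g) = Dom V f \<otimes> Dom V g" "Cod V (f \<boxtimes> g) = Cod V f \<otimes> Cod V g"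
  using TenA_in[of f "Dom V f" "Cod V f" g "Dom V g" "Cod V g"] assms by (auto simp: in_Hom)

lemma ten_id [simp]: "X \<in> Obj V \<Longrightarrow> Y \<in> Obj V \<Longrightarrow> Id V X \<boxtimes> Id V Y = Id V (X \<otimes> Y)"
  by (rule TenA_Id)

lemma ten_comp [simp]:
  assumes "f \<in> Arr V" "f' \<in> Arr V" "g \<in> Arr V" "g' \<in> Arr V" "Dom V f' = Cod V f" "Dom V g' = Cod V g"
  shows "(f' \<boxtimes> g') \<cdot> (f \<boxtimes> g) = (f' \<cdot> f) \<boxtimes> (g' \<cdot> g)"
  using TenA_Comp[of f "Dom V f" "Cod V f" f' "Cod V f'" g "Dom V g" "Cod V g" g' "Cod V g'"] assms
  by (auto simp: in_Hom)

lemma ten_comp_tail [simp]: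
  assumes "f \<in> Arr V" "f' \<in> Arr V" "g \<in> Arr V" "g' \<in> Arr V" "Dom V f' = Cod V f" "Dom V g' = Cod V g"
    "r \<in> Arr V" "Cod V r = Dom V f \<otimes> Dom V g"
  shows "(f' \<boxtimes> g') \<cdot> (f \<boxtimes> g) \<cdot> r = ((f' \<cdot> f) \<boxtimes> (g' \<cdot> g)) \<cdot> r"
  by (rule comp_tail[OF ten_comp]) (use assms in auto)

lemma unitor_arr [simp]:
  assumes "X \<in> Obj V"
  shows "Lun V X \<in> Arr V" "Dom V (Lun V X) = \<one> \<otimes> X" "Cod V (Lun V X) = X"
    "Run V X \<in> Arr V" "Dom V (Run V X) = X \<otimes> \<one>" "Cod V (Run V X) = X"
    "is_iso V (Lun V X)" "is_iso V (Run V X)"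
  using Lun_in[of X] Run_in[of X] Lun_iso Run_iso assms by (auto simp: in_Hom)

lemma sym_ev_arr [simp]:
  assumes "X \<in> Obj V" "Y \<in> Obj V"
  shows "Sym V X Y \<in> Arr V" "Dom V (Sym V X Y) = X \<otimes> Y" "Cod V (Sym V X Y) = Y \<otimes> X"
    "Ev V X Y \<in> Arr V" "Dom V (Ev V X Y) = Ihom V X Y \<otimes> X" "Cod V (Ev V X Y) = Y"
    "Sym V Y X \<cdot> Sym V X Y = Id V (X \<otimes> Y)"
  using Sym_in[of X Y] Ev_in[of X Y] Sym_Sym assms by (auto simp: in_Hom)

lemma assoc_arr [simp]:
  assumes "X \<in> Obj V" "Y \<in> Obj V" "Z \<in> Obj V"
  shows "Assoc V X Y Z \<in> Arr V" "Dom V (Assoc V X Y Z) = (X \<otimes> Y) \<otimes> Z"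
    "Cod V (Assoc V X Y Z) = X \<otimes> (Y \<otimes> Z)" "is_iso V (Assoc V X Y Z)"
  using Assoc_in[of X Y Z] Assoc_iso assms by (auto simp: in_Hom)

lemma sym_iso [simp]: "X \<in> Obj V \<Longrightarrow> Y \<in> Obj V \<Longrightarrow> is_iso V (Sym V X Y)"
  by (rule inverse_pairI(1)[of _ "Sym V Y X"]) auto

lemma sym_tail [simp]:
  "\<lbrakk>X \<in> Obj V; Y \<in> Obj V; r \<in> Arr V; Cod V r = X \<otimes> Y\<rbrakk> \<Longrightarrow> Sym V Y X \<cdot> Sym V X Y \<cdot> r = r"
  by (subst comp_tail[OF Sym_Sym]) auto

lemma iso_ten [simp]:
  assumes "is_iso V f" "is_iso V g"
  shows "is_iso V (f \<boxtimes> g)"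
  by (rule inverse_pairI(1)[of _ "inv_arr V f \<boxtimes> inv_arr V g"]) (use assms in \<open>auto simp: iso_arr\<close>)

lemma Assoc_nat:
  assumes "f \<in> Arr V" "g \<in> Arr V" "h \<in> Arr V" "X = Cod V f" "Y = Cod V g" "Z = Cod V h"
  shows "Assoc V X Y Z \<cdot> ((f \<boxtimes> g) \<boxtimes> h) = (f \<boxtimes> (g \<boxtimes> h)) \<cdot> Assoc V (Dom V f) (Dom V g) (Dom V h)"
  using Assoc_natural[of f _ X g _ Y h _ Z] assms by (auto simp: in_Hom)

lemma Assoc_nat_tail:
  assumes "f \<in> Arr V" "g \<in> Arr V" "h \<in> Arr V" "X = Cod V f" "Y = Cod V g" "Z = Cod V h"
    "r \<in> Arr V" "Cod V r = (Dom V f \<otimes> Dom V g) \<otimes> Dom V h"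
  shows "Assoc V X Y Z \<cdot> ((f \<boxtimes> g) \<boxtimes> h) \<cdot> r = (f \<boxtimes> (g \<boxtimes> h)) \<cdot> Assoc V (Dom V f) (Dom V g) (Dom V h) \<cdot> r"
  using comp_tail[OF Assoc_nat[OF assms(1-6)], of r] assms by auto

lemma Lun_nat: "f \<in> Arr V \<Longrightarrow> Y = Cod V f \<Longrightarrow> Lun V Y \<cdot> (Id V \<one> \<boxtimes> f) = f \<cdot> Lun V (Dom V f)"
  using Lun_natural[of f "Dom V f" Y] by (auto simp: in_Hom)

lemma Run_nat: "f \<in> Arr V \<Longrightarrow> Y = Cod V f \<Longrightarrow> Run V Y \<cdot> (f \<boxtimes> Id V \<one>) = f \<cdot> Run V (Dom V f)"
  using Run_natural[of f "Dom V f" Y] by (auto simp: in_Hom)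

lemma Sym_nat: "f \<in> Arr V \<Longrightarrow> g \<in> Arr V \<Longrightarrow> X = Cod V f \<Longrightarrow> Y = Cod V g \<Longrightarrow>
    Sym V X Y \<cdot> (f \<boxtimes> g) = (g \<boxtimes> f) \<cdot> Sym V (Dom V f) (Dom V g)"
  using Sym_natural[of f "Dom V f" X g "Dom V g" Y] by (auto simp: in_Hom)

text \<open>Naturality of \<open>Lun\<close> identifies tensoring with \<open>\<one>\<close> with
  the identity functor up to isomorphism. Unit laws can therefore be proved after tensoring with
  \<open>\<one>\<close>, where the pentagon applies.\<close>

lemma unit_ten_faithful:
  assumes "Id V \<one> \<boxtimes> f = Id V \<one> \<boxtimes> g" "f \<in> Arr V" "g \<in> Arr V" "Cod V f = Cod V g" "Dom V f = Dom V g"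
  shows "f = g"
proof -
  have "f \<cdot> Lun V (Dom V f) = g \<cdot> Lun V (Dom V f)"
    using Lun_nat[of f "Cod V f"] Lun_nat[of g "Cod V g"] assms by simp
  then show ?thesis by (rule iso_epi) (use assms in auto)
qed

lemma ten_unit_faithful:
  assumes "f \<boxtimes> Id V \<one> = g \<boxtimes> Id V \<one>" "f \<in> Arr V" "g \<in> Arr V" "Cod V f = Cod V g" "Dom V f = Dom V g"
  shows "f = g"
proof -
  have "f \<cdot> Run V (Dom V f) = g \<cdot> Run V (Dom V f)"
    using Run_nat[of f "Cod V f"] Run_nat[of g "Cod V g"] assms by simp
  then show ?thesis by (rule iso_epi) (use assms in auto)
qed

text \<open>The axioms contain only the triangle with the unit in the middle. For a unit on the left
  this is Kelly's argument: the pentagon at \<open>\<one>, \<one>, X, Y\<close>, the triangle used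
  twice, and removal of the extra factor \<open>\<one>\<close>.\<close>

lemma Lun_Assoc:
  assumes X[simp]: "X \<in> Obj V" and Y[simp]: "Y \<in> Obj V"
  shows "Lun V (X \<otimes> Y) \<cdot> Assoc V \<one> X Y = Lun V X \<boxtimes> Id V Y"
proof -
  have p: "(Id V \<one> \<boxtimes> Assoc V \<one> X Y) \<cdot> Assoc V \<one> (\<one> \<otimes> X) Y \<cdot> (Assoc V \<one> \<one> X \<boxtimes> Id V Y)
     = Assoc V \<one> \<one> (X \<otimes> Y) \<cdot> Assoc V (\<one> \<otimes> \<one>) X Y"
    by (rule pentagon) auto
  have "(Id V \<one> \<boxtimes> (Lun V (X \<otimes> Y) \<cdot> Assoc V \<one> X Y)) \<cdot> Assoc V \<one> (\<one> \<otimes> X) Y \<cdot> (Assoc V \<one> \<one> X \<boxtimes> Id V Y)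
    = (Id V \<one> \<boxtimes> Lun V (X \<otimes> Y)) \<cdot> (Id V \<one> \<boxtimes> Assoc V \<one> X Y) \<cdot> Assoc V \<one> (\<one> \<otimes> X) Y \<cdot> (Assoc V \<one> \<one> X \<boxtimes> Id V Y)"
    by simp
  also have "\<dots> = (Id V \<one> \<boxtimes> Lun V (X \<otimes> Y)) \<cdot> Assoc V \<one> \<one> (X \<otimes> Y) \<cdot> Assoc V (\<one> \<otimes> \<one>) X Y"
    by (simp only: p)
  also have "\<dots> = (Run V \<one> \<boxtimes> Id V (X \<otimes> Y)) \<cdot> Assoc V (\<one> \<otimes> \<one>) X Y"
    by (subst comp_tail[OF triangle]) auto
  also have "\<dots> = Assoc V \<one> X Y \<cdot> ((Run V \<one> \<boxtimes> Id V X) \<boxtimes> Id V Y)"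
    by (subst Assoc_nat) auto
  also have "\<dots> = Assoc V \<one> X Y \<cdot> (((Id V \<one> \<boxtimes> Lun V X) \<cdot> Assoc V \<one> \<one> X) \<boxtimes> Id V Y)"
    by (simp add: triangle del: ten_comp)
  also have "\<dots> = Assoc V \<one> X Y \<cdot> ((Id V \<one> \<boxtimes> Lun V X) \<boxtimes> Id V Y) \<cdot> (Assoc V \<one> \<one> X \<boxtimes> Id V Y)"
    by simp
  also have "\<dots> = (Id V \<one> \<boxtimes> (Lun V X \<boxtimes> Id V Y)) \<cdot> Assoc V \<one> (\<one> \<otimes> X) Y \<cdot> (Assoc V \<one> \<one> X \<boxtimes> Id V Y)"
    by (subst Assoc_nat_tail) auto
  finally have "Id V \<one> \<boxtimes> (Lun V (X \<otimes> Y) \<cdot> Assoc V \<one> X Y) = Id V \<one> \<boxtimes> (Lun V X \<boxtimes> Id V Y)"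
    by (rule iso_epi) auto
  then show ?thesis by (rule unit_ten_faithful) auto
qed

text \<open>Mirror image of \<open>Lun_Assoc\<close>: the pentagon at
  \<open>X, Y, \<one>, \<one>\<close>, with the factor \<open>\<one>\<close> removed on the
  right.\<close>

lemma Run_Assoc:
  assumes X[simp]: "X \<in> Obj V" and Y[simp]: "Y \<in> Obj V"
  shows "Run V (X \<otimes> Y) = (Id V X \<boxtimes> Run V Y) \<cdot> Assoc V X Y \<one>"
proof -
  have p: "(Id V X \<boxtimes> Assoc V Y \<one> \<one>) \<cdot> Assoc V X (Y \<otimes> \<one>) \<one> \<cdot> (Assoc V X Y \<one> \<boxtimes> Id V \<one>)
     = Assoc V X Y (\<one> \<otimes> \<one>) \<cdot> Assoc V (X \<otimes> Y) \<one> \<one>"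
    by (rule pentagon) auto
  have "Assoc V X Y \<one> \<cdot> (((Id V X \<boxtimes> Run V Y) \<cdot> Assoc V X Y \<one>) \<boxtimes> Id V \<one>)
     = Assoc V X Y \<one> \<cdot> ((Id V X \<boxtimes> Run V Y) \<boxtimes> Id V \<one>) \<cdot> (Assoc V X Y \<one> \<boxtimes> Id V \<one>)" by simp
  also have "\<dots> = (Id V X \<boxtimes> (Run V Y \<boxtimes> Id V \<one>)) \<cdot> Assoc V X (Y \<otimes> \<one>) \<one> \<cdot> (Assoc V X Y \<one> \<boxtimes> Id V \<one>)"
    by (subst Assoc_nat_tail) auto
  also have "\<dots> = (Id V X \<boxtimes> (Id V Y \<boxtimes> Lun V \<one>)) \<cdot> (Id V X \<boxtimes> Assoc V Y \<one> \<one>) \<cdot> Assoc V X (Y \<otimes> \<one>) \<one> \<cdot> (Assoc V X Y \<one> \<boxtimes> Id V \<one>)"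
    by (simp add: triangle)
  also have "\<dots> = (Id V X \<boxtimes> (Id V Y \<boxtimes> Lun V \<one>)) \<cdot> Assoc V X Y (\<one> \<otimes> \<one>) \<cdot> Assoc V (X \<otimes> Y) \<one> \<one>"
    by (simp only: p)
  also have "\<dots> = Assoc V X Y \<one> \<cdot> ((Id V X \<boxtimes> Id V Y) \<boxtimes> Lun V \<one>) \<cdot> Assoc V (X \<otimes> Y) \<one> \<one>"
    by (subst Assoc_nat_tail) auto
  also have "\<dots> = Assoc V X Y \<one> \<cdot> (Run V (X \<otimes> Y) \<boxtimes> Id V \<one>)"
    by (simp add: triangle)
  finally have "((Id V X \<boxtimes> Run V Y) \<cdot> Assoc V X Y \<one>) \<boxtimes> Id V \<one> = Run V (X \<otimes> Y) \<boxtimes> Id V \<one>"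
    by (rule iso_mono) auto
  then show ?thesis by (rule ten_unit_faithful[symmetric]) auto
qed

text \<open>Naturality of \<open>Run\<close> at \<open>Run V \<one>\<close> identifies
  \<open>Run V (\<one> \<otimes> \<one>)\<close> with
  \<open>Run V \<one> \<boxtimes> Id V \<one>\<close>. Comparing the triangle at
  \<open>\<one>, \<one>\<close> with \<open>Run_Assoc\<close> then leaves \<open>Lun\<close> against
  \<open>Run\<close>.\<close>

lemma Lun_Run_unit: "Lun V \<one> = Run V \<one>"
proof -
  have "Run V \<one> \<cdot> (Run V \<one> \<boxtimes> Id V \<one>) = Run V \<one> \<cdot> Run V (\<one> \<otimes> \<one>)"
    using Run_nat[of "Run V \<one>" \<one>] by simp
  then have "Run V \<one> \<boxtimes> Id V \<one> = Run V (\<one> \<otimes> \<one>)"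
    by (rule iso_mono) auto
  then have "(Id V \<one> \<boxtimes> Lun V \<one>) \<cdot> Assoc V \<one> \<one> \<one> = (Id V \<one> \<boxtimes> Run V \<one>) \<cdot> Assoc V \<one> \<one> \<one>"
    by (simp add: triangle flip: Run_Assoc)
  then have "Id V \<one> \<boxtimes> Lun V \<one> = Id V \<one> \<boxtimes> Run V \<one>" by (rule iso_epi) auto
  then show ?thesis by (rule unit_ten_faithful) auto
qed

text \<open>Compatibility of the symmetry with the unit comes from the hexagon at
  \<open>X, \<one>, \<one>\<close>, after tensoring with \<open>\<one>\<close> on the right. The
  second equation follows because the symmetry is its own inverse.\<close>

lemma Lun_Sym:
  assumes [simp]: "X \<in> Obj V"
  shows "Lun V X \<cdot> Sym V X \<one> = Run V X" "Run V X \<cdot> Sym V \<one> X = Lun V X"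
proof -
  have h: "Assoc V \<one> \<one> X \<cdot> Sym V X (\<one> \<otimes> \<one>) \<cdot> Assoc V X \<one> \<one>
           = (Id V \<one> \<boxtimes> Sym V X \<one>) \<cdot> Assoc V \<one> X \<one> \<cdot> (Sym V X \<one> \<boxtimes> Id V \<one>)"
    by (rule hexagon) auto
  have "Sym V X \<one> \<cdot> ((Lun V X \<cdot> Sym V X \<one>) \<boxtimes> Id V \<one>) = Sym V X \<one> \<cdot> (Lun V X \<boxtimes> Id V \<one>) \<cdot> (Sym V X \<one> \<boxtimes> Id V \<one>)"
    by simp
  also have "\<dots> = Sym V X \<one> \<cdot> Lun V (X \<otimes> \<one>) \<cdot> Assoc V \<one> X \<one> \<cdot> (Sym V X \<one> \<boxtimes> Id V \<one>)"
    by (simp flip: Lun_Assoc)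
  also have "\<dots> = Lun V (\<one> \<otimes> X) \<cdot> (Id V \<one> \<boxtimes> Sym V X \<one>) \<cdot> Assoc V \<one> X \<one> \<cdot> (Sym V X \<one> \<boxtimes> Id V \<one>)"
    using comp_tail[OF Lun_nat[of "Sym V X \<one>" "\<one> \<otimes> X"]] by simp
  also have "\<dots> = Lun V (\<one> \<otimes> X) \<cdot> Assoc V \<one> \<one> X \<cdot> Sym V X (\<one> \<otimes> \<one>) \<cdot> Assoc V X \<one> \<one>"
    by (simp only: h)
  also have "\<dots> = (Lun V \<one> \<boxtimes> Id V X) \<cdot> Sym V X (\<one> \<otimes> \<one>) \<cdot> Assoc V X \<one> \<one>"
    by (subst comp_tail[OF Lun_Assoc]) auto
  also have "\<dots> = Sym V X \<one> \<cdot> (Id V X \<boxtimes> Lun V \<one>) \<cdot> Assoc V X \<one> \<one>"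
    using comp_tail[OF Sym_nat[of "Id V X" "Lun V \<one>" X \<one>]] by simp
  also have "\<dots> = Sym V X \<one> \<cdot> (Run V X \<boxtimes> Id V \<one>)"
    by (simp add: triangle)
  finally have "(Lun V X \<cdot> Sym V X \<one>) \<boxtimes> Id V \<one> = Run V X \<boxtimes> Id V \<one>"
    by (rule iso_mono) auto
  then show a: "Lun V X \<cdot> Sym V X \<one> = Run V X" by (rule ten_unit_faithful) auto
  show "Run V X \<cdot> Sym V \<one> X = Lun V X" by (simp flip: a)
qed

section \<open>Adjacent transpositions on right-nested tensor products and the braid
  relation\<close>

definition swp :: "'v \<Rightarrow> 'v \<Rightarrow> 'v \<Rightarrow> 'm" where
  "swp X Y R = Assoc V Y X R \<cdot> (Sym V X Y \<boxtimes> Id V R) \<cdot> inv_arr V (Assoc V X Y R)"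

lemma swp_arr [simp]:
  assumes "X \<in> Obj V" "Y \<in> Obj V" "R \<in> Obj V"
  shows "swp X Y R \<in> Arr V" "Dom V (swp X Y R) = X \<otimes> (Y \<otimes> R)" "Cod V (swp X Y R) = Y \<otimes> (X \<otimes> R)"
    "is_iso V (swp X Y R)"
  using assms by (auto simp: swp_def)

lemma swp_Assoc:
  "\<lbrakk>X \<in> Obj V; Y \<in> Obj V; R \<in> Obj V\<rbrakk> \<Longrightarrow>
    swp X Y R \<cdot> Assoc V X Y R = Assoc V Y X R \<cdot> (Sym V X Y \<boxtimes> Id V R)"
  by (simp add: swp_def)

lemma swp_swp:
  assumes "X \<in> Obj V" "Y \<in> Obj V" "R \<in> Obj V"
  shows "swp Y X R \<cdot> swp X Y R = Id V (X \<otimes> (Y \<otimes> R))"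
  using assms by (simp add: swp_def)

lemma swp_nat:
  assumes [simp]: "f \<in> Arr V" "g \<in> Arr V" "h \<in> Arr V" and e: "X = Cod V f" "Y = Cod V g" "Z = Cod V h"
  shows "swp X Y Z \<cdot> (f \<boxtimes> (g \<boxtimes> h)) = (g \<boxtimes> (f \<boxtimes> h)) \<cdot> swp (Dom V f) (Dom V g) (Dom V h)"
proof -
  have "(swp X Y Z \<cdot> (f \<boxtimes> (g \<boxtimes> h))) \<cdot> Assoc V (Dom V f) (Dom V g) (Dom V h)
     = swp X Y Z \<cdot> Assoc V X Y Z \<cdot> ((f \<boxtimes> g) \<boxtimes> h)"
    using e by (simp add: Assoc_nat)
  also have "\<dots> = Assoc V Y X Z \<cdot> ((Sym V X Y \<cdot> (f \<boxtimes> g)) \<boxtimes> h)"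
    using e by (subst comp_tail[OF swp_Assoc]) auto
  also have "\<dots> = Assoc V Y X Z \<cdot> ((g \<boxtimes> f) \<boxtimes> h) \<cdot> (Sym V (Dom V f) (Dom V g) \<boxtimes> Id V (Dom V h))"
    using e by (simp add: Sym_nat)
  also have "\<dots> = (g \<boxtimes> (f \<boxtimes> h)) \<cdot> Assoc V (Dom V g) (Dom V f) (Dom V h) \<cdot> (Sym V (Dom V f) (Dom V g) \<boxtimes> Id V (Dom V h))"
    using e by (subst Assoc_nat_tail) auto
  also have "\<dots> = ((g \<boxtimes> (f \<boxtimes> h)) \<cdot> swp (Dom V f) (Dom V g) (Dom V h)) \<cdot> Assoc V (Dom V f) (Dom V g) (Dom V h)"
    by (simp add: swp_Assoc)
  finally show ?thesis by (rule iso_epi) (use e in auto)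
qed

text \<open>\<open>swp\<close> acts on the two leading factors only, so it commutes with
  rebracketing the rest of the product. Two instances of the pentagon express this.\<close>

lemma swp_ten:
  assumes [simp]: "X \<in> Obj V" "Y \<in> Obj V" "P \<in> Obj V" "R \<in> Obj V"
  shows "swp X Y (P \<otimes> R) \<cdot> (Id V X \<boxtimes> Assoc V Y P R) \<cdot> Assoc V X (Y \<otimes> P) R
    = (Id V Y \<boxtimes> Assoc V X P R) \<cdot> Assoc V Y (X \<otimes> P) R \<cdot> (swp X Y P \<boxtimes> Id V R)"
proof -
  have p: "(Id V X \<boxtimes> Assoc V Y P R) \<cdot> Assoc V X (Y \<otimes> P) R \<cdot> (Assoc V X Y P \<boxtimes> Id V R)
     = Assoc V X Y (P \<otimes> R) \<cdot> Assoc V (X \<otimes> Y) P R"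
    and p': "(Id V Y \<boxtimes> Assoc V X P R) \<cdot> Assoc V Y (X \<otimes> P) R \<cdot> (Assoc V Y X P \<boxtimes> Id V R)
     = Assoc V Y X (P \<otimes> R) \<cdot> Assoc V (Y \<otimes> X) P R"
    by (rule pentagon; simp)+
  have "(swp X Y (P \<otimes> R) \<cdot> (Id V X \<boxtimes> Assoc V Y P R) \<cdot> Assoc V X (Y \<otimes> P) R) \<cdot> (Assoc V X Y P \<boxtimes> Id V R)
     = swp X Y (P \<otimes> R) \<cdot> (Id V X \<boxtimes> Assoc V Y P R) \<cdot> Assoc V X (Y \<otimes> P) R \<cdot> (Assoc V X Y P \<boxtimes> Id V R)"
    by simp
  also have "\<dots> = swp X Y (P \<otimes> R) \<cdot> Assoc V X Y (P \<otimes> R) \<cdot> Assoc V (X \<otimes> Y) P R"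
    by (simp only: p)
  also have "\<dots> = Assoc V Y X (P \<otimes> R) \<cdot> (Sym V X Y \<boxtimes> (Id V P \<boxtimes> Id V R)) \<cdot> Assoc V (X \<otimes> Y) P R"
    by (subst comp_tail[OF swp_Assoc]) auto
  also have "\<dots> = Assoc V Y X (P \<otimes> R) \<cdot> Assoc V (Y \<otimes> X) P R \<cdot> ((Sym V X Y \<boxtimes> Id V P) \<boxtimes> Id V R)"
    by (subst Assoc_nat) auto
  also have "\<dots> = (Assoc V Y X (P \<otimes> R) \<cdot> Assoc V (Y \<otimes> X) P R) \<cdot> ((Sym V X Y \<boxtimes> Id V P) \<boxtimes> Id V R)"
    by simp
  also have "\<dots> = ((Id V Y \<boxtimes> Assoc V X P R) \<cdot> Assoc V Y (X \<otimes> P) R \<cdot> (Assoc V Y X P \<boxtimes> Id V R)) \<cdot> ((Sym V X Y \<boxtimes> Id V P) \<boxtimes> Id V R)"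
    by (simp only: p')
  also have "\<dots> = ((Id V Y \<boxtimes> Assoc V X P R) \<cdot> Assoc V Y (X \<otimes> P) R \<cdot> (swp X Y P \<boxtimes> Id V R)) \<cdot> (Assoc V X Y P \<boxtimes> Id V R)"
    by (simp add: swp_Assoc)
  finally show ?thesis by (rule iso_epi) auto
qed

text \<open>The hexagon with a tail \<open>R\<close>: moving \<open>X\<close> past
  \<open>Y \<otimes> Z\<close> is moving it past \<open>Y\<close> and then past
  \<open>Z\<close>.\<close>

lemma swp_hexagon:
  assumes [simp]: "X \<in> Obj V" "Y \<in> Obj V" "Z \<in> Obj V" "R \<in> Obj V"
  shows "Assoc V Y Z (X \<otimes> R) \<cdot> swp X (Y \<otimes> Z) R
    = (Id V Y \<boxtimes> swp X Z R) \<cdot> swp X Y (Z \<otimes> R) \<cdot> (Id V X \<boxtimes> Assoc V Y Z R)"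
proof -
  have pXYZ: "(Id V X \<boxtimes> Assoc V Y Z R) \<cdot> Assoc V X (Y \<otimes> Z) R \<cdot> (Assoc V X Y Z \<boxtimes> Id V R)
     = Assoc V X Y (Z \<otimes> R) \<cdot> Assoc V (X \<otimes> Y) Z R"
    and pYZX: "(Id V Y \<boxtimes> Assoc V Z X R) \<cdot> Assoc V Y (Z \<otimes> X) R \<cdot> (Assoc V Y Z X \<boxtimes> Id V R)
     = Assoc V Y Z (X \<otimes> R) \<cdot> Assoc V (Y \<otimes> Z) X R"
    and pYXZ: "(Id V Y \<boxtimes> Assoc V X Z R) \<cdot> Assoc V Y (X \<otimes> Z) R \<cdot> (Assoc V Y X Z \<boxtimes> Id V R)
     = Assoc V Y X (Z \<otimes> R) \<cdot> Assoc V (Y \<otimes> X) Z R"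
    by (rule pentagon; simp)+
  have h: "Assoc V Y Z X \<cdot> Sym V X (Y \<otimes> Z) \<cdot> Assoc V X Y Z
           = (Id V Y \<boxtimes> Sym V X Z) \<cdot> Assoc V Y X Z \<cdot> (Sym V X Y \<boxtimes> Id V Z)"
    by (rule hexagon) auto
  let ?E = "Assoc V X (Y \<otimes> Z) R \<cdot> (Assoc V X Y Z \<boxtimes> Id V R)"
  let ?S = "(Assoc V Y X Z \<boxtimes> Id V R) \<cdot> ((Sym V X Y \<boxtimes> Id V Z) \<boxtimes> Id V R)"
  have "(Assoc V Y Z (X \<otimes> R) \<cdot> swp X (Y \<otimes> Z) R) \<cdot> ?E
     = Assoc V Y Z (X \<otimes> R) \<cdot> (swp X (Y \<otimes> Z) R \<cdot> Assoc V X (Y \<otimes> Z) R) \<cdot> (Assoc V X Y Z \<boxtimes> Id V R)"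
    by simp
  also have "\<dots> = (Assoc V Y Z (X \<otimes> R) \<cdot> Assoc V (Y \<otimes> Z) X R) \<cdot> ((Sym V X (Y \<otimes> Z) \<cdot> Assoc V X Y Z) \<boxtimes> Id V R)"
    by (simp add: swp_Assoc)
  also have "\<dots> = (Id V Y \<boxtimes> Assoc V Z X R) \<cdot> Assoc V Y (Z \<otimes> X) R \<cdot> ((Assoc V Y Z X \<cdot> Sym V X (Y \<otimes> Z) \<cdot> Assoc V X Y Z) \<boxtimes> Id V R)"
    unfolding pYZX[symmetric] by simp
  also have "\<dots> = (Id V Y \<boxtimes> Assoc V Z X R) \<cdot> Assoc V Y (Z \<otimes> X) R \<cdot> (((Id V Y \<boxtimes> Sym V X Z) \<cdot> Assoc V Y X Z \<cdot> (Sym V X Y \<boxtimes> Id V Z)) \<boxtimes> Id V R)"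
    by (simp only: h)
  also have "\<dots> = (Id V Y \<boxtimes> Assoc V Z X R) \<cdot> Assoc V Y (Z \<otimes> X) R \<cdot> ((Id V Y \<boxtimes> Sym V X Z) \<boxtimes> Id V R) \<cdot> ?S"
    by simp
  also have "\<dots> = (Id V Y \<boxtimes> Assoc V Z X R) \<cdot> (Id V Y \<boxtimes> (Sym V X Z \<boxtimes> Id V R)) \<cdot> Assoc V Y (X \<otimes> Z) R \<cdot> ?S"
    by (subst Assoc_nat_tail) auto
  also have "\<dots> = (Id V Y \<boxtimes> (swp X Z R \<cdot> Assoc V X Z R)) \<cdot> Assoc V Y (X \<otimes> Z) R \<cdot> ?S"
    by (simp add: swp_Assoc)
  also have "\<dots> = (Id V Y \<boxtimes> swp X Z R) \<cdot> ((Id V Y \<boxtimes> Assoc V X Z R) \<cdot> Assoc V Y (X \<otimes> Z) R \<cdot> (Assoc V Y X Z \<boxtimes> Id V R)) \<cdot> ((Sym V X Y \<boxtimes> Id V Z) \<boxtimes> Id V R)"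
    by simp
  also have "\<dots> = (Id V Y \<boxtimes> swp X Z R) \<cdot> Assoc V Y X (Z \<otimes> R) \<cdot> Assoc V (Y \<otimes> X) Z R \<cdot> ((Sym V X Y \<boxtimes> Id V Z) \<boxtimes> Id V R)"
    by (simp add: pYXZ)
  also have "\<dots> = (Id V Y \<boxtimes> swp X Z R) \<cdot> Assoc V Y X (Z \<otimes> R) \<cdot> (Sym V X Y \<boxtimes> (Id V Z \<boxtimes> Id V R)) \<cdot> Assoc V (X \<otimes> Y) Z R"
    by (subst Assoc_nat) auto
  also have "\<dots> = (Id V Y \<boxtimes> swp X Z R) \<cdot> (swp X Y (Z \<otimes> R) \<cdot> Assoc V X Y (Z \<otimes> R)) \<cdot> Assoc V (X \<otimes> Y) Z R"
    by (simp add: swp_Assoc)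
  also have "\<dots> = ((Id V Y \<boxtimes> swp X Z R) \<cdot> swp X Y (Z \<otimes> R) \<cdot> (Id V X \<boxtimes> Assoc V Y Z R)) \<cdot> ?E"
    by (simp add: pXYZ)
  finally show ?thesis by (rule iso_epi) auto
qed

text \<open>\<open>X\<close> can pass the pair of \<open>Y\<close> and \<open>Z\<close> before or
  after these are exchanged. By naturality of \<open>swp\<close> the two ways agree, and
  \<open>swp_hexagon\<close> splits each passage into two transpositions.\<close>

lemma swp_braid:
  assumes [simp]: "X \<in> Obj V" "Y \<in> Obj V" "Z \<in> Obj V" "R \<in> Obj V"
  shows "swp Y Z (X \<otimes> R) \<cdot> (Id V Y \<boxtimes> swp X Z R) \<cdot> swp X Y (Z \<otimes> R)
    = (Id V Z \<boxtimes> swp X Y R) \<cdot> swp X Z (Y \<otimes> R) \<cdot> (Id V X \<boxtimes> swp Y Z R)"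
proof -
  have "(swp Y Z (X \<otimes> R) \<cdot> (Id V Y \<boxtimes> swp X Z R) \<cdot> swp X Y (Z \<otimes> R)) \<cdot> (Id V X \<boxtimes> Assoc V Y Z R)
    = swp Y Z (X \<otimes> R) \<cdot> (Id V Y \<boxtimes> swp X Z R) \<cdot> swp X Y (Z \<otimes> R) \<cdot> (Id V X \<boxtimes> Assoc V Y Z R)"
    by simp
  also have "\<dots> = swp Y Z (X \<otimes> R) \<cdot> Assoc V Y Z (X \<otimes> R) \<cdot> swp X (Y \<otimes> Z) R"
    by (simp only: swp_hexagon[OF assms])
  also have "\<dots> = Assoc V Z Y (X \<otimes> R) \<cdot> (Sym V Y Z \<boxtimes> (Id V X \<boxtimes> Id V R)) \<cdot> swp X (Y \<otimes> Z) R"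
    by (subst comp_tail[OF swp_Assoc]) auto
  also have "\<dots> = Assoc V Z Y (X \<otimes> R) \<cdot> swp X (Z \<otimes> Y) R \<cdot> (Id V X \<boxtimes> (Sym V Y Z \<boxtimes> Id V R))"
    by (subst swp_nat) auto
  also have "\<dots> = (Assoc V Z Y (X \<otimes> R) \<cdot> swp X (Z \<otimes> Y) R) \<cdot> (Id V X \<boxtimes> (Sym V Y Z \<boxtimes> Id V R))"
    by simp
  also have "\<dots> = (Id V Z \<boxtimes> swp X Y R) \<cdot> swp X Z (Y \<otimes> R) \<cdot> (Id V X \<boxtimes> (Assoc V Z Y R \<cdot> (Sym V Y Z \<boxtimes> Id V R)))"
    by (simp add: swp_hexagon)
  also have "\<dots> = (Id V Z \<boxtimes> swp X Y R) \<cdot> swp X Z (Y \<otimes> R) \<cdot> (Id V X \<boxtimes> (swp Y Z R \<cdot> Assoc V Y Z R))"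
    by (simp add: swp_Assoc)
  also have "\<dots> = ((Id V Z \<boxtimes> swp X Y R) \<cdot> swp X Z (Y \<otimes> R) \<cdot> (Id V X \<boxtimes> swp Y Z R)) \<cdot> (Id V X \<boxtimes> Assoc V Y Z R)"
    by simp
  finally show ?thesis by (rule iso_epi) auto
qed

text \<open>The block \<open>X \<otimes> P\<close> moves past \<open>Y\<close> one factor at a time.
  This is the hexagon for \<open>Y, X, P\<close> read backwards.\<close>

lemma swp_Sym:
  assumes [simp]: "X \<in> Obj V" "Y \<in> Obj V" "P \<in> Obj V"
  shows "swp X Y P \<cdot> (Id V X \<boxtimes> Sym V P Y) \<cdot> Assoc V X P Y = Sym V (X \<otimes> P) Y"
proof -
  have h: "Assoc V X P Y \<cdot> Sym V Y (X \<otimes> P) \<cdot> Assoc V Y X P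
           = (Id V X \<boxtimes> Sym V Y P) \<cdot> Assoc V X Y P \<cdot> (Sym V Y X \<boxtimes> Id V P)"
    by (rule hexagon) auto
  have "(swp X Y P \<cdot> (Id V X \<boxtimes> Sym V P Y) \<cdot> Assoc V X P Y) \<cdot> (Sym V Y (X \<otimes> P) \<cdot> Assoc V Y X P)
    = swp X Y P \<cdot> (Id V X \<boxtimes> Sym V P Y) \<cdot> (Assoc V X P Y \<cdot> Sym V Y (X \<otimes> P) \<cdot> Assoc V Y X P)"
    by simp
  also have "\<dots> = Assoc V Y X P"
    unfolding h by (simp add: swp_def)
  also have "Assoc V Y X P = Sym V (X \<otimes> P) Y \<cdot> (Sym V Y (X \<otimes> P) \<cdot> Assoc V Y X P)"
    by simp
  finally show ?thesis by (rule iso_epi) auto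
qed


section \<open>Reordering tensor products along lists of labelled objects\<close>

fun tens :: "(nat \<times> 'v) list \<Rightarrow> 'v \<Rightarrow> 'v" where
  "tens [] R = R"
| "tens (x # xs) R = snd x \<otimes> tens xs R"

text \<open>
  The tensor product of \<open>xs\<close> is reordered to that of \<open>ys\<close> by pulling out the labels of \<open>ys\<close> one at a
  time.  That these reorderings compose replaces the coherence theorem.
\<close>

fun pull :: "nat \<times> 'v \<Rightarrow> (nat \<times> 'v) list \<Rightarrow> 'v \<Rightarrow> 'm" where
  "pull y [] R = undefined"
| "pull y (x # xs) R = (if x = y then Id V (tens (x # xs) R)
     else swp (snd x) (snd y) (tens (remove1 y xs) R) \<cdot> (Id V (snd x) \<boxtimes> pull y xs R))"

fun perm :: "(nat \<times> 'v) list \<Rightarrow> (nat \<times> 'v) list \<Rightarrow> 'v \<Rightarrow> 'm" where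
  "perm xs [] R = Id V R"
| "perm xs (y # ys) R = (Id V (snd y) \<boxtimes> perm (remove1 y xs) ys R) \<cdot> pull y xs R"

text \<open>This rebracketing isomorphism from \<open>tens xs \<one> \<otimes> R\<close> to
  \<open>tens xs R\<close> relates the tensor product of two lists to that of their concatenation.
  For the empty list it is the left unitor.\<close>

fun mu :: "(nat \<times> 'v) list \<Rightarrow> 'v \<Rightarrow> 'm" where
  "mu [] R = Lun V R"
| "mu (x # xs) R = (Id V (snd x) \<boxtimes> mu xs R) \<cdot> Assoc V (snd x) (tens xs \<one>) R"

definition lob :: "(nat \<times> 'v) list \<Rightarrow> bool" where
  "lob xs \<longleftrightarrow> (\<forall>x \<in> set xs. snd x \<in> Obj V)"

lemma lob_simps [simp]:
  "lob []" "lob (x # xs) \<longleftrightarrow> snd x \<in> Obj V \<and> lob xs" "lob (xs @ ys) \<longleftrightarrow> lob xs \<and> lob ys"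
  "lob xs \<Longrightarrow> lob (remove1 y xs)" "lob xs \<Longrightarrow> y \<in> set xs \<Longrightarrow> snd y \<in> Obj V"
  using set_remove1_subset[of y xs] by (auto simp: lob_def)

lemma tens_obj [simp]: "lob xs \<Longrightarrow> R \<in> Obj V \<Longrightarrow> tens xs R \<in> Obj V"
  by (induction xs) auto

text \<open>The reason for the base object \<open>R\<close> in \<open>tens\<close>: concatenation
  becomes substitution of the second product for \<open>R\<close>, an equality rather than an
  isomorphism.\<close>

lemma tens_append [simp]: "tens (xs @ ys) R = tens xs (tens ys R)"
  by (induction xs) auto

lemma pull_arr [simp]:
  assumes "y \<in> set xs" "lob xs" "R \<in> Obj V"
  shows "pull y xs R \<in> Arr V" "Dom V (pull y xs R) = tens xs R"
    "Cod V (pull y xs R) = snd y \<otimes> tens (remove1 y xs) R" "is_iso V (pull y xs R)"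
  using assms by (induction xs) (auto simp: iso_arr)

lemma perm_arr [simp]:
  assumes "set xs = set ys" "distinct xs" "distinct ys" "lob xs" "R \<in> Obj V"
  shows "perm xs ys R \<in> Arr V" "Dom V (perm xs ys R) = tens xs R" "Cod V (perm xs ys R) = tens ys R"
    "is_iso V (perm xs ys R)"
proof -
  have "perm xs ys R \<in> Arr V \<and> Dom V (perm xs ys R) = tens xs R \<and> Cod V (perm xs ys R) = tens ys R
      \<and> is_iso V (perm xs ys R)"
    using assms
  proof (induction ys arbitrary: xs)
    case (Cons y ys)
    have "set (remove1 y xs) = set ys" "y \<in> set xs" using Cons.prems by auto
    then show ?case using Cons by auto
  qed auto
  then show "perm xs ys R \<in> Arr V" "Dom V (perm xs ys R) = tens xs R" "Cod V (perm xs ys R) = tens ys R"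
    "is_iso V (perm xs ys R)" by auto
qed

lemma mu_arr [simp]:
  assumes "lob xs" "R \<in> Obj V"
  shows "mu xs R \<in> Arr V" "Dom V (mu xs R) = tens xs \<one> \<otimes> R" "Cod V (mu xs R) = tens xs R"
    "is_iso V (mu xs R)"
  using assms by (induction xs) (auto simp: iso_arr)

text \<open>The relations of the symmetric group in inductive form. A head equal to \<open>z\<close>
  is handled by \<open>swp_swp\<close>, and a head different from both labels by
  \<open>swp_braid\<close> and naturality.\<close>

lemma pull_pull:
  assumes "y \<noteq> z" "y \<in> set xs" "z \<in> set xs" "distinct xs" "lob xs" and R[simp]: "R \<in> Obj V"
  shows "swp (snd y) (snd z) (tens (remove1 z (remove1 y xs)) R) \<cdot> (Id V (snd y) \<boxtimes> pull z (remove1 y xs) R) \<cdot> pull y xs R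
    = (Id V (snd z) \<boxtimes> pull y (remove1 z xs) R) \<cdot> pull z xs R"
  using assms
proof (induction xs)
  case (Cons x xs)
  have cs: "x = y \<and> z \<in> set xs \<or> x = z \<and> y \<in> set xs \<or> x \<noteq> y \<and> x \<noteq> z \<and> y \<in> set xs \<and> z \<in> set xs"
    using Cons.prems by auto
  note [simp] = Cons.prems(1) Cons.prems(1)[symmetric]
  have [simp]: "lob xs" "distinct xs" "x \<notin> set xs" "snd x \<in> Obj V" using Cons.prems by auto
  have [simp]: "snd y \<in> Obj V" "snd z \<in> Obj V"
    using Cons.prems(5) Cons.prems(2,3) lob_def by blast+
  consider "x = y" "z \<in> set xs" | "x = z" "y \<in> set xs" | "x \<noteq> y" "x \<noteq> z" "y \<in> set xs" "z \<in> set xs"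
    using cs by auto
  then show ?case
  proof cases
    case 1
    then show ?thesis by simp
  next
    case 2
    then show ?thesis using comp_tail[OF swp_swp[of "snd z" "snd y" "tens (remove1 y xs) R"]] by simp
  next
    case 3
    note [simp] = 3 3(1,2)[symmetric]
    let ?X = "snd x" and ?Y = "snd y" and ?Z = "snd z" and ?Q = "tens (remove1 z (remove1 y xs)) R"
    have rc: "remove1 y (remove1 z xs) = remove1 z (remove1 y xs)" by (rule remove1_commute)
    have IH: "swp ?Y ?Z ?Q \<cdot> (Id V ?Y \<boxtimes> pull z (remove1 y xs) R) \<cdot> pull y xs R
       = (Id V ?Z \<boxtimes> pull y (remove1 z xs) R) \<cdot> pull z xs R"
      using Cons by simp
    have "swp ?Y ?Z (?X \<otimes> ?Q) \<cdot> (Id V ?Y \<boxtimes> pull z (remove1 y (x # xs)) R) \<cdot> pull y (x # xs) R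
      = swp ?Y ?Z (?X \<otimes> ?Q) \<cdot> (Id V ?Y \<boxtimes> swp ?X ?Z ?Q) \<cdot> ((Id V ?Y \<boxtimes> (Id V ?X \<boxtimes> pull z (remove1 y xs) R)) \<cdot> swp ?X ?Y (tens (remove1 y xs) R)) \<cdot> (Id V ?X \<boxtimes> pull y xs R)"
      by simp
    also have "\<dots> = swp ?Y ?Z (?X \<otimes> ?Q) \<cdot> (Id V ?Y \<boxtimes> swp ?X ?Z ?Q) \<cdot> (swp ?X ?Y (?Z \<otimes> ?Q) \<cdot> (Id V ?X \<boxtimes> (Id V ?Y \<boxtimes> pull z (remove1 y xs) R))) \<cdot> (Id V ?X \<boxtimes> pull y xs R)"
      using swp_nat[of "Id V ?X" "Id V ?Y" "pull z (remove1 y xs) R" ?X ?Y "?Z \<otimes> ?Q"] by simp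
    also have "\<dots> = (swp ?Y ?Z (?X \<otimes> ?Q) \<cdot> (Id V ?Y \<boxtimes> swp ?X ?Z ?Q) \<cdot> swp ?X ?Y (?Z \<otimes> ?Q)) \<cdot> (Id V ?X \<boxtimes> ((Id V ?Y \<boxtimes> pull z (remove1 y xs) R) \<cdot> pull y xs R))"
      by simp
    also have "\<dots> = (Id V ?Z \<boxtimes> swp ?X ?Y ?Q) \<cdot> swp ?X ?Z (?Y \<otimes> ?Q) \<cdot> (Id V ?X \<boxtimes> (swp ?Y ?Z ?Q \<cdot> (Id V ?Y \<boxtimes> pull z (remove1 y xs) R) \<cdot> pull y xs R))"
      by (simp add: swp_braid)
    also have "\<dots> = (Id V ?Z \<boxtimes> swp ?X ?Y ?Q) \<cdot> swp ?X ?Z (?Y \<otimes> ?Q) \<cdot> (Id V ?X \<boxtimes> ((Id V ?Z \<boxtimes> pull y (remove1 z xs) R) \<cdot> pull z xs R))"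
      by (simp only: IH)
    also have "\<dots> = (Id V ?Z \<boxtimes> swp ?X ?Y ?Q) \<cdot> (swp ?X ?Z (?Y \<otimes> ?Q) \<cdot> (Id V ?X \<boxtimes> (Id V ?Z \<boxtimes> pull y (remove1 z xs) R))) \<cdot> (Id V ?X \<boxtimes> pull z xs R)"
      by (simp add: rc)
    also have "\<dots> = (Id V ?Z \<boxtimes> swp ?X ?Y ?Q) \<cdot> ((Id V ?Z \<boxtimes> (Id V ?X \<boxtimes> pull y (remove1 z xs) R)) \<cdot> swp ?X ?Z (tens (remove1 z xs) R)) \<cdot> (Id V ?X \<boxtimes> pull z xs R)"
      using swp_nat[of "Id V ?X" "Id V ?Z" "pull y (remove1 z xs) R" ?X ?Z "?Y \<otimes> ?Q"] by (simp add: rc)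
    also have "\<dots> = (Id V ?Z \<boxtimes> pull y (remove1 z (x # xs)) R) \<cdot> pull z (x # xs) R"
      by (simp add: rc)
    finally show ?thesis by simp
  qed
qed simp

text \<open>Extraction commutes with reordering. The inductive step moves \<open>z\<close> past the
  head \<open>y\<close> of the target list and uses \<open>pull_pull\<close> to exchange the order
  in which \<open>y\<close> and \<open>z\<close> leave \<open>xs\<close>.\<close>

lemma pull_perm:
  assumes "z \<in> set ys" "set xs = set ys" "distinct xs" "distinct ys" "lob xs" "lob ys" and R[simp]: "R \<in> Obj V"
  shows "pull z ys R \<cdot> perm xs ys R = (Id V (snd z) \<boxtimes> perm (remove1 z xs) (remove1 z ys) R) \<cdot> pull z xs R"
  using assms
proof (induction ys arbitrary: xs)
  case (Cons y ys)
  have [simp]: "lob ys" "distinct ys" "y \<notin> set ys" "snd y \<in> Obj V" "lob xs" "distinct xs" "y \<in> set xs"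
    using Cons.prems by auto
  have s: "set xs = insert y (set ys)" using Cons.prems by simp
  show ?case
  proof (cases "y = z")
    case True
    have "set (remove1 y xs) = set ys" using s by simp
    then show ?thesis by (simp flip: True)
  next
    case False
    then have [simp]: "z \<in> set ys" "z \<in> set xs" "y \<noteq> z" "z \<noteq> y" "snd z \<in> Obj V" using Cons.prems s
      by (auto simp: lob_def)
    have rc: "remove1 y (remove1 z xs) = remove1 z (remove1 y xs)" by (rule remove1_commute)
    have s1: "set (remove1 y xs) = set ys" using s by simp
    have s2: "set (remove1 z (remove1 y xs)) = set (remove1 z ys)" using s by simp
    let ?P = "perm (remove1 z (remove1 y xs)) (remove1 z ys) R"
    have "pull z (y # ys) R \<cdot> perm xs (y # ys) R
      = swp (snd y) (snd z) (tens (remove1 z ys) R) \<cdot> (Id V (snd y) \<boxtimes> (pull z ys R \<cdot> perm (remove1 y xs) ys R)) \<cdot> pull y xs R"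
      using s1 by simp
    also have "\<dots> = swp (snd y) (snd z) (tens (remove1 z ys) R) \<cdot> (Id V (snd y) \<boxtimes> ((Id V (snd z) \<boxtimes> ?P) \<cdot> pull z (remove1 y xs) R)) \<cdot> pull y xs R"
      using Cons.IH[of "remove1 y xs"] s1 by simp
    also have "\<dots> = (swp (snd y) (snd z) (tens (remove1 z ys) R) \<cdot> (Id V (snd y) \<boxtimes> (Id V (snd z) \<boxtimes> ?P))) \<cdot> (Id V (snd y) \<boxtimes> pull z (remove1 y xs) R) \<cdot> pull y xs R"
      using s2 by simp
    also have "\<dots> = (Id V (snd z) \<boxtimes> (Id V (snd y) \<boxtimes> ?P)) \<cdot> (swp (snd y) (snd z) (tens (remove1 z (remove1 y xs)) R) \<cdot> (Id V (snd y) \<boxtimes> pull z (remove1 y xs) R) \<cdot> pull y xs R)"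
      using swp_nat[of "Id V (snd y)" "Id V (snd z)" ?P "snd y" "snd z" "tens (remove1 z ys) R"] s2 by simp
    also have "\<dots> = (Id V (snd z) \<boxtimes> (Id V (snd y) \<boxtimes> ?P)) \<cdot> (Id V (snd z) \<boxtimes> pull y (remove1 z xs) R) \<cdot> pull z xs R"
      by (simp add: pull_pull)
    also have "\<dots> = (Id V (snd z) \<boxtimes> perm (remove1 z xs) (remove1 z (y # ys)) R) \<cdot> pull z xs R"
      using s2 by (simp add: rc)
    finally show ?thesis .
  qed
qed simp

text \<open>Induction on the final list: its head is pulled out of the intermediate list, and
  \<open>pull_perm\<close> turns this into pulling it out of the first one.\<close>

lemma perm_perm:
  assumes "set xs = set ys" "set ys = set zs" "distinct xs" "distinct ys" "distinct zs"
    "lob xs" "lob ys" "lob zs" and R[simp]: "R \<in> Obj V"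
  shows "perm ys zs R \<cdot> perm xs ys R = perm xs zs R"
  using assms
proof (induction zs arbitrary: xs ys)
  case (Cons z zs)
  have [simp]: "z \<in> set xs" "z \<in> set ys" "z \<notin> set zs" "distinct xs" "distinct ys" "distinct zs"
    "lob xs" "lob ys" "lob zs" "snd z \<in> Obj V" using Cons.prems by auto
  have s: "set xs = insert z (set zs)" "set ys = insert z (set zs)" using Cons.prems by auto
  have "perm ys (z # zs) R \<cdot> perm xs ys R
     = (Id V (snd z) \<boxtimes> perm (remove1 z ys) zs R) \<cdot> (pull z ys R \<cdot> perm xs ys R)"
    using s by simp
  also have "\<dots> = (Id V (snd z) \<boxtimes> perm (remove1 z ys) zs R) \<cdot> (Id V (snd z) \<boxtimes> perm (remove1 z xs) (remove1 z ys) R) \<cdot> pull z xs R"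
    using s by (simp add: pull_perm)
  also have "\<dots> = perm xs (z # zs) R" using s by (simp add: Cons.IH)
  finally show ?case .
qed simp

lemma perm_refl [simp]: "distinct xs \<Longrightarrow> lob xs \<Longrightarrow> R \<in> Obj V \<Longrightarrow> perm xs xs R = Id V (tens xs R)"
  by (induction xs) auto

lemma pull_append: "y \<in> set xs \<Longrightarrow> pull y (xs @ ys) R = pull y xs (tens ys R)"
  by (induction xs) (auto simp: remove1_append)

lemma perm_append_right:
  assumes "set xs = set ys" "distinct xs" "distinct ys" "distinct zs" "set xs \<inter> set zs = {}"
    "lob xs" "lob ys" "lob zs" and R[simp]: "R \<in> Obj V"
  shows "perm (xs @ zs) (ys @ zs) R = perm xs ys (tens zs R)"
  using assms
proof (induction ys arbitrary: xs)
  case (Cons y ys)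
  then have "y \<in> set xs" "set (remove1 y xs) = set ys" by auto
  then show ?case using Cons by (auto simp: pull_append remove1_append)
qed simp

lemma perm_append_left:
  assumes "set ys = set zs" "distinct xs" "distinct ys" "distinct zs" "set xs \<inter> set zs = {}"
    "lob xs" "lob ys" "lob zs"
  shows "perm (xs @ ys) (xs @ zs) \<one> \<cdot> mu xs (tens ys \<one>) = mu xs (tens zs \<one>) \<cdot> (Id V (tens xs \<one>) \<boxtimes> perm ys zs \<one>)"
  using assms
proof (induction xs)
  case Nil
  then show ?case using Lun_nat[of "perm ys zs \<one>" "tens zs \<one>"] by simp
next
  case (Cons x xs)
  have s: "set (xs @ ys) = set (xs @ zs)" using Cons.prems by simp
  let ?I = "Id V (snd x)" and ?T = "Id V (tens xs \<one>)" and ?p = "perm ys zs \<one>"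
  have "perm ((x # xs) @ ys) ((x # xs) @ zs) \<one> \<cdot> mu (x # xs) (tens ys \<one>)
     = (?I \<boxtimes> (perm (xs @ ys) (xs @ zs) \<one> \<cdot> mu xs (tens ys \<one>))) \<cdot> Assoc V (snd x) (tens xs \<one>) (tens ys \<one>)"
    using Cons.prems s by simp
  also have "\<dots> = (?I \<boxtimes> mu xs (tens zs \<one>)) \<cdot> (?I \<boxtimes> (?T \<boxtimes> ?p)) \<cdot> Assoc V (snd x) (tens xs \<one>) (tens ys \<one>)"
    using Cons by simp
  also have "\<dots> = (?I \<boxtimes> mu xs (tens zs \<one>)) \<cdot> Assoc V (snd x) (tens xs \<one>) (tens zs \<one>) \<cdot> ((?I \<boxtimes> ?T) \<boxtimes> ?p)"
    using Cons.prems by (subst Assoc_nat) auto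
  finally show ?case using Cons.prems by simp
qed

text \<open>Naturality of \<open>mu xs R\<close> under reordering of \<open>xs\<close>, for a single
  extraction; \<open>perm_mu\<close> iterates it. The case of a different head is
  \<open>swp_ten\<close>.\<close>

lemma pull_mu:
  assumes "y \<in> set xs" "lob xs" "R \<in> Obj V"
  shows "pull y xs R \<cdot> mu xs R = (Id V (snd y) \<boxtimes> mu (remove1 y xs) R) \<cdot> Assoc V (snd y) (tens (remove1 y xs) \<one>) R \<cdot> (pull y xs \<one> \<boxtimes> Id V R)"
  using assms
proof (induction xs)
  case (Cons x xs)
  note [simp] = \<open>R \<in> Obj V\<close>
  show ?case
  proof (cases "x = y")
    case True
    then show ?thesis using Cons.prems by simp
  next
    case False
    then have [simp]: "y \<in> set xs" "lob xs" "snd x \<in> Obj V" "snd y \<in> Obj V" "x \<noteq> y" "y \<noteq> x"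
      using Cons.prems by auto
    let ?X = "snd x" and ?Y = "snd y" and ?P = "tens (remove1 y xs) \<one>" and ?m = "mu (remove1 y xs) R"
    have "pull y (x # xs) R \<cdot> mu (x # xs) R
      = swp ?X ?Y (tens (remove1 y xs) R) \<cdot> (Id V ?X \<boxtimes> (pull y xs R \<cdot> mu xs R)) \<cdot> Assoc V ?X (tens xs \<one>) R"
      by simp
    also have "\<dots> = swp ?X ?Y (tens (remove1 y xs) R) \<cdot> (Id V ?X \<boxtimes> ((Id V ?Y \<boxtimes> ?m) \<cdot> Assoc V ?Y ?P R \<cdot> (pull y xs \<one> \<boxtimes> Id V R))) \<cdot> Assoc V ?X (tens xs \<one>) R"
      by (simp only: Cons.IH[OF \<open>y \<in> set xs\<close> \<open>lob xs\<close> \<open>R \<in> Obj V\<close>])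
    also have "\<dots> = (swp ?X ?Y (tens (remove1 y xs) R) \<cdot> (Id V ?X \<boxtimes> (Id V ?Y \<boxtimes> ?m))) \<cdot> (Id V ?X \<boxtimes> Assoc V ?Y ?P R) \<cdot> ((Id V ?X \<boxtimes> (pull y xs \<one> \<boxtimes> Id V R)) \<cdot> Assoc V ?X (tens xs \<one>) R)"
      by simp
    also have "\<dots> = ((Id V ?Y \<boxtimes> (Id V ?X \<boxtimes> ?m)) \<cdot> swp ?X ?Y (?P \<otimes> R)) \<cdot> (Id V ?X \<boxtimes> Assoc V ?Y ?P R) \<cdot> (Assoc V ?X (?Y \<otimes> ?P) R \<cdot> ((Id V ?X \<boxtimes> pull y xs \<one>) \<boxtimes> Id V R))"
      by (subst swp_nat; (subst Assoc_nat)?) auto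
    also have "\<dots> = (Id V ?Y \<boxtimes> (Id V ?X \<boxtimes> ?m)) \<cdot> (swp ?X ?Y (?P \<otimes> R) \<cdot> (Id V ?X \<boxtimes> Assoc V ?Y ?P R) \<cdot> Assoc V ?X (?Y \<otimes> ?P) R) \<cdot> ((Id V ?X \<boxtimes> pull y xs \<one>) \<boxtimes> Id V R)"
      by simp
    also have "\<dots> = (Id V ?Y \<boxtimes> mu (remove1 y (x # xs)) R) \<cdot> Assoc V ?Y (tens (remove1 y (x # xs)) \<one>) R \<cdot> (pull y (x # xs) \<one> \<boxtimes> Id V R)"
      by (subst swp_ten) auto
    finally show ?thesis .
  qed
qed simp

lemma perm_mu:
  assumes "set xs = set ys" "distinct xs" "distinct ys" "lob xs" "lob ys" and R[simp]: "R \<in> Obj V"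
  shows "perm xs ys R \<cdot> mu xs R = mu ys R \<cdot> (perm xs ys \<one> \<boxtimes> Id V R)"
  using assms
proof (induction ys arbitrary: xs)
  case (Cons y ys)
  then have [simp]: "y \<in> set xs" "set (remove1 y xs) = set ys" "lob xs" "distinct xs" "lob ys" "distinct ys"
    "snd y \<in> Obj V" by auto
  let ?Y = "Id V (snd y)" and ?P = "tens (remove1 y xs) \<one>"
  have "perm xs (y # ys) R \<cdot> mu xs R = (?Y \<boxtimes> perm (remove1 y xs) ys R) \<cdot> (pull y xs R \<cdot> mu xs R)"
    by simp
  also have "\<dots> = (?Y \<boxtimes> (perm (remove1 y xs) ys R \<cdot> mu (remove1 y xs) R)) \<cdot> Assoc V (snd y) ?P R \<cdot> (pull y xs \<one> \<boxtimes> Id V R)"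
    by (simp add: pull_mu)
  also have "\<dots> = (?Y \<boxtimes> (mu ys R \<cdot> (perm (remove1 y xs) ys \<one> \<boxtimes> Id V R))) \<cdot> Assoc V (snd y) ?P R \<cdot> (pull y xs \<one> \<boxtimes> Id V R)"
    by (subst Cons.IH) auto
  also have "\<dots> = (?Y \<boxtimes> mu ys R) \<cdot> (?Y \<boxtimes> (perm (remove1 y xs) ys \<one> \<boxtimes> Id V R)) \<cdot> Assoc V (snd y) ?P R \<cdot> (pull y xs \<one> \<boxtimes> Id V R)"
    by simp
  also have "\<dots> = (?Y \<boxtimes> mu ys R) \<cdot> Assoc V (snd y) (tens ys \<one>) R \<cdot> ((?Y \<boxtimes> perm (remove1 y xs) ys \<one>) \<boxtimes> Id V R) \<cdot> (pull y xs \<one> \<boxtimes> Id V R)"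
    by (subst Assoc_nat_tail) auto
  finally show ?case by simp
qed simp

text \<open>The pentagon for lists: splitting a concatenation into three blocks does not depend on
  the bracketing. Associativity of pairing rests on this.\<close>

lemma mu_mu:
  assumes "lob xs" "lob ys" "R \<in> Obj V"
  shows "mu (xs @ ys) R \<cdot> (mu xs (tens ys \<one>) \<boxtimes> Id V R)
    = mu xs (tens ys R) \<cdot> (Id V (tens xs \<one>) \<boxtimes> mu ys R) \<cdot> Assoc V (tens xs \<one>) (tens ys \<one>) R"
  using assms
proof (induction xs)
  case Nil
  have "mu ys R \<cdot> (Lun V (tens ys \<one>) \<boxtimes> Id V R) = mu ys R \<cdot> Lun V (tens ys \<one> \<otimes> R) \<cdot> Assoc V \<one> (tens ys \<one>) R"
    using Nil by (simp add: Lun_Assoc)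
  also have "\<dots> = Lun V (tens ys R) \<cdot> (Id V \<one> \<boxtimes> mu ys R) \<cdot> Assoc V \<one> (tens ys \<one>) R"
    using comp_tail[OF Lun_nat[of "mu ys R" "tens ys R"]] Nil by simp
  finally show ?case by simp
next
  case (Cons x xs)
  then have [simp]: "lob xs" "lob ys" "R \<in> Obj V" "snd x \<in> Obj V" by auto
  let ?X = "Id V (snd x)" and ?P = "tens xs \<one>" and ?Q = "tens ys \<one>"
  have p: "(?X \<boxtimes> Assoc V ?P ?Q R) \<cdot> Assoc V (snd x) (?P \<otimes> ?Q) R \<cdot> (Assoc V (snd x) ?P ?Q \<boxtimes> Id V R)
     = Assoc V (snd x) ?P (?Q \<otimes> R) \<cdot> Assoc V (snd x \<otimes> ?P) ?Q R"
    by (rule pentagon) auto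
  have "mu ((x # xs) @ ys) R \<cdot> (mu (x # xs) ?Q \<boxtimes> Id V R)
     = (?X \<boxtimes> mu (xs @ ys) R) \<cdot> (Assoc V (snd x) (tens xs ?Q) R \<cdot> ((?X \<boxtimes> mu xs ?Q) \<boxtimes> Id V R)) \<cdot> (Assoc V (snd x) ?P ?Q \<boxtimes> Id V R)"
    by simp
  also have "\<dots> = (?X \<boxtimes> mu (xs @ ys) R) \<cdot> ((?X \<boxtimes> (mu xs ?Q \<boxtimes> Id V R)) \<cdot> Assoc V (snd x) (?P \<otimes> ?Q) R) \<cdot> (Assoc V (snd x) ?P ?Q \<boxtimes> Id V R)"
    by (subst Assoc_nat) auto
  also have "\<dots> = (?X \<boxtimes> (mu (xs @ ys) R \<cdot> (mu xs ?Q \<boxtimes> Id V R))) \<cdot> Assoc V (snd x) (?P \<otimes> ?Q) R \<cdot> (Assoc V (snd x) ?P ?Q \<boxtimes> Id V R)"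
    by simp
  also have "\<dots> = (?X \<boxtimes> mu xs (tens ys R)) \<cdot> (?X \<boxtimes> (Id V ?P \<boxtimes> mu ys R)) \<cdot> ((?X \<boxtimes> Assoc V ?P ?Q R) \<cdot> Assoc V (snd x) (?P \<otimes> ?Q) R \<cdot> (Assoc V (snd x) ?P ?Q \<boxtimes> Id V R))"
    by (simp add: Cons.IH)
  also have "\<dots> = (?X \<boxtimes> mu xs (tens ys R)) \<cdot> ((?X \<boxtimes> (Id V ?P \<boxtimes> mu ys R)) \<cdot> Assoc V (snd x) ?P (?Q \<otimes> R)) \<cdot> Assoc V (snd x \<otimes> ?P) ?Q R"
    by (simp add: p)
  also have "\<dots> = (?X \<boxtimes> mu xs (tens ys R)) \<cdot> (Assoc V (snd x) ?P (tens ys R) \<cdot> ((?X \<boxtimes> Id V ?P) \<boxtimes> mu ys R)) \<cdot> Assoc V (snd x \<otimes> ?P) ?Q R"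
    by (subst Assoc_nat) auto
  finally show ?case by simp
qed

lemma mu_unit: "lob xs \<Longrightarrow> mu xs \<one> = Run V (tens xs \<one>)"
  by (induction xs) (auto simp: Lun_Run_unit Run_Assoc)

text \<open>The single label \<open>y\<close> crosses the whole block \<open>xs\<close>, and the
  transpositions add up to one symmetry of \<open>V\<close>. Induction on \<open>xs\<close> by
  \<open>swp_ten\<close> and \<open>swp_Sym\<close>.\<close>

lemma pull_mu_Sym:
  assumes "y \<notin> set xs" "lob xs" "lob ys" "snd y \<in> Obj V" "R \<in> Obj V"
  shows "pull y (xs @ y # ys) R \<cdot> mu xs (snd y \<otimes> tens ys R) \<cdot> Assoc V (tens xs \<one>) (snd y) (tens ys R)
    = (Id V (snd y) \<boxtimes> mu xs (tens ys R)) \<cdot> Assoc V (snd y) (tens xs \<one>) (tens ys R) \<cdot> (Sym V (tens xs \<one>) (snd y) \<boxtimes> Id V (tens ys R))"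
  using assms
proof (induction xs)
  case Nil
  then show ?case using comp_tail[OF triangle[of "snd y" "tens ys R"], of "Sym V \<one> (snd y) \<boxtimes> Id V (tens ys R)"]
    by (simp add: Lun_Assoc Lun_Sym)
next
  case (Cons x xs)
  then have [simp]: "lob xs" "lob ys" "R \<in> Obj V" "snd x \<in> Obj V" "snd y \<in> Obj V" "x \<noteq> y" "y \<notin> set xs" by auto
  have [simp]: "remove1 y (xs @ y # ys) = xs @ ys" by (simp add: remove1_append)
  let ?X = "snd x" and ?Y = "snd y" and ?P = "tens xs \<one>" and ?S = "tens ys R"
  have p: "(Id V ?X \<boxtimes> Assoc V ?P ?Y ?S) \<cdot> Assoc V ?X (?P \<otimes> ?Y) ?S \<cdot> (Assoc V ?X ?P ?Y \<boxtimes> Id V ?S)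
     = Assoc V ?X ?P (?Y \<otimes> ?S) \<cdot> Assoc V (?X \<otimes> ?P) ?Y ?S"
    by (rule pentagon) auto
  have "pull y ((x # xs) @ y # ys) R \<cdot> mu (x # xs) (?Y \<otimes> ?S) \<cdot> Assoc V (tens (x # xs) \<one>) ?Y ?S
     = swp ?X ?Y (tens xs ?S) \<cdot> (Id V ?X \<boxtimes> (pull y (xs @ y # ys) R \<cdot> mu xs (?Y \<otimes> ?S))) \<cdot> (Assoc V ?X ?P (?Y \<otimes> ?S) \<cdot> Assoc V (?X \<otimes> ?P) ?Y ?S)"
    by simp
  also have "\<dots> = swp ?X ?Y (tens xs ?S) \<cdot> (Id V ?X \<boxtimes> (pull y (xs @ y # ys) R \<cdot> mu xs (?Y \<otimes> ?S) \<cdot> Assoc V ?P ?Y ?S)) \<cdot> Assoc V ?X (?P \<otimes> ?Y) ?S \<cdot> (Assoc V ?X ?P ?Y \<boxtimes> Id V ?S)"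
    unfolding p[symmetric] by simp
  also have "\<dots> = swp ?X ?Y (tens xs ?S) \<cdot> (Id V ?X \<boxtimes> ((Id V ?Y \<boxtimes> mu xs ?S) \<cdot> Assoc V ?Y ?P ?S \<cdot> (Sym V ?P ?Y \<boxtimes> Id V ?S))) \<cdot> Assoc V ?X (?P \<otimes> ?Y) ?S \<cdot> (Assoc V ?X ?P ?Y \<boxtimes> Id V ?S)"
    using Cons.IH by simp
  also have "\<dots> = (swp ?X ?Y (tens xs ?S) \<cdot> (Id V ?X \<boxtimes> (Id V ?Y \<boxtimes> mu xs ?S))) \<cdot> (Id V ?X \<boxtimes> Assoc V ?Y ?P ?S) \<cdot> ((Id V ?X \<boxtimes> (Sym V ?P ?Y \<boxtimes> Id V ?S)) \<cdot> Assoc V ?X (?P \<otimes> ?Y) ?S) \<cdot> (Assoc V ?X ?P ?Y \<boxtimes> Id V ?S)"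
    by simp
  also have "\<dots> = ((Id V ?Y \<boxtimes> (Id V ?X \<boxtimes> mu xs ?S)) \<cdot> swp ?X ?Y (?P \<otimes> ?S)) \<cdot> (Id V ?X \<boxtimes> Assoc V ?Y ?P ?S) \<cdot> (Assoc V ?X (?Y \<otimes> ?P) ?S \<cdot> ((Id V ?X \<boxtimes> Sym V ?P ?Y) \<boxtimes> Id V ?S)) \<cdot> (Assoc V ?X ?P ?Y \<boxtimes> Id V ?S)"
    by (subst swp_nat; (subst Assoc_nat)?) auto
  also have "\<dots> = (Id V ?Y \<boxtimes> (Id V ?X \<boxtimes> mu xs ?S)) \<cdot> (swp ?X ?Y (?P \<otimes> ?S) \<cdot> (Id V ?X \<boxtimes> Assoc V ?Y ?P ?S) \<cdot> Assoc V ?X (?Y \<otimes> ?P) ?S) \<cdot> (((Id V ?X \<boxtimes> Sym V ?P ?Y) \<cdot> Assoc V ?X ?P ?Y) \<boxtimes> Id V ?S)"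
    by simp
  also have "\<dots> = (Id V ?Y \<boxtimes> mu (x # xs) ?S) \<cdot> Assoc V ?Y (?X \<otimes> ?P) ?S \<cdot> ((swp ?X ?Y ?P \<cdot> (Id V ?X \<boxtimes> Sym V ?P ?Y) \<cdot> Assoc V ?X ?P ?Y) \<boxtimes> Id V ?S)"
    by (subst swp_ten) auto
  finally show ?case by (simp add: swp_Sym)
qed

text \<open>Exchanging two blocks label by label is one symmetry of \<open>V\<close>. The hexagon
  splits off the first label of \<open>ys\<close>, which \<open>pull_mu_Sym\<close> moves; for empty
  \<open>ys\<close> the claim is the unit law \<open>Lun_Sym\<close>.\<close>

lemma perm_mu_Sym:
  assumes "set xs \<inter> set ys = {}" "distinct xs" "distinct ys" "lob xs" "lob ys"
  shows "perm (xs @ ys) (ys @ xs) \<one> \<cdot> mu xs (tens ys \<one>) = mu ys (tens xs \<one>) \<cdot> Sym V (tens xs \<one>) (tens ys \<one>)"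
  using assms
proof (induction ys)
  case Nil
  then show ?case by (simp add: mu_unit Lun_Sym)
next
  case (Cons y ys)
  then have [simp]: "lob xs" "lob ys" "snd y \<in> Obj V" "y \<notin> set xs" "distinct xs" "distinct ys" "y \<notin> set ys"
    "set xs \<inter> set ys = {}" "set ys \<union> set xs = set xs \<union> set ys" "set ys \<inter> set xs = {}" by auto
  have [simp]: "remove1 y (xs @ y # ys) = xs @ ys" by (simp add: remove1_append)
  let ?Y = "snd y" and ?P = "tens xs \<one>" and ?Q = "tens ys \<one>"
  have h: "Assoc V ?Y ?Q ?P \<cdot> Sym V ?P (?Y \<otimes> ?Q) \<cdot> Assoc V ?P ?Y ?Q
           = (Id V ?Y \<boxtimes> Sym V ?P ?Q) \<cdot> Assoc V ?Y ?P ?Q \<cdot> (Sym V ?P ?Y \<boxtimes> Id V ?Q)"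
    by (rule hexagon) auto
  have "(perm (xs @ y # ys) ((y # ys) @ xs) \<one> \<cdot> mu xs (tens (y # ys) \<one>)) \<cdot> Assoc V ?P ?Y ?Q
     = (Id V ?Y \<boxtimes> perm (xs @ ys) (ys @ xs) \<one>) \<cdot> (pull y (xs @ y # ys) \<one> \<cdot> mu xs (?Y \<otimes> ?Q) \<cdot> Assoc V ?P ?Y ?Q)"
    by simp
  also have "\<dots> = (Id V ?Y \<boxtimes> (perm (xs @ ys) (ys @ xs) \<one> \<cdot> mu xs ?Q)) \<cdot> Assoc V ?Y ?P ?Q \<cdot> (Sym V ?P ?Y \<boxtimes> Id V ?Q)"
    by (subst pull_mu_Sym) auto
  also have "\<dots> = (Id V ?Y \<boxtimes> mu ys ?P) \<cdot> ((Id V ?Y \<boxtimes> Sym V ?P ?Q) \<cdot> Assoc V ?Y ?P ?Q \<cdot> (Sym V ?P ?Y \<boxtimes> Id V ?Q))"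
    using Cons.IH by simp
  also have "\<dots> = (mu (y # ys) ?P \<cdot> Sym V ?P (?Y \<otimes> ?Q)) \<cdot> Assoc V ?P ?Y ?Q"
    unfolding h[symmetric] by simp
  finally show ?case unfolding tens.simps by (rule iso_epi) auto
qed

end

section \<open>Generalised elements\<close>

text \<open>Labels form a set and not a list, with the order fixed once by \<open>enum\<close>;
  equality of elements then ignores the order of pairing. The number in a label keeps several
  variables of the same object apart.\<close>

datatype ('v, 'm) gelt = Gelt (labels: "(nat \<times> 'v) set") (arrow: 'm)

context symmetric_monoidal_closed
begin

declare lob_simps(5) [simp del]

text \<open>
  A generalised element of \<open>X\<close> is a finite set of labelled objects together with an arrow into \<open>X\<close>
  from their tensor product.  Pairing elements with disjoint label sets is strictly associative and
  symmetric, because the coherence isomorphisms are absorbed by reordering labels; so equations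
  between composites in \<open>V\<close> can be checked as if \<open>V\<close> were a category of sets.
\<close>

definition enum :: "(nat \<times> 'v) set \<Rightarrow> (nat \<times> 'v) list" where
  "enum S = (SOME xs. set xs = S \<and> distinct xs)"

definition elt :: "('v, 'm) gelt \<Rightarrow> bool" where
  "elt a \<longleftrightarrow> finite (labels a) \<and> (\<forall>l \<in> labels a. snd l \<in> Obj V) \<and> arrow a \<in> Arr V \<and>
     Dom V (arrow a) = tens (enum (labels a)) \<one>"

definition ty :: "('v, 'm) gelt \<Rightarrow> 'v" where
  "ty a = Cod V (arrow a)"

definition app :: "'m \<Rightarrow> ('v, 'm) gelt \<Rightarrow> ('v, 'm) gelt" where
  "app f a = Gelt (labels a) (f \<cdot> arrow a)"

text \<open>The joint product is reordered into the block of \<open>a\<close> followed by that of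
  \<open>b\<close>, split by the inverse of \<open>mu\<close>, and both arrows are applied. This is
  meaningful for disjoint label sets only: \<open>V\<close> need not have diagonals, so no label is
  used twice.\<close>

definition pr :: "('v, 'm) gelt \<Rightarrow> ('v, 'm) gelt \<Rightarrow> ('v, 'm) gelt" where
  "pr a b = Gelt (labels a \<union> labels b) ((arrow a \<boxtimes> arrow b) \<cdot> inv_arr V (mu (enum (labels a)) (tens (enum (labels b)) \<one>)) \<cdot>
     perm (enum (labels a \<union> labels b)) (enum (labels a) @ enum (labels b)) \<one>)"

text \<open>The empty product is \<open>\<one>\<close>, so the elements without labels are the
  arrows out of the unit.\<close>

definition gl :: "'m \<Rightarrow> ('v, 'm) gelt" where
  "gl f = Gelt {} f"

definition dj :: "('v, 'm) gelt \<Rightarrow> ('v, 'm) gelt \<Rightarrow> bool" where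
  "dj a b \<longleftrightarrow> labels a \<inter> labels b = {}"

abbreviation star :: "('v, 'm) gelt" where
  "star \<equiv> gl (Id V \<one>)"

text \<open>The arrow of \<open>a\<close> read along an arbitrary listing of its labels instead of
  the one chosen by \<open>enum\<close>. Calculations use listings adapted to the shape of a
  pair.\<close>

definition val :: "('v, 'm) gelt \<Rightarrow> (nat \<times> 'v) list \<Rightarrow> 'm" where
  "val a xs = arrow a \<cdot> perm xs (enum (labels a)) \<one>"

lemma enum [simp]: "finite S \<Longrightarrow> set (enum S) = S" "finite S \<Longrightarrow> distinct (enum S)"
proof -
  assume "finite S"
  then have "\<exists>xs. set xs = S \<and> distinct xs" using finite_distinct_list by blast
  then have "set (enum S) = S \<and> distinct (enum S)" unfolding enum_def by (rule someI_ex)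
  then show "set (enum S) = S" "distinct (enum S)" by auto
qed

lemma enum_empty [simp]: "enum {} = []"
  using enum(1)[of "{}"] by (metis finite.emptyI set_empty)

lemma enum_singleton [simp]: "enum {l} = [l]"
proof -
  have s: "set (enum {l}) = {l}" and d: "distinct (enum {l})" by simp_all
  then have "length (enum {l}) = 1" using distinct_card[OF d] by simp
  then show ?thesis using s by (cases "enum {l}") auto
qed

lemma lobI: "elt a \<Longrightarrow> set xs \<subseteq> labels a \<Longrightarrow> lob xs"
  and lobI2: "elt a \<Longrightarrow> elt b \<Longrightarrow> set xs \<subseteq> labels a \<union> labels b \<Longrightarrow> lob xs"
  by (auto simp: elt_def lob_def)

lemma eltI:
  assumes "finite (labels a)" "lob (enum (labels a))" "arrow a \<in> Arr V" "Dom V (arrow a) = tens (enum (labels a)) \<one>"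
  shows "elt a"
  using assms by (auto simp: elt_def lob_def)

lemma elt_lob [simp]:
  assumes "elt a"
  shows "lob (enum (labels a))" "finite (labels a)" "arrow a \<in> Arr V" "Dom V (arrow a) = tens (enum (labels a)) \<one>"
    "Cod V (arrow a) = ty a"
  using assms by (auto simp: elt_def lob_def ty_def)

lemma ty_obj [simp]: "elt a \<Longrightarrow> ty a \<in> Obj V"
  using obj_Cod[OF elt_lob(3)] by simp

lemma val_arr [simp]:
  assumes "elt a" "set xs = labels a" "distinct xs"
  shows "val a xs \<in> Arr V" "Dom V (val a xs) = tens xs \<one>" "Cod V (val a xs) = ty a"
proof -
  have "lob xs" using assms lobI by auto
  then show "val a xs \<in> Arr V" "Dom V (val a xs) = tens xs \<one>" "Cod V (val a xs) = ty a"
    using assms by (auto simp: val_def)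
qed

lemma val_perm:
  assumes "elt a" "set xs = labels a" "distinct xs" "set ys = labels a" "distinct ys"
  shows "val a ys \<cdot> perm xs ys \<one> = val a xs"
proof -
  have "lob xs" "lob ys" using assms lobI by auto
  then show ?thesis using assms by (simp add: val_def perm_perm)
qed

lemma elt_eqI:
  assumes "elt a" "elt b" "labels a = labels b" "set xs = labels a" "distinct xs" "val a xs = val b xs"
  shows "a = b"
proof -
  have [simp]: "lob xs" using assms lobI by auto
  have "arrow a \<cdot> perm xs (enum (labels a)) \<one> = arrow b \<cdot> perm xs (enum (labels a)) \<one>"
    using assms by (simp add: val_def)
  then have "arrow a = arrow b" by (rule iso_epi) (use assms in auto)
  then show ?thesis using assms by (simp add: gelt.expand)
qed

lemma dj_simps [simp]:
  "dj (app f a) b = dj a b" "dj b (app f a) = dj b a"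
  "dj (pr a b) c \<longleftrightarrow> dj a c \<and> dj b c" "dj c (pr a b) \<longleftrightarrow> dj c a \<and> dj c b"
  "dj (gl g) c" "dj c (gl g)"
  by (auto simp: dj_def app_def pr_def gl_def)

lemma dj_sym: "dj a b \<Longrightarrow> dj b a"
  by (auto simp: dj_def)

lemma app_elt [simp]:
  assumes "elt a" "f \<in> Arr V" "Dom V f = ty a"
  shows "elt (app f a)" "ty (app f a) = Cod V f"
  using assms by (auto intro!: eltI simp: app_def ty_def[of "Gelt (labels a) (f \<cdot> arrow a)"])

lemma app_comp [simp]:
  "\<lbrakk>elt a; f \<in> Arr V; g \<in> Arr V; Dom V f = ty a; Dom V g = Cod V f\<rbrakk> \<Longrightarrow>
    app (g \<cdot> f) a = app g (app f a)"
  by (auto simp: app_def)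

lemma app_id [simp]: "elt a \<Longrightarrow> ty a = X \<Longrightarrow> app (Id V X) a = a"
  by (auto simp: app_def gelt.expand)

lemma gl_elt [simp]:
  "f \<in> Arr V \<Longrightarrow> Dom V f = \<one> \<Longrightarrow> elt (gl f)" "ty (gl f) = Cod V f"
  by (auto intro!: eltI simp: ty_def gl_def)

lemma app_gl [simp]: "app f (gl g) = gl (f \<cdot> g)"
  by (simp add: app_def gl_def)

lemma gl_eq [simp]: "gl f = gl g \<longleftrightarrow> f = g"
  by (simp add: gl_def)

lemma pr_elt [simp]:
  assumes "elt a" "elt b" "dj a b"
  shows "elt (pr a b)" "ty (pr a b) = ty a \<otimes> ty b"
proof -
  have l: "lob (enum (labels a \<union> labels b))" using assms by (intro lobI2[of a b]) auto
  have n: "labels a \<inter> labels b = {}" using assms by (auto simp: dj_def)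
  show "elt (pr a b)"
    by (rule eltI) (use assms l n in \<open>auto simp: pr_def\<close>)
  show "ty (pr a b) = ty a \<otimes> ty b"
    unfolding ty_def[of "pr a b"] unfolding pr_def gelt.sel using assms l n by simp
qed

text \<open>Along a concatenated listing, pairing is the tensor product of the two arrows up to
  \<open>mu\<close>. The reorderings into and out of \<open>enum\<close> compose by
  \<open>perm_perm\<close>, and the two blocks are rearranged independently.\<close>

lemma val_pr:
  assumes e: "elt a" "elt b" "dj a b" and x: "set xs = labels a" "distinct xs" and y: "set ys = labels b" "distinct ys"
  shows "val (pr a b) (xs @ ys) \<cdot> mu xs (tens ys \<one>) = val a xs \<boxtimes> val b ys"
proof -
  let ?A = "enum (labels a)" and ?B = "enum (labels b)" and ?C = "enum (labels a \<union> labels b)"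
  have [simp]: "lob xs" "lob ys" "lob ?C" "finite (labels a)" "finite (labels b)"
    "labels a \<inter> labels b = {}" "labels b \<inter> labels a = {}" "set xs = labels a" "set ys = labels b" "distinct xs" "distinct ys" "elt a" "elt b"
    using assms by (auto simp: dj_def intro: lobI2[of a b] lobI)
  have "val (pr a b) (xs @ ys) \<cdot> mu xs (tens ys \<one>)
      = (arrow a \<boxtimes> arrow b) \<cdot> inv_arr V (mu ?A (tens ?B \<one>)) \<cdot> (perm ?C (?A @ ?B) \<one> \<cdot> perm (xs @ ys) ?C \<one>) \<cdot> mu xs (tens ys \<one>)"
    by (simp add: val_def pr_def)
  also have "\<dots> = (arrow a \<boxtimes> arrow b) \<cdot> inv_arr V (mu ?A (tens ?B \<one>)) \<cdot> (perm (xs @ ?B) (?A @ ?B) \<one> \<cdot> perm (xs @ ys) (xs @ ?B) \<one>) \<cdot> mu xs (tens ys \<one>)"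
    by (subst (1 2) perm_perm) auto
  also have "\<dots> = (arrow a \<boxtimes> arrow b) \<cdot> inv_arr V (mu ?A (tens ?B \<one>)) \<cdot> perm xs ?A (tens ?B \<one>) \<cdot> (perm (xs @ ys) (xs @ ?B) \<one> \<cdot> mu xs (tens ys \<one>))"
    by (simp add: perm_append_right)
  also have "\<dots> = (arrow a \<boxtimes> arrow b) \<cdot> inv_arr V (mu ?A (tens ?B \<one>)) \<cdot> (perm xs ?A (tens ?B \<one>) \<cdot> mu xs (tens ?B \<one>)) \<cdot> (Id V (tens xs \<one>) \<boxtimes> perm ys ?B \<one>)"
    by (simp add: perm_append_left)
  also have "\<dots> = (arrow a \<boxtimes> arrow b) \<cdot> (perm xs ?A \<one> \<boxtimes> perm ys ?B \<one>)"
    by (simp add: perm_mu)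
  finally show ?thesis by (simp add: val_def)
qed

lemma val_app:
  "\<lbrakk>elt a; f \<in> Arr V; Dom V f = ty a; set xs = labels a; distinct xs\<rbrakk> \<Longrightarrow> val (app f a) xs = f \<cdot> val a xs"
proof -
  assume a: "elt a" "f \<in> Arr V" "Dom V f = ty a" "set xs = labels a" "distinct xs"
  then have "lob xs" using lobI by auto
  then show ?thesis using a by (simp add: val_def app_def)
qed

lemma labels_simps [simp]: "labels (app f a) = labels a" "labels (pr a b) = labels a \<union> labels b" "labels (gl f) = {}"
  by (simp_all add: app_def pr_def gl_def)

text \<open>The common route to the rules for tensor, symmetry, associator and unitor: along a
  suitable listing an equation about pairs becomes one between tensor products of arrows.\<close>

lemma pr_eqI:
  assumes a: "elt a" "elt b" "dj a b" "elt c" "labels c = labels a \<union> labels b" "f \<in> Arr V" "Dom V f = ty a \<otimes> ty b"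
    and x: "set xs = labels a" "distinct xs" and y: "set ys = labels b" "distinct ys"
    and e: "val c (xs @ ys) \<cdot> mu xs (tens ys \<one>) = f \<cdot> (val a xs \<boxtimes> val b ys)"
  shows "c = app f (pr a b)"
proof (rule elt_eqI[where xs = "xs @ ys"])
  have [simp]: "lob xs" "lob ys" using a x y lobI by auto
  have [simp]: "distinct (xs @ ys)" using a(3) x y by (simp add: dj_def)
  show "elt c" "elt (app f (pr a b))" "labels c = labels (app f (pr a b))" "set (xs @ ys) = labels c" "distinct (xs @ ys)"
    using a x y by (simp_all add: dj_def)
  have "val c (xs @ ys) \<cdot> mu xs (tens ys \<one>) = (f \<cdot> val (pr a b) (xs @ ys)) \<cdot> mu xs (tens ys \<one>)"
    using a x y by (simp add: val_pr e dj_def)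
  then have "val c (xs @ ys) = f \<cdot> val (pr a b) (xs @ ys)"
    by (rule iso_epi) (use a x y in \<open>simp_all add: dj_def\<close>)
  then show "val c (xs @ ys) = val (app f (pr a b)) (xs @ ys)"
    using a x y by (simp add: val_app dj_def)
qed

lemma app_ten [simp]:
  assumes "elt a" "elt b" "dj a b" "f \<in> Arr V" "g \<in> Arr V" "Dom V f = ty a" "Dom V g = ty b"
  shows "app (f \<boxtimes> g) (pr a b) = pr (app f a) (app g b)"
  by (rule pr_eqI[symmetric, of _ _ _ _ "enum (labels a)" "enum (labels b)"])
    (use assms in \<open>auto simp: val_pr val_app\<close>)

lemma app_Sym [simp]:
  assumes "elt a" "elt b" "dj a b" "ty a = X" "ty b = Y"
  shows "app (Sym V X Y) (pr a b) = pr b a"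
proof (rule pr_eqI[symmetric, of _ _ _ _ "enum (labels a)" "enum (labels b)"])
  let ?A = "enum (labels a)" and ?B = "enum (labels b)"
  have [simp]: "dj b a" "labels a \<inter> labels b = {}" "labels b \<inter> labels a = {}" using assms by (auto simp: dj_def)
  have "val (pr b a) (?A @ ?B) \<cdot> mu ?A (tens ?B \<one>)
      = val (pr b a) (?B @ ?A) \<cdot> (perm (?A @ ?B) (?B @ ?A) \<one> \<cdot> mu ?A (tens ?B \<one>))"
    using assms by (subst val_perm[symmetric, of _ "?A @ ?B" "?B @ ?A"]) (auto simp: Un_commute)
  also have "\<dots> = (val (pr b a) (?B @ ?A) \<cdot> mu ?B (tens ?A \<one>)) \<cdot> Sym V (tens ?A \<one>) (tens ?B \<one>)"
    using assms by (simp add: perm_mu_Sym)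
  also have "\<dots> = Sym V X Y \<cdot> (val a ?A \<boxtimes> val b ?B)"
    using assms by (simp add: val_pr Sym_nat)
  finally show "val (pr b a) (?A @ ?B) \<cdot> mu ?A (tens ?B \<one>) = Sym V X Y \<cdot> (val a ?A \<boxtimes> val b ?B)" .
qed (use assms in \<open>auto simp: dj_sym\<close>)

text \<open>Both bracketings of a triple are read along the same listing, because concatenation of
  lists is associative; the associator enters through \<open>mu_mu\<close>.\<close>

lemma app_Assoc [simp]:
  assumes [simp]: "elt a" "elt b" "elt c" "dj a b" "dj a c" "dj b c" and t: "ty a = X" "ty b = Y" "ty c = Z"
  shows "app (Assoc V X Y Z) (pr (pr a b) c) = pr a (pr b c)"
proof (rule pr_eqI[symmetric, of _ _ _ _ "enum (labels a) @ enum (labels b)" "enum (labels c)"])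
  let ?A = "enum (labels a)" and ?B = "enum (labels b)" and ?C = "enum (labels c)"
  have [simp]: "labels a \<inter> labels b = {}" "labels a \<inter> labels c = {}" "labels b \<inter> labels c = {}"
    "labels a \<inter> (labels b \<union> labels c) = {}" using assms by (auto simp: dj_def)
  let ?m = "mu ?A (tens ?B \<one>) \<boxtimes> Id V (tens ?C \<one>)"
  have [simp]: "X \<in> Obj V" "Y \<in> Obj V" "Z \<in> Obj V" using t by auto
  have "(val (pr a (pr b c)) ((?A @ ?B) @ ?C) \<cdot> mu (?A @ ?B) (tens ?C \<one>)) \<cdot> ?m
      = val (pr a (pr b c)) (?A @ (?B @ ?C)) \<cdot> (mu (?A @ ?B) (tens ?C \<one>) \<cdot> ?m)"
    by simp
  also have "\<dots> = (val (pr a (pr b c)) (?A @ (?B @ ?C)) \<cdot> mu ?A (tens (?B @ ?C) \<one>)) \<cdot> (Id V (tens ?A \<one>) \<boxtimes> mu ?B (tens ?C \<one>)) \<cdot> Assoc V (tens ?A \<one>) (tens ?B \<one>) (tens ?C \<one>)"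
    by (subst mu_mu) auto
  also have "\<dots> = (val a ?A \<boxtimes> (val b ?B \<boxtimes> val c ?C)) \<cdot> Assoc V (tens ?A \<one>) (tens ?B \<one>) (tens ?C \<one>)"
    by (subst val_pr) (auto simp: val_pr)
  also have "\<dots> = (Assoc V X Y Z \<cdot> ((val a ?A \<boxtimes> val b ?B) \<boxtimes> val c ?C))"
    using t by (subst Assoc_nat) auto
  also have "\<dots> = (Assoc V X Y Z \<cdot> (val (pr a b) (?A @ ?B) \<boxtimes> val c ?C)) \<cdot> ?m"
    using t by (simp add: val_pr)
  finally show "val (pr a (pr b c)) ((?A @ ?B) @ ?C) \<cdot> mu (?A @ ?B) (tens ?C \<one>)
      = Assoc V X Y Z \<cdot> (val (pr a b) (?A @ ?B) \<boxtimes> val c ?C)"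
    by (rule iso_epi) (use t in auto)
qed (use assms in \<open>auto simp: Un_assoc simp flip: dj_def\<close>)

lemma app_Lun [simp]:
  assumes "elt a" "ty a = X"
  shows "app (Lun V X) (pr star a) = a"
proof (rule pr_eqI[symmetric, of _ _ _ _ "[]" "enum (labels a)"])
  show "val a ([] @ enum (labels a)) \<cdot> mu [] (tens (enum (labels a)) \<one>) = Lun V X \<cdot> (val star [] \<boxtimes> val a (enum (labels a)))"
    using assms Lun_nat[of "arrow a" X] by (auto simp: val_def gl_def)
qed (use assms in auto)

lemma app_Run [simp]:
  assumes "elt a" "ty a = X"
  shows "app (Run V X) (pr a star) = a"
proof -
  have "app (Run V X) (pr a star) = app (Run V X) (app (Sym V \<one> X) (pr star a))"
    using assms by simp
  also have "\<dots> = app (Run V X \<cdot> Sym V \<one> X) (pr star a)"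
    using assms by (subst app_comp) auto
  also have "\<dots> = a" using assms ty_obj[of a] by (simp add: Lun_Sym del: ty_obj)
  finally show ?thesis .
qed

lemma app_inv:
  assumes "is_iso V f" "elt a" "ty a = Dom V f"
  shows "app (inv_arr V f) (app f a) = a"
  using assms by (subst app_comp[symmetric]) (auto simp: iso_arr)

lemma app_inv_Lun [simp]: "elt a \<Longrightarrow> ty a = X \<Longrightarrow> app (inv_arr V (Lun V X)) a = pr star a"
  using app_inv[of "Lun V X" "pr star a"] ty_obj[of a] by (auto simp del: ty_obj)

lemma app_inv_Run [simp]: "elt a \<Longrightarrow> ty a = X \<Longrightarrow> app (inv_arr V (Run V X)) a = pr a star"
  using app_inv[of "Run V X" "pr a star"] ty_obj[of a] by (auto simp del: ty_obj)

lemma app_inv_Assoc [simp]: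
  assumes "elt a" "elt b" "elt c" "dj a b" "dj a c" "dj b c" "ty a = X" "ty b = Y" "ty c = Z"
  shows "app (inv_arr V (Assoc V X Y Z)) (pr a (pr b c)) = pr (pr a b) c"
  using app_inv[of "Assoc V X Y Z" "pr (pr a b) c"] assms by auto

lemma gl_inv_Lun [simp]: "gl (inv_arr V (Lun V \<one>)) = pr star star"
  using app_inv_Lun[of star \<one>] by simp

lemma gl_comp_pr: "f \<in> Arr V \<Longrightarrow> Dom V f = \<one> \<otimes> \<one> \<Longrightarrow> gl (f \<cdot> inv_arr V (Lun V \<one>)) = app f (pr star star)"
  by (simp flip: app_gl gl_inv_Lun)

section \<open>Variables, and equality of arrows tested on them\<close>

definition generic :: "('v, 'm) gelt \<Rightarrow> bool" where
  "generic a \<longleftrightarrow> elt a \<and> is_iso V (arrow a)"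

text \<open>The product of a single labelled object is \<open>X \<otimes> \<one>\<close>, so the
  arrow of a variable is the right unitor and not an identity.\<close>

definition var :: "nat \<Rightarrow> 'v \<Rightarrow> ('v, 'm) gelt" where
  "var n X = Gelt {(n, X)} (Run V X)"

lemma var_elt [simp]:
  assumes "X \<in> Obj V"
  shows "elt (var n X)" "ty (var n X) = X" "generic (var n X)" "labels (var n X) = {(n, X)}"
proof -
  show "elt (var n X)" using assms by (auto intro!: eltI simp: var_def)
  then show "ty (var n X) = X" "generic (var n X)" "labels (var n X) = {(n, X)}"
    using assms by (auto simp: generic_def ty_def var_def)
qed

lemma dj_var [simp]: "dj (var m X) (var n Y) \<longleftrightarrow> m \<noteq> n \<or> X \<noteq> Y"
  by (auto simp: dj_def var_def)

lemma generic_pr [simp]: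
  assumes "generic a" "generic b" "dj a b"
  shows "generic (pr a b)"
proof -
  have "lob (enum (labels a \<union> labels b))" using assms by (intro lobI2[of a b]) (auto simp: generic_def)
  then have "is_iso V (arrow (pr a b))" using assms by (auto simp: generic_def pr_def dj_def)
  then show ?thesis using assms by (auto simp: generic_def)
qed

text \<open>Applying arrows to a generic element is precomposing them with an isomorphism, which
  cancels. The rules \<open>arr_eqI\<close>, \<open>arr_eqI2\<close> and so on use tuples of
  distinct variables, but ask for the equation at arbitrary disjoint elements of the right
  types.\<close>

lemma eq_generic:
  assumes "app f a = app g a" "generic a" "f \<in> Arr V" "g \<in> Arr V" "Dom V f = ty a" "Dom V g = ty a"
  shows "f = g"
proof -
  have "f \<cdot> arrow a = g \<cdot> arrow a" using assms(1) by (simp add: app_def)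
  then show ?thesis by (rule iso_epi) (use assms in \<open>auto simp: generic_def\<close>)
qed

lemma arr_eqI:
  assumes "f \<in> Arr V" "g \<in> Arr V" "Dom V f = X" "Dom V g = X"
    and "\<And>a. elt a \<Longrightarrow> ty a = X \<Longrightarrow> app f a = app g a"
  shows "f = g"
proof -
  have [simp]: "X \<in> Obj V" using assms by auto
  show ?thesis by (rule eq_generic[of _ "var 0 X"]) (use assms in auto)
qed

lemma arr_eqI0:
  assumes "gl f = gl g"
  shows "f = g"
  using assms by simp

lemma arr_eqI2:
  assumes "f \<in> Arr V" "g \<in> Arr V" "Dom V f = X \<otimes> Y" "Dom V g = X \<otimes> Y" "X \<in> Obj V" "Y \<in> Obj V"
    and "\<And>a b. \<lbrakk>elt a; elt b; ty a = X; ty b = Y; dj a b; dj b a\<rbrakk> \<Longrightarrow> app f (pr a b) = app g (pr a b)"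
  shows "f = g"
  by (rule eq_generic[of _ "pr (var 0 X) (var 1 Y)"]) (use assms in auto)

lemma arr_eqI3:
  assumes "f \<in> Arr V" "g \<in> Arr V" "Dom V f = (X \<otimes> Y) \<otimes> Z" "Dom V g = (X \<otimes> Y) \<otimes> Z"
    "X \<in> Obj V" "Y \<in> Obj V" "Z \<in> Obj V"
    and "\<And>a b c. \<lbrakk>elt a; elt b; elt c; ty a = X; ty b = Y; ty c = Z; dj a b; dj b a; dj a c; dj c a; dj b c; dj c b\<rbrakk>
      \<Longrightarrow> app f (pr (pr a b) c) = app g (pr (pr a b) c)"
  shows "f = g"
  by (rule eq_generic[of _ "pr (pr (var 0 X) (var 1 Y)) (var 2 Z)"]) (use assms in auto)

lemma arr_eqI4:
  assumes "f \<in> Arr V" "g \<in> Arr V" "Dom V f = (X \<otimes> Y) \<otimes> (Z \<otimes> W)" "Dom V g = (X \<otimes> Y) \<otimes> (Z \<otimes> W)"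
    "X \<in> Obj V" "Y \<in> Obj V" "Z \<in> Obj V" "W \<in> Obj V"
    and "\<And>a b c d. \<lbrakk>elt a; elt b; elt c; elt d; ty a = X; ty b = Y; ty c = Z; ty d = W;
      dj a b; dj b a; dj a c; dj c a; dj b c; dj c b; dj a d; dj d a; dj b d; dj d b; dj c d; dj d c\<rbrakk>
      \<Longrightarrow> app f (pr (pr a b) (pr c d)) = app g (pr (pr a b) (pr c d))"
  shows "f = g"
  by (rule eq_generic[of _ "pr (pr (var 0 X) (var 1 Y)) (pr (var 2 Z) (var 3 W))"]) (use assms in auto)

lemma app_interchange [simp]:
  assumes "elt a" "elt b" "elt c" "elt d" "ty a = X" "ty b = Y" "ty c = Z" "ty d = W"
    "dj a b" "dj a c" "dj a d" "dj b c" "dj b d" "dj c b" "dj c d"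
  shows "app (interchange V X Y Z W) (pr (pr a b) (pr c d)) = pr (pr a c) (pr b d)"
proof -
  have [simp]: "X \<in> Obj V" "Y \<in> Obj V" "Z \<in> Obj V" "W \<in> Obj V" using assms by auto
  show ?thesis using assms by (simp add: interchange_def)
qed

lemma interchange_arr [simp]:
  assumes "X \<in> Obj V" "Y \<in> Obj V" "Z \<in> Obj V" "W \<in> Obj V"
  shows "interchange V X Y Z W \<in> Arr V" "Dom V (interchange V X Y Z W) = (X \<otimes> Y) \<otimes> (Z \<otimes> W)"
    "Cod V (interchange V X Y Z W) = (X \<otimes> Z) \<otimes> (Y \<otimes> W)"
  using assms by (auto simp: interchange_def)

lemma generic_star [simp]: "generic star"
  by (simp add: generic_def) (simp add: gl_def)

lemma genericD: "generic a \<Longrightarrow> elt a"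
  by (simp add: generic_def)

lemma arr_eqI3':
  assumes "f \<in> Arr V" "g \<in> Arr V" "Dom V f = X \<otimes> (Y \<otimes> Z)" "Dom V g = X \<otimes> (Y \<otimes> Z)"
    "X \<in> Obj V" "Y \<in> Obj V" "Z \<in> Obj V"
    and "\<And>a b c. \<lbrakk>elt a; elt b; elt c; ty a = X; ty b = Y; ty c = Z; dj a b; dj b a; dj a c; dj c a; dj b c; dj c b\<rbrakk>
      \<Longrightarrow> app f (pr a (pr b c)) = app g (pr a (pr b c))"
  shows "f = g"
  by (rule eq_generic[of _ "pr (var 0 X) (pr (var 1 Y) (var 2 Z))"]) (use assms in auto)

text \<open>Labels carry natural numbers, and \<open>a\<close> and \<open>b\<close> use finitely
  many. Fresh variables are the arguments fed to elements of exponentials and cotensors when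
  extensionality is applied.\<close>

lemma fresh:
  assumes "elt a" "elt b" "X \<in> Obj V"
  obtains k where "generic k" "elt k" "ty k = X" "dj k a" "dj a k" "dj k b" "dj b k"
proof -
  have "finite (fst ` (labels a \<union> labels b))" using assms by auto
  then obtain n where "n \<notin> fst ` (labels a \<union> labels b)" using ex_new_if_finite[OF infinite_UNIV_nat] by blast
  then have "dj (var n X) a \<and> dj (var n X) b" by (force simp: dj_def var_def)
  then show thesis using that[of "var n X"] assms dj_sym by auto
qed

lemma fresh2:
  assumes "elt a" "elt b" "X \<in> Obj V" "Y \<in> Obj V"
  obtains k l where "generic k" "elt k" "ty k = X" "dj k a" "dj a k" "dj k b" "dj b k"
    "generic l" "elt l" "ty l = Y" "dj l a" "dj a l" "dj l b" "dj b l" "dj k l" "dj l k"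
proof -
  obtain k where k: "generic k" "elt k" "ty k = X" "dj k a" "dj a k" "dj k b" "dj b k"
    using fresh assms by metis
  obtain l where "generic l" "elt l" "ty l = Y" "dj l (pr a k)" "dj (pr a k) l" "dj l b" "dj b l"
    using fresh[of "pr a k" b Y] assms k by auto
  then show thesis using that[of k l] k by auto
qed

section \<open>Extensionality and existence for universal arrows\<close>

text \<open>Exponentials and cotensors are both instances of the following universal property.\<close>

definition univ :: "'v \<Rightarrow> 'v \<Rightarrow> 'm \<Rightarrow> bool" where
  "univ P K E \<longleftrightarrow> P \<in> Obj V \<and> K \<in> Obj V \<and> E \<in> Arr V \<and> Dom V E = P \<otimes> K \<and>
     (\<forall>Z f. Z \<in> Obj V \<longrightarrow> f \<in> Hom V (Z \<otimes> K) (Cod V E) \<longrightarrow>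
       (\<exists>!g. g \<in> Hom V Z P \<and> E \<cdot> (g \<boxtimes> Id V K) = f))"

lemma univ_arr_ex:
  assumes "univ P K E" "Z \<in> Obj V" "f \<in> Arr V" "Dom V f = Z \<otimes> K" "Cod V f = Cod V E"
  shows "\<exists>g. g \<in> Arr V \<and> Dom V g = Z \<and> Cod V g = P \<and> E \<cdot> (g \<boxtimes> Id V K) = f"
  using assms unfolding univ_def in_Hom by blast

lemma univ_arr_eq:
  assumes u: "univ P K E" and a: "g \<in> Arr V" "Cod V g = P" "h \<in> Arr V" "Dom V g = Dom V h" "Cod V h = P"
    and e: "E \<cdot> (g \<boxtimes> Id V K) = E \<cdot> (h \<boxtimes> Id V K)"
  shows "g = h"
proof -
  have "E \<cdot> (h \<boxtimes> Id V K) \<in> Hom V (Dom V h \<otimes> K) (Cod V E)" "Dom V h \<in> Obj V"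
    using u a by (auto simp: univ_def in_Hom)
  then show ?thesis using u a e unfolding univ_def in_Hom by metis
qed

lemma univ_ex:
  assumes "univ P K E" "Z \<in> Obj V" "f \<in> Arr V" "Dom V f = Z \<otimes> K" "Cod V f = Cod V E"
  obtains g where "g \<in> Arr V" "Dom V g = Z" "Cod V g = P"
    "\<And>z k. \<lbrakk>elt z; ty z = Z; elt k; ty k = K; dj z k\<rbrakk> \<Longrightarrow> app E (pr (app g z) k) = app f (pr z k)"
proof -
  have [simp]: "P \<in> Obj V" "K \<in> Obj V" "E \<in> Arr V" "Dom V E = P \<otimes> K" using assms(1) by (auto simp: univ_def)
  obtain g where g: "g \<in> Arr V" "Dom V g = Z" "Cod V g = P" "E \<cdot> (g \<boxtimes> Id V K) = f"
    using univ_arr_ex[OF assms] by auto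
  then show thesis using that[of g] by (auto simp flip: g(4))
qed

lemma univ_eq:
  assumes u: "univ P K E" and a: "elt a" "ty a = P" "elt b" "ty b = P"
    and k: "generic k" "ty k = K" "dj k a" "dj k b" and e: "app E (pr a k) = app E (pr b k)"
  shows "a = b"
proof -
  note genericD[OF k(1), simp]
  have [simp]: "P \<in> Obj V" "K \<in> Obj V" "E \<in> Arr V" "Dom V E = P \<otimes> K" using u by (auto simp: univ_def)
  have "labels a \<union> labels k = labels b \<union> labels k" using arg_cong[OF e, of labels] by simp
  then have f: "labels a = labels b" using k(3,4) by (auto simp: dj_def)
  \<comment> \<open>The identity on the product of the labels is the most general element with these
    labels. Both \<open>a\<close> and \<open>b\<close> arise from it by applying their arrows, which
    reduces the claim to uniqueness for arrows.\<close>
  define z where "z = Gelt (labels a) (Id V (tens (enum (labels a)) \<one>))"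
  have z: "elt z" using a by (auto intro!: eltI simp: z_def)
  then have gz: "generic z" using a by (auto simp: generic_def z_def)
  have tz: "ty z = tens (enum (labels a)) \<one>" unfolding ty_def z_def using a by simp
  have za: "app (arrow a) z = a" "app (arrow b) z = b" using a f by (auto simp: app_def z_def gelt.expand)
  have d: "dj z k" using k(3) by (auto simp: dj_def z_def)
  have "E \<cdot> (arrow a \<boxtimes> Id V K) = E \<cdot> (arrow b \<boxtimes> Id V K)"
  proof (rule eq_generic)
    show "app (E \<cdot> (arrow a \<boxtimes> Id V K)) (pr z k) = app (E \<cdot> (arrow b \<boxtimes> Id V K)) (pr z k)"
      using a k e z d za tz f by simp
    show "generic (pr z k)" using gz k d by simp
  qed (use a k z d tz f in auto)
  then have "arrow a = arrow b" by (rule univ_arr_eq[OF u, rotated -1]) (use a f in auto)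
  then show ?thesis using f by (simp add: gelt.expand)
qed

lemma univI:
  assumes o: "P \<in> Obj V" "K \<in> Obj V" "E \<in> Arr V" "Dom V E = P \<otimes> K"
    and ex: "\<And>Z f. \<lbrakk>Z \<in> Obj V; f \<in> Arr V; Dom V f = Z \<otimes> K; Cod V f = Cod V E\<rbrakk> \<Longrightarrow>
      \<exists>g. g \<in> Arr V \<and> Dom V g = Z \<and> Cod V g = P \<and>
        (\<forall>z k. elt z \<and> ty z = Z \<and> elt k \<and> ty k = K \<and> dj z k \<and> dj k z \<longrightarrow> app E (pr (app g z) k) = app f (pr z k))"
    and eq: "\<And>a b. \<lbrakk>elt a; ty a = P; elt b; ty b = P; labels a = labels b;
        \<And>k. \<lbrakk>elt k; ty k = K; dj a k; dj k a; dj b k; dj k b\<rbrakk> \<Longrightarrow> app E (pr a k) = app E (pr b k)\<rbrakk> \<Longrightarrow> a = b"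
  shows "univ P K E"
  unfolding univ_def in_Hom
proof (intro conjI o allI impI)
  fix Z f assume Z: "Z \<in> Obj V" and f: "f \<in> Arr V \<and> Dom V f = Z \<otimes> K \<and> Cod V f = Cod V E"
  obtain g where g: "g \<in> Arr V" "Dom V g = Z" "Cod V g = P"
    and gf: "\<And>z k. \<lbrakk>elt z; ty z = Z; elt k; ty k = K; dj z k; dj k z\<rbrakk> \<Longrightarrow> app E (pr (app g z) k) = app f (pr z k)"
    using ex[OF Z, of f] f by blast
  show "\<exists>!g. (g \<in> Arr V \<and> Dom V g = Z \<and> Cod V g = P) \<and> E \<cdot> (g \<boxtimes> Id V K) = f"
  proof (rule ex1I[of _ g])
    have "E \<cdot> (g \<boxtimes> Id V K) = f"
      by (rule arr_eqI2[of _ _ Z K]) (use o f g gf Z in auto)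
    then show "(g \<in> Arr V \<and> Dom V g = Z \<and> Cod V g = P) \<and> E \<cdot> (g \<boxtimes> Id V K) = f" using g by simp
  next
    fix h assume h: "(h \<in> Arr V \<and> Dom V h = Z \<and> Cod V h = P) \<and> E \<cdot> (h \<boxtimes> Id V K) = f"
    show "h = g"
    proof (rule arr_eqI[of _ _ Z])
      fix z assume z: "elt z" "ty z = Z"
      show "app h z = app g z"
      proof (rule eq)
        fix k assume k: "elt k" "ty k = K" "dj (app h z) k" "dj k (app h z)" "dj (app g z) k" "dj k (app g z)"
        have "app E (pr (app h z) k) = app (E \<cdot> (h \<boxtimes> Id V K)) (pr z k)"
          using conjunct1[OF h] k z o by simp
        also have "\<dots> = app E (pr (app g z) k)" using conjunct2[OF h] gf[of z k] k z by simp
        finally show "app E (pr (app h z) k) = app E (pr (app g z) k)" .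
      qed (use h g z in auto)
    qed (use h g in auto)
  qed
qed

lemma univ_Ev: "X \<in> Obj V \<Longrightarrow> Y \<in> Obj V \<Longrightarrow> univ (Ihom V X Y) X (Ev V X Y)"
  using Ev_universal[of X Y] by (simp add: univ_def)

lemma curry:
  assumes "Z \<in> Obj V" "X \<in> Obj V" "Y \<in> Obj V" "f \<in> Arr V" "Dom V f = Z \<otimes> X" "Cod V f = Y"
  shows "curry_arr V Z X Y f \<in> Arr V" "Dom V (curry_arr V Z X Y f) = Z"
    "Cod V (curry_arr V Z X Y f) = Ihom V X Y" "Ev V X Y \<cdot> (curry_arr V Z X Y f \<boxtimes> Id V X) = f"
proof -
  have "\<exists>!g. g \<in> Hom V Z (Ihom V X Y) \<and> Ev V X Y \<cdot> (g \<boxtimes> Id V X) = f"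
    using Ev_universal[of X Y Z f] assms by (simp add: in_Hom)
  from theI'[OF this] show "curry_arr V Z X Y f \<in> Arr V" "Dom V (curry_arr V Z X Y f) = Z"
    "Cod V (curry_arr V Z X Y f) = Ihom V X Y" "Ev V X Y \<cdot> (curry_arr V Z X Y f \<boxtimes> Id V X) = f"
    unfolding curry_arr_def by (auto simp: in_Hom)
qed

lemma app_curry:
  assumes "Z \<in> Obj V" "X \<in> Obj V" "Y \<in> Obj V" "f \<in> Arr V" "Dom V f = Z \<otimes> X" "Cod V f = Y"
    "elt z" "ty z = Z" "elt x" "ty x = X" "dj z x"
  shows "app (Ev V X Y) (pr (app (curry_arr V Z X Y f) z) x) = app f (pr z x)"
proof -
  note c = curry[OF assms(1-6)]
  have "app (Ev V X Y) (pr (app (curry_arr V Z X Y f) z) x) = app (Ev V X Y \<cdot> (curry_arr V Z X Y f \<boxtimes> Id V X)) (pr z x)"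
    using assms c(1-3) by simp
  then show ?thesis by (simp only: c(4))
qed

lemma Ihom_eq:
  assumes "elt a" "ty a = Ihom V X Y" "elt b" "ty b = Ihom V X Y" "X \<in> Obj V" "Y \<in> Obj V"
    "generic x" "ty x = X" "dj x a" "dj x b" "app (Ev V X Y) (pr a x) = app (Ev V X Y) (pr b x)"
  shows "a = b"
  by (rule univ_eq[OF univ_Ev]) (use assms in auto)

text \<open>The transpose compares \<open>E\<close> with the universal arrow \<open>Ev\<close>, so
  it is invertible exactly when \<open>E\<close> is universal too. This replaces the invertible
  transpose in \<open>is_cotensor\<close> by a property that can be used on elements.\<close>

lemma iso_curry_iff:
  assumes [simp]: "P \<in> Obj V" "K \<in> Obj V" "Q \<in> Obj V" "E \<in> Arr V" "Dom V E = P \<otimes> K" "Cod V E = Q"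
  shows "is_iso V (curry_arr V P K Q E) \<longleftrightarrow> univ P K E"
proof -
  let ?c = "curry_arr V P K Q E"
  note [simp] = curry(1-3)[of P K Q E, simplified]
  have ev: "Ev V K Q \<cdot> ((?c \<cdot> g) \<boxtimes> Id V K) = E \<cdot> (g \<boxtimes> Id V K)" if [simp]: "g \<in> Arr V" "Cod V g = P" for g
  proof -
    have "Ev V K Q \<cdot> ((?c \<cdot> g) \<boxtimes> Id V K) = (Ev V K Q \<cdot> (?c \<boxtimes> Id V K)) \<cdot> (g \<boxtimes> Id V K)"
      by simp
    then show ?thesis by (simp only: curry[of P K Q E, simplified])
  qed
  show ?thesis
  proof
    assume i: "is_iso V ?c"
    show "univ P K E"
      unfolding univ_def in_Hom
    proof (intro conjI allI impI)
      fix Z f assume [simp]: "Z \<in> Obj V" and f: "f \<in> Arr V \<and> Dom V f = Z \<otimes> K \<and> Cod V f = Cod V E"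
      note [simp] = curry[of Z K Q f]
      let ?g = "inv_arr V ?c \<cdot> curry_arr V Z K Q f"
      have g: "(?g \<in> Arr V \<and> Dom V ?g = Z \<and> Cod V ?g = P) \<and> E \<cdot> (?g \<boxtimes> Id V K) = f"
        using i f ev[of ?g] by simp
      show "\<exists>!g. (g \<in> Arr V \<and> Dom V g = Z \<and> Cod V g = P) \<and> E \<cdot> (g \<boxtimes> Id V K) = f"
      proof (rule ex1I[of _ ?g])
        fix h assume h: "(h \<in> Arr V \<and> Dom V h = Z \<and> Cod V h = P) \<and> E \<cdot> (h \<boxtimes> Id V K) = f"
        have "?c \<cdot> h = ?c \<cdot> ?g"
        proof (rule univ_arr_eq[OF univ_Ev])
          show "Ev V K Q \<cdot> ((?c \<cdot> h) \<boxtimes> Id V K) = Ev V K Q \<cdot> ((?c \<cdot> ?g) \<boxtimes> Id V K)"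
            using ev[of h] ev[of ?g] h g by metis
        qed (use h i f in auto)
        then show "h = ?g" by (rule iso_mono) (use h i f in auto)
      qed (rule g)
    qed auto
  next
    assume u: "univ P K E"
    obtain g where g: "g \<in> Arr V" "Dom V g = Ihom V K Q" "Cod V g = P" "E \<cdot> (g \<boxtimes> Id V K) = Ev V K Q"
      using univ_arr_ex[OF u, of "Ihom V K Q" "Ev V K Q"] by auto
    have 1: "?c \<cdot> g = Id V (Ihom V K Q)"
      by (rule univ_arr_eq[OF univ_Ev[of K Q]]) (use g(1-3) ev[of g] g(4) in \<open>simp_all del: comp_assoc\<close>)
    have "E \<cdot> ((g \<cdot> ?c) \<boxtimes> Id V K) = (E \<cdot> (g \<boxtimes> Id V K)) \<cdot> (?c \<boxtimes> Id V K)"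
      using g(1-3) by simp
    then have e: "E \<cdot> ((g \<cdot> ?c) \<boxtimes> Id V K) = E" by (simp only: g(4) curry[of P K Q E, simplified])
    have 2: "g \<cdot> ?c = Id V P"
    proof (rule univ_arr_eq[OF u])
      show "E \<cdot> ((g \<cdot> ?c) \<boxtimes> Id V K) = E \<cdot> (Id V P \<boxtimes> Id V K)" by (simp add: e)
    qed (use g(1-3) in auto)
    show "is_iso V ?c" by (rule inverse_pairI(1)[of _ g]) (use 1 2 g in auto)
  qed
qed

end

section \<open>Enriched categories by elements\<close>

lemma res2_simp [simp]: "x \<in> S \<Longrightarrow> y \<in> S \<Longrightarrow> res2 S f x y = f x y"
  by (simp add: res2_def)

lemma res3_simp [simp]: "x \<in> S \<Longrightarrow> y \<in> S \<Longrightarrow> z \<in> S \<Longrightarrow> res3 S f x y z = f x y z"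
  by (simp add: res3_def)

lemma res2_res2 [simp]: "res2 S (res2 S f) = res2 S f"
  by (auto simp: res2_def fun_eq_iff)

lemma res3_res3 [simp]: "res3 S (res3 S f) = res3 S f"
  by (auto simp: res3_def fun_eq_iff)

lemma res2_cong: "(\<And>x y. x \<in> S \<Longrightarrow> y \<in> S \<Longrightarrow> f x y = g x y) \<Longrightarrow> res2 S f = res2 S g"
  by (auto simp: res2_def fun_eq_iff)

lemma comp_vfun_simps [simp]:
  "x \<in> vob B \<Longrightarrow> fob (comp_vfun V B G F) x = fob G (fob F x)"
  "x \<in> vob B \<Longrightarrow> y \<in> vob B \<Longrightarrow>
    fhom (comp_vfun V B G F) x y = Comp V (fhom G (fob F x) (fob F y)) (fhom F x y)"
  by (simp_all add: comp_vfun_def)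

lemma id_vfun_simps [simp]:
  "x \<in> vob B \<Longrightarrow> fob (id_vfun V B) x = x"
  "x \<in> vob B \<Longrightarrow> y \<in> vob B \<Longrightarrow> fhom (id_vfun V B) x y = Id V (vhom B x y)"
  by (simp_all add: id_vfun_def)

lemma vop_simps [simp]:
  "vob (vop V B) = vob B" "vhom (vop V B) x y = vhom B y x" "vid (vop V B) = vid B"
  by (simp_all add: vop_def)

lemma vtensor_simps [simp]:
  "vob (vtensor V B C) = vob B \<times> vob C"
  "vhom (vtensor V B C) (x, x') (y, y') = TenO V (vhom B x y) (vhom C x' y')"
  by (simp_all add: vtensor_def)

text \<open>The part of \<open>vfunctor\<close> that fixes the values outside the objects. Equality
  of enriched functors by values needs no more than this, and every \<open>comp_vfun\<close> has it
  without being known to be a functor.\<close>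

definition vfun_ext :: "'b set \<Rightarrow> ('m, 'b, 'c) vfun \<Rightarrow> bool" where
  "vfun_ext S F \<longleftrightarrow> fob F \<in> extensional S \<and> fhom F = res2 S (fhom F)"

lemma vfun_eqI:
  assumes "vfun_ext S F" "vfun_ext S G" "\<And>x. x \<in> S \<Longrightarrow> fob F x = fob G x"
    "\<And>x y. x \<in> S \<Longrightarrow> y \<in> S \<Longrightarrow> fhom F x y = fhom G x y"
  shows "F = G"
proof (rule vfun.equality)
  show "fob F = fob G" using assms by (auto simp: vfun_ext_def intro: extensionalityI)
  show "fhom F = fhom G" using assms res2_cong unfolding vfun_ext_def by metis
qed simp

lemma vfun_ext_simps [simp]:
  "vfun_ext (vob B) (comp_vfun V B G F)" "vfun_ext (vob B) (id_vfun V B)"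
  by (simp_all add: vfun_ext_def comp_vfun_def id_vfun_def)

lemma vfunctor_ext: "vfunctor V B C F \<Longrightarrow> vfun_ext (vob B) F"
  unfolding vfunctor_def vfun_ext_def by (auto simp: PiE_def)

section \<open>Enriched categories, functors, transformations and wedges on elements\<close>

context symmetric_monoidal_closed
begin

abbreviation cmp :: "('v, 'm, 'b) vcat \<Rightarrow> 'b \<Rightarrow> 'b \<Rightarrow> 'b \<Rightarrow> ('v, 'm) gelt \<Rightarrow> ('v, 'm) gelt \<Rightarrow> ('v, 'm) gelt" where
  "cmp B x y z b a \<equiv> app (vcomp B x y z) (pr b a)"

lemma arr_eqI_Lun:
  assumes "f \<in> Arr V" "g \<in> Arr V" "Dom V f = \<one> \<otimes> X" "Dom V g = \<one> \<otimes> X" "X \<in> Obj V"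
    and "\<And>a. \<lbrakk>elt a; ty a = X\<rbrakk> \<Longrightarrow> app f (pr star a) = app g (pr star a)"
  shows "f = g"
  by (rule eq_generic[of _ "pr star (var 0 X)"]) (use assms in auto)

lemma arr_eqI_Run:
  assumes "f \<in> Arr V" "g \<in> Arr V" "Dom V f = X \<otimes> \<one>" "Dom V g = X \<otimes> \<one>" "X \<in> Obj V"
    and "\<And>a. \<lbrakk>elt a; ty a = X\<rbrakk> \<Longrightarrow> app f (pr a star) = app g (pr a star)"
  shows "f = g"
  by (rule eq_generic[of _ "pr (var 0 X) star"]) (use assms in auto)

lemma vcat_hom [simp]: "vcategory V B \<Longrightarrow> x \<in> vob B \<Longrightarrow> y \<in> vob B \<Longrightarrow> vhom B x y \<in> Obj V"
  by (simp add: vcategory_def)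

lemma vcat_id [simp]:
  assumes "vcategory V B" "x \<in> vob B"
  shows "vid B x \<in> Arr V" "Dom V (vid B x) = \<one>" "Cod V (vid B x) = vhom B x x"
  using assms unfolding vcategory_def in_Hom by blast+

lemma vcat_comp [simp]:
  assumes "vcategory V B" "x \<in> vob B" "y \<in> vob B" "z \<in> vob B"
  shows "vcomp B x y z \<in> Arr V" "Dom V (vcomp B x y z) = vhom B y z \<otimes> vhom B x y"
    "Cod V (vcomp B x y z) = vhom B x z"
  using assms unfolding vcategory_def in_Hom by blast+

lemma cmp_id [simp]:
  assumes "vcategory V B" "x \<in> vob B" "y \<in> vob B" "elt a" "ty a = vhom B x y"
  shows "cmp B x y y (gl (vid B y)) a = a" "cmp B x x y a (gl (vid B x)) = a"
proof -
  have 1: "vcomp B x y y \<cdot> (vid B y \<boxtimes> Id V (vhom B x y)) = Lun V (vhom B x y)"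
    and 2: "vcomp B x x y \<cdot> (Id V (vhom B x y) \<boxtimes> vid B x) = Run V (vhom B x y)"
    using assms unfolding vcategory_def by blast+
  show "cmp B x y y (gl (vid B y)) a = a"
    using arg_cong[OF 1, of "\<lambda>f. app f (pr star a)"] assms by simp
  show "cmp B x x y a (gl (vid B x)) = a"
    using arg_cong[OF 2, of "\<lambda>f. app f (pr a star)"] assms by simp
qed

lemma cmp_assoc [simp]:
  assumes "vcategory V B" "w \<in> vob B" "x \<in> vob B" "y \<in> vob B" "z \<in> vob B"
    "elt a" "elt b" "elt c" "ty a = vhom B w x" "ty b = vhom B x y" "ty c = vhom B y z"
    "dj c b" "dj c a" "dj b a"
  shows "cmp B w x z (cmp B x y z c b) a = cmp B w y z c (cmp B w x y b a)"
proof -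
  have "vcomp B w y z \<cdot> (Id V (vhom B y z) \<boxtimes> vcomp B w x y) \<cdot> Assoc V (vhom B y z) (vhom B x y) (vhom B w x)
          = vcomp B w x z \<cdot> (vcomp B x y z \<boxtimes> Id V (vhom B w x))"
    using assms unfolding vcategory_def by blast+
  from arg_cong[OF this, of "\<lambda>f. app f (pr (pr c b) a)"] show ?thesis using assms by simp
qed

lemma vcategoryI:
  assumes h [simp]: "\<And>x y. x \<in> vob B \<Longrightarrow> y \<in> vob B \<Longrightarrow> vhom B x y \<in> Obj V"
    and i: "\<And>x. x \<in> vob B \<Longrightarrow> vid B x \<in> Hom V \<one> (vhom B x x)"
    and c: "\<And>x y z. \<lbrakk>x \<in> vob B; y \<in> vob B; z \<in> vob B\<rbrakk> \<Longrightarrow>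
      vcomp B x y z \<in> Hom V (vhom B y z \<otimes> vhom B x y) (vhom B x z)"
    and assoc: "\<And>w x y z a b c. \<lbrakk>w \<in> vob B; x \<in> vob B; y \<in> vob B; z \<in> vob B; elt a; elt b; elt c;
      ty a = vhom B w x; ty b = vhom B x y; ty c = vhom B y z; dj c b; dj b c; dj c a; dj a c; dj b a; dj a b\<rbrakk> \<Longrightarrow>
      cmp B w y z c (cmp B w x y b a) = cmp B w x z (cmp B x y z c b) a"
    and idl: "\<And>x y a. \<lbrakk>x \<in> vob B; y \<in> vob B; elt a; ty a = vhom B x y\<rbrakk> \<Longrightarrow> cmp B x y y (gl (vid B y)) a = a"
    and idr: "\<And>x y a. \<lbrakk>x \<in> vob B; y \<in> vob B; elt a; ty a = vhom B x y\<rbrakk> \<Longrightarrow> cmp B x x y a (gl (vid B x)) = a"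
  shows "vcategory V B"
proof -
  have [simp]: "vid B x \<in> Arr V" "Dom V (vid B x) = \<one>" "Cod V (vid B x) = vhom B x x" if "x \<in> vob B" for x
    using i[OF that] by (auto simp: in_Hom)
  have [simp]: "vcomp B x y z \<in> Arr V" "Dom V (vcomp B x y z) = vhom B y z \<otimes> vhom B x y"
    "Cod V (vcomp B x y z) = vhom B x z" if "x \<in> vob B" "y \<in> vob B" "z \<in> vob B" for x y z
    using c[OF that] by (auto simp: in_Hom)
  show ?thesis
    unfolding vcategory_def
  proof (intro conjI ballI h i c)
    fix w x y z assume [simp]: "w \<in> vob B" "x \<in> vob B" "y \<in> vob B" "z \<in> vob B"
    show "vcomp B w y z \<cdot> (Id V (vhom B y z) \<boxtimes> vcomp B w x y) \<cdot> Assoc V (vhom B y z) (vhom B x y) (vhom B w x)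
          = vcomp B w x z \<cdot> (vcomp B x y z \<boxtimes> Id V (vhom B w x))"
      by (rule arr_eqI3[of _ _ "vhom B y z" "vhom B x y" "vhom B w x"]) (auto simp: assoc)
  next
    fix x y assume [simp]: "x \<in> vob B" "y \<in> vob B"
    show "vcomp B x y y \<cdot> (vid B y \<boxtimes> Id V (vhom B x y)) = Lun V (vhom B x y)"
      by (rule arr_eqI_Lun[of _ _ "vhom B x y"]) (auto simp: idl)
    show "vcomp B x x y \<cdot> (Id V (vhom B x y) \<boxtimes> vid B x) = Run V (vhom B x y)"
      by (rule arr_eqI_Run[of _ _ "vhom B x y"]) (auto simp: idr)
  qed
qed

lemma ucomp_arr [simp]:
  assumes "vcategory V C" "x \<in> vob C" "y \<in> vob C" "z \<in> vob C" "f \<in> Arr V" "Dom V f = \<one>"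
    "Cod V f = vhom C x y" "g \<in> Arr V" "Dom V g = \<one>" "Cod V g = vhom C y z"
  shows "ucomp V C x y z g f \<in> Arr V" "Dom V (ucomp V C x y z g f) = \<one>"
    "Cod V (ucomp V C x y z g f) = vhom C x z"
    "gl (ucomp V C x y z g f) = cmp C x y z (gl g) (gl f)"
proof -
  show "ucomp V C x y z g f \<in> Arr V" "Dom V (ucomp V C x y z g f) = \<one>"
    "Cod V (ucomp V C x y z g f) = vhom C x z"
    using assms by (auto simp: ucomp_def)
  have "ucomp V C x y z g f = (vcomp C x y z \<cdot> (g \<boxtimes> f)) \<cdot> inv_arr V (Lun V \<one>)"
    using assms by (simp add: ucomp_def)
  then have "gl (ucomp V C x y z g f) = app (vcomp C x y z \<cdot> (g \<boxtimes> f)) (pr star star)"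
    using assms by (simp only:) (rule gl_comp_pr, auto)
  also have "\<dots> = cmp C x y z (gl g) (gl f)" using assms by simp
  finally show "gl (ucomp V C x y z g f) = cmp C x y z (gl g) (gl f)" .
qed

lemma vfunD:
  assumes "vfunctor V B C F" "vcategory V B" "vcategory V C"
  shows "\<And>x. x \<in> vob B \<Longrightarrow> fob F x \<in> vob C"
    "\<And>x y. x \<in> vob B \<Longrightarrow> y \<in> vob B \<Longrightarrow> fhom F x y \<in> Arr V"
    "\<And>x y. x \<in> vob B \<Longrightarrow> y \<in> vob B \<Longrightarrow> Dom V (fhom F x y) = vhom B x y"
    "\<And>x y. x \<in> vob B \<Longrightarrow> y \<in> vob B \<Longrightarrow> Cod V (fhom F x y) = vhom C (fob F x) (fob F y)"
    "\<And>x. x \<in> vob B \<Longrightarrow> fhom F x x \<cdot> vid B x = vid C (fob F x)"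
    "\<And>x y z a b. \<lbrakk>x \<in> vob B; y \<in> vob B; z \<in> vob B; elt a; elt b; ty a = vhom B x y; ty b = vhom B y z; dj b a\<rbrakk> \<Longrightarrow>
      app (fhom F x z) (cmp B x y z b a) = cmp C (fob F x) (fob F y) (fob F z) (app (fhom F y z) b) (app (fhom F x y) a)"
proof -
  show 1 [simp]: "\<And>x. x \<in> vob B \<Longrightarrow> fob F x \<in> vob C"
    and 2 [simp]: "\<And>x y. x \<in> vob B \<Longrightarrow> y \<in> vob B \<Longrightarrow> fhom F x y \<in> Arr V"
    "\<And>x y. x \<in> vob B \<Longrightarrow> y \<in> vob B \<Longrightarrow> Dom V (fhom F x y) = vhom B x y"
    "\<And>x y. x \<in> vob B \<Longrightarrow> y \<in> vob B \<Longrightarrow> Cod V (fhom F x y) = vhom C (fob F x) (fob F y)"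
    "\<And>x. x \<in> vob B \<Longrightarrow> fhom F x x \<cdot> vid B x = vid C (fob F x)"
    using assms(1) unfolding vfunctor_def in_Hom by (auto simp: PiE_def)
  fix x y z a b assume a: "x \<in> vob B" "y \<in> vob B" "z \<in> vob B" "elt a" "elt b" "ty a = vhom B x y" "ty b = vhom B y z" "dj b a"
  have "fhom F x z \<cdot> vcomp B x y z = vcomp C (fob F x) (fob F y) (fob F z) \<cdot> (fhom F y z \<boxtimes> fhom F x y)"
    using assms(1) a(1-3) by (auto simp: vfunctor_def)
  from arg_cong[OF this, of "\<lambda>f. app f (pr b a)"]
  show "app (fhom F x z) (cmp B x y z b a) = cmp C (fob F x) (fob F y) (fob F z) (app (fhom F y z) b) (app (fhom F x y) a)"
    using a assms(2,3) by simp
qed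

lemma vfunctorI:
  assumes B: "vcategory V B" and C: "vcategory V C" and e: "vfun_ext (vob B) F"
    and o [simp]: "\<And>x. x \<in> vob B \<Longrightarrow> fob F x \<in> vob C"
    and h: "\<And>x y. x \<in> vob B \<Longrightarrow> y \<in> vob B \<Longrightarrow> fhom F x y \<in> Hom V (vhom B x y) (vhom C (fob F x) (fob F y))"
    and i: "\<And>x. x \<in> vob B \<Longrightarrow> app (fhom F x x) (gl (vid B x)) = gl (vid C (fob F x))"
    and c: "\<And>x y z a b. \<lbrakk>x \<in> vob B; y \<in> vob B; z \<in> vob B; elt a; elt b; ty a = vhom B x y; ty b = vhom B y z; dj b a; dj a b\<rbrakk> \<Longrightarrow>
      app (fhom F x z) (cmp B x y z b a) = cmp C (fob F x) (fob F y) (fob F z) (app (fhom F y z) b) (app (fhom F x y) a)"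
  shows "vfunctor V B C F"
proof -
  have [simp]: "fhom F x y \<in> Arr V" "Dom V (fhom F x y) = vhom B x y"
    "Cod V (fhom F x y) = vhom C (fob F x) (fob F y)" if "x \<in> vob B" "y \<in> vob B" for x y
    using h[OF that] by (auto simp: in_Hom)
  show ?thesis
    unfolding vfunctor_def
  proof (intro conjI ballI h)
    show "fob F \<in> vob B \<rightarrow>\<^sub>E vob C" "fhom F = res2 (vob B) (fhom F)"
      using e by (auto simp: vfun_ext_def PiE_def)
    fix x assume x: "x \<in> vob B"
    show "fhom F x x \<cdot> vid B x = vid C (fob F x)" using i[OF x] by simp
  next
    fix x y z assume x: "x \<in> vob B" "y \<in> vob B" "z \<in> vob B"
    show "fhom F x z \<cdot> vcomp B x y z = vcomp C (fob F x) (fob F y) (fob F z) \<cdot> (fhom F y z \<boxtimes> fhom F x y)"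
      by (rule arr_eqI2[of _ _ "vhom B y z" "vhom B x y"]) (use x B C c in auto)
  qed
qed

lemma vfunctor_comp:
  assumes F: "vfunctor V B C F" and G: "vfunctor V C D G"
    and [simp]: "vcategory V B" "vcategory V C" "vcategory V D"
  shows "vfunctor V B D (comp_vfun V B G F)"
proof -
  note [simp] = vfunD[OF F] vfunD[OF G]
  show ?thesis
    by (rule vfunctorI) (auto simp: in_Hom)
qed

lemma vfunctor_id:
  assumes [simp]: "vcategory V B"
  shows "vfunctor V B B (id_vfun V B)"
  by (rule vfunctorI) (auto simp: in_Hom)

lemma vnatI:
  assumes F: "vfunctor V B C F" and G: "vfunctor V B C G" and B [simp]: "vcategory V B" and C [simp]: "vcategory V C"
    and e: "\<alpha> \<in> extensional (vob B)"
    and h: "\<And>x. x \<in> vob B \<Longrightarrow> \<alpha> x \<in> Hom V \<one> (vhom C (fob F x) (fob G x))"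
    and n: "\<And>x y a. \<lbrakk>x \<in> vob B; y \<in> vob B; elt a; ty a = vhom B x y\<rbrakk> \<Longrightarrow>
      cmp C (fob F x) (fob F y) (fob G y) (gl (\<alpha> y)) (app (fhom F x y) a)
        = cmp C (fob F x) (fob G x) (fob G y) (app (fhom G x y) a) (gl (\<alpha> x))"
  shows "vnat V B C F G \<alpha>"
proof -
  note [simp] = vfunD[OF F B C] vfunD[OF G B C]
  have [simp]: "\<alpha> x \<in> Arr V" "Dom V (\<alpha> x) = \<one>" "Cod V (\<alpha> x) = vhom C (fob F x) (fob G x)"
    if "x \<in> vob B" for x using h[OF that] by (auto simp: in_Hom)
  show ?thesis
    unfolding vnat_def
  proof (intro conjI ballI e h)
    fix x y assume x [simp]: "x \<in> vob B" "y \<in> vob B"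
    show "vcomp C (fob F x) (fob F y) (fob G y) \<cdot> (\<alpha> y \<boxtimes> fhom F x y) \<cdot> inv_arr V (Lun V (vhom B x y))
      = vcomp C (fob F x) (fob G x) (fob G y) \<cdot> (fhom G x y \<boxtimes> \<alpha> x) \<cdot> inv_arr V (Run V (vhom B x y))"
      by (rule arr_eqI[of _ _ "vhom B x y"]) (auto simp: n)
  qed
qed

lemma vnatD:
  assumes n: "vnat V B C F G \<alpha>" and F: "vfunctor V B C F" and G: "vfunctor V B C G"
    and B [simp]: "vcategory V B" and C [simp]: "vcategory V C"
  shows "\<And>x. x \<in> vob B \<Longrightarrow> \<alpha> x \<in> Arr V"
    "\<And>x. x \<in> vob B \<Longrightarrow> Dom V (\<alpha> x) = \<one>"
    "\<And>x. x \<in> vob B \<Longrightarrow> Cod V (\<alpha> x) = vhom C (fob F x) (fob G x)"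
    "\<And>x y a. \<lbrakk>x \<in> vob B; y \<in> vob B; elt a; ty a = vhom B x y\<rbrakk> \<Longrightarrow>
      cmp C (fob F x) (fob F y) (fob G y) (gl (\<alpha> y)) (app (fhom F x y) a)
        = cmp C (fob F x) (fob G x) (fob G y) (app (fhom G x y) a) (gl (\<alpha> x))"
proof -
  note [simp] = vfunD[OF F B C] vfunD[OF G B C]
  show [simp]: "\<And>x. x \<in> vob B \<Longrightarrow> \<alpha> x \<in> Arr V"
    "\<And>x. x \<in> vob B \<Longrightarrow> Dom V (\<alpha> x) = \<one>"
    "\<And>x. x \<in> vob B \<Longrightarrow> Cod V (\<alpha> x) = vhom C (fob F x) (fob G x)"
    using n unfolding vnat_def in_Hom by auto
  fix x y a assume a [simp]: "x \<in> vob B" "y \<in> vob B" "elt a" "ty a = vhom B x y"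
  have "vcomp C (fob F x) (fob F y) (fob G y) \<cdot> (\<alpha> y \<boxtimes> fhom F x y) \<cdot> inv_arr V (Lun V (vhom B x y))
      = vcomp C (fob F x) (fob G x) (fob G y) \<cdot> (fhom G x y \<boxtimes> \<alpha> x) \<cdot> inv_arr V (Run V (vhom B x y))"
    using n unfolding vnat_def by auto
  from arg_cong[OF this, of "\<lambda>f. app f a"]
  show "cmp C (fob F x) (fob F y) (fob G y) (gl (\<alpha> y)) (app (fhom F x y) a)
        = cmp C (fob F x) (fob G x) (fob G y) (app (fhom G x y) a) (gl (\<alpha> x))"
    by simp
qed

text \<open>A wedge is read as a natural transformation with a parameter \<open>z\<close>; the
  symmetry in \<open>is_wedge\<close> only moves the parameter past the element \<open>a\<close> of
  the hom-object.\<close>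

lemma wedgeI:
  assumes F: "vfunctor V B C F" and G: "vfunctor V B C G" and B [simp]: "vcategory V B" and C [simp]: "vcategory V C"
    and Z [simp]: "Z \<in> Obj V"
    and h: "\<And>x. x \<in> vob B \<Longrightarrow> \<kappa> x \<in> Hom V Z (vhom C (fob F x) (fob G x))"
    and n: "\<And>x y a z. \<lbrakk>x \<in> vob B; y \<in> vob B; elt a; ty a = vhom B x y; elt z; ty z = Z; dj a z; dj z a\<rbrakk> \<Longrightarrow>
      cmp C (fob F x) (fob G x) (fob G y) (app (fhom G x y) a) (app (\<kappa> x) z)
        = cmp C (fob F x) (fob F y) (fob G y) (app (\<kappa> y) z) (app (fhom F x y) a)"
  shows "is_wedge V B C F G Z \<kappa>"
proof -
  note [simp] = vfunD[OF F B C] vfunD[OF G B C]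
  have [simp]: "\<kappa> x \<in> Arr V" "Dom V (\<kappa> x) = Z" "Cod V (\<kappa> x) = vhom C (fob F x) (fob G x)"
    if "x \<in> vob B" for x using h[OF that] by (auto simp: in_Hom)
  show ?thesis
    unfolding is_wedge_def
  proof (intro conjI ballI h Z)
    fix x y assume x [simp]: "x \<in> vob B" "y \<in> vob B"
    show "vcomp C (fob F x) (fob G x) (fob G y) \<cdot> (fhom G x y \<boxtimes> \<kappa> x)
          = vcomp C (fob F x) (fob F y) (fob G y) \<cdot> (\<kappa> y \<boxtimes> fhom F x y) \<cdot> Sym V (vhom B x y) Z"
      by (rule arr_eqI2[of _ _ "vhom B x y" Z]) (auto simp: n)
  qed
qed

lemma wedgeD:
  assumes n: "is_wedge V B C F G Z \<kappa>" and F: "vfunctor V B C F" and G: "vfunctor V B C G"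
    and B [simp]: "vcategory V B" and C [simp]: "vcategory V C"
  shows "Z \<in> Obj V"
    "\<And>x. x \<in> vob B \<Longrightarrow> \<kappa> x \<in> Arr V"
    "\<And>x. x \<in> vob B \<Longrightarrow> Dom V (\<kappa> x) = Z"
    "\<And>x. x \<in> vob B \<Longrightarrow> Cod V (\<kappa> x) = vhom C (fob F x) (fob G x)"
    "\<And>x y a z. \<lbrakk>x \<in> vob B; y \<in> vob B; elt a; ty a = vhom B x y; elt z; ty z = Z; dj a z; dj z a\<rbrakk> \<Longrightarrow>
      cmp C (fob F x) (fob G x) (fob G y) (app (fhom G x y) a) (app (\<kappa> x) z)
        = cmp C (fob F x) (fob F y) (fob G y) (app (\<kappa> y) z) (app (fhom F x y) a)"
proof -
  note [simp] = vfunD[OF F B C] vfunD[OF G B C]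
  show [simp]: "Z \<in> Obj V"
    "\<And>x. x \<in> vob B \<Longrightarrow> \<kappa> x \<in> Arr V"
    "\<And>x. x \<in> vob B \<Longrightarrow> Dom V (\<kappa> x) = Z"
    "\<And>x. x \<in> vob B \<Longrightarrow> Cod V (\<kappa> x) = vhom C (fob F x) (fob G x)"
    using n unfolding is_wedge_def in_Hom by auto
  fix x y a z assume a [simp]: "x \<in> vob B" "y \<in> vob B" "elt a" "ty a = vhom B x y" "elt z" "ty z = Z" "dj a z" "dj z a"
  have "vcomp C (fob F x) (fob G x) (fob G y) \<cdot> (fhom G x y \<boxtimes> \<kappa> x)
          = vcomp C (fob F x) (fob F y) (fob G y) \<cdot> (\<kappa> y \<boxtimes> fhom F x y) \<cdot> Sym V (vhom B x y) Z"
    using n unfolding is_wedge_def by auto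
  from arg_cong[OF this, of "\<lambda>f. app f (pr a z)"]
  show "cmp C (fob F x) (fob G x) (fob G y) (app (fhom G x y) a) (app (\<kappa> x) z)
        = cmp C (fob F x) (fob F y) (fob G y) (app (\<kappa> y) z) (app (fhom F x y) a)"
    by simp
qed

lemma cmp_vop [simp]:
  assumes "vcategory V B" "x \<in> vob B" "y \<in> vob B" "z \<in> vob B" "elt a" "elt b" "ty a = vhom B y x" "ty b = vhom B z y" "dj b a"
  shows "cmp (vop V B) x y z b a = cmp B z y x a b"
  using assms dj_sym[of b a] by (simp add: vop_def)

lemma vcategory_vop [simp]:
  assumes [simp]: "vcategory V B"
  shows "vcategory V (vop V B)"
proof (rule vcategoryI)
  fix x y z assume "x \<in> vob (vop V B)" "y \<in> vob (vop V B)" "z \<in> vob (vop V B)"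
  then show "vcomp (vop V B) x y z \<in> Hom V (vhom (vop V B) y z \<otimes> vhom (vop V B) x y) (vhom (vop V B) x z)"
    by (simp add: vop_def in_Hom)
qed (auto simp: in_Hom)

section \<open>Cotensors by elements\<close>

definition cot_arr :: "('v, 'm, 'b) vcat \<Rightarrow> 'v \<Rightarrow> 'b \<Rightarrow> 'b \<Rightarrow> 'm \<Rightarrow> 'b \<Rightarrow> 'm" where
  "cot_arr B K c P \<gamma> x = vcomp B x P c \<cdot> (\<gamma> \<boxtimes> Id V (vhom B x P)) \<cdot> Sym V (vhom B x P) K"

lemma cot_arr [simp]:
  assumes "vcategory V B" "c \<in> vob B" "P \<in> vob B" "x \<in> vob B" "\<gamma> \<in> Arr V" "Dom V \<gamma> = K" "Cod V \<gamma> = vhom B P c"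
  shows "cot_arr B K c P \<gamma> x \<in> Arr V" "Dom V (cot_arr B K c P \<gamma> x) = vhom B x P \<otimes> K"
    "Cod V (cot_arr B K c P \<gamma> x) = vhom B x c"
    "\<lbrakk>elt a; ty a = vhom B x P; elt k; ty k = K; dj a k\<rbrakk> \<Longrightarrow>
      app (cot_arr B K c P \<gamma> x) (pr a k) = cmp B x P c (app \<gamma> k) a"
  using assms dj_sym[of a k] obj_Dom[OF assms(5)] by (auto simp: cot_arr_def simp del: obj_Dom)

text \<open>\<open>cot_arr\<close> sends \<open>(a, k)\<close> to \<open>\<gamma>(k)\<close> after
  \<open>a\<close>. Its transpose is the arrow that the definition of a cotensor requires to be
  invertible, so \<open>iso_curry_iff\<close> applies at each \<open>x\<close>.\<close>

lemma is_cotensor_iff: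
  assumes "vcategory V B" "c \<in> vob B"
  shows "is_cotensor V B K c P \<gamma> \<longleftrightarrow> P \<in> vob B \<and> \<gamma> \<in> Hom V K (vhom B P c) \<and>
    (\<forall>x \<in> vob B. univ (vhom B x P) K (cot_arr B K c P \<gamma> x))"
proof -
  have "is_iso V (curry_arr V (vhom B x P) K (vhom B x c) (cot_arr B K c P \<gamma> x))
    \<longleftrightarrow> univ (vhom B x P) K (cot_arr B K c P \<gamma> x)"
    if "P \<in> vob B" "\<gamma> \<in> Hom V K (vhom B P c)" "x \<in> vob B" for x
    by (rule iso_curry_iff) (use that assms in \<open>auto simp: in_Hom\<close>)
  then show ?thesis unfolding is_cotensor_def cot_arr_def[symmetric] by blast
qed

lemma cotD [simp]:
  assumes "is_cotensor V B K c P \<gamma>"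
  shows "P \<in> vob B" "\<gamma> \<in> Arr V" "Dom V \<gamma> = K" "Cod V \<gamma> = vhom B P c" "K \<in> Obj V"
  using assms by (auto simp: is_cotensor_def in_Hom)

lemma cot_ex:
  assumes c: "is_cotensor V B K c P \<gamma>" and [simp]: "vcategory V B" "c \<in> vob B" "x \<in> vob B"
    and f: "Z \<in> Obj V" "f \<in> Arr V" "Dom V f = Z \<otimes> K" "Cod V f = vhom B x c"
  obtains g where "g \<in> Arr V" "Dom V g = Z" "Cod V g = vhom B x P"
    "\<And>z k. \<lbrakk>elt z; ty z = Z; elt k; ty k = K; dj z k\<rbrakk> \<Longrightarrow> cmp B x P c (app \<gamma> k) (app g z) = app f (pr z k)"
proof -
  note [simp] = cotD[OF c]
  have u: "univ (vhom B x P) K (cot_arr B K c P \<gamma> x)" using c \<open>x \<in> vob B\<close> unfolding is_cotensor_iff[OF \<open>vcategory V B\<close> \<open>c \<in> vob B\<close>] by blast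
  show thesis
  proof (rule univ_ex[OF u f(1-3)])
    show "Cod V f = Cod V (cot_arr B K c P \<gamma> x)" using f by simp
    fix g assume g: "g \<in> Arr V" "Dom V g = Z" "Cod V g = vhom B x P"
      and gf: "\<And>z k. \<lbrakk>elt z; ty z = Z; elt k; ty k = K; dj z k\<rbrakk> \<Longrightarrow> app (cot_arr B K c P \<gamma> x) (pr (app g z) k) = app f (pr z k)"
    show thesis by (rule that[OF g]) (use g gf in auto)
  qed
qed

text \<open>The cancellation rule used throughout: composing with the counit at a single fresh
  variable loses nothing.\<close>

lemma cot_eq:
  assumes c: "is_cotensor V B K c P \<gamma>" and [simp]: "vcategory V B" "c \<in> vob B" "x \<in> vob B"
    and a: "elt a" "ty a = vhom B x P" "elt b" "ty b = vhom B x P"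
    and k: "generic k" "ty k = K" "dj k a" "dj k b" and e: "cmp B x P c (app \<gamma> k) a = cmp B x P c (app \<gamma> k) b"
  shows "a = b"
proof -
  note [simp] = cotD[OF c]
  have u: "univ (vhom B x P) K (cot_arr B K c P \<gamma> x)" using c \<open>x \<in> vob B\<close> unfolding is_cotensor_iff[OF \<open>vcategory V B\<close> \<open>c \<in> vob B\<close>] by blast
  show ?thesis by (rule univ_eq[OF u a k]) (use e a k dj_sym genericD in auto)
qed

lemma cotI:
  assumes B [simp]: "vcategory V B" "c \<in> vob B" "P \<in> vob B" and \<gamma>: "\<gamma> \<in> Arr V" "Dom V \<gamma> = K" "Cod V \<gamma> = vhom B P c"
    and ex: "\<And>x Z f. \<lbrakk>x \<in> vob B; Z \<in> Obj V; f \<in> Arr V; Dom V f = Z \<otimes> K; Cod V f = vhom B x c\<rbrakk> \<Longrightarrow>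
      \<exists>g. g \<in> Arr V \<and> Dom V g = Z \<and> Cod V g = vhom B x P \<and>
        (\<forall>z k. elt z \<and> ty z = Z \<and> elt k \<and> ty k = K \<and> dj z k \<and> dj k z \<longrightarrow> cmp B x P c (app \<gamma> k) (app g z) = app f (pr z k))"
    and eq: "\<And>x a b. \<lbrakk>x \<in> vob B; elt a; ty a = vhom B x P; elt b; ty b = vhom B x P;
        \<And>k. \<lbrakk>elt k; ty k = K; dj a k; dj k a; dj b k; dj k b\<rbrakk> \<Longrightarrow> cmp B x P c (app \<gamma> k) a = cmp B x P c (app \<gamma> k) b\<rbrakk> \<Longrightarrow> a = b"
  shows "is_cotensor V B K c P \<gamma>"
proof -
  have K: "K \<in> Obj V" using \<gamma> by auto
  have "univ (vhom B x P) K (cot_arr B K c P \<gamma> x)" if x [simp]: "x \<in> vob B" for x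
  proof (rule univI)
    fix Z f assume Z: "Z \<in> Obj V" "f \<in> Arr V" "Dom V f = Z \<otimes> K" "Cod V f = Cod V (cot_arr B K c P \<gamma> x)"
    then have f: "Cod V f = vhom B x c" using \<gamma> by simp
    obtain g where g: "g \<in> Arr V" "Dom V g = Z" "Cod V g = vhom B x P"
      "\<And>z k. \<lbrakk>elt z; ty z = Z; elt k; ty k = K; dj z k; dj k z\<rbrakk> \<Longrightarrow> cmp B x P c (app \<gamma> k) (app g z) = app f (pr z k)"
      using ex[OF x Z(1-3) f] by blast
    show "\<exists>g. g \<in> Arr V \<and> Dom V g = Z \<and> Cod V g = vhom B x P \<and>
        (\<forall>z k. elt z \<and> ty z = Z \<and> elt k \<and> ty k = K \<and> dj z k \<and> dj k z \<longrightarrow> app (cot_arr B K c P \<gamma> x) (pr (app g z) k) = app f (pr z k))"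
      by (rule exI[of _ g]) (use g \<gamma> in auto)
  next
    fix a b assume a: "elt a" "ty a = vhom B x P" "elt b" "ty b = vhom B x P" "labels a = labels b"
      and e: "\<And>k. \<lbrakk>elt k; ty k = K; dj a k; dj k a; dj b k; dj k b\<rbrakk> \<Longrightarrow>
        app (cot_arr B K c P \<gamma> x) (pr a k) = app (cot_arr B K c P \<gamma> x) (pr b k)"
    show "a = b"
    proof (rule eq[OF x a(1-4)])
      fix k assume "elt k" "ty k = K" "dj a k" "dj k a" "dj b k" "dj k b"
      then show "cmp B x P c (app \<gamma> k) a = cmp B x P c (app \<gamma> k) b" using e[of k] a \<gamma> by simp
    qed
  qed (use \<gamma> K in auto)
  then show ?thesis using \<gamma> by (auto simp: is_cotensor_iff in_Hom)
qed

lemma cot_unit: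
  assumes [simp]: "vcategory V B" "c \<in> vob B"
  shows "is_cotensor V B \<one> c c (vid B c)"
proof (rule cotI)
  fix x Z f assume x [simp]: "x \<in> vob B" "Z \<in> Obj V" "f \<in> Arr V" "Dom V f = Z \<otimes> \<one>" "Cod V f = vhom B x c"
  let ?g = "f \<cdot> inv_arr V (Run V Z)"
  have g [simp]: "?g \<in> Arr V" "Dom V ?g = Z" "Cod V ?g = vhom B x c" by auto
  \<comment> \<open>A variable \<open>k\<close> of type \<open>\<one>\<close> need not be
    \<open>star\<close>. The equation is therefore proved for arrows, where testing on pairs with
    \<open>star\<close> is enough, and then applied to \<open>pr z k\<close>.\<close>
  have "vcomp B x c c \<cdot> (vid B c \<boxtimes> ?g) \<cdot> Sym V Z \<one> = f"
    by (rule arr_eqI_Run[of _ _ Z]) auto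
  then have e: "app (vcomp B x c c \<cdot> (vid B c \<boxtimes> ?g) \<cdot> Sym V Z \<one>) (pr z k) = app f (pr z k)" for z k
    by simp
  show "\<exists>g. g \<in> Arr V \<and> Dom V g = Z \<and> Cod V g = vhom B x c \<and>
        (\<forall>z k. elt z \<and> ty z = Z \<and> elt k \<and> ty k = \<one> \<and> dj z k \<and> dj k z \<longrightarrow> cmp B x c c (app (vid B c) k) (app g z) = app f (pr z k))"
  proof (intro exI[of _ ?g] conjI g allI impI)
    fix z k assume z: "elt z \<and> ty z = Z \<and> elt k \<and> ty k = \<one> \<and> dj z k \<and> dj k z"
    then show "cmp B x c c (app (vid B c) k) (app ?g z) = app f (pr z k)"
      using e[of z k] by simp
  qed
next
  fix x a b assume a: "x \<in> vob B" "elt a" "ty a = vhom B x c" "elt b" "ty b = vhom B x c"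
    and e: "\<And>k. \<lbrakk>elt k; ty k = \<one>; dj a k; dj k a; dj b k; dj k b\<rbrakk> \<Longrightarrow> cmp B x c c (app (vid B c) k) a = cmp B x c c (app (vid B c) k) b"
  show "a = b" using e[of star] a by simp
qed auto

lemma cot_compare:
  assumes c: "is_cotensor V B K c P \<gamma>" "is_cotensor V B K c P' \<gamma>'" and [simp]: "vcategory V B" "c \<in> vob B"
  obtains u where "u \<in> Arr V" "Dom V u = \<one>" "Cod V u = vhom B P' P"
    "\<And>k. \<lbrakk>elt k; ty k = K\<rbrakk> \<Longrightarrow> cmp B P' P c (app \<gamma> k) (gl u) = app \<gamma>' k"
proof -
  note [simp] = cotD[OF c(1)] cotD[OF c(2)]
  obtain g where g: "g \<in> Arr V" "Dom V g = \<one>" "Cod V g = vhom B P' P"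
    "\<And>z k. \<lbrakk>elt z; ty z = \<one>; elt k; ty k = K; dj z k\<rbrakk> \<Longrightarrow> cmp B P' P c (app \<gamma> k) (app g z) = app (\<gamma>' \<cdot> Lun V K) (pr z k)"
    by (rule cot_ex[OF c(1), of P' \<one> "\<gamma>' \<cdot> Lun V K"]) auto
  have "cmp B P' P c (app \<gamma> k) (gl g) = app \<gamma>' k" if "elt k" "ty k = K" for k
    using g(4)[of star k] that g(1-3) by simp
  then show thesis using that g by blast
qed

text \<open>Both comparisons respect the counits, hence so does their composite, and
  \<open>cot_eq\<close> identifies it with the identity.\<close>

lemma cot_section:
  assumes c: "is_cotensor V B K c P \<gamma>" "is_cotensor V B K c Q \<delta>" and [simp]: "vcategory V B" "c \<in> vob B"
    and [simp]: "u \<in> Arr V" "Dom V u = \<one>" "Cod V u = vhom B Q P" "v \<in> Arr V" "Dom V v = \<one>" "Cod V v = vhom B P Q"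
    and u: "\<And>k. \<lbrakk>elt k; ty k = K\<rbrakk> \<Longrightarrow> cmp B Q P c (app \<gamma> k) (gl u) = app \<delta> k"
    and v: "\<And>k. \<lbrakk>elt k; ty k = K\<rbrakk> \<Longrightarrow> cmp B P Q c (app \<delta> k) (gl v) = app \<gamma> k"
  shows "cmp B P Q P (gl u) (gl v) = gl (vid B P)"
proof (rule cot_eq[OF c(1), where k = "var 0 K"])
  note [simp] = cotD[OF c(1)] cotD[OF c(2)]
  have "cmp B P P c (app \<gamma> (var 0 K)) (cmp B P Q P (gl u) (gl v))
    = cmp B P Q c (cmp B Q P c (app \<gamma> (var 0 K)) (gl u)) (gl v)" by simp
  then show "cmp B P P c (app \<gamma> (var 0 K)) (cmp B P Q P (gl u) (gl v)) = cmp B P P c (app \<gamma> (var 0 K)) (gl (vid B P))"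
    by (simp add: u v)
qed (use cotD[OF c(1)] cotD[OF c(2)] in auto)

lemma cot_iso:
  assumes c: "is_cotensor V B K c P \<gamma>" "is_cotensor V B K c P' \<gamma>'" and [simp]: "vcategory V B" "c \<in> vob B"
  obtains u v where "u \<in> Arr V" "Dom V u = \<one>" "Cod V u = vhom B P' P"
    "v \<in> Arr V" "Dom V v = \<one>" "Cod V v = vhom B P P'"
    "\<And>k. \<lbrakk>elt k; ty k = K\<rbrakk> \<Longrightarrow> cmp B P' P c (app \<gamma> k) (gl u) = app \<gamma>' k"
    "\<And>k. \<lbrakk>elt k; ty k = K\<rbrakk> \<Longrightarrow> cmp B P P' c (app \<gamma>' k) (gl v) = app \<gamma> k"
    "cmp B P P' P (gl u) (gl v) = gl (vid B P)" "cmp B P' P P' (gl v) (gl u) = gl (vid B P')"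
proof -
  note [simp] = cotD[OF c(1)] cotD[OF c(2)]
  obtain u where u: "u \<in> Arr V" "Dom V u = \<one>" "Cod V u = vhom B P' P"
    "\<And>k. \<lbrakk>elt k; ty k = K\<rbrakk> \<Longrightarrow> cmp B P' P c (app \<gamma> k) (gl u) = app \<gamma>' k"
    using cot_compare[OF c] by auto
  obtain v where v: "v \<in> Arr V" "Dom V v = \<one>" "Cod V v = vhom B P P'"
    "\<And>k. \<lbrakk>elt k; ty k = K\<rbrakk> \<Longrightarrow> cmp B P P' c (app \<gamma>' k) (gl v) = app \<gamma> k"
    using cot_compare[OF c(2,1)] by auto
  have 1: "cmp B P P' P (gl u) (gl v) = gl (vid B P)"
    by (rule cot_section[OF c]) (simp_all add: u v)
  have 2: "cmp B P' P P' (gl v) (gl u) = gl (vid B P')"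
    by (rule cot_section[OF c(2,1)]) (simp_all add: u v)
  show thesis by (rule that[OF u(1-3) v(1-3) u(4) v(4) 1 2])
qed

text \<open>Two cotensors of the same object are isomorphic over their counits, and \<open>F\<close>
  preserves this isomorphism. Preservation therefore has to be checked for one choice of cotensor
  only.\<close>

lemma preserves_one:
  assumes F: "vfunctor V B C F" and [simp]: "vcategory V B" "vcategory V C" "c \<in> vob B"
    and c: "is_cotensor V B K c P \<gamma>" "is_cotensor V B K c P' \<gamma>'"
    and FP: "is_cotensor V C K (fob F c) (fob F P) (fhom F P c \<cdot> \<gamma>)"
  shows "is_cotensor V C K (fob F c) (fob F P') (fhom F P' c \<cdot> \<gamma>')"
proof -
  note [simp] = vfunD[OF F] cotD[OF c(1)] cotD[OF c(2)]
  obtain u v where [simp]: "u \<in> Arr V" "Dom V u = \<one>" "Cod V u = vhom B P' P"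
    "v \<in> Arr V" "Dom V v = \<one>" "Cod V v = vhom B P P'"
    and u: "\<And>k. \<lbrakk>elt k; ty k = K\<rbrakk> \<Longrightarrow> cmp B P' P c (app \<gamma> k) (gl u) = app \<gamma>' k"
    and v: "\<And>k. \<lbrakk>elt k; ty k = K\<rbrakk> \<Longrightarrow> cmp B P P' c (app \<gamma>' k) (gl v) = app \<gamma> k"
    and uv: "cmp B P P' P (gl u) (gl v) = gl (vid B P)" and vu: "cmp B P' P P' (gl v) (gl u) = gl (vid B P')"
    using cot_iso[OF c] by auto
  let ?u = "gl (fhom F P' P \<cdot> u)" and ?v = "gl (fhom F P P' \<cdot> v)"
  have v': "cmp C (fob F P) (fob F P') (fob F c) (app (fhom F P' c \<cdot> \<gamma>') k) ?v = app (fhom F P c \<cdot> \<gamma>) k"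
    if "elt k" "ty k = K" for k
    using arg_cong[OF v[OF that], of "app (fhom F P c)"] that by simp
  have u': "cmp C (fob F P') (fob F P) (fob F c) (app (fhom F P c \<cdot> \<gamma>) k) ?u = app (fhom F P' c \<cdot> \<gamma>') k"
    if "elt k" "ty k = K" for k
    using arg_cong[OF u[OF that], of "app (fhom F P' c)"] that by simp
  have vu': "cmp C (fob F P') (fob F P) (fob F P') ?v ?u = gl (vid C (fob F P'))"
    using arg_cong[OF vu, of "app (fhom F P' P')"] by simp
  show ?thesis
  proof (rule cotI)
    fix x Z f assume [simp]: "x \<in> vob C" and f [simp]: "Z \<in> Obj V" "f \<in> Arr V" "Dom V f = Z \<otimes> K" "Cod V f = vhom C x (fob F c)"
    obtain g where [simp]: "g \<in> Arr V" "Dom V g = Z" "Cod V g = vhom C x (fob F P)"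
      and g: "\<And>z k. \<lbrakk>elt z; ty z = Z; elt k; ty k = K; dj z k\<rbrakk> \<Longrightarrow> cmp C x (fob F P) (fob F c) (app (fhom F P c \<cdot> \<gamma>) k) (app g z) = app f (pr z k)"
      by (rule cot_ex[OF FP _ _ _ f]) auto
    \<comment> \<open>The lift of \<open>f\<close> to \<open>fob F P\<close>, moved to
      \<open>fob F P'\<close> along the image of \<open>v\<close>.\<close>
    let ?g = "vcomp C x (fob F P) (fob F P') \<cdot> ((fhom F P P' \<cdot> v) \<boxtimes> g) \<cdot> inv_arr V (Lun V Z)"
    show "\<exists>g. g \<in> Arr V \<and> Dom V g = Z \<and> Cod V g = vhom C x (fob F P') \<and>
        (\<forall>z k. elt z \<and> ty z = Z \<and> elt k \<and> ty k = K \<and> dj z k \<and> dj k z \<longrightarrow>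
          cmp C x (fob F P') (fob F c) (app (fhom F P' c \<cdot> \<gamma>') k) (app g z) = app f (pr z k))"
    proof (intro exI[of _ ?g] conjI allI impI)
      fix z k assume z: "elt z \<and> ty z = Z \<and> elt k \<and> ty k = K \<and> dj z k \<and> dj k z"
      have "cmp C x (fob F P') (fob F c) (app (fhom F P' c \<cdot> \<gamma>') k) (app ?g z)
        = cmp C x (fob F P) (fob F c) (cmp C (fob F P) (fob F P') (fob F c) (app (fhom F P' c \<cdot> \<gamma>') k) ?v) (app g z)"
        using z by simp
      also have "\<dots> = app f (pr z k)" using z by (simp only: v' g)
      finally show "cmp C x (fob F P') (fob F c) (app (fhom F P' c \<cdot> \<gamma>') k) (app ?g z) = app f (pr z k)" .
    qed auto
  next
    fix x a b assume [simp]: "x \<in> vob C" and a [simp]: "elt a" "ty a = vhom C x (fob F P')" "elt b" "ty b = vhom C x (fob F P')"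
      and e: "\<And>k. \<lbrakk>elt k; ty k = K; dj a k; dj k a; dj b k; dj k b\<rbrakk> \<Longrightarrow>
        cmp C x (fob F P') (fob F c) (app (fhom F P' c \<cdot> \<gamma>') k) a = cmp C x (fob F P') (fob F c) (app (fhom F P' c \<cdot> \<gamma>') k) b"
    obtain k where k [simp]: "generic k" "elt k" "ty k = K" "dj k a" "dj a k" "dj k b" "dj b k"
      using fresh[of a b K] by auto
    \<comment> \<open>Uniqueness is transported to the known cotensor \<open>fob F P\<close>, where
      the counit can be cancelled; composing with \<open>?v\<close> then returns to
      \<open>fob F P'\<close>.\<close>
    have "cmp C x (fob F P') (fob F P) ?u a = cmp C x (fob F P') (fob F P) ?u b"
    proof (rule cot_eq[OF FP, where k = k])
      have "cmp C x (fob F P) (fob F c) (app (fhom F P c \<cdot> \<gamma>) k) (cmp C x (fob F P') (fob F P) ?u d)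
         = cmp C x (fob F P') (fob F c) (app (fhom F P' c \<cdot> \<gamma>') k) d" if "d \<in> {a, b}" for d
      proof -
        have "cmp C x (fob F P) (fob F c) (app (fhom F P c \<cdot> \<gamma>) k) (cmp C x (fob F P') (fob F P) ?u d)
          = cmp C x (fob F P') (fob F c) (cmp C (fob F P') (fob F P) (fob F c) (app (fhom F P c \<cdot> \<gamma>) k) ?u) d"
          using that by auto
        then show ?thesis by (simp only: u'[OF k(2,3)])
      qed
      then show "cmp C x (fob F P) (fob F c) (app (fhom F P c \<cdot> \<gamma>) k) (cmp C x (fob F P') (fob F P) ?u a)
        = cmp C x (fob F P) (fob F c) (app (fhom F P c \<cdot> \<gamma>) k) (cmp C x (fob F P') (fob F P) ?u b)"
        using e[of k] by simp
    qed auto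
    then have "cmp C x (fob F P) (fob F P') ?v (cmp C x (fob F P') (fob F P) ?u a)
      = cmp C x (fob F P) (fob F P') ?v (cmp C x (fob F P') (fob F P) ?u b)" by simp
    moreover have "cmp C x (fob F P) (fob F P') ?v (cmp C x (fob F P') (fob F P) ?u d) = d" if "d \<in> {a, b}" for d
    proof -
      have "cmp C x (fob F P) (fob F P') ?v (cmp C x (fob F P') (fob F P) ?u d)
        = cmp C x (fob F P') (fob F P') (cmp C (fob F P') (fob F P) (fob F P') ?v ?u) d"
        using that by auto
      also have "\<dots> = cmp C x (fob F P') (fob F P') (gl (vid C (fob F P'))) d" by (simp only: vu')
      also have "\<dots> = d" using that by auto
      finally show ?thesis .
    qed
    ultimately show "a = b" by simp
  qed auto
qed

end

section \<open>Theories from cotensors\<close>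

lemma vfull_simps [simp]: "vob (vfull V J) = J" "vhom (vfull V J) = Ihom V"
  by (simp_all add: vfull_def)

section \<open>Cotensors in the opposite of the arities, and theories presented by their
  counits\<close>

locale arity_system = symmetric_monoidal_closed V
  for V :: "('v, 'm) smc" (structure) +
  fixes J :: "'v set"
  assumes J: "system_of_arities V J"
begin

lemma J_simps [simp]: "X \<in> J \<Longrightarrow> X \<in> Obj V" "\<one> \<in> J" "X \<in> J \<Longrightarrow> Y \<in> J \<Longrightarrow> X \<otimes> Y \<in> J"
  using J by (auto simp: system_of_arities_def)

lemma vfull_id [simp]:
  assumes "X \<in> J"
  shows "vid (vfull V J) X \<in> Arr V" "Dom V (vid (vfull V J) X) = \<one>" "Cod V (vid (vfull V J) X) = Ihom V X X"
    "\<lbrakk>elt w; ty w = X\<rbrakk> \<Longrightarrow> app (Ev V X X) (pr (gl (vid (vfull V J) X)) w) = w"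
  using curry(1-3)[of \<one> X X "Lun V X"] app_curry[of \<one> X X "Lun V X" star w] assms
  by (auto simp: vfull_def)

lemma vfull_comp [simp]:
  assumes "X \<in> J" "Y \<in> J" "Z \<in> J"
  shows "vcomp (vfull V J) X Y Z \<in> Arr V" "Dom V (vcomp (vfull V J) X Y Z) = Ihom V Y Z \<otimes> Ihom V X Y"
    "Cod V (vcomp (vfull V J) X Y Z) = Ihom V X Z"
    "\<lbrakk>elt a; ty a = Ihom V X Y; elt b; ty b = Ihom V Y Z; elt w; ty w = X; dj b a; dj b w; dj a w\<rbrakk> \<Longrightarrow>
      app (Ev V X Z) (pr (cmp (vfull V J) X Y Z b a) w) = app (Ev V Y Z) (pr b (app (Ev V X Y) (pr a w)))"
proof -
  let ?f = "Ev V Y Z \<cdot> (Id V (Ihom V Y Z) \<boxtimes> Ev V X Y) \<cdot> Assoc V (Ihom V Y Z) (Ihom V X Y) X"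
  have f: "Ihom V Y Z \<otimes> Ihom V X Y \<in> Obj V" "X \<in> Obj V" "Z \<in> Obj V" "?f \<in> Arr V"
    "Dom V ?f = (Ihom V Y Z \<otimes> Ihom V X Y) \<otimes> X" "Cod V ?f = Z" using assms by auto
  show "vcomp (vfull V J) X Y Z \<in> Arr V" "Dom V (vcomp (vfull V J) X Y Z) = Ihom V Y Z \<otimes> Ihom V X Y"
    "Cod V (vcomp (vfull V J) X Y Z) = Ihom V X Z"
    using curry[OF f] by (auto simp: vfull_def)
  assume "elt a" "ty a = Ihom V X Y" "elt b" "ty b = Ihom V Y Z" "elt w" "ty w = X" "dj b a" "dj b w" "dj a w"
  then show "app (Ev V X Z) (pr (cmp (vfull V J) X Y Z b a) w) = app (Ev V Y Z) (pr b (app (Ev V X Y) (pr a w)))"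
    using app_curry[OF f, of "pr b a" w] assms by (auto simp: vfull_def)
qed

lemma vcategory_vfull [simp]: "vcategory V (vfull V J)"
proof (rule vcategoryI)
  fix w x y z a b c
  assume [simp]: "w \<in> vob (vfull V J)" "x \<in> vob (vfull V J)" "y \<in> vob (vfull V J)" "z \<in> vob (vfull V J)"
    "elt a" "elt b" "elt c" "ty a = vhom (vfull V J) w x" "ty b = vhom (vfull V J) x y" "ty c = vhom (vfull V J) y z"
    "dj c b" "dj b c" "dj c a" "dj a c" "dj b a" "dj a b"
  have [simp]: "w \<in> J" "x \<in> J" "y \<in> J" "z \<in> J" using \<open>w \<in> vob (vfull V J)\<close> \<open>x \<in> vob (vfull V J)\<close>
    \<open>y \<in> vob (vfull V J)\<close> \<open>z \<in> vob (vfull V J)\<close> by simp_all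
  obtain k where [simp]: "generic k" "elt k" "ty k = w" "dj k (pr a b)" "dj (pr a b) k" "dj k c" "dj c k"
    using fresh[of "pr a b" c w] by auto
  show "cmp (vfull V J) w y z c (cmp (vfull V J) w x y b a) = cmp (vfull V J) w x z (cmp (vfull V J) x y z c b) a"
    by (rule Ihom_eq[of _ w z _ k]) (use \<open>dj k (pr a b)\<close> \<open>dj (pr a b) k\<close> in auto)
next
  fix x y a assume [simp]: "x \<in> vob (vfull V J)" "y \<in> vob (vfull V J)" "elt a" "ty a = vhom (vfull V J) x y"
  have [simp]: "x \<in> J" "y \<in> J" using \<open>x \<in> vob (vfull V J)\<close> \<open>y \<in> vob (vfull V J)\<close> by simp_all
  obtain k where [simp]: "generic k" "elt k" "ty k = x" "dj k a" "dj a k"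
    using fresh[of a a x] by auto
  show "cmp (vfull V J) x y y (gl (vid (vfull V J) y)) a = a"
    by (rule Ihom_eq[of _ x y _ k]) auto
  show "cmp (vfull V J) x x y a (gl (vid (vfull V J) x)) = a"
    by (rule Ihom_eq[of _ x y _ k]) auto
qed (auto simp: in_Hom)

abbreviation JO :: "('v, 'm, 'v) vcat" where
  "JO \<equiv> vop V (vfull V J)"

text \<open>
  In \<open>JO\<close>, the opposite of the full subcategory on \<open>J\<close>, the object \<open>X\<close> is the cotensor \<open>[X, \<one>]\<close> with
  counit \<open>nm X\<close>, and \<open>K \<otimes> X\<close> is the cotensor \<open>[K, X]\<close> with counit \<open>dl K X\<close>.
\<close>

definition nm :: "'v \<Rightarrow> 'm" where
  "nm X = curry_arr V X \<one> X (Run V X)"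

definition dl :: "'v \<Rightarrow> 'v \<Rightarrow> 'm" where
  "dl K X = curry_arr V K X (K \<otimes> X) (Id V (K \<otimes> X))"

lemma nm [simp]:
  assumes "X \<in> Obj V"
  shows "nm X \<in> Arr V" "Dom V (nm X) = X" "Cod V (nm X) = Ihom V \<one> X"
    "\<lbrakk>elt x; ty x = X\<rbrakk> \<Longrightarrow> app (Ev V \<one> X) (pr (app (nm X) x) star) = x"
  using curry(1-3)[of X \<one> X "Run V X"] app_curry[of X \<one> X "Run V X" x star] assms
  by (auto simp: nm_def)

lemma dl [simp]:
  assumes "K \<in> Obj V" "X \<in> Obj V"
  shows "dl K X \<in> Arr V" "Dom V (dl K X) = K" "Cod V (dl K X) = Ihom V X (K \<otimes> X)"
    "\<lbrakk>elt k; ty k = K; elt x; ty x = X; dj k x\<rbrakk> \<Longrightarrow> app (Ev V X (K \<otimes> X)) (pr (app (dl K X) k) x) = pr k x"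
  using curry(1-3)[of K X "K \<otimes> X" "Id V (K \<otimes> X)"] app_curry[of K X "K \<otimes> X" "Id V (K \<otimes> X)" k x] assms
  by (auto simp: dl_def)

lemma nm_unit: "nm \<one> = vid (vfull V J) \<one>"
  by (simp add: nm_def vfull_def Lun_Run_unit)

text \<open>The hom-object of \<open>JO\<close> from \<open>Y\<close> to
  \<open>K \<otimes> X\<close> is \<open>[K \<otimes> X, Y]\<close>, which currying identifies with
  \<open>[K, [X, Y]]\<close>.\<close>

lemma cot_JO:
  assumes K [simp]: "K \<in> J" and X [simp]: "X \<in> J"
  shows "is_cotensor V JO K X (K \<otimes> X) (dl K X)"
proof (rule cotI)
  fix Y Z f assume "Y \<in> vob JO" and Z [simp]: "Z \<in> Obj V" "f \<in> Arr V" "Dom V f = Z \<otimes> K" and f: "Cod V f = vhom JO Y X"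
  then have [simp]: "Y \<in> J" "Cod V f = Ihom V X Y" by simp_all
  \<comment> \<open>Sends \<open>(z, (k, x))\<close> to \<open>f(z, k)\<close> evaluated at
    \<open>x\<close>.\<close>
  let ?h = "Ev V X Y \<cdot> (f \<boxtimes> Id V X) \<cdot> inv_arr V (Assoc V Z K X)"
  have h: "Z \<in> Obj V" "K \<otimes> X \<in> Obj V" "Y \<in> Obj V" "?h \<in> Arr V" "Dom V ?h = Z \<otimes> (K \<otimes> X)" "Cod V ?h = Y" by auto
  note [simp] = curry(1-3)[OF h]
  let ?g = "curry_arr V Z (K \<otimes> X) Y ?h"
  show "\<exists>g. g \<in> Arr V \<and> Dom V g = Z \<and> Cod V g = vhom JO Y (K \<otimes> X) \<and>
        (\<forall>z k. elt z \<and> ty z = Z \<and> elt k \<and> ty k = K \<and> dj z k \<and> dj k z \<longrightarrow>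
          cmp JO Y (K \<otimes> X) X (app (dl K X) k) (app g z) = app f (pr z k))"
  proof (intro exI[of _ ?g] conjI allI impI)
    fix z k assume a: "elt z \<and> ty z = Z \<and> elt k \<and> ty k = K \<and> dj z k \<and> dj k z"
    then have [simp]: "elt z" "ty z = Z" "elt k" "ty k = K" "dj z k" "dj k z" by auto
    obtain x where [simp]: "generic x" "elt x" "ty x = X" "dj x z" "dj z x" "dj x k" "dj k x"
      using fresh[of z k X] by auto
    show "cmp JO Y (K \<otimes> X) X (app (dl K X) k) (app ?g z) = app f (pr z k)"
      by (rule Ihom_eq[of _ X Y _ x]) (auto simp: app_curry[OF h])
  qed auto
next
  fix Y a b assume "Y \<in> vob JO" and a: "elt a" "ty a = vhom JO Y (K \<otimes> X)" "elt b" "ty b = vhom JO Y (K \<otimes> X)"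
    and e: "\<And>k. \<lbrakk>elt k; ty k = K; dj a k; dj k a; dj b k; dj k b\<rbrakk> \<Longrightarrow>
      cmp JO Y (K \<otimes> X) X (app (dl K X) k) a = cmp JO Y (K \<otimes> X) X (app (dl K X) k) b"
  then have [simp]: "Y \<in> J" "elt a" "elt b" "ty a = Ihom V (K \<otimes> X) Y" "ty b = Ihom V (K \<otimes> X) Y" by simp_all
  obtain k x where [simp]: "generic k" "elt k" "ty k = K" "dj k a" "dj a k" "dj k b" "dj b k"
    "generic x" "elt x" "ty x = X" "dj x a" "dj a x" "dj x b" "dj b x" "dj k x" "dj x k"
    using fresh2[of a b K X] by auto
  have ev: "app (Ev V (K \<otimes> X) Y) (pr d (pr k x)) = app (Ev V X Y) (pr (cmp JO Y (K \<otimes> X) X (app (dl K X) k) d) x)"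
    if "d = a \<or> d = b" for d
    using that by auto
  have E: "cmp JO Y (K \<otimes> X) X (app (dl K X) k) a = cmp JO Y (K \<otimes> X) X (app (dl K X) k) b"
    by (rule e) simp_all
  have "app (Ev V (K \<otimes> X) Y) (pr a (pr k x)) = app (Ev V (K \<otimes> X) Y) (pr b (pr k x))"
    by (metis E ev)
  then show "a = b"
    by (rule Ihom_eq[of a "K \<otimes> X" Y b "pr k x", rotated -1]) simp_all
qed auto

text \<open>Naming identifies \<open>Y\<close> with \<open>[\<one>, Y]\<close>, hence
  \<open>[X, Y]\<close> with \<open>[X, [\<one>, Y]]\<close>.\<close>

lemma cot_nm:
  assumes X [simp]: "X \<in> J"
  shows "is_cotensor V JO X \<one> X (nm X)"
proof (rule cotI)
  fix Y Z f assume "Y \<in> vob JO" and Z [simp]: "Z \<in> Obj V" "f \<in> Arr V" "Dom V f = Z \<otimes> X" and f: "Cod V f = vhom JO Y \<one>"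
  then have [simp]: "Y \<in> J" "Cod V f = Ihom V \<one> Y" by simp_all
  let ?h = "Ev V \<one> Y \<cdot> (f \<boxtimes> Id V \<one>) \<cdot> inv_arr V (Run V (Z \<otimes> X))"
  have h: "Z \<in> Obj V" "X \<in> Obj V" "Y \<in> Obj V" "?h \<in> Arr V" "Dom V ?h = Z \<otimes> X" "Cod V ?h = Y" by auto
  note [simp] = curry(1-3)[OF h]
  let ?g = "curry_arr V Z X Y ?h"
  show "\<exists>g. g \<in> Arr V \<and> Dom V g = Z \<and> Cod V g = vhom JO Y X \<and>
        (\<forall>z k. elt z \<and> ty z = Z \<and> elt k \<and> ty k = X \<and> dj z k \<and> dj k z \<longrightarrow>
          cmp JO Y X \<one> (app (nm X) k) (app g z) = app f (pr z k))"
  proof (intro exI[of _ ?g] conjI allI impI)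
    fix z k assume a: "elt z \<and> ty z = Z \<and> elt k \<and> ty k = X \<and> dj z k \<and> dj k z"
    then have [simp]: "elt z" "ty z = Z" "elt k" "ty k = X" "dj z k" "dj k z" by auto
    show "cmp JO Y X \<one> (app (nm X) k) (app ?g z) = app f (pr z k)"
      by (rule Ihom_eq[of _ \<one> Y _ star]) (auto simp: app_curry[OF h])
  qed auto
next
  fix Y a b assume "Y \<in> vob JO" and a: "elt a" "ty a = vhom JO Y X" "elt b" "ty b = vhom JO Y X"
    and e: "\<And>k. \<lbrakk>elt k; ty k = X; dj a k; dj k a; dj b k; dj k b\<rbrakk> \<Longrightarrow>
      cmp JO Y X \<one> (app (nm X) k) a = cmp JO Y X \<one> (app (nm X) k) b"
  then have [simp]: "Y \<in> J" "elt a" "elt b" "ty a = Ihom V X Y" "ty b = Ihom V X Y" by simp_all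
  obtain x where [simp]: "generic x" "elt x" "ty x = X" "dj x a" "dj a x" "dj x b" "dj b x"
    using fresh[of a b X] by auto
  have ev: "app (Ev V X Y) (pr d x) = app (Ev V \<one> Y) (pr (cmp JO Y X \<one> (app (nm X) x) d) star)"
    if "d = a \<or> d = b" for d
    using that by auto
  have E: "cmp JO Y X \<one> (app (nm X) x) a = cmp JO Y X \<one> (app (nm X) x) b"
    by (rule e) simp_all
  have "app (Ev V X Y) (pr a x) = app (Ev V X Y) (pr b x)"
    by (metis E ev)
  then show "a = b"
    by (rule Ihom_eq[of a X Y b x, rotated -1]) simp_all
qed auto

text \<open>The identification of \<open>[K \<otimes> X, \<one>]\<close> with
  \<open>[K, [X, \<one>]]\<close> at the level of counits.\<close>

lemma nm_dl:
  assumes [simp]: "K \<in> J" "X \<in> J" "elt k" "ty k = K" "elt x" "ty x = X" "dj x k" "dj k x"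
  shows "cmp JO (K \<otimes> X) X \<one> (app (nm X) x) (app (dl K X) k) = app (nm (K \<otimes> X)) (pr k x)"
  by (rule Ihom_eq[of _ \<one> "K \<otimes> X" _ star]) auto

text \<open>By \<open>nm_dl\<close> the image of \<open>K \<otimes> X\<close> is an iterated
  cotensor \<open>[K, [X, F(\<one>)]]\<close>, and cancelling the inner counit leaves
  \<open>[K, F(X)]\<close>. Every other cotensor of \<open>X\<close> by \<open>K\<close> is reached
  by \<open>preserves_one\<close>.\<close>

lemma preserves_cotensors_JO:
  assumes F: "vfunctor V JO C F" and [simp]: "vcategory V C"
    and c: "\<And>X. X \<in> J \<Longrightarrow> is_cotensor V C X (fob F \<one>) (fob F X) (fhom F X \<one> \<cdot> nm X)"
  shows "preserves_cotensors V J JO C F"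
  unfolding preserves_cotensors_def
proof (intro ballI allI impI)
  fix K X P \<delta> assume [simp]: "K \<in> J" and "X \<in> vob JO" and \<delta>: "is_cotensor V JO K X P \<delta>"
  then have [simp]: "X \<in> J" by simp
  note [simp] = vfunD[OF F vcategory_vop[OF vcategory_vfull] \<open>vcategory V C\<close>, simplified]
  let ?I = "fob F \<one>" and ?X = "fob F X" and ?P = "fob F (K \<otimes> X)"
  have "cmp C ?P ?X ?I (app (fhom F X \<one> \<cdot> nm X) x) (app (fhom F (K \<otimes> X) X \<cdot> dl K X) k)
      = app (fhom F (K \<otimes> X) \<one> \<cdot> nm (K \<otimes> X)) (pr k x)"
    if [simp]: "elt k" "ty k = K" "elt x" "ty x = X" "dj x k" "dj k x" for k x
    using arg_cong[OF nm_dl[of K X k x], of "app (fhom F (K \<otimes> X) \<one>)"] by (simp del: cmp_vop)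
  then have e: "cmp C c ?X ?I (app (fhom F X \<one> \<cdot> nm X) x) (cmp C c ?P ?X (app (fhom F (K \<otimes> X) X \<cdot> dl K X) k) a)
      = cmp C c ?P ?I (app (fhom F (K \<otimes> X) \<one> \<cdot> nm (K \<otimes> X)) (pr k x)) a"
    if [simp]: "c \<in> vob C" "elt k" "ty k = K" "elt x" "ty x = X" "dj x k" "dj k x" "elt a" "ty a = vhom C c ?P" "dj k a" "dj x a"
    for k x a c
    using that by (subst cmp_assoc[symmetric]) auto
  have cot: "is_cotensor V C K ?X ?P (fhom F (K \<otimes> X) X \<cdot> dl K X)"
  proof (rule cotI)
    fix c Z f assume [simp]: "c \<in> vob C" "Z \<in> Obj V" "f \<in> Arr V" "Dom V f = Z \<otimes> K" "Cod V f = vhom C c ?X"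
    \<comment> \<open>Sends \<open>(z, (k, x))\<close> to the counit of \<open>F(X)\<close> at
      \<open>x\<close> after \<open>f(z, k)\<close>.\<close>
    let ?h = "vcomp C c ?X ?I \<cdot> ((fhom F X \<one> \<cdot> nm X) \<boxtimes> f) \<cdot> Sym V (Z \<otimes> K) X \<cdot> inv_arr V (Assoc V Z K X)"
    obtain g where [simp]: "g \<in> Arr V" "Dom V g = Z" "Cod V g = vhom C c ?P"
      and g: "\<And>z k. \<lbrakk>elt z; ty z = Z; elt k; ty k = K \<otimes> X; dj z k\<rbrakk> \<Longrightarrow>
        cmp C c ?P ?I (app (fhom F (K \<otimes> X) \<one> \<cdot> nm (K \<otimes> X)) k) (app g z) = app ?h (pr z k)"
      by (rule cot_ex[OF c[of "K \<otimes> X"], of c Z ?h]) auto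
    show "\<exists>g. g \<in> Arr V \<and> Dom V g = Z \<and> Cod V g = vhom C c ?P \<and>
      (\<forall>z k. elt z \<and> ty z = Z \<and> elt k \<and> ty k = K \<and> dj z k \<and> dj k z \<longrightarrow>
        cmp C c ?P ?X (app (fhom F (K \<otimes> X) X \<cdot> dl K X) k) (app g z) = app f (pr z k))"
    proof (intro exI[of _ g] conjI allI impI)
      fix z k assume "elt z \<and> ty z = Z \<and> elt k \<and> ty k = K \<and> dj z k \<and> dj k z"
      then have [simp]: "elt z" "ty z = Z" "elt k" "ty k = K" "dj z k" "dj k z" by auto
      obtain x where x [simp]: "generic x" "elt x" "ty x = X" "dj x z" "dj z x" "dj x k" "dj k x"
        using fresh[of z k X] by auto
      show "cmp C c ?P ?X (app (fhom F (K \<otimes> X) X \<cdot> dl K X) k) (app g z) = app f (pr z k)"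
      proof (rule cot_eq[OF c[of X], where k = x])
        have "cmp C c ?X ?I (app (fhom F X \<one> \<cdot> nm X) x) (cmp C c ?P ?X (app (fhom F (K \<otimes> X) X \<cdot> dl K X) k) (app g z))
           = app ?h (pr z (pr k x))"
          by (subst e; (subst g)?) auto
        also have "\<dots> = cmp C c ?X ?I (app (fhom F X \<one> \<cdot> nm X) x) (app f (pr z k))" by simp
        finally show "cmp C c ?X ?I (app (fhom F X \<one> \<cdot> nm X) x) (cmp C c ?P ?X (app (fhom F (K \<otimes> X) X \<cdot> dl K X) k) (app g z))
           = cmp C c ?X ?I (app (fhom F X \<one> \<cdot> nm X) x) (app f (pr z k))" .
      qed auto
    qed auto
  next
    fix c a b assume [simp]: "c \<in> vob C" and a [simp]: "elt a" "ty a = vhom C c ?P" "elt b" "ty b = vhom C c ?P"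
      and ab: "\<And>k. \<lbrakk>elt k; ty k = K; dj a k; dj k a; dj b k; dj k b\<rbrakk> \<Longrightarrow>
        cmp C c ?P ?X (app (fhom F (K \<otimes> X) X \<cdot> dl K X) k) a = cmp C c ?P ?X (app (fhom F (K \<otimes> X) X \<cdot> dl K X) k) b"
    obtain k x where kx [simp]: "generic k" "elt k" "ty k = K" "dj k a" "dj a k" "dj k b" "dj b k"
      "generic x" "elt x" "ty x = X" "dj x a" "dj a x" "dj x b" "dj b x" "dj k x" "dj x k"
      using fresh2[of a b K X] by auto
    show "a = b"
    proof (rule cot_eq[OF c[of "K \<otimes> X"], where k = "pr k x"])
      show "cmp C c ?P ?I (app (fhom F (K \<otimes> X) \<one> \<cdot> nm (K \<otimes> X)) (pr k x)) a
         = cmp C c ?P ?I (app (fhom F (K \<otimes> X) \<one> \<cdot> nm (K \<otimes> X)) (pr k x)) b"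
        by (subst (1 2) e[symmetric]) (simp_all only: kx a ab \<open>c \<in> vob C\<close>)
    qed auto
  qed auto
  show "is_cotensor V C K ?X (fob F P) (fhom F P X \<cdot> \<delta>)"
    by (rule preserves_one[OF F _ _ _ cot_JO \<delta>]) (use cot in auto)
qed

lemma preserves_cotensorsD:
  assumes "preserves_cotensors V J B C F" "K \<in> J" "b \<in> vob B" "is_cotensor V B K b P \<gamma>"
  shows "is_cotensor V C K (fob F b) (fob F P) (fhom F P b \<cdot> \<gamma>)"
  using assms unfolding preserves_cotensors_def by blast

text \<open>The structure morphism \<open>X \<rightarrow> T(X, \<one>)\<close> of a theory,
  recovered from its structure functor along the naming isomorphism
  \<open>X \<rightarrow> [\<one>, X]\<close>.\<close>

definition gam :: "('v, 'm) jtheory \<Rightarrow> 'v \<Rightarrow> 'm" where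
  "gam T X = fhom (tstr T) X \<one> \<cdot> nm X"

lemma jtheoryD:
  assumes T: "is_jtheory V J T"
  shows "vcategory V (tcat T)" "vob (tcat T) = J" "vfunctor V JO (tcat T) (tstr T)"
    "\<And>X. X \<in> J \<Longrightarrow> fob (tstr T) X = X" "vcat_extensional (tcat T)"
    "preserves_cotensors V J JO (tcat T) (tstr T)"
  using T by (auto simp: is_jtheory_def)

lemma tstr_simps:
  assumes T: "is_jtheory V J T"
  shows "\<And>X Y. X \<in> J \<Longrightarrow> Y \<in> J \<Longrightarrow> fhom (tstr T) X Y \<in> Arr V"
    "\<And>X Y. X \<in> J \<Longrightarrow> Y \<in> J \<Longrightarrow> Dom V (fhom (tstr T) X Y) = Ihom V Y X"
    "\<And>X Y. X \<in> J \<Longrightarrow> Y \<in> J \<Longrightarrow> Cod V (fhom (tstr T) X Y) = vhom (tcat T) X Y"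
    "\<And>X. X \<in> J \<Longrightarrow> fhom (tstr T) X X \<cdot> vid (vfull V J) X = vid (tcat T) X"
    "\<And>X Y Z a b. \<lbrakk>X \<in> J; Y \<in> J; Z \<in> J; elt a; elt b; ty a = Ihom V Y X; ty b = Ihom V Z Y; dj b a\<rbrakk> \<Longrightarrow>
      app (fhom (tstr T) X Z) (cmp JO X Y Z b a) = cmp (tcat T) X Y Z (app (fhom (tstr T) Y Z) b) (app (fhom (tstr T) X Y) a)"
  using vfunD[OF jtheoryD(3)[OF T] vcategory_vop[OF vcategory_vfull] jtheoryD(1)[OF T]]
  by (simp_all add: jtheoryD(4)[OF T])

lemma gam_cot:
  assumes T: "is_jtheory V J T" and X: "X \<in> J"
  shows "is_cotensor V (tcat T) X \<one> X (gam T X)"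
  using preserves_cotensorsD[OF jtheoryD(6)[OF T] X _ cot_nm[OF X]] X by (simp add: jtheoryD(4)[OF T] gam_def)

lemma gam_simps [simp]:
  assumes T: "is_jtheory V J T" and X: "X \<in> J"
  shows "gam T X \<in> Arr V" "Dom V (gam T X) = X" "Cod V (gam T X) = vhom (tcat T) X \<one>"
  using cotD[OF gam_cot[OF assms]] by auto

lemma gam_unit: "is_jtheory V J T \<Longrightarrow> gam T \<one> = vid (tcat T) \<one>"
  using tstr_simps(4)[of T \<one>] by (simp add: gam_def nm_unit)

text \<open>The counits in turn determine the structure functor: \<open>gam T Y\<close> can be
  cancelled, so this equation characterises the arrow out of \<open>[Y, X]\<close>.\<close>

lemma gam_tstr:
  assumes T: "is_jtheory V J T" and [simp]: "X \<in> J" "Y \<in> J" "elt y" "ty y = Y" "elt f" "ty f = Ihom V Y X" "dj y f" "dj f y"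
  shows "cmp (tcat T) X Y \<one> (app (gam T Y) y) (app (fhom (tstr T) X Y) f) = app (gam T X) (app (Ev V Y X) (pr f y))"
proof -
  note [simp] = tstr_simps[OF T] jtheoryD(1,2)[OF T]
  have "cmp JO X Y \<one> (app (nm Y) y) f = app (nm X) (app (Ev V Y X) (pr f y))"
    by (rule Ihom_eq[of _ \<one> X _ star]) auto
  from arg_cong[OF this, of "app (fhom (tstr T) X \<one>)"] show ?thesis by (simp add: gam_def del: cmp_vop)
qed

text \<open>In a theory \<open>K \<otimes> X\<close> with the image of \<open>dl K X\<close> is a
  cotensor \<open>[K, X]\<close>. By \<open>preserves_one\<close> it is enough to study
  \<open>A\<close> along the structure functor, and there \<open>preserves_cotensors_JO\<close> asks
  for the counits only.\<close>

lemma preserves_cotensors_theory: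
  assumes T: "is_jtheory V J T" and A: "vfunctor V (tcat T) C A" and [simp]: "vcategory V C"
    and c: "\<And>X. X \<in> J \<Longrightarrow> is_cotensor V C X (fob A \<one>) (fob A X) (fhom A X \<one> \<cdot> gam T X)"
  shows "preserves_cotensors V J (tcat T) C A"
proof -
  note [simp] = jtheoryD(1,2,4)[OF T] tstr_simps[OF T]
  note [simp] = vfunD[OF A jtheoryD(1)[OF T] \<open>vcategory V C\<close>, simplified]
  have F: "vfunctor V JO C (comp_vfun V JO A (tstr T))"
    by (rule vfunctor_comp[OF jtheoryD(3)[OF T] A]) auto
  have p: "preserves_cotensors V J JO C (comp_vfun V JO A (tstr T))"
  proof (rule preserves_cotensors_JO[OF F])
    fix X assume [simp]: "X \<in> J"
    show "is_cotensor V C X (fob (comp_vfun V JO A (tstr T)) \<one>) (fob (comp_vfun V JO A (tstr T)) X)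
        (fhom (comp_vfun V JO A (tstr T)) X \<one> \<cdot> nm X)"
      using c[of X] by (simp add: gam_def)
  qed auto
  show ?thesis
    unfolding preserves_cotensors_def
  proof (intro ballI allI impI)
    fix K X P \<delta> assume [simp]: "K \<in> J" and "X \<in> vob (tcat T)" and \<delta>: "is_cotensor V (tcat T) K X P \<delta>"
    then have [simp]: "X \<in> J" by simp
    have 1: "is_cotensor V (tcat T) K X (K \<otimes> X) (fhom (tstr T) (K \<otimes> X) X \<cdot> dl K X)"
      using preserves_cotensorsD[OF jtheoryD(6)[OF T] _ _ cot_JO, of K X] by simp
    have 2: "is_cotensor V C K (fob A X) (fob A (K \<otimes> X)) (fhom A (K \<otimes> X) X \<cdot> fhom (tstr T) (K \<otimes> X) X \<cdot> dl K X)"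
      using preserves_cotensorsD[OF p _ _ cot_JO, of K X] by simp
    show "is_cotensor V C K (fob A X) (fob A P) (fhom A P X \<cdot> \<delta>)"
      by (rule preserves_one[OF A _ _ _ 1 \<delta> 2]) auto
  qed
qed

text \<open>Each arrow of \<open>S\<close> is the unique solution of the equation in
  \<open>gam_tstr\<close>. Functoriality follows by cancelling counits, and preservation of
  cotensors from \<open>preserves_cotensors_JO\<close>.\<close>

lemma jtheoryI:
  assumes T [simp]: "vcategory V T" and e: "vcat_extensional T" and o [simp]: "vob T = J"
    and c: "\<And>X. X \<in> J \<Longrightarrow> is_cotensor V T X \<one> X (\<gamma> X)" and \<gamma>1: "\<gamma> \<one> = vid T \<one>"
    and S: "S = \<lparr>fob = (\<lambda>X \<in> J. X), fhom = res2 J (\<lambda>X Y. THE t. t \<in> Hom V (Ihom V Y X) (vhom T X Y) \<and>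
         vcomp T X Y \<one> \<cdot> (\<gamma> Y \<boxtimes> t) \<cdot> Sym V (Ihom V Y X) Y = \<gamma> X \<cdot> Ev V Y X)\<rparr>"
  shows "is_jtheory V J \<lparr>tcat = T, tstr = S\<rparr>" "\<And>X. X \<in> J \<Longrightarrow> gam \<lparr>tcat = T, tstr = S\<rparr> X = \<gamma> X"
proof -
  have \<gamma> [simp]: "\<gamma> X \<in> Arr V" "Dom V (\<gamma> X) = X" "Cod V (\<gamma> X) = vhom T X \<one>" if "X \<in> J" for X
    using cotD[OF c[OF that]] by auto
  let ?P = "\<lambda>X Y t. t \<in> Hom V (Ihom V Y X) (vhom T X Y) \<and> vcomp T X Y \<one> \<cdot> (\<gamma> Y \<boxtimes> t) \<cdot> Sym V (Ihom V Y X) Y = \<gamma> X \<cdot> Ev V Y X"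
  have ex: "\<exists>!t. ?P X Y t" if [simp]: "X \<in> J" "Y \<in> J" for X Y
  proof -
    obtain g where g [simp]: "g \<in> Arr V" "Dom V g = Ihom V Y X" "Cod V g = vhom T X Y"
      and gf: "\<And>z k. \<lbrakk>elt z; ty z = Ihom V Y X; elt k; ty k = Y; dj z k\<rbrakk> \<Longrightarrow>
        cmp T X Y \<one> (app (\<gamma> Y) k) (app g z) = app (\<gamma> X \<cdot> Ev V Y X) (pr z k)"
      by (rule cot_ex[OF c[of Y], of X "Ihom V Y X" "\<gamma> X \<cdot> Ev V Y X"]) auto
    show ?thesis
    proof (rule ex1I[of _ g])
      have "vcomp T X Y \<one> \<cdot> (\<gamma> Y \<boxtimes> g) \<cdot> Sym V (Ihom V Y X) Y = \<gamma> X \<cdot> Ev V Y X"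
        by (rule arr_eqI2[of _ _ "Ihom V Y X" Y]) (auto simp: gf)
      then show "?P X Y g" by (simp add: in_Hom)
    next
      fix t assume t: "?P X Y t"
      then have [simp]: "t \<in> Arr V" "Dom V t = Ihom V Y X" "Cod V t = vhom T X Y" by (auto simp: in_Hom)
      have te: "vcomp T X Y \<one> \<cdot> (\<gamma> Y \<boxtimes> t) \<cdot> Sym V (Ihom V Y X) Y = \<gamma> X \<cdot> Ev V Y X" using t by simp
      show "t = g"
      proof (rule arr_eqI[of _ _ "Ihom V Y X"])
        fix f assume [simp]: "elt f" "ty f = Ihom V Y X"
        obtain k where [simp]: "generic k" "elt k" "ty k = Y" "dj k f" "dj f k" using fresh[of f f Y] by auto
        show "app t f = app g f"
          by (rule cot_eq[OF c[of Y], where k = k])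
            (use arg_cong[OF te, of "\<lambda>h. app h (pr f k)"] gf[of f k] in auto)
      qed auto
    qed
  qed
  have [simp]: "fob S X = X" if "X \<in> J" for X using that by (simp add: S)
  have P: "?P X Y (fhom S X Y)" if [simp]: "X \<in> J" "Y \<in> J" for X Y
    using theI'[OF ex[OF that]] by (simp add: S)
  have [simp]: "fhom S X Y \<in> Arr V" "Dom V (fhom S X Y) = Ihom V Y X" "Cod V (fhom S X Y) = vhom T X Y"
    if "X \<in> J" "Y \<in> J" for X Y using P[OF that] by (auto simp: in_Hom)
  have r: "cmp T X Y \<one> (app (\<gamma> Y) y) (app (fhom S X Y) f) = app (\<gamma> X) (app (Ev V Y X) (pr f y))"
    if [simp]: "X \<in> J" "Y \<in> J" "elt f" "ty f = Ihom V Y X" "elt y" "ty y = Y" "dj f y" "dj y f" for X Y f y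
    using arg_cong[OF conjunct2[OF P[OF that(1,2)]], of "\<lambda>h. app h (pr f y)"] by simp
  have SF: "vfunctor V JO T S"
  proof (rule vfunctorI)
    show "vfun_ext (vob JO) S" by (simp add: vfun_ext_def S)
  next
    fix X assume "X \<in> vob JO"
    then have [simp]: "X \<in> J" by simp
    obtain k where [simp]: "generic k" "elt k" "ty k = X" using fresh[of star star X] by auto
    have "app (fhom S X X) (gl (vid JO X)) = gl (vid T X)"
      by (rule cot_eq[OF c[of X], where k = k]) (use r[of X X "gl (vid (vfull V J) X)" k] in auto)
    then show "app (fhom S X X) (gl (vid JO X)) = gl (vid T (fob S X))" by simp
  next
    fix X Y Z a b assume o: "X \<in> vob JO" "Y \<in> vob JO" "Z \<in> vob JO" and ab: "elt a" "elt b" "ty a = vhom JO X Y" "ty b = vhom JO Y Z" "dj b a" "dj a b"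
    have [simp]: "X \<in> J" "Y \<in> J" "Z \<in> J" "elt a" "elt b" "ty a = Ihom V Y X" "ty b = Ihom V Z Y" "dj b a" "dj a b"
      using o ab by simp_all
    obtain k where k [simp]: "generic k" "elt k" "ty k = Z" "dj k a" "dj a k" "dj k b" "dj b k" using fresh[of a b Z] by auto
    let ?w = "app (Ev V Z Y) (pr b k)"
    have "cmp T X Z \<one> (app (\<gamma> Z) k) (cmp T X Y Z (app (fhom S Y Z) b) (app (fhom S X Y) a))
       = cmp T X Y \<one> (cmp T Y Z \<one> (app (\<gamma> Z) k) (app (fhom S Y Z) b)) (app (fhom S X Y) a)" by simp
    also have "\<dots> = cmp T X Y \<one> (app (\<gamma> Y) ?w) (app (fhom S X Y) a)" by (simp only: r \<open>Y \<in> J\<close> \<open>Z \<in> J\<close> k \<open>elt b\<close> \<open>ty b = Ihom V Z Y\<close>)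
    also have "\<dots> = app (\<gamma> X) (app (Ev V Y X) (pr a ?w))" by (rule r) auto
    also have "\<dots> = cmp T X Z \<one> (app (\<gamma> Z) k) (app (fhom S X Z) (cmp JO X Y Z b a))"
      by (subst r) auto
    finally have eq: "cmp T X Z \<one> (app (\<gamma> Z) k) (cmp T X Y Z (app (fhom S Y Z) b) (app (fhom S X Y) a)) = \<dots>" .
    have "app (fhom S X Z) (cmp JO X Y Z b a) = cmp T X Y Z (app (fhom S Y Z) b) (app (fhom S X Y) a)"
      by (rule cot_eq[OF c[of Z], where k = k]) (use eq in auto)
    then show "app (fhom S X Z) (cmp JO X Y Z b a)
       = cmp T (fob S X) (fob S Y) (fob S Z) (app (fhom S Y Z) b) (app (fhom S X Y) a)" by simp
  qed (auto simp: in_Hom)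
  have g: "fhom S X \<one> \<cdot> nm X = \<gamma> X" if [simp]: "X \<in> J" for X
  proof (rule arr_eqI[of _ _ X])
    fix x assume [simp]: "elt x" "ty x = X"
    \<comment> \<open>The counit at \<open>\<one>\<close> is an identity by
      \<open>\<gamma>1\<close>, so the defining equation of \<open>S\<close> at \<open>star\<close>
      returns \<open>\<gamma> X\<close> itself.\<close>
    have "cmp T X \<one> \<one> (app (\<gamma> \<one>) star) (app (fhom S X \<one>) (app (nm X) x)) = app (\<gamma> X) (app (Ev V \<one> X) (pr (app (nm X) x) star))"
      by (rule r) auto
    then show "app (fhom S X \<one> \<cdot> nm X) x = app (\<gamma> X) x" by (simp add: \<gamma>1)
  qed auto
  show "is_jtheory V J \<lparr>tcat = T, tstr = S\<rparr>"
    unfolding is_jtheory_def jtheory.simps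
  proof (intro conjI T e o SF)
    show "fob S = (\<lambda>X \<in> J. X)" by (simp add: S)
    show "preserves_cotensors V J JO T S"
      by (rule preserves_cotensors_JO[OF SF]) (auto simp: g c)
  qed
  show "\<And>X. X \<in> J \<Longrightarrow> gam \<lparr>tcat = T, tstr = S\<rparr> X = \<gamma> X" by (simp add: gam_def g)
qed

end

section \<open>Enriched categories of algebras and commutants\<close>

locale admissible = arity_system V J
  for V :: "('v, 'm) smc" (structure) and J +
  fixes C :: "('v, 'm, 'c) vcat" and ct :: "'v \<Rightarrow> 'c \<Rightarrow> 'c \<times> 'm"
  assumes adm: "J_admissible V J C ct"
begin

abbreviation Th :: "('v, 'm) jtheory \<Rightarrow> bool" where "Th \<equiv> is_jtheory V J"
abbreviation alg :: "('v, 'm) jtheory \<Rightarrow> ('m, 'v, 'c) vfun \<Rightarrow> bool" where "alg \<equiv> is_algebra V J C"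
abbreviation AV :: "('v, 'm) jtheory \<Rightarrow> ('v, 'm, ('m, 'v, 'c) vfun) vcat" where "AV \<equiv> AlgV V J C"
abbreviation eo :: "('v, 'm) jtheory \<Rightarrow> ('m, 'v, 'c) vfun \<Rightarrow> ('m, 'v, 'c) vfun \<Rightarrow> 'v" where
  "eo T \<equiv> end_ob V (tcat T) C"
abbreviation pj :: "('v, 'm) jtheory \<Rightarrow> ('m, 'v, 'c) vfun \<Rightarrow> ('m, 'v, 'c) vfun \<Rightarrow> 'v \<Rightarrow> 'm" where
  "pj T \<equiv> end_proj V (tcat T) C"

lemma C_cat [simp]: "vcategory V C"
  using adm by (simp add: J_admissible_def)

lemma ct_cot: "c \<in> vob C \<Longrightarrow> K \<in> J \<Longrightarrow> is_cotensor V C K c (fst (ct K c)) (snd (ct K c))"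
  and ct_unit [simp]: "c \<in> vob C \<Longrightarrow> ct \<one> c = (c, vid C c)"
  using adm by (auto simp: J_admissible_def designated_cotensors_def)

lemma Th_simps [simp]:
  assumes "Th T"
  shows "vcategory V (tcat T)" "vob (tcat T) = J" "X \<in> J \<Longrightarrow> fob (tstr T) X = X"
  using jtheoryD[OF assms] by auto

lemma alg_fun:
  assumes "alg T A"
  shows "vfunctor V (tcat T) C A" "preserves_cotensors V J (tcat T) C A"
  using assms by (auto simp: is_algebra_def)

lemma algD:
  assumes "alg T A" "Th T"
  shows "x \<in> J \<Longrightarrow> fob A x \<in> vob C"
    "x \<in> J \<Longrightarrow> y \<in> J \<Longrightarrow> fhom A x y \<in> Arr V"
    "x \<in> J \<Longrightarrow> y \<in> J \<Longrightarrow> Dom V (fhom A x y) = vhom (tcat T) x y"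
    "x \<in> J \<Longrightarrow> y \<in> J \<Longrightarrow> Cod V (fhom A x y) = vhom C (fob A x) (fob A y)"
    "x \<in> J \<Longrightarrow> fhom A x x \<cdot> vid (tcat T) x = vid C (fob A x)"
    "\<lbrakk>x \<in> J; y \<in> J; z \<in> J; elt a; elt b; ty a = vhom (tcat T) x y; ty b = vhom (tcat T) y z; dj b a\<rbrakk> \<Longrightarrow>
      app (fhom A x z) (cmp (tcat T) x y z b a) = cmp C (fob A x) (fob A y) (fob A z) (app (fhom A y z) b) (app (fhom A x y) a)"
  using vfunD[OF alg_fun(1)[OF assms(1)] _ C_cat] assms(2) by (simp_all)

lemma alg_gam:
  assumes "alg T A" "Th T" "X \<in> J"
  shows "is_cotensor V C X (fob A \<one>) (fob A X) (fhom A X \<one> \<cdot> gam T X)"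
  using preserves_cotensorsD[OF alg_fun(2)[OF assms(1)] assms(3) _ gam_cot[OF assms(2,3)]] assms by simp

lemma algI:
  assumes "Th T" "vfunctor V (tcat T) C A"
    "\<And>X. X \<in> J \<Longrightarrow> is_cotensor V C X (fob A \<one>) (fob A X) (fhom A X \<one> \<cdot> gam T X)"
  shows "alg T A"
  using preserves_cotensors_theory[OF assms(1,2) C_cat assms(3)] assms(2) by (simp add: is_algebra_def)

lemma hom_end:
  assumes "Th T" "alg T A" "alg T B"
  shows "is_hom_end V (tcat T) C A B (eo T A B) (pj T A B)"
proof -
  have "\<exists>E \<pi>. is_hom_end V (tcat T) C A B E \<pi>"
    using adm assms unfolding J_admissible_def by blast
  then have "\<exists>p. case p of (E, \<pi>) \<Rightarrow> is_hom_end V (tcat T) C A B E \<pi>" by auto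
  then have "case hom_end V (tcat T) C A B of (E, \<pi>) \<Rightarrow> is_hom_end V (tcat T) C A B E \<pi>"
    unfolding hom_end_def by (rule someI_ex)
  then show ?thesis by (simp add: end_ob_def end_proj_def split: prod.splits)
qed

lemma end_simps [simp]:
  assumes "Th T" "alg T A" "alg T B"
  shows "eo T A B \<in> Obj V" "x \<in> J \<Longrightarrow> pj T A B x \<in> Arr V" "x \<in> J \<Longrightarrow> Dom V (pj T A B x) = eo T A B"
    "x \<in> J \<Longrightarrow> Cod V (pj T A B x) = vhom C (fob A x) (fob B x)"
  using wedgeD(1-4)[OF conjunct1[OF hom_end[OF assms, unfolded is_hom_end_def]] alg_fun(1)[OF assms(2)] alg_fun(1)[OF assms(3)]]
    assms by auto

lemma end_nat:
  assumes "Th T" "alg T A" "alg T B" "x \<in> J" "y \<in> J" "elt t" "ty t = vhom (tcat T) x y" "elt \<phi>" "ty \<phi> = eo T A B" "dj t \<phi>" "dj \<phi> t"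
  shows "cmp C (fob A x) (fob B x) (fob B y) (app (fhom B x y) t) (app (pj T A B x) \<phi>)
    = cmp C (fob A x) (fob A y) (fob B y) (app (pj T A B y) \<phi>) (app (fhom A x y) t)"
  using wedgeD(5)[OF conjunct1[OF hom_end[OF assms(1-3), unfolded is_hom_end_def]] alg_fun(1)[OF assms(2)] alg_fun(1)[OF assms(3)]]
    assms by auto

lemma end_ex:
  assumes "Th T" "alg T A" "alg T B" and Z: "Z \<in> Obj V"
    and h: "\<And>x. x \<in> J \<Longrightarrow> \<kappa> x \<in> Hom V Z (vhom C (fob A x) (fob B x))"
    and n: "\<And>x y t z. \<lbrakk>x \<in> J; y \<in> J; elt t; ty t = vhom (tcat T) x y; elt z; ty z = Z; dj t z; dj z t\<rbrakk> \<Longrightarrow>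
      cmp C (fob A x) (fob B x) (fob B y) (app (fhom B x y) t) (app (\<kappa> x) z)
        = cmp C (fob A x) (fob A y) (fob B y) (app (\<kappa> y) z) (app (fhom A x y) t)"
  shows "\<exists>!g. g \<in> Hom V Z (eo T A B) \<and> (\<forall>x \<in> J. pj T A B x \<cdot> g = \<kappa> x)"
proof -
  have "is_wedge V (tcat T) C A B Z \<kappa>"
    by (rule wedgeI) (use assms alg_fun in auto)
  then show ?thesis using hom_end[OF assms(1-3)] assms(1) unfolding is_hom_end_def by simp
qed

lemma end_arr_eq:
  assumes [simp]: "Th T" "alg T A" "alg T B" and h: "h \<in> Arr V" "Cod V h = eo T A B" "g \<in> Arr V" "Cod V g = eo T A B" "Dom V h = Dom V g"
    and e: "\<And>x. x \<in> J \<Longrightarrow> pj T A B x \<cdot> h = pj T A B x \<cdot> g"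
  shows "h = g"
proof -
  have "\<exists>!k. k \<in> Hom V (Dom V g) (eo T A B) \<and> (\<forall>x \<in> J. pj T A B x \<cdot> k = pj T A B x \<cdot> g)"
    by (rule end_ex) (use h end_nat[of T A B] in \<open>auto simp: in_Hom\<close>)
  then show ?thesis using h e unfolding in_Hom by blast
qed

lemma end_eq:
  assumes T: "Th T" "alg T A" "alg T B" and a: "elt \<phi>" "ty \<phi> = eo T A B" "elt \<psi>" "ty \<psi> = eo T A B"
    and e: "\<And>x. x \<in> J \<Longrightarrow> app (pj T A B x) \<phi> = app (pj T A B x) \<psi>"
  shows "\<phi> = \<psi>"
proof -
  \<comment> \<open>\<open>J\<close> contains \<open>\<one>\<close>, so there is a projection from
    which equality of the label sets can be read off.\<close>
  have l: "labels \<phi> = labels \<psi>" using arg_cong[OF e[of \<one>], of labels] by simp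
  have "arrow \<phi> = arrow \<psi>"
  proof (rule end_arr_eq[OF T])
    fix x assume "x \<in> J"
    from arg_cong[OF e[OF this], of arrow] show "pj T A B x \<cdot> arrow \<phi> = pj T A B x \<cdot> arrow \<psi>"
      by (simp add: app_def)
  qed (use a l in auto)
  then show ?thesis using l by (simp add: gelt.expand)
qed

lemma AV_simps [simp]: "vob (AV T) = {A. alg T A}" "vhom (AV T) = eo T"
  by (simp_all add: AlgV_def)

lemma AV_id:
  assumes [simp]: "Th T" "alg T A"
  shows "vid (AV T) A \<in> Hom V \<one> (eo T A A) \<and> (\<forall>x \<in> J. pj T A A x \<cdot> vid (AV T) A = vid C (fob A x))"
proof -
  note [simp] = algD[OF \<open>alg T A\<close> \<open>Th T\<close>]
  have "\<exists>!h. h \<in> Hom V \<one> (eo T A A) \<and> (\<forall>x \<in> J. pj T A A x \<cdot> h = vid C (fob A x))"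
  proof (rule end_ex)
    fix x y t z assume [simp]: "x \<in> J" "y \<in> J" "elt t" "ty t = vhom (tcat T) x y" "elt z" "ty z = \<one>" "dj t z" "dj z t"
    \<comment> \<open>The element \<open>z\<close> of type \<open>\<one>\<close> need not be
      \<open>star\<close>, so the equation is proved for arrows and evaluated afterwards.\<close>
    have "vcomp C (fob A x) (fob A x) (fob A y) \<cdot> (fhom A x y \<boxtimes> vid C (fob A x))
       = vcomp C (fob A x) (fob A y) (fob A y) \<cdot> (vid C (fob A y) \<boxtimes> fhom A x y) \<cdot> Sym V (vhom (tcat T) x y) \<one>"
      by (rule arr_eqI_Run[of _ _ "vhom (tcat T) x y"]) auto
    from arg_cong[OF this, of "\<lambda>f. app f (pr t z)"]
    show "cmp C (fob A x) (fob A x) (fob A y) (app (fhom A x y) t) (app (vid C (fob A x)) z)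
        = cmp C (fob A x) (fob A y) (fob A y) (app (vid C (fob A y)) z) (app (fhom A x y) t)" by simp
  qed (auto simp: in_Hom)
  then have "\<exists>!h. h \<in> Hom V \<one> (eo T A A) \<and> (\<forall>x \<in> vob (tcat T). pj T A A x \<cdot> h = vid C (fob A x))" by simp
  from theI'[OF this] show ?thesis by (simp add: AlgV_def)
qed

lemma AV_id_simps [simp]:
  assumes "Th T" "alg T A"
  shows "vid (AV T) A \<in> Arr V" "Dom V (vid (AV T) A) = \<one>" "Cod V (vid (AV T) A) = eo T A A"
    "x \<in> J \<Longrightarrow> pj T A A x \<cdot> vid (AV T) A = vid C (fob A x)"
  using AV_id[OF assms] by (auto simp: in_Hom)

lemma AV_comp:
  assumes [simp]: "Th T" "alg T A" "alg T B" "alg T D"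
  shows "vcomp (AV T) A B D \<in> Hom V (eo T B D \<otimes> eo T A B) (eo T A D) \<and>
    (\<forall>x \<in> J. pj T A D x \<cdot> vcomp (AV T) A B D = vcomp C (fob A x) (fob B x) (fob D x) \<cdot> (pj T B D x \<boxtimes> pj T A B x))"
proof -
  note [simp] = algD[OF \<open>alg T A\<close> \<open>Th T\<close>] algD[OF \<open>alg T B\<close> \<open>Th T\<close>] algD[OF \<open>alg T D\<close> \<open>Th T\<close>]
  have "\<exists>!h. h \<in> Hom V (eo T B D \<otimes> eo T A B) (eo T A D) \<and>
    (\<forall>x \<in> J. pj T A D x \<cdot> h = vcomp C (fob A x) (fob B x) (fob D x) \<cdot> (pj T B D x \<boxtimes> pj T A B x))"
  proof (rule end_ex)
    fix x y t z assume [simp]: "x \<in> J" "y \<in> J" "elt t" "ty t = vhom (tcat T) x y" "elt z" "ty z = eo T B D \<otimes> eo T A B" "dj t z" "dj z t"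
    let ?k = "\<lambda>x. vcomp C (fob A x) (fob B x) (fob D x) \<cdot> (pj T B D x \<boxtimes> pj T A B x)"
    \<comment> \<open>\<open>z\<close> need not be a pair. The equation is proved for arrows on
      three variables, the last two standing for the transformations to be composed, and is then
      evaluated at \<open>z\<close>.\<close>
    have "vcomp C (fob A x) (fob D x) (fob D y) \<cdot> (fhom D x y \<boxtimes> ?k x)
       = vcomp C (fob A x) (fob A y) (fob D y) \<cdot> (?k y \<boxtimes> fhom A x y) \<cdot> Sym V (vhom (tcat T) x y) (eo T B D \<otimes> eo T A B)"
    proof (rule arr_eqI3'[of _ _ "vhom (tcat T) x y" "eo T B D" "eo T A B"])
      fix t b a assume [simp]: "elt t" "elt b" "elt a" "ty t = vhom (tcat T) x y" "ty b = eo T B D" "ty a = eo T A B"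
        "dj t b" "dj b t" "dj t a" "dj a t" "dj b a" "dj a b"
      let ?A = "fob A" and ?B = "fob B" and ?D = "fob D"
      have "cmp C (?A x) (?D x) (?D y) (app (fhom D x y) t) (cmp C (?A x) (?B x) (?D x) (app (pj T B D x) b) (app (pj T A B x) a))
        = cmp C (?A x) (?B x) (?D y) (cmp C (?B x) (?D x) (?D y) (app (fhom D x y) t) (app (pj T B D x) b)) (app (pj T A B x) a)"
        by simp
      also have "\<dots> = cmp C (?A x) (?B x) (?D y) (cmp C (?B x) (?B y) (?D y) (app (pj T B D y) b) (app (fhom B x y) t)) (app (pj T A B x) a)"
        by (subst end_nat) auto
      also have "\<dots> = cmp C (?A x) (?B y) (?D y) (app (pj T B D y) b) (cmp C (?A x) (?B x) (?B y) (app (fhom B x y) t) (app (pj T A B x) a))"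
        by simp
      also have "\<dots> = cmp C (?A x) (?B y) (?D y) (app (pj T B D y) b) (cmp C (?A x) (?A y) (?B y) (app (pj T A B y) a) (app (fhom A x y) t))"
        by (subst end_nat) auto
      finally show "app (vcomp C (fob A x) (fob D x) (fob D y) \<cdot> (fhom D x y \<boxtimes> ?k x)) (pr t (pr b a))
       = app (vcomp C (fob A x) (fob A y) (fob D y) \<cdot> (?k y \<boxtimes> fhom A x y) \<cdot> Sym V (vhom (tcat T) x y) (eo T B D \<otimes> eo T A B)) (pr t (pr b a))"
        by simp
    qed auto
    from arg_cong[OF this, of "\<lambda>f. app f (pr t z)"]
    show "cmp C (fob A x) (fob D x) (fob D y) (app (fhom D x y) t) (app (?k x) z)
        = cmp C (fob A x) (fob A y) (fob D y) (app (?k y) z) (app (fhom A x y) t)" by simp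
  qed (auto simp: in_Hom)
  then have "\<exists>!h. h \<in> Hom V (eo T B D \<otimes> eo T A B) (eo T A D) \<and>
    (\<forall>x \<in> vob (tcat T). pj T A D x \<cdot> h = vcomp C (fob A x) (fob B x) (fob D x) \<cdot> (pj T B D x \<boxtimes> pj T A B x))" by simp
  from theI'[OF this] show ?thesis by (simp add: AlgV_def)
qed

lemma AV_comp_simps [simp]:
  assumes "Th T" "alg T A" "alg T B" "alg T D"
  shows "vcomp (AV T) A B D \<in> Arr V" "Dom V (vcomp (AV T) A B D) = eo T B D \<otimes> eo T A B"
    "Cod V (vcomp (AV T) A B D) = eo T A D"
    "\<lbrakk>x \<in> J; elt a; elt b; ty a = eo T A B; ty b = eo T B D; dj b a\<rbrakk> \<Longrightarrow>
      app (pj T A D x) (cmp (AV T) A B D b a) = cmp C (fob A x) (fob B x) (fob D x) (app (pj T B D x) b) (app (pj T A B x) a)"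
proof -
  note [simp] = algD[OF assms(2,1)] algD[OF assms(3,1)] algD[OF assms(4,1)]
  show 1 [simp]: "vcomp (AV T) A B D \<in> Arr V" "Dom V (vcomp (AV T) A B D) = eo T B D \<otimes> eo T A B"
    "Cod V (vcomp (AV T) A B D) = eo T A D"
    using AV_comp[OF assms] by (auto simp: in_Hom)
  assume a: "x \<in> J" "elt a" "elt b" "ty a = eo T A B" "ty b = eo T B D" "dj b a"
  then have "pj T A D x \<cdot> vcomp (AV T) A B D = vcomp C (fob A x) (fob B x) (fob D x) \<cdot> (pj T B D x \<boxtimes> pj T A B x)"
    using AV_comp[OF assms] by blast
  from arg_cong[OF this, of "\<lambda>f. app f (pr b a)"]
  show "app (pj T A D x) (cmp (AV T) A B D b a) = cmp C (fob A x) (fob B x) (fob D x) (app (pj T B D x) b) (app (pj T A B x) a)"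
    using a assms by simp
qed

lemma vcategory_AV [simp]:
  assumes T [simp]: "Th T"
  shows "vcategory V (AV T)"
proof (rule vcategoryI)
  fix w x y z a b c
  assume "w \<in> vob (AV T)" "x \<in> vob (AV T)" "y \<in> vob (AV T)" "z \<in> vob (AV T)" and
    "elt a" "elt b" "elt c" "ty a = vhom (AV T) w x" "ty b = vhom (AV T) x y" "ty c = vhom (AV T) y z"
    "dj c b" "dj b c" "dj c a" "dj a c" "dj b a" "dj a b"
  then have [simp]: "alg T w" "alg T x" "alg T y" "alg T z"
    "elt a" "elt b" "elt c" "ty a = eo T w x" "ty b = eo T x y" "ty c = eo T y z"
    "dj c b" "dj b c" "dj c a" "dj a c" "dj b a" "dj a b" by simp_all
  note [simp] = algD[OF \<open>alg T w\<close> T] algD[OF \<open>alg T x\<close> T] algD[OF \<open>alg T y\<close> T] algD[OF \<open>alg T z\<close> T]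
  show "cmp (AV T) w y z c (cmp (AV T) w x y b a) = cmp (AV T) w x z (cmp (AV T) x y z c b) a"
    by (rule end_eq[of T w z]) auto
next
  fix x y a
  assume "x \<in> vob (AV T)" "y \<in> vob (AV T)" "elt a" "ty a = vhom (AV T) x y"
  then have [simp]: "alg T x" "alg T y" "elt a" "ty a = eo T x y" by simp_all
  note [simp] = algD[OF \<open>alg T x\<close> T] algD[OF \<open>alg T y\<close> T]
  show "cmp (AV T) x y y (gl (vid (AV T) y)) a = a" by (rule end_eq[of T x y]) auto
  show "cmp (AV T) x x y a (gl (vid (AV T) x)) = a" by (rule end_eq[of T x y]) auto
qed (auto simp: in_Hom)

text \<open>Evaluation at \<open>x\<close> as an enriched functor, so that
  \<open>preserves_one\<close> can transfer cotensors of algebras to \<open>C\<close>.\<close>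

definition evf :: "('v, 'm) jtheory \<Rightarrow> 'v \<Rightarrow> ('m, ('m, 'v, 'c) vfun, 'c) vfun" where
  "evf T x = \<lparr>fob = (\<lambda>A \<in> vob (AV T). fob A x), fhom = res2 (vob (AV T)) (\<lambda>A B. pj T A B x)\<rparr>"

lemma vfunctor_evf:
  assumes [simp]: "Th T" "x \<in> J"
  shows "vfunctor V (AV T) C (evf T x)"
proof (rule vfunctorI)
  show "vfun_ext (vob (AV T)) (evf T x)" by (simp add: vfun_ext_def evf_def)
qed (auto simp: evf_def in_Hom algD[OF _ \<open>Th T\<close>])

text \<open>Lifts through the pointwise cotensors exist for each \<open>x\<close>. They are natural
  in \<open>x\<close> because the counit at \<open>y\<close> can be cancelled, so they form a wedge
  and give an arrow into the end.\<close>

lemma cot_AV: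
  assumes [simp]: "Th T" "alg T A" "alg T P" and \<gamma> [simp]: "\<gamma> \<in> Arr V" "Dom V \<gamma> = K" "Cod V \<gamma> = eo T P A"
    and c: "\<And>x. x \<in> J \<Longrightarrow> is_cotensor V C K (fob A x) (fob P x) (pj T P A x \<cdot> \<gamma>)"
  shows "is_cotensor V (AV T) K A P \<gamma>"
proof (rule cotI)
  have K [simp]: "K \<in> Obj V" using obj_Dom[OF \<gamma>(1)] by simp
  fix B Z f assume "B \<in> vob (AV T)" and [simp]: "Z \<in> Obj V" "f \<in> Arr V" "Dom V f = Z \<otimes> K" and "Cod V f = vhom (AV T) B A"
  then have [simp]: "alg T B" "Cod V f = eo T B A" by simp_all
  note [simp] = algD[OF \<open>alg T A\<close> \<open>Th T\<close>] algD[OF \<open>alg T B\<close> \<open>Th T\<close>] algD[OF \<open>alg T P\<close> \<open>Th T\<close>]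
  let ?R = "\<lambda>x g. g \<in> Arr V \<and> Dom V g = Z \<and> Cod V g = vhom C (fob B x) (fob P x) \<and>
    (\<forall>z k. elt z \<and> ty z = Z \<and> elt k \<and> ty k = K \<and> dj z k \<longrightarrow>
      cmp C (fob B x) (fob P x) (fob A x) (app (pj T P A x \<cdot> \<gamma>) k) (app g z) = app (pj T B A x \<cdot> f) (pr z k))"
  have "\<exists>g. ?R x g" if [simp]: "x \<in> J" for x
    by (rule cot_ex[OF c[of x], of "fob B x" Z "pj T B A x \<cdot> f"]) auto
  then obtain \<kappa> where \<kappa>: "\<And>x. x \<in> J \<Longrightarrow> ?R x (\<kappa> x)" by metis
  have [simp]: "\<kappa> x \<in> Arr V" "Dom V (\<kappa> x) = Z" "Cod V (\<kappa> x) = vhom C (fob B x) (fob P x)" if "x \<in> J" for x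
    using \<kappa>[OF that] by auto
  have \<kappa>e: "cmp C (fob B x) (fob P x) (fob A x) (app (pj T P A x) (app \<gamma> k)) (app (\<kappa> x) z) = app (pj T B A x) (app f (pr z k))"
    if [simp]: "x \<in> J" "elt z" "ty z = Z" "elt k" "ty k = K" "dj z k" for x z k
    using \<kappa>[OF that(1)] by simp
  have "\<exists>!g. g \<in> Hom V Z (eo T B P) \<and> (\<forall>x \<in> J. pj T B P x \<cdot> g = \<kappa> x)"
  proof (rule end_ex)
    fix x y t z assume [simp]: "x \<in> J" "y \<in> J" "elt t" "ty t = vhom (tcat T) x y" "elt z" "ty z = Z" "dj t z" "dj z t"
    obtain k where k [simp]: "generic k" "elt k" "ty k = K" "dj k t" "dj t k" "dj k z" "dj z k"
      using fresh[of t z K] by auto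
    let ?A = "fob A" and ?B = "fob B" and ?P = "fob P" and ?g = "app (pj T P A y) (app \<gamma> k)"
    show "cmp C (?B x) (?P x) (?P y) (app (fhom P x y) t) (app (\<kappa> x) z)
        = cmp C (?B x) (?B y) (?P y) (app (\<kappa> y) z) (app (fhom B x y) t)"
    proof (rule cot_eq[OF c[of y], where k = k])
      have "cmp C (?B x) (?P y) (?A y) ?g (cmp C (?B x) (?P x) (?P y) (app (fhom P x y) t) (app (\<kappa> x) z))
        = cmp C (?B x) (?P x) (?A y) (cmp C (?P x) (?P y) (?A y) ?g (app (fhom P x y) t)) (app (\<kappa> x) z)"
        by simp
      also have "\<dots> = cmp C (?B x) (?P x) (?A y) (cmp C (?P x) (?A x) (?A y) (app (fhom A x y) t) (app (pj T P A x) (app \<gamma> k))) (app (\<kappa> x) z)"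
        by (subst end_nat) auto
      also have "\<dots> = cmp C (?B x) (?A x) (?A y) (app (fhom A x y) t) (app (pj T B A x) (app f (pr z k)))"
        by (simp add: \<kappa>e)
      also have "\<dots> = cmp C (?B x) (?B y) (?A y) (app (pj T B A y) (app f (pr z k))) (app (fhom B x y) t)"
        by (subst end_nat) auto
      also have "\<dots> = cmp C (?B x) (?P y) (?A y) ?g (cmp C (?B x) (?B y) (?P y) (app (\<kappa> y) z) (app (fhom B x y) t))"
        by (simp flip: \<kappa>e)
      finally show "cmp C (?B x) (?P y) (?A y) (app (pj T P A y \<cdot> \<gamma>) k) (cmp C (?B x) (?P x) (?P y) (app (fhom P x y) t) (app (\<kappa> x) z))
        = cmp C (?B x) (?P y) (?A y) (app (pj T P A y \<cdot> \<gamma>) k) (cmp C (?B x) (?B y) (?P y) (app (\<kappa> y) z) (app (fhom B x y) t))"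
        by simp
    qed auto
  qed (auto simp: in_Hom)
  then obtain g where [simp]: "g \<in> Arr V" "Dom V g = Z" "Cod V g = eo T B P" "\<And>x. x \<in> J \<Longrightarrow> pj T B P x \<cdot> g = \<kappa> x"
    unfolding in_Hom by blast
  have g: "app (pj T B P x) (app g z) = app (\<kappa> x) z" if "x \<in> J" "elt z" "ty z = Z" for x z
    using that by (simp flip: app_comp)
  show "\<exists>g. g \<in> Arr V \<and> Dom V g = Z \<and> Cod V g = vhom (AV T) B P \<and>
        (\<forall>z k. elt z \<and> ty z = Z \<and> elt k \<and> ty k = K \<and> dj z k \<and> dj k z \<longrightarrow> cmp (AV T) B P A (app \<gamma> k) (app g z) = app f (pr z k))"
  proof (intro exI[of _ g] conjI allI impI)
    fix z k assume "elt z \<and> ty z = Z \<and> elt k \<and> ty k = K \<and> dj z k \<and> dj k z"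
    then have [simp]: "elt z" "ty z = Z" "elt k" "ty k = K" "dj z k" "dj k z" by auto
    show "cmp (AV T) B P A (app \<gamma> k) (app g z) = app f (pr z k)"
      by (rule end_eq[of T B A]) (auto simp: g \<kappa>e)
  qed auto
next
  have K [simp]: "K \<in> Obj V" using obj_Dom[OF \<gamma>(1)] by simp
  fix B a b assume "B \<in> vob (AV T)" and [simp]: "elt a" "elt b" and "ty a = vhom (AV T) B P" "ty b = vhom (AV T) B P"
    and e: "\<And>k. \<lbrakk>elt k; ty k = K; dj a k; dj k a; dj b k; dj k b\<rbrakk> \<Longrightarrow> cmp (AV T) B P A (app \<gamma> k) a = cmp (AV T) B P A (app \<gamma> k) b"
  then have [simp]: "alg T B" "ty a = eo T B P" "ty b = eo T B P" by simp_all
  note [simp] = algD[OF \<open>alg T A\<close> \<open>Th T\<close>] algD[OF \<open>alg T B\<close> \<open>Th T\<close>] algD[OF \<open>alg T P\<close> \<open>Th T\<close>]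
  show "a = b"
  proof (rule end_eq[of T B P])
    fix x assume [simp]: "x \<in> J"
    obtain k where k [simp]: "generic k" "elt k" "ty k = K" "dj k a" "dj a k" "dj k b" "dj b k"
      using fresh[of a b K] by auto
    show "app (pj T B P x) a = app (pj T B P x) b"
      by (rule cot_eq[OF c[of x], where k = k]) (use arg_cong[OF e[of k], of "app (pj T B A x)"] in auto)
  qed auto
qed auto

lemma ct_simps [simp]:
  assumes "c \<in> vob C" "K \<in> J"
  shows "fst (ct K c) \<in> vob C" "snd (ct K c) \<in> Arr V" "Dom V (snd (ct K c)) = K" "Cod V (snd (ct K c)) = vhom C (fst (ct K c)) c"
  using cotD[OF ct_cot[OF assms]] by auto

text \<open>\<open>P\<close> takes \<open>x\<close> to the designated \<open>[K, A(x)]\<close>, with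
  an action on homs forced by the counits. It preserves cotensors because cotensors commute with
  each other: \<open>[K, [X, A(\<one>)]]\<close> is also \<open>[X, [K, A(\<one>)]]\<close>.\<close>

lemma pointwise_cotensor:
  assumes T [simp]: "Th T" and A [simp]: "alg T A" and K [simp]: "K \<in> J"
  obtains P \<gamma> where "alg T P" "\<gamma> \<in> Arr V" "Dom V \<gamma> = K" "Cod V \<gamma> = eo T P A"
    "\<And>x. x \<in> J \<Longrightarrow> fob P x = fst (ct K (fob A x))" "\<And>x. x \<in> J \<Longrightarrow> pj T P A x \<cdot> \<gamma> = snd (ct K (fob A x))"
proof -
  note [simp] = algD[OF A T]
  let ?A = "fob A"
  define Q where "Q x = fst (ct K (?A x))" for x
  define \<epsilon> where "\<epsilon> x = snd (ct K (?A x))" for x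
  have Qc: "is_cotensor V C K (?A x) (Q x) (\<epsilon> x)" if "x \<in> J" for x
    unfolding Q_def \<epsilon>_def by (rule ct_cot) (use that in auto)
  have [simp]: "Q x \<in> vob C" "\<epsilon> x \<in> Arr V" "Dom V (\<epsilon> x) = K" "Cod V (\<epsilon> x) = vhom C (Q x) (?A x)" if "x \<in> J" for x
    using that by (auto simp: Q_def \<epsilon>_def)
  \<comment> \<open>Naturality of the counit in \<open>x\<close>, imposed as the definition of the
    action of \<open>P\<close> on \<open>t\<close>.\<close>
  let ?R = "\<lambda>x y g. g \<in> Arr V \<and> Dom V g = vhom (tcat T) x y \<and> Cod V g = vhom C (Q x) (Q y) \<and>
    (\<forall>t k. elt t \<and> ty t = vhom (tcat T) x y \<and> elt k \<and> ty k = K \<and> dj t k \<longrightarrow>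
      cmp C (Q x) (Q y) (?A y) (app (\<epsilon> y) k) (app g t) = app (vcomp C (Q x) (?A x) (?A y) \<cdot> (fhom A x y \<boxtimes> \<epsilon> x)) (pr t k))"
  have "\<exists>g. ?R x y g" if [simp]: "x \<in> J" "y \<in> J" for x y
    by (rule cot_ex[OF Qc[of y], of "Q x" "vhom (tcat T) x y" "vcomp C (Q x) (?A x) (?A y) \<cdot> (fhom A x y \<boxtimes> \<epsilon> x)"]) auto
  then obtain G where G: "\<And>x y. x \<in> J \<Longrightarrow> y \<in> J \<Longrightarrow> ?R x y (G x y)" by metis
  have [simp]: "G x y \<in> Arr V" "Dom V (G x y) = vhom (tcat T) x y" "Cod V (G x y) = vhom C (Q x) (Q y)"
    if "x \<in> J" "y \<in> J" for x y using G[OF that] by auto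
  have e: "cmp C (Q x) (Q y) (?A y) (app (\<epsilon> y) k) (app (G x y) t) = cmp C (Q x) (?A x) (?A y) (app (fhom A x y) t) (app (\<epsilon> x) k)"
    if [simp]: "x \<in> J" "y \<in> J" "elt t" "ty t = vhom (tcat T) x y" "elt k" "ty k = K" "dj t k" "dj k t" for x y t k
    using G[OF that(1,2)] by simp
  have e': "cmp C w (Q y) (?A y) (app (\<epsilon> y) k) (cmp C w (Q x) (Q y) (app (G x y) t) a)
      = cmp C w (?A x) (?A y) (app (fhom A x y) t) (cmp C w (Q x) (?A x) (app (\<epsilon> x) k) a)"
    if [simp]: "w \<in> vob C" "x \<in> J" "y \<in> J" "elt t" "ty t = vhom (tcat T) x y" "elt k" "ty k = K" "dj t k" "dj k t"
      "elt a" "ty a = vhom C w (Q x)" "dj t a" "dj k a" for w x y t k a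
  proof -
    have "cmp C w (Q y) (?A y) (app (\<epsilon> y) k) (cmp C w (Q x) (Q y) (app (G x y) t) a)
      = cmp C w (Q x) (?A y) (cmp C (Q x) (Q y) (?A y) (app (\<epsilon> y) k) (app (G x y) t)) a" by simp
    also have "\<dots> = cmp C w (?A x) (?A y) (app (fhom A x y) t) (cmp C w (Q x) (?A x) (app (\<epsilon> x) k) a)"
      by (subst e) auto
    finally show ?thesis .
  qed
  define P where "P = \<lparr>fob = (\<lambda>x \<in> J. Q x), fhom = res2 J G\<rparr>"
  have [simp]: "fob P x = Q x" "y \<in> J \<Longrightarrow> fhom P x y = G x y" if "x \<in> J" for x y using that by (auto simp: P_def)
  have PF: "vfunctor V (tcat T) C P"
  proof (rule vfunctorI)
    show "vfun_ext (vob (tcat T)) P" by (simp add: vfun_ext_def P_def)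
  next
    fix x assume "x \<in> vob (tcat T)"
    then have [simp]: "x \<in> J" by simp
    obtain k where [simp]: "generic k" "elt k" "ty k = K" using fresh[of star star K] by auto
    have "app (G x x) (gl (vid (tcat T) x)) = gl (vid C (Q x))"
      by (rule cot_eq[OF Qc[of x], where k = k]) (use e[of x x "gl (vid (tcat T) x)" k] in auto)
    then show "app (fhom P x x) (gl (vid (tcat T) x)) = gl (vid C (fob P x))" by simp
  next
    fix x y z a b assume "x \<in> vob (tcat T)" "y \<in> vob (tcat T)" "z \<in> vob (tcat T)"
      and [simp]: "elt a" "elt b" "ty a = vhom (tcat T) x y" "ty b = vhom (tcat T) y z" "dj b a" "dj a b"
    then have [simp]: "x \<in> J" "y \<in> J" "z \<in> J" by simp_all
    obtain k where [simp]: "generic k" "elt k" "ty k = K" "dj k a" "dj a k" "dj k b" "dj b k" using fresh[of a b K] by auto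
    have "app (G x z) (cmp (tcat T) x y z b a) = cmp C (Q x) (Q y) (Q z) (app (G y z) b) (app (G x y) a)"
      by (rule cot_eq[OF Qc[of z], where k = k]) (auto simp: e e')
    then show "app (fhom P x z) (cmp (tcat T) x y z b a) = cmp C (fob P x) (fob P y) (fob P z) (app (fhom P y z) b) (app (fhom P x y) a)"
      by simp
  qed (auto simp: in_Hom)
  have P [simp]: "alg T P"
  proof (rule algI[OF T PF])
    fix X assume X [simp]: "X \<in> J"
    let ?g = "gam T X"
    show "is_cotensor V C X (fob P \<one>) (fob P X) (fhom P X \<one> \<cdot> gam T X)"
    proof (rule cotI)
      fix c Z f assume [simp]: "c \<in> vob C" "Z \<in> Obj V" "f \<in> Arr V" "Dom V f = Z \<otimes> X" and "Cod V f = vhom C c (fob P \<one>)"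
      then have [simp]: "Cod V f = vhom C c (Q \<one>)" by simp
      \<comment> \<open>Sends \<open>((z, k), j)\<close> to the counit at \<open>k\<close> after
        \<open>f(z, j)\<close>. Lifting it through \<open>A(X) = [X, A(\<one>)]\<close> and then
        through \<open>Q X = [K, A(X)]\<close> exchanges the two cotensors.\<close>
      let ?r = "vcomp C c (Q \<one>) (?A \<one>) \<cdot> Sym V (vhom C c (Q \<one>)) (vhom C (Q \<one>) (?A \<one>)) \<cdot> (f \<boxtimes> \<epsilon> \<one>) \<cdot> inv_arr V (Assoc V Z X K) \<cdot>
        (Id V Z \<boxtimes> Sym V K X) \<cdot> Assoc V Z K X"
      obtain r where [simp]: "r \<in> Arr V" "Dom V r = Z \<otimes> K" "Cod V r = vhom C c (?A X)"
        and r: "\<And>z j. \<lbrakk>elt z; ty z = Z \<otimes> K; elt j; ty j = X; dj z j\<rbrakk> \<Longrightarrow>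
          cmp C c (?A X) (?A \<one>) (app (fhom A X \<one> \<cdot> ?g) j) (app r z) = app ?r (pr z j)"
        by (rule cot_ex[OF alg_gam[of T A X], of c "Z \<otimes> K" ?r]) auto
      obtain g where [simp]: "g \<in> Arr V" "Dom V g = Z" "Cod V g = vhom C c (Q X)"
        and g: "\<And>z k. \<lbrakk>elt z; ty z = Z; elt k; ty k = K; dj z k\<rbrakk> \<Longrightarrow>
          cmp C c (Q X) (?A X) (app (\<epsilon> X) k) (app g z) = app r (pr z k)"
        by (rule cot_ex[OF Qc[of X], of c Z r]) auto
      show "\<exists>g. g \<in> Arr V \<and> Dom V g = Z \<and> Cod V g = vhom C c (fob P X) \<and>
        (\<forall>z k. elt z \<and> ty z = Z \<and> elt k \<and> ty k = X \<and> dj z k \<and> dj k z \<longrightarrow>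
          cmp C c (fob P X) (fob P \<one>) (app (fhom P X \<one> \<cdot> gam T X) k) (app g z) = app f (pr z k))"
      proof (intro exI[of _ g] conjI allI impI)
        fix z j assume "elt z \<and> ty z = Z \<and> elt j \<and> ty j = X \<and> dj z j \<and> dj j z"
        then have [simp]: "elt z" "ty z = Z" "elt j" "ty j = X" "dj z j" "dj j z" by auto
        obtain k where [simp]: "generic k" "elt k" "ty k = K" "dj k z" "dj z k" "dj k j" "dj j k" using fresh[of z j K] by auto
        have rr: "cmp C c (?A X) (?A \<one>) (app (fhom A X \<one>) (app ?g j)) (app r (pr z k)) = cmp C c (Q \<one>) (?A \<one>) (app (\<epsilon> \<one>) k) (app f (pr z j))"
          using r[of "pr z k" j] by simp
        have "cmp C c (Q X) (Q \<one>) (app (G X \<one> \<cdot> gam T X) j) (app g z) = app f (pr z j)"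
          by (rule cot_eq[OF Qc[of \<one>], where k = k]) (auto simp: e' g rr)
        then show "cmp C c (fob P X) (fob P \<one>) (app (fhom P X \<one> \<cdot> gam T X) j) (app g z) = app f (pr z j)" by simp
      qed auto
    next
      fix c a b assume [simp]: "c \<in> vob C" "elt a" "elt b" and "ty a = vhom C c (fob P X)" "ty b = vhom C c (fob P X)"
        and ab: "\<And>k. \<lbrakk>elt k; ty k = X; dj a k; dj k a; dj b k; dj k b\<rbrakk> \<Longrightarrow>
          cmp C c (fob P X) (fob P \<one>) (app (fhom P X \<one> \<cdot> gam T X) k) a = cmp C c (fob P X) (fob P \<one>) (app (fhom P X \<one> \<cdot> gam T X) k) b"
      then have [simp]: "ty a = vhom C c (Q X)" "ty b = vhom C c (Q X)" by simp_all
      obtain k j where kj [simp]: "generic k" "elt k" "ty k = K" "dj k a" "dj a k" "dj k b" "dj b k"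
        "generic j" "elt j" "ty j = X" "dj j a" "dj a j" "dj j b" "dj b j" "dj k j" "dj j k"
        using fresh2[of a b K X] by auto
      have "cmp C c (Q X) (Q \<one>) (app (G X \<one>) (app ?g j)) a = cmp C c (Q X) (Q \<one>) (app (G X \<one>) (app ?g j)) b"
        using ab[of j] by simp
      then have j: "cmp C c (Q \<one>) (?A \<one>) (app (\<epsilon> \<one>) k) (cmp C c (Q X) (Q \<one>) (app (G X \<one>) (app ?g j)) a)
          = cmp C c (Q \<one>) (?A \<one>) (app (\<epsilon> \<one>) k) (cmp C c (Q X) (Q \<one>) (app (G X \<one>) (app ?g j)) b)" by simp
      have k: "cmp C c (Q X) (?A X) (app (\<epsilon> X) k) a = cmp C c (Q X) (?A X) (app (\<epsilon> X) k) b"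
        by (rule cot_eq[OF alg_gam[of T A X], where k = j]) (use j in \<open>auto simp: e'\<close>)
      show "a = b" by (rule cot_eq[OF Qc[of X], where k = k]) (use k in auto)
    qed auto
  qed
  \<comment> \<open>The counits of the \<open>[K, A(x)]\<close> form a wedge by the equation that
    defined \<open>G\<close>.\<close>
  have "\<exists>!\<gamma>. \<gamma> \<in> Hom V K (eo T P A) \<and> (\<forall>x \<in> J. pj T P A x \<cdot> \<gamma> = \<epsilon> x)"
    by (rule end_ex) (auto simp: in_Hom e)
  then obtain \<gamma> where "\<gamma> \<in> Arr V" "Dom V \<gamma> = K" "Cod V \<gamma> = eo T P A" "\<And>x. x \<in> J \<Longrightarrow> pj T P A x \<cdot> \<gamma> = \<epsilon> x"
    unfolding in_Hom by blast
  then show thesis using that[of P \<gamma>] by (simp add: Q_def \<epsilon>_def)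
qed

end

section \<open>Functors of two variables\<close>

context symmetric_monoidal_closed
begin

lemma vtensor_id [simp]:
  assumes "vcategory V B" "vcategory V C" "x \<in> vob B" "x' \<in> vob C"
  shows "vid (vtensor V B C) (x, x') \<in> Arr V" "Dom V (vid (vtensor V B C) (x, x')) = \<one>"
    "Cod V (vid (vtensor V B C) (x, x')) = vhom B x x \<otimes> vhom C x' x'"
    "gl (vid (vtensor V B C) (x, x')) = pr (gl (vid B x)) (gl (vid C x'))"
  using assms gl_comp_pr[of "vid B x \<boxtimes> vid C x'"] by (auto simp: vtensor_def)

lemma vtensor_comp [simp]:
  assumes "vcategory V B" "vcategory V C" "x \<in> vob B" "x' \<in> vob C" "y \<in> vob B" "y' \<in> vob C" "z \<in> vob B" "z' \<in> vob C"
  shows "vcomp (vtensor V B C) (x, x') (y, y') (z, z') \<in> Arr V"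
    "Dom V (vcomp (vtensor V B C) (x, x') (y, y') (z, z')) = (vhom B y z \<otimes> vhom C y' z') \<otimes> (vhom B x y \<otimes> vhom C x' y')"
    "Cod V (vcomp (vtensor V B C) (x, x') (y, y') (z, z')) = vhom B x z \<otimes> vhom C x' z'"
    "\<lbrakk>elt a; elt a'; elt b; elt b'; ty a = vhom B x y; ty a' = vhom C x' y'; ty b = vhom B y z; ty b' = vhom C y' z';
      dj b b'; dj b a; dj b a'; dj b' a; dj a b'; dj b' a'; dj a a'\<rbrakk> \<Longrightarrow>
      cmp (vtensor V B C) (x, x') (y, y') (z, z') (pr b b') (pr a a') = pr (cmp B x y z b a) (cmp C x' y' z' b' a')"
  using assms by (auto simp: vtensor_def)

lemma vcategory_vtensor [simp]:
  assumes [simp]: "vcategory V B" "vcategory V C"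
  shows "vcategory V (vtensor V B C)"
  unfolding vcategory_def
proof (intro conjI ballI)
  fix p q assume "p \<in> vob (vtensor V B C)" "q \<in> vob (vtensor V B C)"
  then obtain x x' y y' where [simp]: "p = (x, x')" "q = (y, y')" "x \<in> vob B" "x' \<in> vob C" "y \<in> vob B" "y' \<in> vob C"
    by auto
  show "vhom (vtensor V B C) p q \<in> Obj V" by simp
  let ?a = "var 0 (vhom B x y)" and ?a' = "var 1 (vhom C x' y')"
  show "vcomp (vtensor V B C) p q q \<cdot> (vid (vtensor V B C) q \<boxtimes> Id V (vhom (vtensor V B C) p q)) = Lun V (vhom (vtensor V B C) p q)"
    by (rule eq_generic[of _ "pr star (pr ?a ?a')"]) auto
  show "vcomp (vtensor V B C) p p q \<cdot> (Id V (vhom (vtensor V B C) p q) \<boxtimes> vid (vtensor V B C) p) = Run V (vhom (vtensor V B C) p q)"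
    by (rule eq_generic[of _ "pr (pr ?a ?a') star"]) auto
next
  fix p assume "p \<in> vob (vtensor V B C)"
  then show "vid (vtensor V B C) p \<in> Hom V \<one> (vhom (vtensor V B C) p p)" by (auto simp: in_Hom)
next
  fix p q r assume "p \<in> vob (vtensor V B C)" "q \<in> vob (vtensor V B C)" "r \<in> vob (vtensor V B C)"
  then show "vcomp (vtensor V B C) p q r \<in> Hom V (vhom (vtensor V B C) q r \<otimes> vhom (vtensor V B C) p q) (vhom (vtensor V B C) p r)"
    by (auto simp: in_Hom)
next
  fix o' p q r assume "o' \<in> vob (vtensor V B C)" "p \<in> vob (vtensor V B C)" "q \<in> vob (vtensor V B C)" "r \<in> vob (vtensor V B C)"
  then obtain w w' x x' y y' z z' where [simp]: "o' = (w, w')" "p = (x, x')" "q = (y, y')" "r = (z, z')"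
    "w \<in> vob B" "w' \<in> vob C" "x \<in> vob B" "x' \<in> vob C" "y \<in> vob B" "y' \<in> vob C" "z \<in> vob B" "z' \<in> vob C"
    by auto
  let ?a = "var 0 (vhom B w x)" and ?a' = "var 1 (vhom C w' x')" and ?b = "var 2 (vhom B x y)"
    and ?b' = "var 3 (vhom C x' y')" and ?c = "var 4 (vhom B y z)" and ?c' = "var 5 (vhom C y' z')"
  let ?T = "vtensor V B C"
  show "vcomp ?T o' q r \<cdot> (Id V (vhom ?T q r) \<boxtimes> vcomp ?T o' p q) \<cdot> Assoc V (vhom ?T q r) (vhom ?T p q) (vhom ?T o' p)
      = vcomp ?T o' p r \<cdot> (vcomp ?T p q r \<boxtimes> Id V (vhom ?T o' p))"
    by (rule eq_generic[of _ "pr (pr (pr ?c ?c') (pr ?b ?b')) (pr ?a ?a')"]) auto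
qed

text \<open>An element of a tensor product of hom-objects need not be a pair, but functoriality is
  an equation of arrows and can be tested on pairs.\<close>

lemma vfunctorI2:
  assumes [simp]: "vcategory V B" "vcategory V B'" "vcategory V C" and e: "vfun_ext (vob B \<times> vob B') D"
    and o [simp]: "\<And>x k. x \<in> vob B \<Longrightarrow> k \<in> vob B' \<Longrightarrow> fob D (x, k) \<in> vob C"
    and h: "\<And>x y k l. \<lbrakk>x \<in> vob B; y \<in> vob B; k \<in> vob B'; l \<in> vob B'\<rbrakk> \<Longrightarrow>
      fhom D (x, k) (y, l) \<in> Hom V (vhom B x y \<otimes> vhom B' k l) (vhom C (fob D (x, k)) (fob D (y, l)))"
    and i: "\<And>x k. \<lbrakk>x \<in> vob B; k \<in> vob B'\<rbrakk> \<Longrightarrow>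
      app (fhom D (x, k) (x, k)) (pr (gl (vid B x)) (gl (vid B' k))) = gl (vid C (fob D (x, k)))"
    and c: "\<And>x y z k l m a b a' b'. \<lbrakk>x \<in> vob B; y \<in> vob B; z \<in> vob B; k \<in> vob B'; l \<in> vob B'; m \<in> vob B';
      elt a; elt b; elt a'; elt b'; ty a = vhom B x y; ty b = vhom B y z; ty a' = vhom B' k l; ty b' = vhom B' l m;
      dj a b; dj b a; dj a a'; dj a' a; dj a b'; dj b' a; dj b a'; dj a' b; dj b b'; dj b' b; dj a' b'; dj b' a'\<rbrakk> \<Longrightarrow>
      app (fhom D (x, k) (z, m)) (pr (cmp B x y z b a) (cmp B' k l m b' a'))
        = cmp C (fob D (x, k)) (fob D (y, l)) (fob D (z, m)) (app (fhom D (y, l) (z, m)) (pr b b')) (app (fhom D (x, k) (y, l)) (pr a a'))"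
  shows "vfunctor V (vtensor V B B') C D"
proof -
  have [simp]: "fhom D (x, k) (y, l) \<in> Arr V" "Dom V (fhom D (x, k) (y, l)) = vhom B x y \<otimes> vhom B' k l"
    "Cod V (fhom D (x, k) (y, l)) = vhom C (fob D (x, k)) (fob D (y, l))"
    if "x \<in> vob B" "y \<in> vob B" "k \<in> vob B'" "l \<in> vob B'" for x y k l
    using h[OF that] by (auto simp: in_Hom)
  show ?thesis
    unfolding vfunctor_def
  proof (intro conjI ballI)
    show "fob D \<in> vob (vtensor V B B') \<rightarrow>\<^sub>E vob C" "fhom D = res2 (vob (vtensor V B B')) (fhom D)"
      using e by (auto simp: vfun_ext_def PiE_def)
    fix p assume "p \<in> vob (vtensor V B B')"
    then obtain x k where [simp]: "p = (x, k)" "x \<in> vob B" "k \<in> vob B'" by auto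
    have "gl (fhom D p p \<cdot> vid (vtensor V B B') p) = gl (vid C (fob D p))"
      using i[of x k] by (simp flip: app_gl)
    then show "fhom D p p \<cdot> vid (vtensor V B B') p = vid C (fob D p)" by simp
  next
    fix p q assume "p \<in> vob (vtensor V B B')" "q \<in> vob (vtensor V B B')"
    then show "fhom D p q \<in> Hom V (vhom (vtensor V B B') p q) (vhom C (fob D p) (fob D q))"
      by (auto simp: in_Hom)
  next
    fix p q r assume "p \<in> vob (vtensor V B B')" "q \<in> vob (vtensor V B B')" "r \<in> vob (vtensor V B B')"
    then obtain x k y l z m where [simp]: "p = (x, k)" "q = (y, l)" "r = (z, m)" "x \<in> vob B" "k \<in> vob B'"
      "y \<in> vob B" "l \<in> vob B'" "z \<in> vob B" "m \<in> vob B'" by auto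
    show "fhom D p r \<cdot> vcomp (vtensor V B B') p q r
        = vcomp C (fob D p) (fob D q) (fob D r) \<cdot> (fhom D q r \<boxtimes> fhom D p q)"
      by (rule arr_eqI4[of _ _ "vhom B y z" "vhom B' l m" "vhom B x y" "vhom B' k l"]) (auto simp: c)
  qed
qed

lemma vfunD2:
  assumes D: "vfunctor V (vtensor V B B') C D" and [simp]: "vcategory V B" "vcategory V B'" "vcategory V C"
  shows "\<And>x k. x \<in> vob B \<Longrightarrow> k \<in> vob B' \<Longrightarrow> fob D (x, k) \<in> vob C"
    "\<And>x y k l. \<lbrakk>x \<in> vob B; y \<in> vob B; k \<in> vob B'; l \<in> vob B'\<rbrakk> \<Longrightarrow> fhom D (x, k) (y, l) \<in> Arr V"
    "\<And>x y k l. \<lbrakk>x \<in> vob B; y \<in> vob B; k \<in> vob B'; l \<in> vob B'\<rbrakk> \<Longrightarrow> Dom V (fhom D (x, k) (y, l)) = vhom B x y \<otimes> vhom B' k l"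
    "\<And>x y k l. \<lbrakk>x \<in> vob B; y \<in> vob B; k \<in> vob B'; l \<in> vob B'\<rbrakk> \<Longrightarrow> Cod V (fhom D (x, k) (y, l)) = vhom C (fob D (x, k)) (fob D (y, l))"
    "\<And>x k. \<lbrakk>x \<in> vob B; k \<in> vob B'\<rbrakk> \<Longrightarrow>
      app (fhom D (x, k) (x, k)) (pr (gl (vid B x)) (gl (vid B' k))) = gl (vid C (fob D (x, k)))"
    "\<And>x y z k l m a b a' b'. \<lbrakk>x \<in> vob B; y \<in> vob B; z \<in> vob B; k \<in> vob B'; l \<in> vob B'; m \<in> vob B';
      elt a; elt b; elt a'; elt b'; ty a = vhom B x y; ty b = vhom B y z; ty a' = vhom B' k l; ty b' = vhom B' l m;
      dj b a; dj a a'; dj a b'; dj b' a; dj b a'; dj b b'; dj b' a'\<rbrakk> \<Longrightarrow>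
      app (fhom D (x, k) (z, m)) (pr (cmp B x y z b a) (cmp B' k l m b' a'))
        = cmp C (fob D (x, k)) (fob D (y, l)) (fob D (z, m)) (app (fhom D (y, l) (z, m)) (pr b b')) (app (fhom D (x, k) (y, l)) (pr a a'))"
proof -
  note F = vfunD[OF D vcategory_vtensor[OF \<open>vcategory V B\<close> \<open>vcategory V B'\<close>] \<open>vcategory V C\<close>]
  show "\<And>x k. x \<in> vob B \<Longrightarrow> k \<in> vob B' \<Longrightarrow> fob D (x, k) \<in> vob C"
    "\<And>x y k l. \<lbrakk>x \<in> vob B; y \<in> vob B; k \<in> vob B'; l \<in> vob B'\<rbrakk> \<Longrightarrow> fhom D (x, k) (y, l) \<in> Arr V"
    "\<And>x y k l. \<lbrakk>x \<in> vob B; y \<in> vob B; k \<in> vob B'; l \<in> vob B'\<rbrakk> \<Longrightarrow> Dom V (fhom D (x, k) (y, l)) = vhom B x y \<otimes> vhom B' k l"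
    "\<And>x y k l. \<lbrakk>x \<in> vob B; y \<in> vob B; k \<in> vob B'; l \<in> vob B'\<rbrakk> \<Longrightarrow> Cod V (fhom D (x, k) (y, l)) = vhom C (fob D (x, k)) (fob D (y, l))"
    by (simp_all add: F)
  fix x k assume a: "x \<in> vob B" "k \<in> vob B'"
  then have "gl (fhom D (x, k) (x, k) \<cdot> vid (vtensor V B B') (x, k)) = gl (vid C (fob D (x, k)))"
    by (simp add: F(5))
  then show "app (fhom D (x, k) (x, k)) (pr (gl (vid B x)) (gl (vid B' k))) = gl (vid C (fob D (x, k)))"
    using a by (simp flip: app_gl)
next
  fix x y z k l m a b a' b'
  assume "x \<in> vob B" "y \<in> vob B" "z \<in> vob B" "k \<in> vob B'" "l \<in> vob B'" "m \<in> vob B'"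
      "elt a" "elt b" "elt a'" "elt b'" "ty a = vhom B x y" "ty b = vhom B y z" "ty a' = vhom B' k l" "ty b' = vhom B' l m"
      "dj b a" "dj a a'" "dj a b'" "dj b' a" "dj b a'" "dj b b'" "dj b' a'"
  then show "app (fhom D (x, k) (z, m)) (pr (cmp B x y z b a) (cmp B' k l m b' a'))
        = cmp C (fob D (x, k)) (fob D (y, l)) (fob D (z, m)) (app (fhom D (y, l) (z, m)) (pr b b')) (app (fhom D (x, k) (y, l)) (pr a a'))"
    using vfunD(6)[OF D vcategory_vtensor[OF \<open>vcategory V B\<close> \<open>vcategory V B'\<close>] \<open>vcategory V C\<close>, of "(x, k)" "(y, l)" "(z, m)" "pr a a'" "pr b b'"]
    by simp
qed

lemma fix_fob [simp]:
  "x \<in> vob B \<Longrightarrow> fob (fix_right V B B' D k) x = fob D (x, k)"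
  "k \<in> vob B' \<Longrightarrow> fob (fix_left V B B' D x) k = fob D (x, k)"
  by (simp_all add: fix_right_def fix_left_def)

lemma fix_ext [simp]:
  "vfun_ext (vob B) (fix_right V B B' D k)" "vfun_ext (vob B') (fix_left V B B' D x)"
  by (simp_all add: vfun_ext_def fix_right_def fix_left_def)

lemma fix_fhom:
  assumes D: "vfunctor V (vtensor V B B') C D" and [simp]: "vcategory V B" "vcategory V B'" "vcategory V C"
  shows "\<And>x y k. \<lbrakk>x \<in> vob B; y \<in> vob B; k \<in> vob B'\<rbrakk> \<Longrightarrow> fhom (fix_right V B B' D k) x y \<in> Arr V"
    "\<And>x y k. \<lbrakk>x \<in> vob B; y \<in> vob B; k \<in> vob B'\<rbrakk> \<Longrightarrow> Dom V (fhom (fix_right V B B' D k) x y) = vhom B x y"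
    "\<And>x y k. \<lbrakk>x \<in> vob B; y \<in> vob B; k \<in> vob B'\<rbrakk> \<Longrightarrow> Cod V (fhom (fix_right V B B' D k) x y) = vhom C (fob D (x, k)) (fob D (y, k))"
    "\<And>x y k t. \<lbrakk>x \<in> vob B; y \<in> vob B; k \<in> vob B'; elt t; ty t = vhom B x y\<rbrakk> \<Longrightarrow>
      app (fhom (fix_right V B B' D k) x y) t = app (fhom D (x, k) (y, k)) (pr t (gl (vid B' k)))"
    "\<And>x k l. \<lbrakk>x \<in> vob B; k \<in> vob B'; l \<in> vob B'\<rbrakk> \<Longrightarrow> fhom (fix_left V B B' D x) k l \<in> Arr V"
    "\<And>x k l. \<lbrakk>x \<in> vob B; k \<in> vob B'; l \<in> vob B'\<rbrakk> \<Longrightarrow> Dom V (fhom (fix_left V B B' D x) k l) = vhom B' k l"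
    "\<And>x k l. \<lbrakk>x \<in> vob B; k \<in> vob B'; l \<in> vob B'\<rbrakk> \<Longrightarrow> Cod V (fhom (fix_left V B B' D x) k l) = vhom C (fob D (x, k)) (fob D (x, l))"
    "\<And>x k l u. \<lbrakk>x \<in> vob B; k \<in> vob B'; l \<in> vob B'; elt u; ty u = vhom B' k l\<rbrakk> \<Longrightarrow>
      app (fhom (fix_left V B B' D x) k l) u = app (fhom D (x, k) (x, l)) (pr (gl (vid B x)) u)"
proof -
  note [simp] = vfunD2[OF assms]
  show "\<And>x y k. \<lbrakk>x \<in> vob B; y \<in> vob B; k \<in> vob B'\<rbrakk> \<Longrightarrow> fhom (fix_right V B B' D k) x y \<in> Arr V"
    "\<And>x y k. \<lbrakk>x \<in> vob B; y \<in> vob B; k \<in> vob B'\<rbrakk> \<Longrightarrow> Dom V (fhom (fix_right V B B' D k) x y) = vhom B x y"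
    "\<And>x y k. \<lbrakk>x \<in> vob B; y \<in> vob B; k \<in> vob B'\<rbrakk> \<Longrightarrow> Cod V (fhom (fix_right V B B' D k) x y) = vhom C (fob D (x, k)) (fob D (y, k))"
    "\<And>x y k t. \<lbrakk>x \<in> vob B; y \<in> vob B; k \<in> vob B'; elt t; ty t = vhom B x y\<rbrakk> \<Longrightarrow>
      app (fhom (fix_right V B B' D k) x y) t = app (fhom D (x, k) (y, k)) (pr t (gl (vid B' k)))"
    "\<And>x k l. \<lbrakk>x \<in> vob B; k \<in> vob B'; l \<in> vob B'\<rbrakk> \<Longrightarrow> fhom (fix_left V B B' D x) k l \<in> Arr V"
    "\<And>x k l. \<lbrakk>x \<in> vob B; k \<in> vob B'; l \<in> vob B'\<rbrakk> \<Longrightarrow> Dom V (fhom (fix_left V B B' D x) k l) = vhom B' k l"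
    "\<And>x k l. \<lbrakk>x \<in> vob B; k \<in> vob B'; l \<in> vob B'\<rbrakk> \<Longrightarrow> Cod V (fhom (fix_left V B B' D x) k l) = vhom C (fob D (x, k)) (fob D (x, l))"
    "\<And>x k l u. \<lbrakk>x \<in> vob B; k \<in> vob B'; l \<in> vob B'; elt u; ty u = vhom B' k l\<rbrakk> \<Longrightarrow>
      app (fhom (fix_left V B B' D x) k l) u = app (fhom D (x, k) (x, l)) (pr (gl (vid B x)) u)"
    by (simp_all add: fix_right_def fix_left_def)
qed

text \<open>A pair \<open>(t, u)\<close> is \<open>(t, 1)\<close> followed by \<open>(1, u)\<close>,
  and also the other way round. Equating the two forms gives the interchange of the partial
  actions.\<close>

lemma two_var_split:
  assumes D: "vfunctor V (vtensor V B B') C D" and [simp]: "vcategory V B" "vcategory V B'" "vcategory V C"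
    and [simp]: "x \<in> vob B" "y \<in> vob B" "k \<in> vob B'" "l \<in> vob B'" "elt t" "ty t = vhom B x y" "elt u" "ty u = vhom B' k l" "dj t u" "dj u t"
  shows "app (fhom D (x, k) (y, l)) (pr t u) = cmp C (fob D (x, k)) (fob D (y, k)) (fob D (y, l))
      (app (fhom (fix_left V B B' D y) k l) u) (app (fhom (fix_right V B B' D k) x y) t)"
    "app (fhom D (x, k) (y, l)) (pr t u) = cmp C (fob D (x, k)) (fob D (x, l)) (fob D (y, l))
      (app (fhom (fix_right V B B' D l) x y) t) (app (fhom (fix_left V B B' D x) k l) u)"
proof -
  note [simp] = fix_fhom[OF assms(1-4)] vfunD2(1-5)[OF assms(1-4)]
  note c = vfunD2(6)[OF assms(1-4), symmetric]
  show "app (fhom D (x, k) (y, l)) (pr t u) = cmp C (fob D (x, k)) (fob D (y, k)) (fob D (y, l))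
      (app (fhom (fix_left V B B' D y) k l) u) (app (fhom (fix_right V B B' D k) x y) t)"
    by (simp add: c)
  show "app (fhom D (x, k) (y, l)) (pr t u) = cmp C (fob D (x, k)) (fob D (x, l)) (fob D (y, l))
      (app (fhom (fix_right V B B' D l) x y) t) (app (fhom (fix_left V B B' D x) k l) u)"
    by (simp add: c)
qed

lemma vfunctor_fix:
  assumes D: "vfunctor V (vtensor V B B') C D" and [simp]: "vcategory V B" "vcategory V B'" "vcategory V C"
  shows "k \<in> vob B' \<Longrightarrow> vfunctor V B C (fix_right V B B' D k)" "x \<in> vob B \<Longrightarrow> vfunctor V B' C (fix_left V B B' D x)"
proof -
  note [simp] = fix_fhom[OF assms] vfunD2(1-5)[OF assms]
  note c = vfunD2(6)[OF assms, symmetric]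
  show "vfunctor V B C (fix_right V B B' D k)" if [simp]: "k \<in> vob B'"
  proof (rule vfunctorI)
    fix x assume [simp]: "x \<in> vob B"
    have "app (fhom (fix_right V B B' D k) x x) (gl (vid B x)) = gl (vid C (fob (fix_right V B B' D k) x))"
      by (subst fix_fhom(4)[OF assms]) auto
    then show "app (fhom (fix_right V B B' D k) x x) (gl (vid B x)) = gl (vid C (fob (fix_right V B B' D k) x))" .
  qed (auto simp: in_Hom c)
  show "vfunctor V B' C (fix_left V B B' D x)" if [simp]: "x \<in> vob B"
  proof (rule vfunctorI)
    fix k assume [simp]: "k \<in> vob B'"
    have "app (fhom (fix_left V B B' D x) k k) (gl (vid B' k)) = gl (vid C (fob (fix_left V B B' D x) k))"
      by (subst fix_fhom(8)[OF assms]) auto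
    then show "app (fhom (fix_left V B B' D x) k k) (gl (vid B' k)) = gl (vid C (fob (fix_left V B B' D x) k))" .
  qed (auto simp: in_Hom c)
qed

end

section \<open>The bifold algebra of an algebra and its commutant\<close>

context admissible
begin

text \<open>
  In the notation of the paper, \<open>CA T A K\<close> is \<open>[K, A]\<close> with counit \<open>CU T A K\<close>, \<open>CT T A\<close> is \<open>T\<^sup>\<bottom>\<^sub>A\<close>, \<open>CG T A\<close>
  is \<open>A\<^sup>\<bottom>\<close>, and below \<open>RD T A\<close> is the functor \<open>(X, K) \<mapsto> [K, A](X)\<close>.
\<close>

abbreviation CA :: "('v, 'm) jtheory \<Rightarrow> ('m, 'v, 'c) vfun \<Rightarrow> 'v \<Rightarrow> ('m, 'v, 'c) vfun" where
  "CA T A K \<equiv> cot_alg V J C ct T K A"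
abbreviation CU :: "('v, 'm) jtheory \<Rightarrow> ('m, 'v, 'c) vfun \<Rightarrow> 'v \<Rightarrow> 'm" where
  "CU T A K \<equiv> cot_counit V J C ct T K A"
abbreviation CC :: "('v, 'm) jtheory \<Rightarrow> ('m, 'v, 'c) vfun \<Rightarrow> ('v, 'm, 'v) vcat" where
  "CC \<equiv> commutant_cat V J C ct"
abbreviation CT :: "('v, 'm) jtheory \<Rightarrow> ('m, 'v, 'c) vfun \<Rightarrow> ('v, 'm) jtheory" where
  "CT \<equiv> commutant_theory V J C ct"
abbreviation CG :: "('v, 'm) jtheory \<Rightarrow> ('m, 'v, 'c) vfun \<Rightarrow> ('m, 'v, 'c) vfun" where
  "CG \<equiv> commutant_algebra V J C ct"

text \<open>The choice in \<open>alg_cotensor\<close> can be satisfied: by \<open>A\<close> itself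
  for \<open>K = \<one>\<close>, and by the pointwise cotensor otherwise. In the first case the
  value at \<open>\<one>\<close> is the designated one because \<open>ct \<one> c\<close> is
  \<open>c\<close> with its identity.\<close>

lemma cot_alg_spec:
  assumes [simp]: "Th T" "alg T A" "K \<in> J"
  shows "is_cotensor V (AV T) K A (CA T A K) (CU T A K)"
    "(fob (CA T A K) \<one>, pj T (CA T A K) A \<one> \<cdot> CU T A K) = ct K (fob A \<one>)"
    "CA T A \<one> = A" "CU T A \<one> = vid (AV T) A"
proof -
  note [simp] = algD[OF \<open>alg T A\<close> \<open>Th T\<close>]
  let ?S = "\<lambda>K P \<gamma>. is_cotensor V (AV T) K A P \<gamma> \<and> (fob P \<one>, pj T P A \<one> \<cdot> \<gamma>) = ct K (fob A \<one>) \<and>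
     (K = \<one> \<longrightarrow> (P, \<gamma>) = (A, vid (AV T) A))"
  have spec: "?S K (CA T A K) (CU T A K)" if [simp]: "K \<in> J" for K
  proof -
    have "\<exists>P \<gamma>. ?S K P \<gamma>"
    proof (cases "K = \<one>")
      case True
      have "?S K A (vid (AV T) A)" using cot_unit[of "AV T" A] True by simp
      then show ?thesis by blast
    next
      case False
      obtain P \<gamma> where p: "alg T P" "\<gamma> \<in> Arr V" "Dom V \<gamma> = K" "Cod V \<gamma> = eo T P A"
        and q: "\<And>x. x \<in> J \<Longrightarrow> fob P x = fst (ct K (fob A x))" "\<And>x. x \<in> J \<Longrightarrow> pj T P A x \<cdot> \<gamma> = snd (ct K (fob A x))"
        using pointwise_cotensor[of T A K] by auto
      have "is_cotensor V (AV T) K A P \<gamma>"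
        by (rule cot_AV) (use p q ct_cot in auto)
      then show ?thesis using False q by force
    qed
    then have "\<exists>p. case p of (P, \<gamma>) \<Rightarrow> ?S K P \<gamma>" by auto
    then have "case alg_cotensor V J C ct T K A of (P, \<gamma>) \<Rightarrow> ?S K P \<gamma>"
      unfolding alg_cotensor_def by (rule someI_ex)
    then show ?thesis unfolding case_prod_beta by (auto simp: cot_alg_def cot_counit_def prod_eq_iff)
  qed
  show "is_cotensor V (AV T) K A (CA T A K) (CU T A K)"
    "(fob (CA T A K) \<one>, pj T (CA T A K) A \<one> \<cdot> CU T A K) = ct K (fob A \<one>)"
    using spec[of K] by auto
  show "CA T A \<one> = A" "CU T A \<one> = vid (AV T) A"
    using spec[of \<one>] by auto
qed

lemma CA_simps [simp]:
  assumes "Th T" "alg T A"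
  shows "K \<in> J \<Longrightarrow> alg T (CA T A K)" "K \<in> J \<Longrightarrow> CU T A K \<in> Arr V" "K \<in> J \<Longrightarrow> Dom V (CU T A K) = K"
    "K \<in> J \<Longrightarrow> Cod V (CU T A K) = eo T (CA T A K) A" "K \<in> J \<Longrightarrow> fob (CA T A K) \<one> = fst (ct K (fob A \<one>))"
    "K \<in> J \<Longrightarrow> pj T (CA T A K) A \<one> \<cdot> CU T A K = snd (ct K (fob A \<one>))"
    "CA T A \<one> = A" "CU T A \<one> = vid (AV T) A"
  using cot_alg_spec(1,2)[OF assms] cot_alg_spec(3,4)[OF assms J_simps(2)] cotD[OF cot_alg_spec(1)[OF assms]]
  by (auto simp: prod_eq_iff)

text \<open>\<open>alg_cotensor\<close> prescribes the value of \<open>[K, A]\<close> at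
  \<open>\<one>\<close> only. At other objects it is compared with the pointwise cotensor, whose
  evaluations are cotensors by construction.\<close>

lemma CA_pointwise:
  assumes [simp]: "Th T" "alg T A" "K \<in> J" "x \<in> J"
  shows "is_cotensor V C K (fob A x) (fob (CA T A K) x) (pj T (CA T A K) A x \<cdot> CU T A K)"
proof -
  note [simp] = algD[OF \<open>alg T A\<close> \<open>Th T\<close>]
  obtain P \<gamma> where p: "alg T P" "\<gamma> \<in> Arr V" "Dom V \<gamma> = K" "Cod V \<gamma> = eo T P A"
    and q: "\<And>x. x \<in> J \<Longrightarrow> fob P x = fst (ct K (fob A x))" "\<And>x. x \<in> J \<Longrightarrow> pj T P A x \<cdot> \<gamma> = snd (ct K (fob A x))"
    using pointwise_cotensor[of T A K] by auto
  have 1: "is_cotensor V (AV T) K A P \<gamma>"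
    by (rule cot_AV) (use p q ct_cot in auto)
  have "is_cotensor V C K (fob (evf T x) A) (fob (evf T x) (CA T A K)) (fhom (evf T x) (CA T A K) A \<cdot> CU T A K)"
  proof (rule preserves_one[OF vfunctor_evf _ _ _ 1 cot_alg_spec(1)])
    show "is_cotensor V C K (fob (evf T x) A) (fob (evf T x) P) (fhom (evf T x) P A \<cdot> \<gamma>)"
      using ct_cot[of "fob A x" K] p q by (simp add: evf_def)
  qed auto
  then show ?thesis by (simp add: evf_def)
qed

lemma CC_simps [simp]:
  "vob (CC T A) = J" "X \<in> J \<Longrightarrow> Y \<in> J \<Longrightarrow> vhom (CC T A) X Y = eo T (CA T A X) (CA T A Y)"
  "X \<in> J \<Longrightarrow> vid (CC T A) X = vid (AV T) (CA T A X)"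
  "X \<in> J \<Longrightarrow> Y \<in> J \<Longrightarrow> Z \<in> J \<Longrightarrow> vcomp (CC T A) X Y Z = vcomp (AV T) (CA T A X) (CA T A Y) (CA T A Z)"
  by (simp_all add: commutant_cat_def)

lemma tcat_CT [simp]: "tcat (CT T A) = CC T A"
  by (simp add: commutant_theory_def)

lemma vcategory_CC [simp]:
  assumes [simp]: "Th T" "alg T A"
  shows "vcategory V (CC T A)"
  by (rule vcategoryI) (auto simp: in_Hom)

lemma Th_CT [simp]:
  assumes [simp]: "Th T" "alg T A"
  shows "Th (CT T A)" "X \<in> J \<Longrightarrow> gam (CT T A) X = CU T A X"
proof -
  have c: "is_cotensor V (CC T A) X \<one> X (CU T A X)" if X [simp]: "X \<in> J" for X
  proof -
    have "is_cotensor V (AV T) X A (CA T A X) (CU T A X)" by (rule cot_alg_spec) auto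
    \<comment> \<open>The homs of the commutant are those of \<open>AV T\<close> between the
      \<open>[X, A]\<close>, so the universal property is tested against fewer objects;
      \<open>[\<one>, A]\<close> is \<open>A\<close>.\<close>
    then show ?thesis by (auto simp: is_cotensor_def)
  qed
  have e: "vcat_extensional (CC T A)"
    by (simp add: vcat_extensional_def) (simp add: commutant_cat_def)
  note I = jtheoryI[of "CC T A" "CU T A", OF _ e _ c _ refl]
  have ct: "CT T A = \<lparr>tcat = CC T A, tstr = \<lparr>fob = (\<lambda>X \<in> J. X), fhom = res2 J (\<lambda>X Y. THE t. t \<in> Hom V (Ihom V Y X) (vhom (CC T A) X Y) \<and>
         vcomp (CC T A) X Y \<one> \<cdot> (CU T A Y \<boxtimes> t) \<cdot> Sym V (Ihom V Y X) Y = CU T A X \<cdot> Ev V Y X)\<rparr>\<rparr>"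
    unfolding commutant_theory_def ..
  show "Th (CT T A)" unfolding ct by (rule I(1)) auto
  show "X \<in> J \<Longrightarrow> gam (CT T A) X = CU T A X" unfolding ct by (rule I(2)) auto
qed

text \<open>The pair \<open>(t, \<phi>)\<close> acts by \<open>[K, A](t)\<close> followed by
  \<open>\<phi>\<close> at \<open>y\<close>. By naturality of \<open>\<phi>\<close> the other order
  gives the same.\<close>

definition RD :: "('v, 'm) jtheory \<Rightarrow> ('m, 'v, 'c) vfun \<Rightarrow> ('m, 'v \<times> 'v, 'c) vfun" where
  "RD T A = \<lparr>fob = (\<lambda>(x, K) \<in> J \<times> J. fob (CA T A K) x),
     fhom = res2 (J \<times> J) (\<lambda>(x, K) (y, L). vcomp C (fob (CA T A K) x) (fob (CA T A K) y) (fob (CA T A L) y) \<cdot>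
       (pj T (CA T A K) (CA T A L) y \<boxtimes> fhom (CA T A K) x y) \<cdot> Sym V (vhom (tcat T) x y) (eo T (CA T A K) (CA T A L)))\<rparr>"

lemma RD_fob [simp]: "x \<in> J \<Longrightarrow> K \<in> J \<Longrightarrow> fob (RD T A) (x, K) = fob (CA T A K) x"
  by (simp add: RD_def)

lemma RD_fhom:
  assumes [simp]: "Th T" "alg T A" "x \<in> J" "y \<in> J" "K \<in> J" "L \<in> J"
  shows "fhom (RD T A) (x, K) (y, L) \<in> Arr V"
    "Dom V (fhom (RD T A) (x, K) (y, L)) = vhom (tcat T) x y \<otimes> eo T (CA T A K) (CA T A L)"
    "Cod V (fhom (RD T A) (x, K) (y, L)) = vhom C (fob (CA T A K) x) (fob (CA T A L) y)"
    "\<lbrakk>elt t; ty t = vhom (tcat T) x y; elt \<phi>; ty \<phi> = eo T (CA T A K) (CA T A L); dj t \<phi>; dj \<phi> t\<rbrakk> \<Longrightarrow>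
      app (fhom (RD T A) (x, K) (y, L)) (pr t \<phi>)
        = cmp C (fob (CA T A K) x) (fob (CA T A K) y) (fob (CA T A L) y) (app (pj T (CA T A K) (CA T A L) y) \<phi>) (app (fhom (CA T A K) x y) t)"
proof -
  note [simp] = algD[OF CA_simps(1)[OF \<open>Th T\<close> \<open>alg T A\<close> \<open>K \<in> J\<close>] \<open>Th T\<close>] algD[OF CA_simps(1)[OF \<open>Th T\<close> \<open>alg T A\<close> \<open>L \<in> J\<close>] \<open>Th T\<close>]
  show "fhom (RD T A) (x, K) (y, L) \<in> Arr V"
    "Dom V (fhom (RD T A) (x, K) (y, L)) = vhom (tcat T) x y \<otimes> eo T (CA T A K) (CA T A L)"
    "Cod V (fhom (RD T A) (x, K) (y, L)) = vhom C (fob (CA T A K) x) (fob (CA T A L) y)"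
    "\<lbrakk>elt t; ty t = vhom (tcat T) x y; elt \<phi>; ty \<phi> = eo T (CA T A K) (CA T A L); dj t \<phi>; dj \<phi> t\<rbrakk> \<Longrightarrow>
      app (fhom (RD T A) (x, K) (y, L)) (pr t \<phi>)
        = cmp C (fob (CA T A K) x) (fob (CA T A K) y) (fob (CA T A L) y) (app (pj T (CA T A K) (CA T A L) y) \<phi>) (app (fhom (CA T A K) x y) t)"
    by (simp_all add: RD_def)
qed

lemma vfunctor_RD:
  assumes [simp]: "Th T" "alg T A"
  shows "vfunctor V (vtensor V (tcat T) (CC T A)) C (RD T A)"
proof (rule vfunctorI2)
  show "vfun_ext (vob (tcat T) \<times> vob (CC T A)) (RD T A)" by (simp add: vfun_ext_def RD_def)
next
  fix x k assume "x \<in> vob (tcat T)" "k \<in> vob (CC T A)"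
  then have [simp]: "x \<in> J" "k \<in> J" by simp_all
  note [simp] = algD[OF CA_simps(1)[OF \<open>Th T\<close> \<open>alg T A\<close> \<open>k \<in> J\<close>] \<open>Th T\<close>]
  show "fob (RD T A) (x, k) \<in> vob C" by simp
  show "app (fhom (RD T A) (x, k) (x, k)) (pr (gl (vid (tcat T) x)) (gl (vid (CC T A) k))) = gl (vid C (fob (RD T A) (x, k)))"
    by (simp add: RD_fhom(4))
next
  fix x y k l assume "x \<in> vob (tcat T)" "y \<in> vob (tcat T)" "k \<in> vob (CC T A)" "l \<in> vob (CC T A)"
  then show "fhom (RD T A) (x, k) (y, l) \<in> Hom V (vhom (tcat T) x y \<otimes> vhom (CC T A) k l) (vhom C (fob (RD T A) (x, k)) (fob (RD T A) (y, l)))"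
    by (simp add: in_Hom RD_fhom)
next
  fix x y z k l m a b a' b' assume o: "x \<in> vob (tcat T)" "y \<in> vob (tcat T)" "z \<in> vob (tcat T)" "k \<in> vob (CC T A)" "l \<in> vob (CC T A)" "m \<in> vob (CC T A)"
    and [simp]: "elt a" "elt b" "elt a'" "elt b'" "ty a = vhom (tcat T) x y" "ty b = vhom (tcat T) y z"
    and t: "ty a' = vhom (CC T A) k l" "ty b' = vhom (CC T A) l m"
    and [simp]: "dj a b" "dj b a" "dj a a'" "dj a' a" "dj a b'" "dj b' a" "dj b a'" "dj a' b" "dj b b'" "dj b' b" "dj a' b'" "dj b' a'"
  have [simp]: "x \<in> J" "y \<in> J" "z \<in> J" "k \<in> J" "l \<in> J" "m \<in> J" using o by simp_all
  have [simp]: "ty a' = eo T (CA T A k) (CA T A l)" "ty b' = eo T (CA T A l) (CA T A m)" using t by simp_all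
  note [simp] = algD[OF CA_simps(1)[OF \<open>Th T\<close> \<open>alg T A\<close> \<open>k \<in> J\<close>] \<open>Th T\<close>]
    algD[OF CA_simps(1)[OF \<open>Th T\<close> \<open>alg T A\<close> \<open>l \<in> J\<close>] \<open>Th T\<close>] algD[OF CA_simps(1)[OF \<open>Th T\<close> \<open>alg T A\<close> \<open>m \<in> J\<close>] \<open>Th T\<close>]
  let ?k = "fob (CA T A k)" and ?l = "fob (CA T A l)" and ?m = "fob (CA T A m)"
  \<comment> \<open>Naturality of the transformation \<open>a'\<close> at \<open>b\<close>: the one
    point where the two variables have to be exchanged.\<close>
  have n: "cmp C (?k x) (?k y) (?l z) (cmp C (?k y) (?k z) (?l z) (app (pj T (CA T A k) (CA T A l) z) a') (app (fhom (CA T A k) y z) b)) w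
     = cmp C (?k x) (?k y) (?l z) (cmp C (?k y) (?l y) (?l z) (app (fhom (CA T A l) y z) b) (app (pj T (CA T A k) (CA T A l) y) a')) w" for w
    by (subst end_nat) auto
  show "app (fhom (RD T A) (x, k) (z, m)) (pr (cmp (tcat T) x y z b a) (cmp (CC T A) k l m b' a'))
        = cmp C (fob (RD T A) (x, k)) (fob (RD T A) (y, l)) (fob (RD T A) (z, m))
          (app (fhom (RD T A) (y, l) (z, m)) (pr b b')) (app (fhom (RD T A) (x, k) (y, l)) (pr a a'))"
    using n[of "app (fhom (CA T A k) x y) a"] by (simp add: RD_fhom)
qed auto

lemma fix_right_RD:
  assumes [simp]: "Th T" "alg T A" "K \<in> J"
  shows "fix_right V (tcat T) (CC T A) (RD T A) K = CA T A K"
proof (rule vfun_eqI)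
  note [simp] = algD[OF CA_simps(1)[OF \<open>Th T\<close> \<open>alg T A\<close> \<open>K \<in> J\<close>] \<open>Th T\<close>]
  note F = fix_fhom[OF vfunctor_RD[OF \<open>Th T\<close> \<open>alg T A\<close>], simplified]
  show "vfun_ext J (CA T A K)" using vfunctor_ext[OF alg_fun(1)[OF CA_simps(1)[OF \<open>Th T\<close> \<open>alg T A\<close> \<open>K \<in> J\<close>]]] by simp
  show "vfun_ext J (fix_right V (tcat T) (CC T A) (RD T A) K)" using fix_ext(1)[of "tcat T"] by simp
  fix x assume x [simp]: "x \<in> J"
  then show "fob (fix_right V (tcat T) (CC T A) (RD T A) K) x = fob (CA T A K) x" by simp
  fix y assume [simp]: "y \<in> J"
  show "fhom (fix_right V (tcat T) (CC T A) (RD T A) K) x y = fhom (CA T A K) x y"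
    by (rule arr_eqI[of _ _ "vhom (tcat T) x y"]) (auto simp: F RD_fhom)
qed

lemma fix_left_RD_fhom:
  assumes [simp]: "Th T" "alg T A" "x \<in> J" "K \<in> J" "L \<in> J"
  shows "fhom (fix_left V (tcat T) (CC T A) (RD T A) x) K L = pj T (CA T A K) (CA T A L) x"
proof -
  note [simp] = algD[OF CA_simps(1)[OF \<open>Th T\<close> \<open>alg T A\<close> \<open>K \<in> J\<close>] \<open>Th T\<close>] algD[OF CA_simps(1)[OF \<open>Th T\<close> \<open>alg T A\<close> \<open>L \<in> J\<close>] \<open>Th T\<close>]
  note F = fix_fhom[OF vfunctor_RD[OF \<open>Th T\<close> \<open>alg T A\<close>], simplified]
  show ?thesis
    by (rule arr_eqI[of _ _ "eo T (CA T A K) (CA T A L)"]) (auto simp: F RD_fhom)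
qed

text \<open>In the first variable \<open>RD T A\<close> is the algebra \<open>[K, A]\<close>. In the
  second its counits are those of \<open>[K, A](x)\<close> over \<open>A(x)\<close>, so
  \<open>CA_pointwise\<close> provides what \<open>preserves_cotensors_theory\<close> asks
  for.\<close>

lemma is_bialgebra_RD:
  assumes [simp]: "Th T" "alg T A"
  shows "is_bialgebra V J C T (CT T A) (RD T A)"
proof -
  have "preserves_cotensors V J (tcat T) C (fix_right V (tcat T) (CC T A) (RD T A) K)" if [simp]: "K \<in> J" for K
    using alg_fun(2)[OF CA_simps(1)[OF assms that]] by (simp add: fix_right_RD)
  moreover have "preserves_cotensors V J (CC T A) C (fix_left V (tcat T) (CC T A) (RD T A) x)" if [simp]: "x \<in> J" for x
  proof -
    have "preserves_cotensors V J (tcat (CT T A)) C (fix_left V (tcat T) (CC T A) (RD T A) x)"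
    proof (rule preserves_cotensors_theory)
      show "vfunctor V (tcat (CT T A)) C (fix_left V (tcat T) (CC T A) (RD T A) x)"
        using vfunctor_fix(2)[OF vfunctor_RD[OF assms]] by simp
    next
      fix X assume [simp]: "X \<in> J"
      show "is_cotensor V C X (fob (fix_left V (tcat T) (CC T A) (RD T A) x) \<one>) (fob (fix_left V (tcat T) (CC T A) (RD T A) x) X)
        (fhom (fix_left V (tcat T) (CC T A) (RD T A) x) X \<one> \<cdot> gam (CT T A) X)"
        using CA_pointwise[of T A X x] by (simp add: fix_left_RD_fhom)
    qed auto
    then show ?thesis by simp
  qed
  ultimately show ?thesis using vfunctor_RD[OF assms] by (simp add: is_bialgebra_def)
qed

text \<open>Equality on objects relies on \<open>[K, A](\<one>)\<close> being the designated
  \<open>[K, A(\<one>)]\<close>; on homs both sides are the projection of the end at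
  \<open>\<one>\<close>.\<close>

lemma fix_left_RD:
  assumes [simp]: "Th T" "alg T A"
  shows "fix_left V (tcat T) (CC T A) (RD T A) \<one> = CG T A"
proof (rule vfun_eqI)
  show "vfun_ext J (fix_left V (tcat T) (CC T A) (RD T A) \<one>)" using fix_ext(2)[of "CC T A"] by simp
  show "vfun_ext J (CG T A)" by (simp add: vfun_ext_def commutant_algebra_def)
qed (auto simp: fix_left_RD_fhom commutant_algebra_def)

end

section \<open>Morphisms of algebras and of bifold algebras\<close>

context symmetric_monoidal_closed
begin

definition ciso :: "('v, 'm, 'c) vcat \<Rightarrow> 'c \<Rightarrow> 'c \<Rightarrow> 'm \<Rightarrow> bool" where
  "ciso C x y f \<longleftrightarrow> f \<in> Hom V \<one> (vhom C x y) \<and> (\<exists>g. g \<in> Hom V \<one> (vhom C y x) \<and>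
     cmp C x y x (gl g) (gl f) = gl (vid C x) \<and> cmp C y x y (gl f) (gl g) = gl (vid C y))"

lemma ciso_arr:
  assumes "ciso C x y f"
  shows "f \<in> Arr V" "Dom V f = \<one>" "Cod V f = vhom C x y"
  using assms by (auto simp: ciso_def in_Hom)

lemma ucomp_eqI:
  assumes "cmp C x y z (gl g) (gl f) = gl h" "vcategory V C" "x \<in> vob C" "y \<in> vob C" "z \<in> vob C"
    "f \<in> Arr V" "Dom V f = \<one>" "Cod V f = vhom C x y" "g \<in> Arr V" "Dom V g = \<one>" "Cod V g = vhom C y z"
  shows "ucomp V C x y z g f = h"
  by (rule arr_eqI0) (use assms in \<open>simp del: gl_eq\<close>)

lemma uinv:
  assumes f: "ciso C x y f" and [simp]: "vcategory V C" "x \<in> vob C" "y \<in> vob C"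
  shows "uinv V C x y f \<in> Arr V" "Dom V (uinv V C x y f) = \<one>" "Cod V (uinv V C x y f) = vhom C y x"
    "cmp C x y x (gl (uinv V C x y f)) (gl f) = gl (vid C x)"
    "cmp C y x y (gl f) (gl (uinv V C x y f)) = gl (vid C y)"
    "\<And>g. \<lbrakk>g \<in> Arr V; Dom V g = \<one>; Cod V g = vhom C y x; cmp C x y x (gl g) (gl f) = gl (vid C x)\<rbrakk> \<Longrightarrow> uinv V C x y f = g"
    "ciso C y x (uinv V C x y f)"
proof -
  note [simp] = ciso_arr[OF f]
  obtain g where g [simp]: "g \<in> Arr V" "Dom V g = \<one>" "Cod V g = vhom C y x"
    and e: "cmp C x y x (gl g) (gl f) = gl (vid C x)" "cmp C y x y (gl f) (gl g) = gl (vid C y)"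
    using f unfolding ciso_def in_Hom by blast
  \<comment> \<open>A left inverse of \<open>f\<close> already equals \<open>g\<close>. This gives
    both the value of \<open>uinv\<close> and its characterisation by one equation.\<close>
  have u: "h = g" if [simp]: "h \<in> Arr V" "Dom V h = \<one>" "Cod V h = vhom C y x" and h: "cmp C x y x (gl h) (gl f) = gl (vid C x)" for h
  proof (rule arr_eqI0)
    have "gl h = cmp C y y x (gl h) (gl (vid C y))" by simp
    also have "\<dots> = cmp C y y x (gl h) (cmp C y x y (gl f) (gl g))" by (simp only: e)
    also have "\<dots> = cmp C y x x (cmp C x y x (gl h) (gl f)) (gl g)" by (subst cmp_assoc) simp_all
    also have "\<dots> = gl g" by (simp only: h) simp
    finally show "gl h = gl g" .
  qed
  have "uinv V C x y f = g"
    unfolding uinv_def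
  proof (rule the_equality)
    have "ucomp V C x y x g f = vid C x" "ucomp V C y x y f g = vid C y"
      by (rule ucomp_eqI; simp add: e del: gl_eq)+
    then show "g \<in> Hom V \<one> (vhom C y x) \<and> ucomp V C x y x g f = vid C x \<and> ucomp V C y x y f g = vid C y"
      by (simp add: in_Hom)
    fix h assume h: "h \<in> Hom V \<one> (vhom C y x) \<and> ucomp V C x y x h f = vid C x \<and> ucomp V C y x y f h = vid C y"
    then have [simp]: "h \<in> Arr V" "Dom V h = \<one>" "Cod V h = vhom C y x" by (auto simp: in_Hom)
    have "gl (ucomp V C x y x h f) = gl (vid C x)" using h by simp
    then show "h = g" by (intro u) (simp_all del: gl_eq)
  qed
  then show "uinv V C x y f \<in> Arr V" "Dom V (uinv V C x y f) = \<one>" "Cod V (uinv V C x y f) = vhom C y x"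
    "cmp C x y x (gl (uinv V C x y f)) (gl f) = gl (vid C x)"
    "cmp C y x y (gl f) (gl (uinv V C x y f)) = gl (vid C y)"
    "\<And>g. \<lbrakk>g \<in> Arr V; Dom V g = \<one>; Cod V g = vhom C y x; cmp C x y x (gl g) (gl f) = gl (vid C x)\<rbrakk> \<Longrightarrow> uinv V C x y f = g"
    "ciso C y x (uinv V C x y f)"
    using e u by (auto simp: ciso_def in_Hom intro!: exI[of _ f])
qed

lemma uinv_cancel:
  assumes f: "ciso C x y f" and [simp]: "vcategory V C" "w \<in> vob C" "x \<in> vob C" "y \<in> vob C" "elt a"
  shows "ty a = vhom C w x \<Longrightarrow> cmp C w y x (gl (uinv V C x y f)) (cmp C w x y (gl f) a) = a"
    "ty a = vhom C w y \<Longrightarrow> cmp C w x y (gl f) (cmp C w y x (gl (uinv V C x y f)) a) = a"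
proof -
  note [simp] = uinv(1-5)[OF f] ciso_arr[OF f]
  show "cmp C w y x (gl (uinv V C x y f)) (cmp C w x y (gl f) a) = a" if [simp]: "ty a = vhom C w x"
    by (subst cmp_assoc[symmetric]) auto
  show "cmp C w x y (gl f) (cmp C w y x (gl (uinv V C x y f)) a) = a" if [simp]: "ty a = vhom C w y"
    by (subst cmp_assoc[symmetric]) auto
qed

lemma ciso_id [simp]: "vcategory V C \<Longrightarrow> x \<in> vob C \<Longrightarrow> ciso C x x (vid C x)"
  by (auto simp: ciso_def in_Hom intro!: exI[of _ "vid C x"])

lemma ciso_comp:
  assumes f: "ciso C x y f" and g: "ciso C y z g" and [simp]: "vcategory V C" "x \<in> vob C" "y \<in> vob C" "z \<in> vob C"
  shows "ciso C x z (ucomp V C x y z g f)"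
    "uinv V C x z (ucomp V C x y z g f) = ucomp V C z y x (uinv V C x y f) (uinv V C y z g)"
proof -
  note [simp] = uinv(1-5)[OF f] uinv(1-5)[OF g] ciso_arr[OF f] ciso_arr[OF g]
  note [simp] = uinv_cancel[OF f] uinv_cancel[OF g]
  let ?h = "ucomp V C z y x (uinv V C x y f) (uinv V C y z g)"
  have e: "cmp C x z x (gl ?h) (gl (ucomp V C x y z g f)) = gl (vid C x)"
    "cmp C z x z (gl (ucomp V C x y z g f)) (gl ?h) = gl (vid C z)"
    by simp_all
  then show c: "ciso C x z (ucomp V C x y z g f)"
    unfolding ciso_def in_Hom by (intro conjI exI[of _ ?h]) simp_all
  show "uinv V C x z (ucomp V C x y z g f) = ?h"
    by (rule uinv(6)[OF c]) (use e(1) in simp_all)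
qed

lemma uinv_uinv:
  assumes f: "ciso C x y f" and [simp]: "vcategory V C" "x \<in> vob C" "y \<in> vob C"
  shows "uinv V C y x (uinv V C x y f) = f"
  by (rule uinv(6)[OF uinv(7)[OF f]]) (use uinv(1-5)[OF f] ciso_arr[OF f] in simp_all)

lemma uinv_id: "vcategory V C \<Longrightarrow> x \<in> vob C \<Longrightarrow> uinv V C x x (vid C x) = vid C x"
  by (rule uinv(6)) auto

text \<open>Inverses of the components of a natural transformation are natural again, so the inverse
  demanded by \<open>vnat_iso\<close> reduces to a condition on each component.\<close>

lemma vnat_iso_iff:
  assumes F: "vfunctor V B C F" and G: "vfunctor V B C G" and B [simp]: "vcategory V B" and C [simp]: "vcategory V C"
  shows "vnat_iso V B C F G \<alpha> \<longleftrightarrow> \<alpha> \<in> extensional (vob B) \<and> (\<forall>x \<in> vob B. ciso C (fob F x) (fob G x) (\<alpha> x)) \<and>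
    (\<forall>x \<in> vob B. \<forall>y \<in> vob B. \<forall>a. elt a \<longrightarrow> ty a = vhom B x y \<longrightarrow>
      cmp C (fob F x) (fob F y) (fob G y) (gl (\<alpha> y)) (app (fhom F x y) a)
        = cmp C (fob F x) (fob G x) (fob G y) (app (fhom G x y) a) (gl (\<alpha> x)))" (is "?l \<longleftrightarrow> ?r")
proof
  note [simp] = vfunD[OF F B C] vfunD[OF G B C]
  {
    assume ?l
    then obtain \<beta> where a: "vnat V B C F G \<alpha>" and b: "vnat V B C G F \<beta>" and e: "\<forall>x \<in> vob B.
        ucomp V C (fob F x) (fob G x) (fob F x) (\<beta> x) (\<alpha> x) = vid C (fob F x) \<and>
        ucomp V C (fob G x) (fob F x) (fob G x) (\<alpha> x) (\<beta> x) = vid C (fob G x)"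
      unfolding vnat_iso_def by blast
    note A [simp] = vnatD[OF a F G B C] and [simp] = vnatD(1-3)[OF b G F B C]
    have "ciso C (fob F x) (fob G x) (\<alpha> x)" if [simp]: "x \<in> vob B" for x
    proof -
      have "gl (ucomp V C (fob F x) (fob G x) (fob F x) (\<beta> x) (\<alpha> x)) = gl (vid C (fob F x))"
        "gl (ucomp V C (fob G x) (fob F x) (fob G x) (\<alpha> x) (\<beta> x)) = gl (vid C (fob G x))"
        using e that by auto
      then show ?thesis unfolding ciso_def in_Hom by (intro conjI exI[of _ "\<beta> x"]) (simp_all del: gl_eq)
    qed
    then show ?r using a by (auto simp: vnat_def)
  next
    assume r: ?r
    then have c: "ciso C (fob F x) (fob G x) (\<alpha> x)" if "x \<in> vob B" for x using that by blast
    have n: "cmp C (fob F x) (fob F y) (fob G y) (gl (\<alpha> y)) (app (fhom F x y) a)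
        = cmp C (fob F x) (fob G x) (fob G y) (app (fhom G x y) a) (gl (\<alpha> x))"
      if "x \<in> vob B" "y \<in> vob B" "elt a" "ty a = vhom B x y" for x y a using r that by blast
    note [simp] = ciso_arr[OF c]
    let ?\<beta> = "\<lambda>x \<in> vob B. uinv V C (fob F x) (fob G x) (\<alpha> x)"
    have [simp]: "uinv V C (fob F x) (fob G x) (\<alpha> x) \<in> Arr V" "Dom V (uinv V C (fob F x) (fob G x) (\<alpha> x)) = \<one>"
      "Cod V (uinv V C (fob F x) (fob G x) (\<alpha> x)) = vhom C (fob G x) (fob F x)"
      "cmp C (fob F x) (fob G x) (fob F x) (gl (uinv V C (fob F x) (fob G x) (\<alpha> x))) (gl (\<alpha> x)) = gl (vid C (fob F x))"
      "cmp C (fob G x) (fob F x) (fob G x) (gl (\<alpha> x)) (gl (uinv V C (fob F x) (fob G x) (\<alpha> x))) = gl (vid C (fob G x))"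
      if "x \<in> vob B" for x using uinv(1-5)[OF c[OF that]] that by auto
    have a: "vnat V B C F G \<alpha>"
      by (rule vnatI[OF F G B C]) (use r n in \<open>auto simp: in_Hom\<close>)
    have b: "vnat V B C G F ?\<beta>"
    proof (rule vnatI[OF G F B C])
      fix x y a assume [simp]: "x \<in> vob B" "y \<in> vob B" "elt a" "ty a = vhom B x y"
      let ?Fx = "fob F x" and ?Fy = "fob F y" and ?Gx = "fob G x" and ?Gy = "fob G y"
      let ?bx = "gl (uinv V C ?Fx ?Gx (\<alpha> x))" and ?by = "gl (uinv V C ?Fy ?Gy (\<alpha> y))"
      have "cmp C ?Gx ?Gy ?Fy ?by (app (fhom G x y) a)
        = cmp C ?Gx ?Gy ?Fy ?by (cmp C ?Gx ?Gx ?Gy (app (fhom G x y) a) (cmp C ?Gx ?Fx ?Gx (gl (\<alpha> x)) ?bx))"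
        by simp
      also have "\<dots> = cmp C ?Gx ?Gy ?Fy ?by (cmp C ?Gx ?Fx ?Gy (cmp C ?Fx ?Gx ?Gy (app (fhom G x y) a) (gl (\<alpha> x))) ?bx)"
        by (subst cmp_assoc) simp_all
      also have "\<dots> = cmp C ?Gx ?Gy ?Fy ?by (cmp C ?Gx ?Fx ?Gy (cmp C ?Fx ?Fy ?Gy (gl (\<alpha> y)) (app (fhom F x y) a)) ?bx)"
        by (subst n) simp_all
      also have "\<dots> = cmp C ?Gx ?Fx ?Fy (app (fhom F x y) a) ?bx"
        using uinv_cancel(1)[OF c[of y], of ?Gx "cmp C ?Gx ?Fx ?Fy (app (fhom F x y) a) ?bx"] by simp
      finally show "cmp C ?Gx ?Gy ?Fy (gl (?\<beta> y)) (app (fhom G x y) a) = cmp C ?Gx ?Fx ?Fy (app (fhom F x y) a) (gl (?\<beta> x))"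
        by simp
    qed (auto simp: in_Hom)
    have "ucomp V C (fob F x) (fob G x) (fob F x) (?\<beta> x) (\<alpha> x) = vid C (fob F x)"
      "ucomp V C (fob G x) (fob F x) (fob G x) (\<alpha> x) (?\<beta> x) = vid C (fob G x)"
      if "x \<in> vob B" for x using that by (intro ucomp_eqI; simp del: gl_eq)+
    then show ?l unfolding vnat_iso_def using a b by (intro conjI exI[of _ ?\<beta>]) auto
  }
qed

lemma comp_vfun_assoc:
  assumes F: "vfunctor V A B F" and G: "vfunctor V B C G" and H: "vfunctor V C D H"
    and [simp]: "vcategory V A" "vcategory V B" "vcategory V C" "vcategory V D"
  shows "comp_vfun V A (comp_vfun V B H G) F = comp_vfun V A H (comp_vfun V A G F)"
proof (rule vfun_eqI)
  note [simp] = vfunD[OF F] vfunD[OF G] vfunD[OF H]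
  fix x y assume "x \<in> vob A" "y \<in> vob A"
  then show "fob (comp_vfun V A (comp_vfun V B H G) F) x = fob (comp_vfun V A H (comp_vfun V A G F)) x"
    "fhom (comp_vfun V A (comp_vfun V B H G) F) x y = fhom (comp_vfun V A H (comp_vfun V A G F)) x y"
    by simp_all
qed simp_all

lemma comp_vfun_id:
  assumes F: "vfunctor V A B F" and [simp]: "vcategory V A" "vcategory V B"
  shows "comp_vfun V A F (id_vfun V A) = F" "comp_vfun V A (id_vfun V B) F = F"
proof -
  note [simp] = vfunD[OF F] vfunctor_ext[OF F]
  show "comp_vfun V A F (id_vfun V A) = F" by (rule vfun_eqI[of "vob A"]) simp_all
  show "comp_vfun V A (id_vfun V B) F = F" by (rule vfun_eqI[of "vob A"]) simp_all
qed

end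

section \<open>Morphisms of theories and strong morphisms of algebras\<close>

context admissible
begin

abbreviation tmor :: "('v, 'm) jtheory \<Rightarrow> ('v, 'm) jtheory \<Rightarrow> ('m, 'v, 'v) vfun \<Rightarrow> bool" where
  "tmor \<equiv> jtheory_mor V J"

lemma tmorD:
  assumes M: "tmor T U M" and T: "Th T" and U: "Th U"
  shows "vfunctor V (tcat T) (tcat U) M" "\<And>x. x \<in> J \<Longrightarrow> fob M x = x"
    "\<And>x y. x \<in> J \<Longrightarrow> y \<in> J \<Longrightarrow> fhom M x y \<in> Arr V"
    "\<And>x y. x \<in> J \<Longrightarrow> y \<in> J \<Longrightarrow> Dom V (fhom M x y) = vhom (tcat T) x y"
    "\<And>x y. x \<in> J \<Longrightarrow> y \<in> J \<Longrightarrow> Cod V (fhom M x y) = vhom (tcat U) x y"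
    "\<And>x. x \<in> J \<Longrightarrow> fhom M x x \<cdot> vid (tcat T) x = vid (tcat U) x"
    "\<And>x y z a b. \<lbrakk>x \<in> J; y \<in> J; z \<in> J; elt a; elt b; ty a = vhom (tcat T) x y; ty b = vhom (tcat T) y z; dj b a\<rbrakk> \<Longrightarrow>
      app (fhom M x z) (cmp (tcat T) x y z b a) = cmp (tcat U) x y z (app (fhom M y z) b) (app (fhom M x y) a)"
    "\<And>x y. x \<in> J \<Longrightarrow> y \<in> J \<Longrightarrow> fhom M x y \<cdot> fhom (tstr T) x y = fhom (tstr U) x y"
    "\<And>x. x \<in> J \<Longrightarrow> fhom M x \<one> \<cdot> gam T x = gam U x"
proof -
  note [simp] = Th_simps[OF T] Th_simps[OF U] tstr_simps[OF T] tstr_simps[OF U]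
  show F: "vfunctor V (tcat T) (tcat U) M" and e: "\<And>x. x \<in> J \<Longrightarrow> fob M x = x"
  proof -
    show "vfunctor V (tcat T) (tcat U) M" using M by (simp add: jtheory_mor_def)
    fix x assume x: "x \<in> J"
    have "fob (comp_vfun V JO M (tstr T)) x = fob (tstr U) x" using M by (simp add: jtheory_mor_def)
    then show "fob M x = x" using x by simp
  qed
  note [simp] = e vfunD[OF F, simplified]
  show "\<And>x y. x \<in> J \<Longrightarrow> y \<in> J \<Longrightarrow> fhom M x y \<in> Arr V"
    "\<And>x y. x \<in> J \<Longrightarrow> y \<in> J \<Longrightarrow> Dom V (fhom M x y) = vhom (tcat T) x y"
    "\<And>x y. x \<in> J \<Longrightarrow> y \<in> J \<Longrightarrow> Cod V (fhom M x y) = vhom (tcat U) x y"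
    "\<And>x. x \<in> J \<Longrightarrow> fhom M x x \<cdot> vid (tcat T) x = vid (tcat U) x"
    "\<And>x y z a b. \<lbrakk>x \<in> J; y \<in> J; z \<in> J; elt a; elt b; ty a = vhom (tcat T) x y; ty b = vhom (tcat T) y z; dj b a\<rbrakk> \<Longrightarrow>
      app (fhom M x z) (cmp (tcat T) x y z b a) = cmp (tcat U) x y z (app (fhom M y z) b) (app (fhom M x y) a)"
    by simp_all
  show s: "fhom M x y \<cdot> fhom (tstr T) x y = fhom (tstr U) x y" if x: "x \<in> J" "y \<in> J" for x y
  proof -
    have "fhom (comp_vfun V JO M (tstr T)) x y = fhom (tstr U) x y" using M by (simp add: jtheory_mor_def)
    then show ?thesis using x by simp
  qed
  show "fhom M x \<one> \<cdot> gam T x = gam U x" if [simp]: "x \<in> J" for x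
    by (simp add: gam_def flip: s)
qed

text \<open>Compatibility with the counits is enough. After composing with \<open>gam U Y\<close>,
  which can be cancelled, both structure arrows reduce by \<open>gam_tstr\<close> to the counit at
  \<open>X\<close>.\<close>

lemma tmorI:
  assumes T: "Th T" and U: "Th U" and F: "vfunctor V (tcat T) (tcat U) M" and o: "\<And>x. x \<in> J \<Longrightarrow> fob M x = x"
    and g: "\<And>x. x \<in> J \<Longrightarrow> fhom M x \<one> \<cdot> gam T x = gam U x"
  shows "tmor T U M"
proof -
  note [simp] = Th_simps[OF T] Th_simps[OF U] tstr_simps[OF T] tstr_simps[OF U] o T U
  note [simp] = vfunD[OF F, simplified]
  have "comp_vfun V JO M (tstr T) = tstr U"
  proof (rule vfun_eqI)
    show "vfun_ext J (comp_vfun V JO M (tstr T))" using vfun_ext_simps(1)[of JO] by simp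
    show "vfun_ext J (tstr U)" using vfunctor_ext[OF jtheoryD(3)[OF U]] by simp
    fix X Y assume [simp]: "X \<in> J" "Y \<in> J"
    show "fob (comp_vfun V JO M (tstr T)) X = fob (tstr U) X" by simp
    have "fhom M X Y \<cdot> fhom (tstr T) X Y = fhom (tstr U) X Y"
    proof (rule arr_eqI[of _ _ "Ihom V Y X"])
      fix f assume [simp]: "elt f" "ty f = Ihom V Y X"
      obtain y where [simp]: "generic y" "elt y" "ty y = Y" "dj y f" "dj f y" using fresh[of f f Y] by auto
      have g': "app (gam U Z) z = app (fhom M Z \<one>) (app (gam T Z) z)" if "Z \<in> J" "elt z" "ty z = Z" for Z z
        using that by (simp flip: g)
      show "app (fhom M X Y \<cdot> fhom (tstr T) X Y) f = app (fhom (tstr U) X Y) f"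
      proof (rule cot_eq[OF gam_cot[OF U \<open>Y \<in> J\<close>], where k = y])
        have "cmp (tcat U) X Y \<one> (app (gam U Y) y) (app (fhom M X Y \<cdot> fhom (tstr T) X Y) f)
          = app (fhom M X \<one>) (cmp (tcat T) X Y \<one> (app (gam T Y) y) (app (fhom (tstr T) X Y) f))"
          by (simp add: g')
        also have "\<dots> = app (fhom M X \<one>) (app (gam T X) (app (Ev V Y X) (pr f y)))"
          by (subst gam_tstr) auto
        also have "\<dots> = cmp (tcat U) X Y \<one> (app (gam U Y) y) (app (fhom (tstr U) X Y) f)"
          by (subst gam_tstr) (auto simp: g')
        finally show "cmp (tcat U) X Y \<one> (app (gam U Y) y) (app (fhom M X Y \<cdot> fhom (tstr T) X Y) f)
          = cmp (tcat U) X Y \<one> (app (gam U Y) y) (app (fhom (tstr U) X Y) f)" .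
      qed auto
    qed auto
    then show "fhom (comp_vfun V JO M (tstr T)) X Y = fhom (tstr U) X Y" by simp
  qed
  then show ?thesis using F by (simp add: jtheory_mor_def)
qed

lemma tmor_id: "Th T \<Longrightarrow> tmor T T (id_vfun V (tcat T))"
  by (rule tmorI) (simp_all add: vfunctor_id)

lemma tmor_comp:
  assumes M: "tmor T U M" and N: "tmor U W N" and [simp]: "Th T" "Th U" "Th W"
  shows "tmor T W (comp_vfun V (tcat T) N M)"
proof -
  note [simp] = tmorD(2-9)[OF M] tmorD(2-9)[OF N]
  show ?thesis
    by (rule tmorI) (simp_all add: vfunctor_comp[OF tmorD(1)[OF M] tmorD(1)[OF N]])
qed

lemma tmor_ext: "tmor T U M \<Longrightarrow> Th T \<Longrightarrow> vfun_ext J M"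
  using vfunctor_ext[of V "tcat T"] by (auto simp: jtheory_mor_def)

text \<open>\<open>strong_mor\<close> with naturality on elements. Morphisms of theories are the
  identity on objects, so \<open>fob M x\<close> is replaced by \<open>x\<close>, which keeps the
  types of composable arrows syntactically equal.\<close>

definition smor :: "('v, 'm) jtheory \<Rightarrow> ('m, 'v, 'c) vfun \<Rightarrow> ('v, 'm) jtheory \<Rightarrow> ('m, 'v, 'c) vfun \<Rightarrow>
    ('m, 'v, 'v) vfun \<Rightarrow> ('v \<Rightarrow> 'm) \<Rightarrow> bool" where
  "smor T A U B M f \<longleftrightarrow> tmor T U M \<and> f \<in> extensional J \<and> (\<forall>x \<in> J. ciso C (fob A x) (fob B x) (f x)) \<and>
    (\<forall>x \<in> J. \<forall>y \<in> J. \<forall>a. elt a \<longrightarrow> ty a = vhom (tcat T) x y \<longrightarrow>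
      cmp C (fob A x) (fob A y) (fob B y) (gl (f y)) (app (fhom A x y) a)
        = cmp C (fob A x) (fob B x) (fob B y) (app (fhom B x y) (app (fhom M x y) a)) (gl (f x)))"

lemma strong_mor_iff:
  assumes [simp]: "Th T" "alg T A" "Th U" "alg U B"
  shows "strong_mor V J C (T, A) (U, B) (M, f) \<longleftrightarrow> smor T A U B M f"
proof (cases "tmor T U M")
  case True
  note [simp] = tmorD(2-9)[OF True] algD[OF \<open>alg T A\<close> \<open>Th T\<close>] algD[OF \<open>alg U B\<close> \<open>Th U\<close>]
  have G: "vfunctor V (tcat T) C (comp_vfun V (tcat T) B M)"
    by (rule vfunctor_comp[OF tmorD(1)[OF True] alg_fun(1)]) auto
  show ?thesis
    using True unfolding strong_mor_def smor_def prod.case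
    by (simp add: vnat_iso_iff[OF alg_fun(1)[OF \<open>alg T A\<close>] G])
next
  case False
  then show ?thesis by (simp add: strong_mor_def smor_def)
qed

abbreviation FR where "FR T U D \<equiv> fix_right V (tcat T) (tcat U) D"
abbreviation FL where "FL T U D \<equiv> fix_left V (tcat T) (tcat U) D"
abbreviation balg where "balg \<equiv> is_bialgebra V J C"

lemma balgD:
  assumes D: "balg T U D" and [simp]: "Th T" "Th U"
  shows "vfunctor V (vtensor V (tcat T) (tcat U)) C D"
    "\<And>k. k \<in> J \<Longrightarrow> alg T (FR T U D k)" "\<And>x. x \<in> J \<Longrightarrow> alg U (FL T U D x)"
    "\<And>x k. x \<in> J \<Longrightarrow> fob (FR T U D k) x = fob D (x, k)" "\<And>x k. k \<in> J \<Longrightarrow> fob (FL T U D x) k = fob D (x, k)"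
    "\<And>x k. x \<in> J \<Longrightarrow> k \<in> J \<Longrightarrow> fob D (x, k) \<in> vob C"
    "\<And>x y k. \<lbrakk>x \<in> J; y \<in> J; k \<in> J\<rbrakk> \<Longrightarrow> fhom (FR T U D k) x y \<in> Arr V"
    "\<And>x y k. \<lbrakk>x \<in> J; y \<in> J; k \<in> J\<rbrakk> \<Longrightarrow> Dom V (fhom (FR T U D k) x y) = vhom (tcat T) x y"
    "\<And>x y k. \<lbrakk>x \<in> J; y \<in> J; k \<in> J\<rbrakk> \<Longrightarrow> Cod V (fhom (FR T U D k) x y) = vhom C (fob D (x, k)) (fob D (y, k))"
    "\<And>x k l. \<lbrakk>x \<in> J; k \<in> J; l \<in> J\<rbrakk> \<Longrightarrow> fhom (FL T U D x) k l \<in> Arr V"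
    "\<And>x k l. \<lbrakk>x \<in> J; k \<in> J; l \<in> J\<rbrakk> \<Longrightarrow> Dom V (fhom (FL T U D x) k l) = vhom (tcat U) k l"
    "\<And>x k l. \<lbrakk>x \<in> J; k \<in> J; l \<in> J\<rbrakk> \<Longrightarrow> Cod V (fhom (FL T U D x) k l) = vhom C (fob D (x, k)) (fob D (x, l))"
proof -
  show F: "vfunctor V (vtensor V (tcat T) (tcat U)) C D" using D by (simp add: is_bialgebra_def)
  show "\<And>k. k \<in> J \<Longrightarrow> alg T (FR T U D k)" "\<And>x. x \<in> J \<Longrightarrow> alg U (FL T U D x)"
    using D vfunctor_fix[OF F] by (simp_all add: is_bialgebra_def is_algebra_def)
qed (use fix_fhom(1-3,5-7)[OF is_bialgebra_def[THEN iffD1, OF D, THEN conjunct1]] vfunD2(1)[OF is_bialgebra_def[THEN iffD1, OF D, THEN conjunct1]] in simp_all)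

end

lemma vfun_tensor_simps [simp]:
  "x \<in> vob B \<Longrightarrow> x' \<in> vob C \<Longrightarrow> fob (vfun_tensor V B C F G) (x, x') = (fob F x, fob G x')"
  "\<lbrakk>x \<in> vob B; x' \<in> vob C; y \<in> vob B; y' \<in> vob C\<rbrakk> \<Longrightarrow>
    fhom (vfun_tensor V B C F G) (x, x') (y, y') = TenA V (fhom F x y) (fhom G x' y')"
  by (simp_all add: vfun_tensor_def)

context symmetric_monoidal_closed
begin

lemma vfunctor_comp_tensor:
  assumes F: "vfunctor V B B2 F" and G: "vfunctor V B' B2' G" and D: "vfunctor V (vtensor V B2 B2') C D"
    and [simp]: "vcategory V B" "vcategory V B'" "vcategory V B2" "vcategory V B2'" "vcategory V C"
  shows "vfunctor V (vtensor V B B') C (comp_vfun V (vtensor V B B') D (vfun_tensor V B B' F G))"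
proof -
  note [simp] = vfunD[OF F] vfunD[OF G] vfunD2[OF D]
  show ?thesis
  proof (rule vfunctorI2)
    show "vfun_ext (vob B \<times> vob B') (comp_vfun V (vtensor V B B') D (vfun_tensor V B B' F G))"
      using vfun_ext_simps(1)[of "vtensor V B B'"] by simp
  qed (simp_all add: in_Hom)
qed

text \<open>\<open>two_var_split\<close> factors a pair into one step in each variable, and the two
  naturality squares are pasted.\<close>

lemma nat_two_var:
  assumes D: "vfunctor V (vtensor V B B') C D" and E: "vfunctor V (vtensor V B B') C E"
    and B: "vcategory V B" and B': "vcategory V B'" and C: "vcategory V C"
    and \<alpha>: "\<And>x k. x \<in> vob B \<Longrightarrow> k \<in> vob B' \<Longrightarrow> \<alpha> (x, k) \<in> Arr V"
      "\<And>x k. x \<in> vob B \<Longrightarrow> k \<in> vob B' \<Longrightarrow> Dom V (\<alpha> (x, k)) = \<one>"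
      "\<And>x k. x \<in> vob B \<Longrightarrow> k \<in> vob B' \<Longrightarrow> Cod V (\<alpha> (x, k)) = vhom C (fob D (x, k)) (fob E (x, k))"
  shows "(\<forall>p \<in> vob B \<times> vob B'. \<forall>q \<in> vob B \<times> vob B'. \<forall>a. elt a \<longrightarrow> ty a = vhom (vtensor V B B') p q \<longrightarrow>
      cmp C (fob D p) (fob D q) (fob E q) (gl (\<alpha> q)) (app (fhom D p q) a)
        = cmp C (fob D p) (fob E p) (fob E q) (app (fhom E p q) a) (gl (\<alpha> p))) \<longleftrightarrow>
    (\<forall>x \<in> vob B. \<forall>y \<in> vob B. \<forall>k \<in> vob B'. \<forall>t. elt t \<longrightarrow> ty t = vhom B x y \<longrightarrow>
      cmp C (fob D (x, k)) (fob D (y, k)) (fob E (y, k)) (gl (\<alpha> (y, k))) (app (fhom (fix_right V B B' D k) x y) t)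
        = cmp C (fob D (x, k)) (fob E (x, k)) (fob E (y, k)) (app (fhom (fix_right V B B' E k) x y) t) (gl (\<alpha> (x, k)))) \<and>
    (\<forall>x \<in> vob B. \<forall>k \<in> vob B'. \<forall>l \<in> vob B'. \<forall>u. elt u \<longrightarrow> ty u = vhom B' k l \<longrightarrow>
      cmp C (fob D (x, k)) (fob D (x, l)) (fob E (x, l)) (gl (\<alpha> (x, l))) (app (fhom (fix_left V B B' D x) k l) u)
        = cmp C (fob D (x, k)) (fob E (x, k)) (fob E (x, l)) (app (fhom (fix_left V B B' E x) k l) u) (gl (\<alpha> (x, k))))"
    (is "?l \<longleftrightarrow> ?r \<and> ?s")
proof
  note [simp] = B B' C \<alpha> vfunD2(1-4)[OF D B B' C] vfunD2(1-4)[OF E B B' C]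
  note FD = fix_fhom[OF D B B' C] and FE = fix_fhom[OF E B B' C]
  {
    assume l: ?l
    show "?r \<and> ?s"
    proof (intro conjI ballI allI impI)
      fix x y k t assume "x \<in> vob B" "y \<in> vob B" "k \<in> vob B'" "elt t" "ty t = vhom B x y"
      then show "cmp C (fob D (x, k)) (fob D (y, k)) (fob E (y, k)) (gl (\<alpha> (y, k))) (app (fhom (fix_right V B B' D k) x y) t)
        = cmp C (fob D (x, k)) (fob E (x, k)) (fob E (y, k)) (app (fhom (fix_right V B B' E k) x y) t) (gl (\<alpha> (x, k)))"
        using l[rule_format, of "(x, k)" "(y, k)" "pr t (gl (vid B' k))"] by (simp add: FD FE)
    next
      fix x k l' u assume "x \<in> vob B" "k \<in> vob B'" "l' \<in> vob B'" "elt u" "ty u = vhom B' k l'"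
      then show "cmp C (fob D (x, k)) (fob D (x, l')) (fob E (x, l')) (gl (\<alpha> (x, l'))) (app (fhom (fix_left V B B' D x) k l') u)
        = cmp C (fob D (x, k)) (fob E (x, k)) (fob E (x, l')) (app (fhom (fix_left V B B' E x) k l') u) (gl (\<alpha> (x, k)))"
        using l[rule_format, of "(x, k)" "(x, l')" "pr (gl (vid B x)) u"] by (simp add: FD FE)
    qed
  next
    assume rs: "?r \<and> ?s"
    show ?l
    proof (intro ballI allI impI)
      fix p q a assume "p \<in> vob B \<times> vob B'" "q \<in> vob B \<times> vob B'" and a: "elt a" "ty a = vhom (vtensor V B B') p q"
      then obtain x k y l where [simp]: "p = (x, k)" "q = (y, l)" "x \<in> vob B" "k \<in> vob B'" "y \<in> vob B" "l \<in> vob B'"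
        by auto
      let ?Dp = "fob D (x, k)" and ?Dq = "fob D (y, l)" and ?Ep = "fob E (x, k)" and ?Eq = "fob E (y, l)"
      let ?Dm = "fob D (y, k)" and ?Em = "fob E (y, k)"
      \<comment> \<open>\<open>a\<close> need not be a pair, so the square is proved as an equation
        of arrows out of the tensor product and then applied to \<open>a\<close>.\<close>
      have "vcomp C ?Dp ?Dq ?Eq \<cdot> (\<alpha> (y, l) \<boxtimes> fhom D (x, k) (y, l)) \<cdot> inv_arr V (Lun V (vhom B x y \<otimes> vhom B' k l))
         = vcomp C ?Dp ?Ep ?Eq \<cdot> (fhom E (x, k) (y, l) \<boxtimes> \<alpha> (x, k)) \<cdot> inv_arr V (Run V (vhom B x y \<otimes> vhom B' k l))"
      proof (rule arr_eqI2[of _ _ "vhom B x y" "vhom B' k l"])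
        fix t u assume [simp]: "elt t" "elt u" "ty t = vhom B x y" "ty u = vhom B' k l" "dj t u" "dj u t"
        note sD = two_var_split(1)[OF D B B' C, of x y k l t u] and sE = two_var_split(1)[OF E B B' C, of x y k l t u]
        note [simp] = FD(1-3,5-7) FE(1-3,5-7)
        let ?Fu = "app (fhom (fix_left V B B' D y) k l) u" and ?Gu = "app (fhom (fix_left V B B' E y) k l) u"
        let ?Ft = "app (fhom (fix_right V B B' D k) x y) t" and ?Gt = "app (fhom (fix_right V B B' E k) x y) t"
        have "cmp C ?Dp ?Dq ?Eq (gl (\<alpha> (y, l))) (cmp C ?Dp ?Dm ?Dq ?Fu ?Ft)
          = cmp C ?Dp ?Dm ?Eq (cmp C ?Dm ?Dq ?Eq (gl (\<alpha> (y, l))) ?Fu) ?Ft" by simp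
        also have "\<dots> = cmp C ?Dp ?Dm ?Eq (cmp C ?Dm ?Em ?Eq ?Gu (gl (\<alpha> (y, k)))) ?Ft"
          using rs by simp
        also have "\<dots> = cmp C ?Dp ?Em ?Eq ?Gu (cmp C ?Dp ?Dm ?Em (gl (\<alpha> (y, k))) ?Ft)" by simp
        also have "\<dots> = cmp C ?Dp ?Em ?Eq ?Gu (cmp C ?Dp ?Ep ?Em ?Gt (gl (\<alpha> (x, k))))"
          using rs by simp
        also have "\<dots> = cmp C ?Dp ?Ep ?Eq (cmp C ?Ep ?Em ?Eq ?Gu ?Gt) (gl (\<alpha> (x, k)))" by simp
        finally show "app (vcomp C ?Dp ?Dq ?Eq \<cdot> (\<alpha> (y, l) \<boxtimes> fhom D (x, k) (y, l)) \<cdot> inv_arr V (Lun V (vhom B x y \<otimes> vhom B' k l))) (pr t u)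
         = app (vcomp C ?Dp ?Ep ?Eq \<cdot> (fhom E (x, k) (y, l) \<boxtimes> \<alpha> (x, k)) \<cdot> inv_arr V (Run V (vhom B x y \<otimes> vhom B' k l))) (pr t u)"
          by (simp add: sD sE)
      qed simp_all
      from arg_cong[OF this, of "\<lambda>f. app f a"]
      show "cmp C (fob D p) (fob D q) (fob E q) (gl (\<alpha> q)) (app (fhom D p q) a)
        = cmp C (fob D p) (fob E p) (fob E q) (app (fhom E p q) a) (gl (\<alpha> p))"
        using a by simp
    qed
  }
qed

text \<open>A square with two invertible sides, read in the opposite direction. It serves the
  inverse comparison in \<open>extension_exists\<close> and the involution on bifold
  algebras.\<close>

lemma inv_nat:
  assumes p: "ciso C x x' p" and q: "ciso C y y' q" and [simp]: "vcategory V C" "x \<in> vob C" "x' \<in> vob C" "y \<in> vob C" "y' \<in> vob C"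
    and [simp]: "elt a" "ty a = vhom C x y" "elt b" "ty b = vhom C x' y'"
    and e: "cmp C x y y' (gl q) a = cmp C x x' y' b (gl p)"
  shows "cmp C x' y' y (gl (uinv V C y y' q)) b = cmp C x' x y a (gl (uinv V C x x' p))"
proof -
  note [simp] = uinv(1-5)[OF p] uinv(1-5)[OF q] ciso_arr[OF p] ciso_arr[OF q]
  have "cmp C x' y' y (gl (uinv V C y y' q)) b
    = cmp C x' y' y (gl (uinv V C y y' q)) (cmp C x' x' y' b (cmp C x' x x' (gl p) (gl (uinv V C x x' p))))"
    by simp
  also have "\<dots> = cmp C x' y' y (gl (uinv V C y y' q)) (cmp C x' x y' (cmp C x x' y' b (gl p)) (gl (uinv V C x x' p)))"
    by (subst cmp_assoc) simp_all
  also have "\<dots> = cmp C x' y' y (gl (uinv V C y y' q)) (cmp C x' y y' (gl q) (cmp C x' x y a (gl (uinv V C x x' p))))"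
    by (simp flip: e)
  also have "\<dots> = cmp C x' x y a (gl (uinv V C x x' p))"
    by (subst uinv_cancel(1)[OF q]) simp_all
  finally show ?thesis .
qed

end

section \<open>The categories of algebras and of bifold algebras\<close>

context admissible
begin

text \<open>\<open>strong_cross_mor\<close> on elements: the twists by \<open>M\<close> and
  \<open>N\<close> disappear on objects and remain on homs, and naturality is split by variable as
  in \<open>nat_two_var\<close>.\<close>

definition scmor where
  "scmor T U D T' U' D' M N f \<longleftrightarrow> tmor T T' M \<and> tmor U' U N \<and> f \<in> extensional (J \<times> J) \<and>
    (\<forall>x \<in> J. \<forall>k \<in> J. ciso C (fob D (x, k)) (fob D' (x, k)) (f (x, k))) \<and>
    (\<forall>x \<in> J. \<forall>y \<in> J. \<forall>k \<in> J. \<forall>t. elt t \<longrightarrow> ty t = vhom (tcat T) x y \<longrightarrow>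
      cmp C (fob D (x, k)) (fob D (y, k)) (fob D' (y, k)) (gl (f (y, k))) (app (fhom (FR T U D k) x y) t)
        = cmp C (fob D (x, k)) (fob D' (x, k)) (fob D' (y, k)) (app (fhom (FR T' U' D' k) x y) (app (fhom M x y) t)) (gl (f (x, k)))) \<and>
    (\<forall>x \<in> J. \<forall>k \<in> J. \<forall>l \<in> J. \<forall>u. elt u \<longrightarrow> ty u = vhom (tcat U') k l \<longrightarrow>
      cmp C (fob D (x, k)) (fob D (x, l)) (fob D' (x, l)) (gl (f (x, l))) (app (fhom (FL T U D x) k l) (app (fhom N k l) u))
        = cmp C (fob D (x, k)) (fob D' (x, k)) (fob D' (x, l)) (app (fhom (FL T' U' D' x) k l) u) (gl (f (x, k))))"

lemma strong_cross_mor_iff: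
  assumes T [simp]: "Th T" "Th U" "Th T'" "Th U'" and D: "balg T U D" and D': "balg T' U' D'"
  shows "strong_cross_mor V J C (T, U, D) (T', U', D') (M, N, f) \<longleftrightarrow> scmor T U D T' U' D' M N f"
proof (cases "tmor T T' M \<and> tmor U' U N")
  case True
  then have M: "tmor T T' M" and N: "tmor U' U N" by auto
  note [simp] = tmorD(2-6)[OF M \<open>Th T\<close> \<open>Th T'\<close>] tmorD(2-6)[OF N \<open>Th U'\<close> \<open>Th U\<close>]
  note [simp] = balgD(4-12)[OF D \<open>Th T\<close> \<open>Th U\<close>] balgD(4-12)[OF D' \<open>Th T'\<close> \<open>Th U'\<close>]
  note d = vfunD2(1-4)[OF balgD(1)[OF D \<open>Th T\<close> \<open>Th U\<close>] _ _ C_cat, simplified]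
  note d' = vfunD2(1-4)[OF balgD(1)[OF D' \<open>Th T'\<close> \<open>Th U'\<close>] _ _ C_cat, simplified]
  note [simp] = d(2-4) d'(2-4)
  note F = fix_fhom[OF balgD(1)[OF D \<open>Th T\<close> \<open>Th U\<close>] _ _ C_cat, simplified]
  note F' = fix_fhom[OF balgD(1)[OF D' \<open>Th T'\<close> \<open>Th U'\<close>] _ _ C_cat, simplified]
  let ?TU = "vtensor V (tcat T) (tcat U')"
  let ?G = "comp_vfun V ?TU D (vfun_tensor V (tcat T) (tcat U') (id_vfun V (tcat T)) N)"
  let ?H = "comp_vfun V ?TU D' (vfun_tensor V (tcat T) (tcat U') M (id_vfun V (tcat U')))"
  have G: "vfunctor V ?TU C ?G"
    by (rule vfunctor_comp_tensor[OF vfunctor_id tmorD(1)[OF N] balgD(1)[OF D]]) simp_all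
  have H: "vfunctor V ?TU C ?H"
    by (rule vfunctor_comp_tensor[OF tmorD(1)[OF M] vfunctor_id balgD(1)[OF D']]) simp_all
  note FG = fix_fhom(4,8)[OF G _ _ C_cat, simplified]
  note FH = fix_fhom(4,8)[OF H _ _ C_cat, simplified]
  \<comment> \<open>The partial functors of the twisted composites are those of \<open>D\<close> and
    \<open>D'\<close>, precomposed with \<open>N\<close> or \<open>M\<close> where these
    act.\<close>
  have eR: "app (fhom (fix_right V (tcat T) (tcat U') ?G k) x y) t = app (fhom (FR T U D k) x y) t"
    "app (fhom (fix_right V (tcat T) (tcat U') ?H k) x y) t = app (fhom (FR T' U' D' k) x y) (app (fhom M x y) t)"
    if "x \<in> J" "y \<in> J" "k \<in> J" "elt t" "ty t = vhom (tcat T) x y" for x y k t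
    using that by (simp_all add: FG FH F F')
  have eL: "app (fhom (fix_left V (tcat T) (tcat U') ?G x) k l) u = app (fhom (FL T U D x) k l) (app (fhom N k l) u)"
    "app (fhom (fix_left V (tcat T) (tcat U') ?H x) k l) u = app (fhom (FL T' U' D' x) k l) u"
    if "x \<in> J" "k \<in> J" "l \<in> J" "elt u" "ty u = vhom (tcat U') k l" for x k l u
    using that by (simp_all add: FG FH F F')
  have "strong_cross_mor V J C (T, U, D) (T', U', D') (M, N, f) \<longleftrightarrow> vnat_iso V ?TU C ?G ?H f"
    using True by (simp add: strong_cross_mor_def)
  also have "\<dots> \<longleftrightarrow> f \<in> extensional (J \<times> J) \<and> (\<forall>x \<in> J. \<forall>k \<in> J. ciso C (fob D (x, k)) (fob D' (x, k)) (f (x, k))) \<and>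
    (\<forall>p \<in> J \<times> J. \<forall>q \<in> J \<times> J. \<forall>a. elt a \<longrightarrow> ty a = vhom ?TU p q \<longrightarrow>
      cmp C (fob ?G p) (fob ?G q) (fob ?H q) (gl (f q)) (app (fhom ?G p q) a)
        = cmp C (fob ?G p) (fob ?H p) (fob ?H q) (app (fhom ?H p q) a) (gl (f p)))"
    by (subst vnat_iso_iff[OF G H]) simp_all
  also have "\<dots> \<longleftrightarrow> scmor T U D T' U' D' M N f"
  proof (cases "\<forall>x \<in> J. \<forall>k \<in> J. ciso C (fob D (x, k)) (fob D' (x, k)) (f (x, k))")
    case c: True
    then have [simp]: "f (x, k) \<in> Arr V" "Dom V (f (x, k)) = \<one>" "Cod V (f (x, k)) = vhom C (fob D (x, k)) (fob D' (x, k))"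
      if "x \<in> J" "k \<in> J" for x k
      using ciso_arr[of C "fob D (x, k)" "fob D' (x, k)" "f (x, k)"] that by simp_all
    have fa: "\<And>x k. x \<in> vob (tcat T) \<Longrightarrow> k \<in> vob (tcat U') \<Longrightarrow> f (x, k) \<in> Arr V"
      "\<And>x k. x \<in> vob (tcat T) \<Longrightarrow> k \<in> vob (tcat U') \<Longrightarrow> Dom V (f (x, k)) = \<one>"
      "\<And>x k. x \<in> vob (tcat T) \<Longrightarrow> k \<in> vob (tcat U') \<Longrightarrow> Cod V (f (x, k)) = vhom C (fob ?G (x, k)) (fob ?H (x, k))"
      by simp_all
    note N = nat_two_var[OF G H Th_simps(1)[OF \<open>Th T\<close>] Th_simps(1)[OF \<open>Th U'\<close>] C_cat fa,
      unfolded Th_simps(2)[OF \<open>Th T\<close>] Th_simps(2)[OF \<open>Th U'\<close>]]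
    have "(\<forall>p \<in> J \<times> J. \<forall>q \<in> J \<times> J. \<forall>a. elt a \<longrightarrow> ty a = vhom ?TU p q \<longrightarrow>
      cmp C (fob ?G p) (fob ?G q) (fob ?H q) (gl (f q)) (app (fhom ?G p q) a)
        = cmp C (fob ?G p) (fob ?H p) (fob ?H q) (app (fhom ?H p q) a) (gl (f p)))
      \<longleftrightarrow> (\<forall>x \<in> J. \<forall>y \<in> J. \<forall>k \<in> J. \<forall>t. elt t \<longrightarrow> ty t = vhom (tcat T) x y \<longrightarrow>
      cmp C (fob D (x, k)) (fob D (y, k)) (fob D' (y, k)) (gl (f (y, k))) (app (fhom (FR T U D k) x y) t)
        = cmp C (fob D (x, k)) (fob D' (x, k)) (fob D' (y, k)) (app (fhom (FR T' U' D' k) x y) (app (fhom M x y) t)) (gl (f (x, k)))) \<and>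
    (\<forall>x \<in> J. \<forall>k \<in> J. \<forall>l \<in> J. \<forall>u. elt u \<longrightarrow> ty u = vhom (tcat U') k l \<longrightarrow>
      cmp C (fob D (x, k)) (fob D (x, l)) (fob D' (x, l)) (gl (f (x, l))) (app (fhom (FL T U D x) k l) (app (fhom N k l) u))
        = cmp C (fob D (x, k)) (fob D' (x, k)) (fob D' (x, l)) (app (fhom (FL T' U' D' x) k l) u) (gl (f (x, k))))"
      by (rule trans[OF N], assumption+, intro conj_cong ball_cong iff_allI imp_cong refl) (simp_all add: eR eL)
    then show ?thesis using True c by (simp add: scmor_def)
  next
    case False
    then show ?thesis by (auto simp: scmor_def)
  qed
  finally show ?thesis .
next
  case False
  then show ?thesis by (auto simp: strong_cross_mor_def scmor_def)
qed

lemma Alg_simps [simp]: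
  "Obj (Alg_s V J C) = alg_obs V J C" "Dom (Alg_s V J C) = src" "Cod (Alg_s V J C) = tgt"
  "Id (Alg_s V J C) (T, A) = \<lparr>src = (T, A), tgt = (T, A), dat = (id_vfun V (tcat T), \<lambda>X \<in> J. vid C (fob A X))\<rparr>"
  "(T, A) \<in> alg_obs V J C \<longleftrightarrow> Th T \<and> alg T A"
  by (simp_all add: Alg_s_def alg_obs_def)

lemma Alg_obj: "X \<in> alg_obs V J C \<longleftrightarrow> (\<exists>T A. X = (T, A) \<and> Th T \<and> alg T A)"
  by (auto simp: alg_obs_def)

lemma Alg_arr_iff: "m \<in> Arr (Alg_s V J C) \<longleftrightarrow> (\<exists>T A U B M f. m = \<lparr>src = (T, A), tgt = (U, B), dat = (M, f)\<rparr> \<and>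
    Th T \<and> alg T A \<and> Th U \<and> alg U B \<and> smor T A U B M f)" (is "?l \<longleftrightarrow> ?r")
proof
  obtain T A U B M f where m: "m = \<lparr>src = (T, A), tgt = (U, B), dat = (M, f)\<rparr>"
    by (cases m) auto
  {
    assume ?l
    then have "strong_mor V J C (T, A) (U, B) (M, f)" "Th T" "alg T A" "Th U" "alg U B"
      by (auto simp: Alg_s_def m alg_obs_def)
    then show ?r using strong_mor_iff m by blast
  }
next
  assume ?r
  then show ?l by (auto simp: Alg_s_def alg_obs_def strong_mor_iff)
qed

lemma Alg_comp:
  assumes M: "tmor T U M" and N: "tmor U W N" and [simp]: "Th T" "Th U" "Th W"
  shows "Comp (Alg_s V J C) \<lparr>src = S, tgt = (W, D), dat = (N, g)\<rparr> \<lparr>src = (T, A), tgt = (U, B), dat = (M, f)\<rparr>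
    = \<lparr>src = (T, A), tgt = (W, D), dat = (comp_vfun V (tcat T) N M, \<lambda>X \<in> J. ucomp V C (fob A X) (fob B X) (fob D X) (g X) (f X))\<rparr>"
proof -
  note [simp] = tmorD(2)[OF M] tmorD(2)[OF N]
  show ?thesis by (simp add: Alg_s_def cong: restrict_cong)
qed

lemma smorD:
  assumes "smor T A U B M f"
  shows "tmor T U M" "f \<in> extensional J" "\<And>x. x \<in> J \<Longrightarrow> ciso C (fob A x) (fob B x) (f x)"
    "\<And>x y a. \<lbrakk>x \<in> J; y \<in> J; elt a; ty a = vhom (tcat T) x y\<rbrakk> \<Longrightarrow>
      cmp C (fob A x) (fob A y) (fob B y) (gl (f y)) (app (fhom A x y) a)
        = cmp C (fob A x) (fob B x) (fob B y) (app (fhom B x y) (app (fhom M x y) a)) (gl (f x))"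
  using assms by (auto simp: smor_def)

lemma smor_id:
  assumes [simp]: "Th T" "alg T A"
  shows "smor T A T A (id_vfun V (tcat T)) (\<lambda>X \<in> J. vid C (fob A X))"
proof -
  note [simp] = algD[OF \<open>alg T A\<close> \<open>Th T\<close>]
  show ?thesis by (simp add: smor_def tmor_id)
qed

text \<open>Pasting of two squares with common middle arrow \<open>b\<close>; it gives naturality of
  composites in both categories.\<close>

lemma nat_comp:
  assumes f: "ciso C x x' f" "ciso C y y' f'" and g: "ciso C x' x'' g" "ciso C y' y'' g'" and [simp]: "vcategory V C"
    "x \<in> vob C" "x' \<in> vob C" "x'' \<in> vob C" "y \<in> vob C" "y' \<in> vob C" "y'' \<in> vob C"
    and [simp]: "elt a" "ty a = vhom C x y" "elt b" "ty b = vhom C x' y'" "elt c" "ty c = vhom C x'' y''"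
    and e: "cmp C x y y' (gl f') a = cmp C x x' y' b (gl f)"
    and e': "cmp C x' y' y'' (gl g') b = cmp C x' x'' y'' c (gl g)"
  shows "cmp C x y y'' (gl (ucomp V C y y' y'' g' f')) a = cmp C x x'' y'' c (gl (ucomp V C x x' x'' g f))"
proof -
  note [simp] = ciso_arr[OF f(1)] ciso_arr[OF f(2)] ciso_arr[OF g(1)] ciso_arr[OF g(2)]
  have "cmp C x y y'' (gl (ucomp V C y y' y'' g' f')) a = cmp C x y' y'' (gl g') (cmp C x y y' (gl f') a)" by simp
  also have "\<dots> = cmp C x x' y'' (cmp C x' y' y'' (gl g') b) (gl f)" by (simp add: e)
  also have "\<dots> = cmp C x x'' y'' c (gl (ucomp V C x x' x'' g f))" by (simp add: e')
  finally show ?thesis .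
qed

lemma smor_comp:
  assumes f: "smor T A U B M f" and g: "smor U B W D N g"
    and [simp]: "Th T" "Th U" "Th W" "alg T A" "alg U B" "alg W D"
  shows "smor T A W D (comp_vfun V (tcat T) N M) (\<lambda>X \<in> J. ucomp V C (fob A X) (fob B X) (fob D X) (g X) (f X))"
proof -
  note [simp] = algD[OF \<open>alg T A\<close> \<open>Th T\<close>] algD[OF \<open>alg U B\<close> \<open>Th U\<close>] algD[OF \<open>alg W D\<close> \<open>Th W\<close>]
  note [simp] = tmorD(2-7)[OF smorD(1)[OF f]] tmorD(2-7)[OF smorD(1)[OF g]]
  have "cmp C (fob A x) (fob A y) (fob D y) (gl (ucomp V C (fob A y) (fob B y) (fob D y) (g y) (f y))) (app (fhom A x y) a)
        = cmp C (fob A x) (fob D x) (fob D y) (app (fhom D x y) (app (fhom (comp_vfun V (tcat T) N M) x y) a))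
          (gl (ucomp V C (fob A x) (fob B x) (fob D x) (g x) (f x)))"
    if [simp]: "x \<in> J" "y \<in> J" "elt a" "ty a = vhom (tcat T) x y" for x y a
    by (rule nat_comp[OF smorD(3)[OF f] smorD(3)[OF f] smorD(3)[OF g] smorD(3)[OF g], where b = "app (fhom B x y) (app (fhom M x y) a)"])
      (simp_all add: smorD(4)[OF f] smorD(4)[OF g])
  then show ?thesis
    unfolding smor_def using tmor_comp[OF smorD(1)[OF f] smorD(1)[OF g]] ciso_comp(1)[OF smorD(3)[OF f] smorD(3)[OF g]]
    by simp
qed

lemma ucomp_id:
  assumes f: "ciso C x y f" and [simp]: "vcategory V C" "x \<in> vob C" "y \<in> vob C"
  shows "ucomp V C x y y (vid C y) f = f" "ucomp V C x x y f (vid C x) = f"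
  using ciso_arr[OF f] by (auto intro!: ucomp_eqI)

lemma ucomp_assoc:
  assumes f: "ciso C w x f" "ciso C x y g" "ciso C y z h" and [simp]: "vcategory V C" "w \<in> vob C" "x \<in> vob C" "y \<in> vob C" "z \<in> vob C"
  shows "ucomp V C w x z (ucomp V C x y z h g) f = ucomp V C w y z h (ucomp V C w x y g f)"
proof -
  note [simp] = ciso_arr[OF f(1)] ciso_arr[OF f(2)] ciso_arr[OF f(3)]
  show ?thesis by (rule ucomp_eqI) (simp_all del: gl_eq)
qed

lemma ext_eqI: "\<lbrakk>f \<in> extensional S; g \<in> extensional S; \<And>x. x \<in> S \<Longrightarrow> f x = g x\<rbrakk> \<Longrightarrow> f = g"
  by (rule extensionalityI)

lemma category_Alg: "category (Alg_s V J C)"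
proof
  fix m assume "m \<in> Arr (Alg_s V J C)"
  then show "Dom (Alg_s V J C) m \<in> Obj (Alg_s V J C)" "Cod (Alg_s V J C) m \<in> Obj (Alg_s V J C)"
    by (auto simp: Alg_arr_iff)
next
  fix X assume "X \<in> Obj (Alg_s V J C)"
  then obtain T A where "X = (T, A)" "Th T" "alg T A" by (auto simp: Alg_obj)
  then show "Id (Alg_s V J C) X \<in> Hom (Alg_s V J C) X X" by (auto simp: in_Hom Alg_arr_iff smor_id)
next
  fix m X Y n Z assume "m \<in> Hom (Alg_s V J C) X Y" "n \<in> Hom (Alg_s V J C) Y Z"
  then obtain T A U B W D M f N g where X: "X = (T, A)" "Y = (U, B)" "Z = (W, D)"
    "m = \<lparr>src = (T, A), tgt = (U, B), dat = (M, f)\<rparr>" "n = \<lparr>src = (U, B), tgt = (W, D), dat = (N, g)\<rparr>"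
    "Th T" "Th U" "Th W" "alg T A" "alg U B" "alg W D" "smor T A U B M f" "smor U B W D N g"
    by (auto simp: in_Hom Alg_arr_iff)
  then show "Comp (Alg_s V J C) n m \<in> Hom (Alg_s V J C) X Z"
    using smor_comp[OF X(12,13)] by (simp add: in_Hom Alg_arr_iff Alg_comp[OF smorD(1)[OF X(12)] smorD(1)[OF X(13)]])
next
  fix m X Y assume "m \<in> Hom (Alg_s V J C) X Y"
  then obtain T A U B M f where X: "X = (T, A)" "Y = (U, B)"
    "m = \<lparr>src = (T, A), tgt = (U, B), dat = (M, f)\<rparr>" and [simp]: "Th T" "Th U" "alg T A" "alg U B" and f: "smor T A U B M f"
    by (auto simp: in_Hom Alg_arr_iff)
  note [simp] = algD(1)[OF \<open>alg T A\<close> \<open>Th T\<close>] algD(1)[OF \<open>alg U B\<close> \<open>Th U\<close>]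
  note [simp] = comp_vfun_id[OF tmorD(1)[OF smorD(1)[OF f]]]
  have "(\<lambda>X \<in> J. ucomp V C (fob A X) (fob B X) (fob B X) ((\<lambda>X \<in> J. vid C (fob B X)) X) (f X)) = f"
    by (rule ext_eqI[OF _ smorD(2)[OF f]]) (simp_all add: ucomp_id[OF smorD(3)[OF f]])
  then show "Comp (Alg_s V J C) (Id (Alg_s V J C) Y) m = m"
    by (simp add: X Alg_comp[OF smorD(1)[OF f] tmor_id])
  have "(\<lambda>X \<in> J. ucomp V C (fob A X) (fob A X) (fob B X) (f X) ((\<lambda>X \<in> J. vid C (fob A X)) X)) = f"
    by (rule ext_eqI[OF _ smorD(2)[OF f]]) (simp_all add: ucomp_id[OF smorD(3)[OF f]])
  then show "Comp (Alg_s V J C) m (Id (Alg_s V J C) X) = m"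
    by (simp add: X Alg_comp[OF tmor_id smorD(1)[OF f]])
next
  fix m W X n Y p Z assume "m \<in> Hom (Alg_s V J C) W X" "n \<in> Hom (Alg_s V J C) X Y" "p \<in> Hom (Alg_s V J C) Y Z"
  then obtain T A U B W' D S E M f N g P h where X: "m = \<lparr>src = (T, A), tgt = (U, B), dat = (M, f)\<rparr>" "n = \<lparr>src = (U, B), tgt = (W', D), dat = (N, g)\<rparr>"
    "p = \<lparr>src = (W', D), tgt = (S, E), dat = (P, h)\<rparr>" and [simp]:
    "Th T" "Th U" "Th W'" "Th S" "alg T A" "alg U B" "alg W' D" "alg S E" and f: "smor T A U B M f" and g: "smor U B W' D N g" and h: "smor W' D S E P h"
    by (auto simp: in_Hom Alg_arr_iff)
  note t = smorD(1)[OF f] smorD(1)[OF g] smorD(1)[OF h]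
  note [simp] = algD(1)[OF \<open>alg T A\<close> \<open>Th T\<close>] algD(1)[OF \<open>alg U B\<close> \<open>Th U\<close>] algD(1)[OF \<open>alg W' D\<close> \<open>Th W'\<close>] algD(1)[OF \<open>alg S E\<close> \<open>Th S\<close>]
  have "comp_vfun V (tcat T) (comp_vfun V (tcat U) P N) M = comp_vfun V (tcat T) P (comp_vfun V (tcat T) N M)"
    by (rule comp_vfun_assoc[OF tmorD(1)[OF t(1)] tmorD(1)[OF t(2)] tmorD(1)[OF t(3)]]) simp_all
  then show "Comp (Alg_s V J C) (Comp (Alg_s V J C) p n) m = Comp (Alg_s V J C) p (Comp (Alg_s V J C) n m)"
    by (simp add: X Alg_comp[OF t(2,3)] Alg_comp[OF t(1,2)] Alg_comp[OF t(1) tmor_comp[OF t(2,3)]] Alg_comp[OF tmor_comp[OF t(1,2)] t(3)]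
      ucomp_assoc[OF smorD(3)[OF f] smorD(3)[OF g] smorD(3)[OF h]] cong: restrict_cong)
qed

lemma BAlg_simps [simp]:
  "Obj (BAlg_sc V J C) = balg_obs V J C" "Dom (BAlg_sc V J C) = src" "Cod (BAlg_sc V J C) = tgt"
  "Id (BAlg_sc V J C) (T, U, D) = \<lparr>src = (T, U, D), tgt = (T, U, D),
     dat = (id_vfun V (tcat T), id_vfun V (tcat U), \<lambda>p \<in> J \<times> J. vid C (fob D p))\<rparr>"
  "(T, U, D) \<in> balg_obs V J C \<longleftrightarrow> Th T \<and> Th U \<and> balg T U D"
  by (simp_all add: BAlg_sc_def balg_obs_def)

lemma BAlg_obj: "X \<in> balg_obs V J C \<longleftrightarrow> (\<exists>T U D. X = (T, U, D) \<and> Th T \<and> Th U \<and> balg T U D)"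
  by (auto simp: balg_obs_def)

lemma BAlg_arr_iff: "m \<in> Arr (BAlg_sc V J C) \<longleftrightarrow> (\<exists>T U D T' U' D' M N f.
    m = \<lparr>src = (T, U, D), tgt = (T', U', D'), dat = (M, N, f)\<rparr> \<and>
    Th T \<and> Th U \<and> balg T U D \<and> Th T' \<and> Th U' \<and> balg T' U' D' \<and> scmor T U D T' U' D' M N f)" (is "?l \<longleftrightarrow> ?r")
proof
  obtain T U D T' U' D' M N f where m: "m = \<lparr>src = (T, U, D), tgt = (T', U', D'), dat = (M, N, f)\<rparr>"
    by (cases m) auto
  {
    assume ?l
    then have "strong_cross_mor V J C (T, U, D) (T', U', D') (M, N, f)" "Th T" "Th U" "balg T U D" "Th T'" "Th U'" "balg T' U' D'"
      by (auto simp: BAlg_sc_def m balg_obs_def)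
    then show ?r using strong_cross_mor_iff m by blast
  }
next
  assume ?r
  then show ?l by (auto simp: BAlg_sc_def balg_obs_def strong_cross_mor_iff)
qed

lemma BAlg_comp:
  assumes M: "tmor T T' M" and M': "tmor T' T'' M'" and N: "tmor U' U N" and N': "tmor U'' U' N'"
    and [simp]: "Th T" "Th T'" "Th T''" "Th U" "Th U'" "Th U''"
  shows "Comp (BAlg_sc V J C) \<lparr>src = S, tgt = (T'', U'', D''), dat = (M', N', f')\<rparr>
      \<lparr>src = (T, U, D), tgt = (T', U', D'), dat = (M, N, f)\<rparr>
    = \<lparr>src = (T, U, D), tgt = (T'', U'', D''), dat = (comp_vfun V (tcat T) M' M, comp_vfun V (tcat U'') N N',
       \<lambda>p \<in> J \<times> J. ucomp V C (fob D p) (fob D' p) (fob D'' p) (f' p) (f p))\<rparr>"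
proof -
  note [simp] = tmorD(2)[OF M] tmorD(2)[OF N] tmorD(2)[OF M'] tmorD(2)[OF N']
  show ?thesis by (auto simp: BAlg_sc_def restrict_def fun_eq_iff)
qed

lemma scmorD:
  assumes "scmor T U D T' U' D' M N f"
  shows "tmor T T' M" "tmor U' U N" "f \<in> extensional (J \<times> J)"
    "\<And>x k. x \<in> J \<Longrightarrow> k \<in> J \<Longrightarrow> ciso C (fob D (x, k)) (fob D' (x, k)) (f (x, k))"
    "\<And>x y k t. \<lbrakk>x \<in> J; y \<in> J; k \<in> J; elt t; ty t = vhom (tcat T) x y\<rbrakk> \<Longrightarrow>
      cmp C (fob D (x, k)) (fob D (y, k)) (fob D' (y, k)) (gl (f (y, k))) (app (fhom (FR T U D k) x y) t)
        = cmp C (fob D (x, k)) (fob D' (x, k)) (fob D' (y, k)) (app (fhom (FR T' U' D' k) x y) (app (fhom M x y) t)) (gl (f (x, k)))"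
    "\<And>x k l u. \<lbrakk>x \<in> J; k \<in> J; l \<in> J; elt u; ty u = vhom (tcat U') k l\<rbrakk> \<Longrightarrow>
      cmp C (fob D (x, k)) (fob D (x, l)) (fob D' (x, l)) (gl (f (x, l))) (app (fhom (FL T U D x) k l) (app (fhom N k l) u))
        = cmp C (fob D (x, k)) (fob D' (x, k)) (fob D' (x, l)) (app (fhom (FL T' U' D' x) k l) u) (gl (f (x, k)))"
  using assms unfolding scmor_def by blast+

lemma scmor_id:
  assumes [simp]: "Th T" "Th U" and D: "balg T U D"
  shows "scmor T U D T U D (id_vfun V (tcat T)) (id_vfun V (tcat U)) (\<lambda>p \<in> J \<times> J. vid C (fob D p))"
proof -
  note [simp] = balgD(4-12)[OF D]
  show ?thesis by (simp add: scmor_def tmor_id)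
qed

lemma scmor_comp:
  assumes f: "scmor T U D T' U' D' M N f" and g: "scmor T' U' D' T'' U'' D'' M' N' g"
    and T [simp]: "Th T" "Th T'" "Th T''" "Th U" "Th U'" "Th U''"
    and D: "balg T U D" "balg T' U' D'" "balg T'' U'' D''"
  shows "scmor T U D T'' U'' D'' (comp_vfun V (tcat T) M' M) (comp_vfun V (tcat U'') N N')
    (\<lambda>p \<in> J \<times> J. ucomp V C (fob D p) (fob D' p) (fob D'' p) (g p) (f p))"
proof -
  note [simp] = balgD(4-12)[OF D(1)] balgD(4-12)[OF D(2)] balgD(4-12)[OF D(3)]
  note [simp] = tmorD(2-7)[OF scmorD(1)[OF f]] tmorD(2-7)[OF scmorD(1)[OF g]] tmorD(2-7)[OF scmorD(2)[OF f]] tmorD(2-7)[OF scmorD(2)[OF g]]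
  let ?h = "\<lambda>p \<in> J \<times> J. ucomp V C (fob D p) (fob D' p) (fob D'' p) (g p) (f p)"
  have h: "?h (x, k) = ucomp V C (fob D (x, k)) (fob D' (x, k)) (fob D'' (x, k)) (g (x, k)) (f (x, k))"
    if "x \<in> J" "k \<in> J" for x k using that by simp
  have 1: "cmp C (fob D (x, k)) (fob D (y, k)) (fob D'' (y, k)) (gl (?h (y, k))) (app (fhom (FR T U D k) x y) t)
        = cmp C (fob D (x, k)) (fob D'' (x, k)) (fob D'' (y, k)) (app (fhom (FR T'' U'' D'' k) x y) (app (fhom (comp_vfun V (tcat T) M' M) x y) t)) (gl (?h (x, k)))"
    if [simp]: "x \<in> J" "y \<in> J" "k \<in> J" "elt t" "ty t = vhom (tcat T) x y" for x y k t
    unfolding h[OF that(1,3)] h[OF that(2,3)]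
    by (rule nat_comp[OF scmorD(4)[OF f] scmorD(4)[OF f] scmorD(4)[OF g] scmorD(4)[OF g], where b = "app (fhom (FR T' U' D' k) x y) (app (fhom M x y) t)"])
      (simp_all add: scmorD(5)[OF f] scmorD(5)[OF g])
  have 2: "cmp C (fob D (x, k)) (fob D (x, l)) (fob D'' (x, l)) (gl (?h (x, l))) (app (fhom (FL T U D x) k l) (app (fhom (comp_vfun V (tcat U'') N N') k l) u))
        = cmp C (fob D (x, k)) (fob D'' (x, k)) (fob D'' (x, l)) (app (fhom (FL T'' U'' D'' x) k l) u) (gl (?h (x, k)))"
    if [simp]: "x \<in> J" "k \<in> J" "l \<in> J" "elt u" "ty u = vhom (tcat U'') k l" for x k l u
    unfolding h[OF that(1,2)] h[OF that(1,3)]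
    by (rule nat_comp[OF scmorD(4)[OF f] scmorD(4)[OF f] scmorD(4)[OF g] scmorD(4)[OF g], where b = "app (fhom (FL T' U' D' x) k l) (app (fhom N' k l) u)"])
      (simp_all add: scmorD(6)[OF f] scmorD(6)[OF g])
  show ?thesis
    unfolding scmor_def
  proof (intro conjI ballI allI impI)
    show "tmor T T'' (comp_vfun V (tcat T) M' M)" by (rule tmor_comp[OF scmorD(1)[OF f] scmorD(1)[OF g]]) simp_all
    show "tmor U'' U (comp_vfun V (tcat U'') N N')" by (rule tmor_comp[OF scmorD(2)[OF g] scmorD(2)[OF f]]) simp_all
    show "?h \<in> extensional (J \<times> J)" by simp
    fix x k assume "x \<in> J" "k \<in> J"
    then show "ciso C (fob D (x, k)) (fob D'' (x, k)) (?h (x, k))"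
      using ciso_comp(1)[OF scmorD(4)[OF f] scmorD(4)[OF g]] by simp
  qed (rule 1 2; assumption)+
qed

lemma category_BAlg: "category (BAlg_sc V J C)"
proof
  fix m assume "m \<in> Arr (BAlg_sc V J C)"
  then show "Dom (BAlg_sc V J C) m \<in> Obj (BAlg_sc V J C)" "Cod (BAlg_sc V J C) m \<in> Obj (BAlg_sc V J C)"
    by (auto simp: BAlg_arr_iff)
next
  fix X assume "X \<in> Obj (BAlg_sc V J C)"
  then obtain T U D where "X = (T, U, D)" "Th T" "Th U" "balg T U D" by (auto simp: BAlg_obj)
  then show "Id (BAlg_sc V J C) X \<in> Hom (BAlg_sc V J C) X X" by (auto simp: in_Hom BAlg_arr_iff scmor_id)
next
  fix m X Y n Z assume "m \<in> Hom (BAlg_sc V J C) X Y" "n \<in> Hom (BAlg_sc V J C) Y Z"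
  then obtain T U D T' U' D' T'' U'' D'' M N f M' N' g where X: "X = (T, U, D)" "Y = (T', U', D')" "Z = (T'', U'', D'')"
    "m = \<lparr>src = (T, U, D), tgt = (T', U', D'), dat = (M, N, f)\<rparr>" "n = \<lparr>src = (T', U', D'), tgt = (T'', U'', D''), dat = (M', N', g)\<rparr>"
    and T: "Th T" "Th T'" "Th T''" "Th U" "Th U'" "Th U''" "balg T U D" "balg T' U' D'" "balg T'' U'' D''"
    and f: "scmor T U D T' U' D' M N f" and g: "scmor T' U' D' T'' U'' D'' M' N' g"
    by (auto simp: in_Hom BAlg_arr_iff)
  show "Comp (BAlg_sc V J C) n m \<in> Hom (BAlg_sc V J C) X Z"
    using scmor_comp[OF f g T] T by (simp add: X in_Hom BAlg_arr_iff BAlg_comp[OF scmorD(1)[OF f] scmorD(1)[OF g] scmorD(2)[OF f] scmorD(2)[OF g]])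
next
  fix m X Y assume "m \<in> Hom (BAlg_sc V J C) X Y"
  then obtain T U D T' U' D' M N f where X: "X = (T, U, D)" "Y = (T', U', D')"
    "m = \<lparr>src = (T, U, D), tgt = (T', U', D'), dat = (M, N, f)\<rparr>"
    and [simp]: "Th T" "Th T'" "Th U" "Th U'" and D: "balg T U D" "balg T' U' D'"
    and f: "scmor T U D T' U' D' M N f"
    by (auto simp: in_Hom BAlg_arr_iff)
  note [simp] = balgD(6)[OF D(1)] balgD(6)[OF D(2)]
  note [simp] = comp_vfun_id[OF tmorD(1)[OF scmorD(1)[OF f]]] comp_vfun_id[OF tmorD(1)[OF scmorD(2)[OF f]]]
  have "(\<lambda>p \<in> J \<times> J. ucomp V C (fob D p) (fob D' p) (fob D' p) ((\<lambda>p \<in> J \<times> J. vid C (fob D' p)) p) (f p)) = f"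
    by (rule ext_eqI[OF _ scmorD(3)[OF f]]) (auto simp: ucomp_id[OF scmorD(4)[OF f]])
  then show "Comp (BAlg_sc V J C) (Id (BAlg_sc V J C) Y) m = m"
    by (simp add: X BAlg_comp[OF scmorD(1)[OF f] tmor_id scmorD(2)[OF f] tmor_id])
  have "(\<lambda>p \<in> J \<times> J. ucomp V C (fob D p) (fob D p) (fob D' p) (f p) ((\<lambda>p \<in> J \<times> J. vid C (fob D p)) p)) = f"
    by (rule ext_eqI[OF _ scmorD(3)[OF f]]) (auto simp: ucomp_id[OF scmorD(4)[OF f]])
  then show "Comp (BAlg_sc V J C) m (Id (BAlg_sc V J C) X) = m"
    by (simp add: X BAlg_comp[OF tmor_id scmorD(1)[OF f] tmor_id scmorD(2)[OF f]])
next
  fix m W X n Y p Z assume "m \<in> Hom (BAlg_sc V J C) W X" "n \<in> Hom (BAlg_sc V J C) X Y" "p \<in> Hom (BAlg_sc V J C) Y Z"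
  then obtain T U D T' U' D' T2 U2 D2 T3 U3 D3 M N f M' N' g M2 N2 h where X:
    "m = \<lparr>src = (T, U, D), tgt = (T', U', D'), dat = (M, N, f)\<rparr>" "n = \<lparr>src = (T', U', D'), tgt = (T2, U2, D2), dat = (M', N', g)\<rparr>"
    "p = \<lparr>src = (T2, U2, D2), tgt = (T3, U3, D3), dat = (M2, N2, h)\<rparr>"
    and [simp]: "Th T" "Th T'" "Th T2" "Th T3" "Th U" "Th U'" "Th U2" "Th U3"
    and D: "balg T U D" "balg T' U' D'" "balg T2 U2 D2" "balg T3 U3 D3"
    and f: "scmor T U D T' U' D' M N f" and g: "scmor T' U' D' T2 U2 D2 M' N' g" and h: "scmor T2 U2 D2 T3 U3 D3 M2 N2 h"
    by (auto simp: in_Hom BAlg_arr_iff)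
  note t = scmorD(1)[OF f] scmorD(1)[OF g] scmorD(1)[OF h]
  note u = scmorD(2)[OF f] scmorD(2)[OF g] scmorD(2)[OF h]
  note [simp] = balgD(6)[OF D(1)] balgD(6)[OF D(2)] balgD(6)[OF D(3)] balgD(6)[OF D(4)]
  have 1: "comp_vfun V (tcat T) (comp_vfun V (tcat T') M2 M') M = comp_vfun V (tcat T) M2 (comp_vfun V (tcat T) M' M)"
    by (rule comp_vfun_assoc[OF tmorD(1)[OF t(1)] tmorD(1)[OF t(2)] tmorD(1)[OF t(3)]]) simp_all
  have 2: "comp_vfun V (tcat U3) (comp_vfun V (tcat U2) N N') N2 = comp_vfun V (tcat U3) N (comp_vfun V (tcat U3) N' N2)"
    by (rule comp_vfun_assoc[OF tmorD(1)[OF u(3)] tmorD(1)[OF u(2)] tmorD(1)[OF u(1)]]) simp_all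
  have 3: "(\<lambda>p \<in> J \<times> J. ucomp V C (fob D p) (fob D' p) (fob D3 p) ((\<lambda>p \<in> J \<times> J. ucomp V C (fob D' p) (fob D2 p) (fob D3 p) (h p) (g p)) p) (f p))
     = (\<lambda>p \<in> J \<times> J. ucomp V C (fob D p) (fob D2 p) (fob D3 p) (h p) ((\<lambda>p \<in> J \<times> J. ucomp V C (fob D p) (fob D' p) (fob D2 p) (g p) (f p)) p))"
    by (rule restrict_ext) (auto simp: ucomp_assoc[OF scmorD(4)[OF f] scmorD(4)[OF g] scmorD(4)[OF h]])
  show "Comp (BAlg_sc V J C) (Comp (BAlg_sc V J C) p n) m = Comp (BAlg_sc V J C) p (Comp (BAlg_sc V J C) n m)"
    by (simp only: X BAlg_comp[OF t(2,3) u(2,3)] BAlg_comp[OF t(1,2) u(1,2)] BAlg_comp[OF t(1) tmor_comp[OF t(2,3)] u(1) tmor_comp[OF u(3,2)]]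
      BAlg_comp[OF tmor_comp[OF t(1,2)] t(3) tmor_comp[OF u(2,1)] u(3)] \<open>Th T\<close> \<open>Th T'\<close> \<open>Th T2\<close> \<open>Th T3\<close> \<open>Th U\<close> \<open>Th U'\<close> \<open>Th U2\<close> \<open>Th U3\<close> 1 2 3)
qed

lemma left_face_simps [simp]: "left_face V (T, U, D) = (T, FR T U D \<one>)"
  by (simp add: left_face_def)

lemma right_face_simps [simp]: "right_face V (T, U, D) = (U, FL T U D \<one>)"
  by (simp add: right_face_def)

lemma smor_left_face:
  assumes [simp]: "Th T" "Th U" "Th T'" "Th U'" and D: "balg T U D" "balg T' U' D'" and f: "scmor T U D T' U' D' M N f"
  shows "smor T (FR T U D \<one>) T' (FR T' U' D' \<one>) M (\<lambda>X \<in> J. f (X, \<one>))"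
  using scmorD[OF f] balgD(4)[OF D(1)] balgD(4)[OF D(2)] by (simp add: smor_def)

lemma is_functor_L: "is_functor (BAlg_sc V J C) (Alg_s V J C) (L_functor V J)"
  unfolding is_functor_def
proof (intro conjI ballI allI category_BAlg category_Alg)
  fix X assume "X \<in> Obj (BAlg_sc V J C)"
  then obtain T U D where X: "X = (T, U, D)" "Th T" "Th U" "balg T U D" by (auto simp: BAlg_obj)
  then show "onObj (L_functor V J) X \<in> Obj (Alg_s V J C)" by (simp add: L_functor_def balgD(2))
  show "onArr (L_functor V J) (Id (BAlg_sc V J C) X) = Id (Alg_s V J C) (onObj (L_functor V J) X)"
    using X by (auto simp: L_functor_def restrict_def balgD(4))
next
  fix X Y m assume "m \<in> Hom (BAlg_sc V J C) X Y"
  then obtain T U D T' U' D' M N f where X: "X = (T, U, D)" "Y = (T', U', D')"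
    "m = \<lparr>src = (T, U, D), tgt = (T', U', D'), dat = (M, N, f)\<rparr>"
    and T: "Th T" "Th U" "Th T'" "Th U'" "balg T U D" "balg T' U' D'" and f: "scmor T U D T' U' D' M N f"
    by (auto simp: in_Hom BAlg_arr_iff)
  show "onArr (L_functor V J) m \<in> Hom (Alg_s V J C) (onObj (L_functor V J) X) (onObj (L_functor V J) Y)"
    using T smor_left_face[OF T f] by (simp add: L_functor_def X in_Hom Alg_arr_iff balgD(2))
next
  fix X Y Z m n assume "m \<in> Hom (BAlg_sc V J C) X Y" "n \<in> Hom (BAlg_sc V J C) Y Z"
  then obtain T U D T' U' D' T'' U'' D'' M N f M' N' g where X:
    "m = \<lparr>src = (T, U, D), tgt = (T', U', D'), dat = (M, N, f)\<rparr>" "n = \<lparr>src = (T', U', D'), tgt = (T'', U'', D''), dat = (M', N', g)\<rparr>"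
    and T: "Th T" "Th T'" "Th T''" "Th U" "Th U'" "Th U''" "balg T U D" "balg T' U' D'" "balg T'' U'' D''"
    and f: "scmor T U D T' U' D' M N f" and g: "scmor T' U' D' T'' U'' D'' M' N' g"
    by (auto simp: in_Hom BAlg_arr_iff)
  show "onArr (L_functor V J) (Comp (BAlg_sc V J C) n m) = Comp (Alg_s V J C) (onArr (L_functor V J) n) (onArr (L_functor V J) m)"
    using T by (simp add: X L_functor_def BAlg_comp[OF scmorD(1)[OF f] scmorD(1)[OF g] scmorD(2)[OF f] scmorD(2)[OF g]]
      Alg_comp[OF scmorD(1)[OF f] scmorD(1)[OF g]] balgD(4) cong: restrict_cong)
qed

end

section \<open>The universal property of the left face\<close>

context symmetric_monoidal_closed
begin

text \<open>A counit composed with an isomorphism of the underlying object is a counit again. In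
  \<open>cot_iso_over\<close> this lifts \<open>f\<close> to an isomorphism of cotensors.\<close>

lemma cot_transport:
  assumes c: "is_cotensor V C K c P \<gamma>" and f: "ciso C c c' f" and [simp]: "vcategory V C" "c \<in> vob C" "c' \<in> vob C"
  obtains \<delta> where "is_cotensor V C K c' P \<delta>" "\<And>k. \<lbrakk>elt k; ty k = K\<rbrakk> \<Longrightarrow> app \<delta> k = cmp C P c c' (gl f) (app \<gamma> k)"
proof -
  note [simp] = cotD[OF c] ciso_arr[OF f] uinv(1-3)[OF f]
  let ?\<delta> = "vcomp C P c c' \<cdot> (f \<boxtimes> \<gamma>) \<cdot> inv_arr V (Lun V K)"
  have \<delta>: "app ?\<delta> k = cmp C P c c' (gl f) (app \<gamma> k)" if "elt k" "ty k = K" for k using that by simp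
  have "is_cotensor V C K c' P ?\<delta>"
  proof (rule cotI)
    fix x Z h assume [simp]: "x \<in> vob C" "Z \<in> Obj V" "h \<in> Arr V" "Dom V h = Z \<otimes> K" "Cod V h = vhom C x c'"
    \<comment> \<open>Before being lifted, \<open>h\<close> is carried back to \<open>c\<close> by
      the inverse of \<open>f\<close>.\<close>
    let ?h = "vcomp C x c' c \<cdot> (uinv V C c c' f \<boxtimes> h) \<cdot> inv_arr V (Lun V (Z \<otimes> K))"
    obtain g where [simp]: "g \<in> Arr V" "Dom V g = Z" "Cod V g = vhom C x P"
      and g: "\<And>z k. \<lbrakk>elt z; ty z = Z; elt k; ty k = K; dj z k\<rbrakk> \<Longrightarrow> cmp C x P c (app \<gamma> k) (app g z) = app ?h (pr z k)"
      by (rule cot_ex[OF c, of x Z ?h]) simp_all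
    show "\<exists>g. g \<in> Arr V \<and> Dom V g = Z \<and> Cod V g = vhom C x P \<and>
        (\<forall>z k. elt z \<and> ty z = Z \<and> elt k \<and> ty k = K \<and> dj z k \<and> dj k z \<longrightarrow> cmp C x P c' (app ?\<delta> k) (app g z) = app h (pr z k))"
    proof (intro exI[of _ g] conjI allI impI)
      fix z k assume "elt z \<and> ty z = Z \<and> elt k \<and> ty k = K \<and> dj z k \<and> dj k z"
      then have [simp]: "elt z" "ty z = Z" "elt k" "ty k = K" "dj z k" "dj k z" by auto
      show "cmp C x P c' (app ?\<delta> k) (app g z) = app h (pr z k)"
        using uinv_cancel(2)[OF f, of x "app h (pr z k)"] by (simp add: g)
    qed simp_all
  next
    fix x a b assume [simp]: "x \<in> vob C" "elt a" "ty a = vhom C x P" "elt b" "ty b = vhom C x P"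
      and e: "\<And>k. \<lbrakk>elt k; ty k = K; dj a k; dj k a; dj b k; dj k b\<rbrakk> \<Longrightarrow> cmp C x P c' (app ?\<delta> k) a = cmp C x P c' (app ?\<delta> k) b"
    obtain k where [simp]: "generic k" "elt k" "ty k = K" "dj k a" "dj a k" "dj k b" "dj b k" using fresh[of a b K] by auto
    have "cmp C x c c' (gl f) (cmp C x P c (app \<gamma> k) a) = cmp C x c c' (gl f) (cmp C x P c (app \<gamma> k) b)"
      using e[of k] by simp
    moreover have "cmp C x c' c (gl (uinv V C c c' f)) (cmp C x c c' (gl f) (cmp C x P c (app \<gamma> k) d)) = cmp C x P c (app \<gamma> k) d"
      if "d = a \<or> d = b" for d
      by (rule uinv_cancel(1)[OF f]) (use that in auto)
    ultimately have *: "cmp C x P c (app \<gamma> k) a = cmp C x P c (app \<gamma> k) b" by metis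
    show "a = b" by (rule cot_eq[OF c _ _ _ _ _ _ _ _ _ _ _ *]) simp_all
  qed simp_all
  then show thesis using that \<delta> by blast
qed

lemma cot_iso_over:
  assumes c: "is_cotensor V C K c P \<gamma>" and c': "is_cotensor V C K c' P' \<gamma>'" and f: "ciso C c c' f"
    and [simp]: "vcategory V C" "c \<in> vob C" "c' \<in> vob C"
  obtains g where "ciso C P P' g" "\<And>k. \<lbrakk>elt k; ty k = K\<rbrakk> \<Longrightarrow> cmp C P P' c' (app \<gamma>' k) (gl g) = cmp C P c c' (gl f) (app \<gamma> k)"
proof -
  obtain \<delta> where d: "is_cotensor V C K c' P \<delta>" "\<And>k. \<lbrakk>elt k; ty k = K\<rbrakk> \<Longrightarrow> app \<delta> k = cmp C P c c' (gl f) (app \<gamma> k)"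
    using cot_transport[OF c f] by auto
  show thesis
  proof (rule cot_iso[OF c' d(1) \<open>vcategory V C\<close> \<open>c' \<in> vob C\<close>])
    fix u v assume "u \<in> Arr V" "Dom V u = \<one>" "Cod V u = vhom C P P'" "v \<in> Arr V" "Dom V v = \<one>" "Cod V v = vhom C P' P"
      "cmp C P' P P' (gl u) (gl v) = gl (vid C P')" "cmp C P P' P (gl v) (gl u) = gl (vid C P)"
      and u: "\<And>k. \<lbrakk>elt k; ty k = K\<rbrakk> \<Longrightarrow> cmp C P P' c' (app \<gamma>' k) (gl u) = app \<delta> k"
    then have "ciso C P P' u" unfolding ciso_def in_Hom by blast
    then show thesis by (rule that) (simp add: u d(2))
  qed
qed

end

context admissible
begin

text \<open>
  An extension \<open>(M, N, g)\<close> of \<open>(M, f)\<close> is forced: naturality of \<open>g\<close> at the counits of the cotensors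
  \<open>K = [K, \<one>]\<close> determines \<open>g\<close>, and then naturality of \<open>g\<close> determines \<open>N\<close>.
\<close>

lemma extension_counit:
  assumes [simp]: "Th T" "alg T A" "Th T'" "Th U'" and D: "balg T' U' D'"
    and g: "scmor T (CT T A) (RD T A) T' U' D' M N g" and [simp]: "x \<in> J" "K \<in> J" "elt k" "ty k = K"
  shows "cmp C (fob (CA T A K) x) (fob D' (x, K)) (fob D' (x, \<one>)) (app (fhom (FL T' U' D' x) K \<one> \<cdot> gam U' K) k) (gl (g (x, K)))
    = cmp C (fob (CA T A K) x) (fob A x) (fob D' (x, \<one>)) (gl (g (x, \<one>))) (app (pj T (CA T A K) A x \<cdot> CU T A K) k)"
proof -
  note N = tmorD[OF scmorD(2)[OF g] \<open>Th U'\<close> Th_CT(1)[OF \<open>Th T\<close> \<open>alg T A\<close>]]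
  note [simp] = balgD(4-12)[OF D \<open>Th T'\<close> \<open>Th U'\<close>] N(3-5)
  have "app (fhom N K \<one>) (app (gam U' K) k) = app (CU T A K) k"
    using arg_cong[OF N(9)[OF \<open>K \<in> J\<close>], of "\<lambda>h. app h k"] by simp
  then show ?thesis
    using scmorD(6)[OF g, of x K \<one> "app (gam U' K) k"] by (simp add: fix_left_RD_fhom)
qed

text \<open>\<open>g\<close> and \<open>g'\<close> agree after the counit of
  \<open>fob D' (x, K)\<close>, a cotensor of \<open>fob D' (x, \<one>)\<close>. As
  \<open>g (x, L)\<close> is invertible and the projections of an end are jointly monic,
  \<open>N\<close> and \<open>N'\<close> agree as well.\<close>

lemma extension_unique:
  assumes [simp]: "Th T" "alg T A" "Th T'" "Th U'" and D: "balg T' U' D'"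
    and g: "scmor T (CT T A) (RD T A) T' U' D' M N g" and g': "scmor T (CT T A) (RD T A) T' U' D' M N' g'"
    and e: "\<And>x. x \<in> J \<Longrightarrow> g (x, \<one>) = g' (x, \<one>)"
  shows "g = g'" "N = N'"
proof -
  note [simp] = algD[OF \<open>alg T A\<close> \<open>Th T\<close>] algD(1)[OF CA_simps(1)[OF \<open>Th T\<close> \<open>alg T A\<close>] \<open>Th T\<close>] balgD(4-12)[OF D \<open>Th T'\<close> \<open>Th U'\<close>]
  note [simp] = ciso_arr[OF scmorD(4)[OF g]] ciso_arr[OF scmorD(4)[OF g']]
  note [simp] = tmorD(2-7)[OF scmorD(2)[OF g] \<open>Th U'\<close> Th_CT(1)[OF \<open>Th T\<close> \<open>alg T A\<close>]]
  note [simp] = tmorD(2-7)[OF scmorD(2)[OF g'] \<open>Th U'\<close> Th_CT(1)[OF \<open>Th T\<close> \<open>alg T A\<close>]]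
  show gg: "g = g'"
  proof (rule ext_eqI[OF scmorD(3)[OF g] scmorD(3)[OF g']])
    fix p assume "p \<in> J \<times> J"
    then obtain x K where [simp]: "p = (x, K)" "x \<in> J" "K \<in> J" by auto
    obtain k where k [simp]: "generic k" "elt k" "ty k = K" using fresh[of star star K] by auto
    have "alg U' (FL T' U' D' x)" by (rule balgD(3)[OF D]) simp_all
    from alg_gam[OF this \<open>Th U'\<close> \<open>K \<in> J\<close>]
    have c: "is_cotensor V C K (fob D' (x, \<one>)) (fob D' (x, K)) (fhom (FL T' U' D' x) K \<one> \<cdot> gam U' K)" by simp
    have "gl (g (x, K)) = gl (g' (x, K))"
    proof (rule cot_eq[OF c, where k = k])
      show "cmp C (fob (CA T A K) x) (fob D' (x, K)) (fob D' (x, \<one>)) (app (fhom (FL T' U' D' x) K \<one> \<cdot> gam U' K) k) (gl (g (x, K)))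
        = cmp C (fob (CA T A K) x) (fob D' (x, K)) (fob D' (x, \<one>)) (app (fhom (FL T' U' D' x) K \<one> \<cdot> gam U' K) k) (gl (g' (x, K)))"
        using extension_counit[OF assms(1-5) g \<open>x \<in> J\<close> \<open>K \<in> J\<close> k(2,3)] extension_counit[OF assms(1-5) g' \<open>x \<in> J\<close> \<open>K \<in> J\<close> k(2,3)] e[of x]
        by (simp only: \<open>x \<in> J\<close>)
    qed simp_all
    then show "g p = g' p" by simp
  qed
  show "N = N'"
  proof (rule vfun_eqI[OF tmor_ext[OF scmorD(2)[OF g]] tmor_ext[OF scmorD(2)[OF g']]])
    fix K L assume [simp]: "K \<in> J" "L \<in> J"
    show "fob N K = fob N' K" by simp
    show "fhom N K L = fhom N' K L"
    proof (rule arr_eqI[of _ _ "vhom (tcat U') K L"])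
      fix u assume [simp]: "elt u" "ty u = vhom (tcat U') K L"
      show "app (fhom N K L) u = app (fhom N' K L) u"
      proof (rule end_eq[of T "CA T A K" "CA T A L"])
        fix x assume [simp]: "x \<in> J"
        let ?P = "fob (CA T A K) x" and ?Q = "fob (CA T A L) x" and ?q = "gl (uinv V C (fob (CA T A L) x) (fob D' (x, L)) (g (x, L)))"
        have q: "ciso C ?Q (fob D' (x, L)) (g (x, L))" using scmorD(4)[OF g, of x L] by simp
        have "cmp C ?P ?Q (fob D' (x, L)) (gl (g (x, L))) (app (pj T (CA T A K) (CA T A L) x) (app (fhom N K L) u))
          = cmp C ?P ?Q (fob D' (x, L)) (gl (g (x, L))) (app (pj T (CA T A K) (CA T A L) x) (app (fhom N' K L) u))"
          using scmorD(6)[OF g, of x K L u] scmorD(6)[OF g', of x K L u] by (simp add: fix_left_RD_fhom gg)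
        from arg_cong[OF this, of "cmp C ?P (fob D' (x, L)) ?Q ?q"]
        show "app (pj T (CA T A K) (CA T A L) x) (app (fhom N K L) u) = app (pj T (CA T A K) (CA T A L) x) (app (fhom N' K L) u)"
          by (subst (asm) (1 2) uinv_cancel(1)[OF q]) simp_all
      qed simp_all
    qed simp_all
  qed simp_all
qed

text \<open>Both \<open>[K, A](x)\<close> and \<open>D'(x, K)\<close> are cotensors by
  \<open>K\<close>, of \<open>A(x)\<close> and of \<open>D'(x, \<one>)\<close>, and \<open>g\<close>
  lifts \<open>f\<close> between them. Conjugation by \<open>g\<close> is natural in
  \<open>x\<close> and so defines \<open>N\<close> on hom-objects through the end.\<close>

lemma extension_exists:
  assumes T [simp]: "Th T" "alg T A" "Th T'" "Th U'" and D: "balg T' U' D'"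
    and f: "smor T A T' (FR T' U' D' \<one>) M f"
  shows "\<exists>N g. scmor T (CT T A) (RD T A) T' U' D' M N g \<and> (\<forall>x \<in> J. g (x, \<one>) = f x)"
proof -
  note [simp] = algD[OF \<open>alg T A\<close> \<open>Th T\<close>] algD[OF CA_simps(1)[OF \<open>Th T\<close> \<open>alg T A\<close>] \<open>Th T\<close>] balgD(4-12)[OF D \<open>Th T'\<close> \<open>Th U'\<close>]
  note [simp] = tmorD(2-7)[OF smorD(1)[OF f] \<open>Th T\<close> \<open>Th T'\<close>]
  have fi: "ciso C (fob A x) (fob D' (x, \<one>)) (f x)" if "x \<in> J" for x using smorD(3)[OF f that] that by simp
  note [simp] = ciso_arr[OF fi]
  let ?P = "\<lambda>K. fob (CA T A K)" and ?F = "\<lambda>x. FL T' U' D' x" and ?R = "\<lambda>K. FR T' U' D' K" and ?D = "\<lambda>x K. fob D' (x, K)"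
  have alF: "alg U' (?F x)" if "x \<in> J" for x by (rule balgD(3)[OF D]) (simp_all add: that)
  have alR: "alg T' (?R K)" if "K \<in> J" for K by (rule balgD(2)[OF D]) (simp_all add: that)
  have Fcomp: "app (fhom (?F x) k m) (cmp (tcat U') k l m b a) = cmp C (?D x k) (?D x l) (?D x m) (app (fhom (?F x) l m) b) (app (fhom (?F x) k l) a)"
    and Fid: "fhom (?F x) k k \<cdot> vid (tcat U') k = vid C (?D x k)"
    if "x \<in> J" "k \<in> J" "l \<in> J" "m \<in> J" "elt a" "elt b" "ty a = vhom (tcat U') k l" "ty b = vhom (tcat U') l m" "dj b a" for x k l m a b
    using algD(5,6)[OF alF[OF \<open>x \<in> J\<close>]] that by simp_all
  have Fid: "fhom (?F x) k k \<cdot> vid (tcat U') k = vid C (?D x k)" if "x \<in> J" "k \<in> J" for x k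
    using algD(5)[OF alF[OF \<open>x \<in> J\<close>]] that by simp
  have c1: "is_cotensor V C K (?D x \<one>) (?D x K) (fhom (?F x) K \<one> \<cdot> gam U' K)" if "x \<in> J" "K \<in> J" for x K
    using alg_gam[OF alF[OF that(1)] \<open>Th U'\<close> that(2)] that by simp
  have c2: "is_cotensor V C K (fob A x) (?P K x) (pj T (CA T A K) A x \<cdot> CU T A K)" if "x \<in> J" "K \<in> J" for x K
    by (rule CA_pointwise) (simp_all add: that)
  \<comment> \<open>The interchange of the two variables of \<open>D'\<close>, used for the
    naturality of \<open>g\<close> and again for that of the conjugate.\<close>
  have comm: "cmp C (?D x K) (?D x L) (?D y L) (app (fhom (?R L) x y) t) (app (fhom (?F x) K L) u)
      = cmp C (?D x K) (?D y K) (?D y L) (app (fhom (?F y) K L) u) (app (fhom (?R K) x y) t)"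
    if "x \<in> J" "y \<in> J" "K \<in> J" "L \<in> J" "elt t" "ty t = vhom (tcat T') x y" "elt u" "ty u = vhom (tcat U') K L" "dj t u" "dj u t"
    for x y K L t u
    using two_var_split[OF balgD(1)[OF D \<open>Th T'\<close> \<open>Th U'\<close>] _ _ C_cat, of x y K L t u] that by simp
  \<comment> \<open>Chosen by \<open>SOME\<close> so that one function of \<open>x\<close> and
    \<open>K\<close> results; \<open>cot_iso_over\<close> supplies the witnesses.\<close>
  define g where "g x K = (SOME g. ciso C (?P K x) (?D x K) g \<and> (\<forall>k. elt k \<longrightarrow> ty k = K \<longrightarrow>
      cmp C (?P K x) (?D x K) (?D x \<one>) (app (fhom (?F x) K \<one> \<cdot> gam U' K) k) (gl g)
        = cmp C (?P K x) (fob A x) (?D x \<one>) (gl (f x)) (app (pj T (CA T A K) A x \<cdot> CU T A K) k)))" for x K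
  have "\<exists>g. ciso C (?P K x) (?D x K) g \<and> (\<forall>k. elt k \<longrightarrow> ty k = K \<longrightarrow>
      cmp C (?P K x) (?D x K) (?D x \<one>) (app (fhom (?F x) K \<one> \<cdot> gam U' K) k) (gl g)
        = cmp C (?P K x) (fob A x) (?D x \<one>) (gl (f x)) (app (pj T (CA T A K) A x \<cdot> CU T A K) k))"
    if x: "x \<in> J" "K \<in> J" for x K
  proof -
    obtain g where "ciso C (?P K x) (?D x K) g" "\<And>k. \<lbrakk>elt k; ty k = K\<rbrakk> \<Longrightarrow>
      cmp C (?P K x) (?D x K) (?D x \<one>) (app (fhom (?F x) K \<one> \<cdot> gam U' K) k) (gl g)
        = cmp C (?P K x) (fob A x) (?D x \<one>) (gl (f x)) (app (pj T (CA T A K) A x \<cdot> CU T A K) k)"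
      by (rule cot_iso_over[OF c2[OF x] c1[OF x] fi[OF x(1)]]) (use x in auto)
    then show ?thesis by blast
  qed
  note gs = someI_ex[OF this, folded g_def]
  have gi: "ciso C (?P K x) (?D x K) (g x K)" if "x \<in> J" "K \<in> J" for x K
    by (rule conjunct1[OF gs[OF that]])
  have gk: "cmp C (?P K x) (?D x K) (?D x \<one>) (app (fhom (?F x) K \<one> \<cdot> gam U' K) k) (gl (g x K))
        = cmp C (?P K x) (fob A x) (?D x \<one>) (gl (f x)) (app (pj T (CA T A K) A x \<cdot> CU T A K) k)"
    if "x \<in> J" "K \<in> J" "elt k" "ty k = K" for x K k
    by (rule conjunct2[OF gs[OF that(1,2)], rule_format]) (rule that)+
  note [simp] = ciso_arr[OF gi]
  let ?i = "\<lambda>x K. uinv V C (?P K x) (?D x K) (g x K)"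
  have ii [simp]: "?i x K \<in> Arr V" "Dom V (?i x K) = \<one>" "Cod V (?i x K) = vhom C (?D x K) (?P K x)"
    "cmp C (?P K x) (?D x K) (?P K x) (gl (?i x K)) (gl (g x K)) = gl (vid C (?P K x))"
    "cmp C (?D x K) (?P K x) (?D x K) (gl (g x K)) (gl (?i x K)) = gl (vid C (?D x K))"
    if "x \<in> J" "K \<in> J" for x K
    using uinv(1-5)[OF gi[OF that]] that by simp_all
  \<comment> \<open>For \<open>K = \<one>\<close> both counits are identities, which leaves
    \<open>f x\<close>.\<close>
  have g1: "g x \<one> = f x" if [simp]: "x \<in> J" for x
  proof (rule arr_eqI0)
    show "gl (g x \<one>) = gl (f x)" using gk[of x \<one> star] Fid[of x \<one>] by (simp add: gam_unit)
  qed
  \<comment> \<open>Tested after the counit of \<open>D'(y, K)\<close>. The chain passes from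
    \<open>g y K\<close> to \<open>f y\<close>, uses naturality of the counit of
    \<open>[K, A]\<close> and of \<open>f\<close>, and returns to \<open>g x K\<close> by the
    interchange in \<open>D'\<close>.\<close>
  have gnat: "cmp C (?P K x) (?P K y) (?D y K) (gl (g y K)) (app (fhom (CA T A K) x y) t)
      = cmp C (?P K x) (?D x K) (?D y K) (app (fhom (?R K) x y) (app (fhom M x y) t)) (gl (g x K))"
    if [simp]: "x \<in> J" "y \<in> J" "K \<in> J" "elt t" "ty t = vhom (tcat T) x y" for x y K t
  proof -
    obtain k where k [simp]: "generic k" "elt k" "ty k = K" "dj k t" "dj t k" using fresh[of t t K] by auto
    let ?d = "app (gam U' K) k" and ?e = "app (CU T A K) k" and ?Mt = "app (fhom M x y) t"
    let ?ex = "app (pj T (CA T A K) A x) ?e" and ?ey = "app (pj T (CA T A K) A y) ?e"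
    have gk': "cmp C (?P K z) (?D z K) (?D z \<one>) (app (fhom (?F z) K \<one>) ?d) (gl (g z K))
        = cmp C (?P K z) (fob A z) (?D z \<one>) (gl (f z)) (app (pj T (CA T A K) A z) ?e)" if "z \<in> J" for z
      using gk[of z K k] that by simp
    show ?thesis
    proof (rule cot_eq[OF c1[of y K], where k = k])
      have "cmp C (?P K x) (?D y K) (?D y \<one>) (app (fhom (?F y) K \<one>) ?d) (cmp C (?P K x) (?P K y) (?D y K) (gl (g y K)) (app (fhom (CA T A K) x y) t))
        = cmp C (?P K x) (?P K y) (?D y \<one>) (cmp C (?P K y) (?D y K) (?D y \<one>) (app (fhom (?F y) K \<one>) ?d) (gl (g y K))) (app (fhom (CA T A K) x y) t)"
        by simp
      also have "\<dots> = cmp C (?P K x) (?P K y) (?D y \<one>) (cmp C (?P K y) (fob A y) (?D y \<one>) (gl (f y)) ?ey) (app (fhom (CA T A K) x y) t)"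
        by (simp only: gk'[OF \<open>y \<in> J\<close>])
      also have "\<dots> = cmp C (?P K x) (fob A y) (?D y \<one>) (gl (f y)) (cmp C (?P K x) (?P K y) (fob A y) ?ey (app (fhom (CA T A K) x y) t))"
        by simp
      also have "\<dots> = cmp C (?P K x) (fob A y) (?D y \<one>) (gl (f y)) (cmp C (?P K x) (fob A x) (fob A y) (app (fhom A x y) t) ?ex)"
        by (subst end_nat[symmetric]) simp_all
      also have "\<dots> = cmp C (?P K x) (fob A x) (?D y \<one>) (cmp C (fob A x) (fob A y) (?D y \<one>) (gl (f y)) (app (fhom A x y) t)) ?ex"
        by simp
      also have "\<dots> = cmp C (?P K x) (fob A x) (?D y \<one>) (cmp C (fob A x) (?D x \<one>) (?D y \<one>) (app (fhom (?R \<one>) x y) ?Mt) (gl (f x))) ?ex"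
        using smorD(4)[OF f, of x y t] by simp
      also have "\<dots> = cmp C (?P K x) (?D x \<one>) (?D y \<one>) (app (fhom (?R \<one>) x y) ?Mt) (cmp C (?P K x) (fob A x) (?D x \<one>) (gl (f x)) ?ex)"
        by simp
      also have "\<dots> = cmp C (?P K x) (?D x \<one>) (?D y \<one>) (app (fhom (?R \<one>) x y) ?Mt) (cmp C (?P K x) (?D x K) (?D x \<one>) (app (fhom (?F x) K \<one>) ?d) (gl (g x K)))"
        by (simp only: gk'[OF \<open>x \<in> J\<close>])
      also have "\<dots> = cmp C (?P K x) (?D x K) (?D y \<one>) (cmp C (?D x K) (?D x \<one>) (?D y \<one>) (app (fhom (?R \<one>) x y) ?Mt) (app (fhom (?F x) K \<one>) ?d)) (gl (g x K))"
        by simp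
      also have "\<dots> = cmp C (?P K x) (?D x K) (?D y \<one>) (cmp C (?D x K) (?D y K) (?D y \<one>) (app (fhom (?F y) K \<one>) ?d) (app (fhom (?R K) x y) ?Mt)) (gl (g x K))"
        by (subst comm) simp_all
      also have "\<dots> = cmp C (?P K x) (?D y K) (?D y \<one>) (app (fhom (?F y) K \<one>) ?d) (cmp C (?P K x) (?D x K) (?D y K) (app (fhom (?R K) x y) ?Mt) (gl (g x K)))"
        by simp
      finally show "cmp C (?P K x) (?D y K) (?D y \<one>) (app (fhom (?F y) K \<one> \<cdot> gam U' K) k) (cmp C (?P K x) (?P K y) (?D y K) (gl (g y K)) (app (fhom (CA T A K) x y) t))
        = cmp C (?P K x) (?D y K) (?D y \<one>) (app (fhom (?F y) K \<one> \<cdot> gam U' K) k) (cmp C (?P K x) (?D x K) (?D y K) (app (fhom (?R K) x y) ?Mt) (gl (g x K)))"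
        by simp
    qed simp_all
  qed
  have inat: "cmp C (?D x K) (?D y K) (?P K y) (gl (?i y K)) (app (fhom (?R K) x y) (app (fhom M x y) t))
      = cmp C (?D x K) (?P K x) (?P K y) (app (fhom (CA T A K) x y) t) (gl (?i x K))"
    if [simp]: "x \<in> J" "y \<in> J" "K \<in> J" "elt t" "ty t = vhom (tcat T) x y" for x y K t
    by (rule inv_nat[OF gi gi]) (simp_all add: gnat)
  \<comment> \<open>The conjugate: \<open>u\<close> goes to the inverse of \<open>g x L\<close>
    after \<open>D'(x, u)\<close> after \<open>g x K\<close>.\<close>
  let ?\<kappa> = "\<lambda>K L x. vcomp C (?P K x) (?D x L) (?P L x) \<cdot> (?i x L \<boxtimes> (vcomp C (?P K x) (?D x K) (?D x L) \<cdot>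
     (fhom (?F x) K L \<boxtimes> g x K) \<cdot> inv_arr V (Run V (vhom (tcat U') K L)))) \<cdot> inv_arr V (Lun V (vhom (tcat U') K L))"
  have ex: "\<exists>!n. n \<in> Hom V (vhom (tcat U') K L) (eo T (CA T A K) (CA T A L)) \<and> (\<forall>x \<in> J. pj T (CA T A K) (CA T A L) x \<cdot> n = ?\<kappa> K L x)"
    if [simp]: "K \<in> J" "L \<in> J" for K L
  proof (rule end_ex)
    fix x y t u assume [simp]: "x \<in> J" "y \<in> J" "elt t" "ty t = vhom (tcat T) x y" "elt u" "ty u = vhom (tcat U') K L" "dj t u" "dj u t"
    let ?Mt = "app (fhom M x y) t"
    have "cmp C (?P K x) (?P L x) (?P L y) (app (fhom (CA T A L) x y) t) (cmp C (?P K x) (?D x L) (?P L x) (gl (?i x L)) (cmp C (?P K x) (?D x K) (?D x L) (app (fhom (?F x) K L) u) (gl (g x K))))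
      = cmp C (?P K x) (?D x L) (?P L y) (cmp C (?D x L) (?P L x) (?P L y) (app (fhom (CA T A L) x y) t) (gl (?i x L))) (cmp C (?P K x) (?D x K) (?D x L) (app (fhom (?F x) K L) u) (gl (g x K)))"
      by simp
    also have "\<dots> = cmp C (?P K x) (?D x L) (?P L y) (cmp C (?D x L) (?D y L) (?P L y) (gl (?i y L)) (app (fhom (?R L) x y) ?Mt)) (cmp C (?P K x) (?D x K) (?D x L) (app (fhom (?F x) K L) u) (gl (g x K)))"
      by (simp only: inat[OF \<open>x \<in> J\<close> \<open>y \<in> J\<close> \<open>L \<in> J\<close> \<open>elt t\<close> \<open>ty t = vhom (tcat T) x y\<close>])
    also have "\<dots> = cmp C (?P K x) (?D y L) (?P L y) (gl (?i y L)) (cmp C (?P K x) (?D x K) (?D y L) (cmp C (?D x K) (?D x L) (?D y L) (app (fhom (?R L) x y) ?Mt) (app (fhom (?F x) K L) u)) (gl (g x K)))"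
      by simp
    also have "\<dots> = cmp C (?P K x) (?D y L) (?P L y) (gl (?i y L)) (cmp C (?P K x) (?D x K) (?D y L) (cmp C (?D x K) (?D y K) (?D y L) (app (fhom (?F y) K L) u) (app (fhom (?R K) x y) ?Mt)) (gl (g x K)))"
      by (subst comm) simp_all
    also have "\<dots> = cmp C (?P K x) (?D y L) (?P L y) (gl (?i y L)) (cmp C (?P K x) (?D y K) (?D y L) (app (fhom (?F y) K L) u) (cmp C (?P K x) (?D x K) (?D y K) (app (fhom (?R K) x y) ?Mt) (gl (g x K))))"
      by simp
    also have "\<dots> = cmp C (?P K x) (?D y L) (?P L y) (gl (?i y L)) (cmp C (?P K x) (?D y K) (?D y L) (app (fhom (?F y) K L) u) (cmp C (?P K x) (?P K y) (?D y K) (gl (g y K)) (app (fhom (CA T A K) x y) t)))"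
      by (simp only: gnat[OF \<open>x \<in> J\<close> \<open>y \<in> J\<close> \<open>K \<in> J\<close> \<open>elt t\<close> \<open>ty t = vhom (tcat T) x y\<close>])
    finally show "cmp C (?P K x) (?P L x) (?P L y) (app (fhom (CA T A L) x y) t) (app (?\<kappa> K L x) u)
        = cmp C (?P K x) (?P K y) (?P L y) (app (?\<kappa> K L y) u) (app (fhom (CA T A K) x y) t)"
      by simp
  qed (simp_all add: in_Hom)
  define n where "n K L = (THE n. n \<in> Hom V (vhom (tcat U') K L) (eo T (CA T A K) (CA T A L)) \<and>
      (\<forall>x \<in> J. pj T (CA T A K) (CA T A L) x \<cdot> n = ?\<kappa> K L x))" for K L
  note n = theI'[OF ex, folded n_def]
  have [simp]: "n K L \<in> Arr V" "Dom V (n K L) = vhom (tcat U') K L" "Cod V (n K L) = eo T (CA T A K) (CA T A L)"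
    if "K \<in> J" "L \<in> J" for K L using n[OF that] by (simp_all add: in_Hom)
  have nx: "app (pj T (CA T A K) (CA T A L) x) (app (n K L) u)
      = cmp C (?P K x) (?D x L) (?P L x) (gl (?i x L)) (cmp C (?P K x) (?D x K) (?D x L) (app (fhom (?F x) K L) u) (gl (g x K)))"
    if [simp]: "K \<in> J" "L \<in> J" "x \<in> J" "elt u" "ty u = vhom (tcat U') K L" for K L x u
  proof -
    have "pj T (CA T A K) (CA T A L) x \<cdot> n K L = ?\<kappa> K L x" using n[of K L] by simp
    from arg_cong[OF this, of "\<lambda>h. app h u"] show ?thesis by simp
  qed
  define N where "N = \<lparr>fob = (\<lambda>K \<in> J. K), fhom = res2 J n\<rparr>"
  have [simp]: "fob N K = K" "L \<in> J \<Longrightarrow> fhom N K L = n K L" if "K \<in> J" for K L using that by (simp_all add: N_def)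
  have NF: "vfunctor V (tcat U') (tcat (CT T A)) N"
  proof (rule vfunctorI)
    show "vfun_ext (vob (tcat U')) N" by (simp add: vfun_ext_def N_def)
  next
    fix K assume "K \<in> vob (tcat U')"
    then have [simp]: "K \<in> J" by simp
    have "app (n K K) (gl (vid (tcat U') K)) = gl (vid (AV T) (CA T A K))"
    proof (rule end_eq[of T "CA T A K" "CA T A K"])
      fix x assume [simp]: "x \<in> J"
      show "app (pj T (CA T A K) (CA T A K) x) (app (n K K) (gl (vid (tcat U') K))) = app (pj T (CA T A K) (CA T A K) x) (gl (vid (AV T) (CA T A K)))"
        using nx[of K K x "gl (vid (tcat U') K)"] by (simp add: Fid del: gl_eq)
    qed simp_all
    then show "app (fhom N K K) (gl (vid (tcat U') K)) = gl (vid (tcat (CT T A)) (fob N K))" by simp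
  next
    fix K L S a b assume "K \<in> vob (tcat U')" "L \<in> vob (tcat U')" "S \<in> vob (tcat U')"
      and [simp]: "elt a" "elt b" "ty a = vhom (tcat U') K L" "ty b = vhom (tcat U') L S" "dj b a" "dj a b"
    then have [simp]: "K \<in> J" "L \<in> J" "S \<in> J" by simp_all
    have "app (n K S) (cmp (tcat U') K L S b a) = cmp (AV T) (CA T A K) (CA T A L) (CA T A S) (app (n L S) b) (app (n K L) a)"
    proof (rule end_eq[of T "CA T A K" "CA T A S"])
      fix x assume [simp]: "x \<in> J"
      let ?w = "cmp C (?P K x) (?D x K) (?D x L) (app (fhom (?F x) K L) a) (gl (g x K))"
      \<comment> \<open>In the composite of two conjugates the inner \<open>g x L\<close> meets its
        inverse and cancels.\<close>
      have "cmp C (?P K x) (?P L x) (?D x L) (gl (g x L)) (cmp C (?P K x) (?D x L) (?P L x) (gl (?i x L)) ?w) = ?w"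
        by (rule uinv_cancel(2)[OF gi]) simp_all
      then show "app (pj T (CA T A K) (CA T A S) x) (app (n K S) (cmp (tcat U') K L S b a))
        = app (pj T (CA T A K) (CA T A S) x) (cmp (AV T) (CA T A K) (CA T A L) (CA T A S) (app (n L S) b) (app (n K L) a))"
        by (simp add: nx Fcomp)
    qed simp_all
    then show "app (fhom N K S) (cmp (tcat U') K L S b a)
      = cmp (tcat (CT T A)) (fob N K) (fob N L) (fob N S) (app (fhom N L S) b) (app (fhom N K L) a)" by simp
  qed (simp_all add: in_Hom)
  have Nt: "tmor U' (CT T A) N"
  proof (rule tmorI[OF \<open>Th U'\<close> _ NF])
    fix K assume [simp]: "K \<in> J"
    \<comment> \<open>The defining property of \<open>g\<close>, together with
      \<open>g x \<one> = f x\<close>, says that conjugation takes the counits of \<open>U'\<close>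
      to those of the commutant.\<close>
    have "n K \<one> \<cdot> gam U' K = CU T A K"
    proof (rule arr_eqI[of _ _ K])
      fix k assume [simp]: "elt k" "ty k = K"
      show "app (n K \<one> \<cdot> gam U' K) k = app (CU T A K) k"
      proof (rule end_eq[of T "CA T A K" A])
        fix x assume [simp]: "x \<in> J"
        have "app (pj T (CA T A K) (CA T A \<one>) x) (app (n K \<one>) (app (gam U' K) k))
          = cmp C (?P K x) (?D x \<one>) (?P \<one> x) (gl (?i x \<one>)) (cmp C (?P K x) (?P \<one> x) (?D x \<one>) (gl (g x \<one>)) (app (pj T (CA T A K) A x) (app (CU T A K) k)))"
          using nx[of K \<one> x "app (gam U' K) k"] gk[of x K k] by (simp add: g1)
        also have "\<dots> = app (pj T (CA T A K) A x) (app (CU T A K) k)"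
          by (rule uinv_cancel(1)[OF gi]) simp_all
        finally show "app (pj T (CA T A K) A x) (app (n K \<one> \<cdot> gam U' K) k) = app (pj T (CA T A K) A x) (app (CU T A K) k)"
          by simp
      qed simp_all
    qed simp_all
    then show "fhom N K \<one> \<cdot> gam U' K = gam (CT T A) K" by simp
  qed simp_all
  have "scmor T (CT T A) (RD T A) T' U' D' M N (\<lambda>(x, K) \<in> J \<times> J. g x K)"
    unfolding scmor_def
  proof (intro conjI ballI allI impI)
    fix x K assume "x \<in> J" "K \<in> J"
    then show "ciso C (fob (RD T A) (x, K)) (fob D' (x, K)) ((\<lambda>(x, K) \<in> J \<times> J. g x K) (x, K))" using gi by simp
  next
    fix x y K t assume "x \<in> J" "y \<in> J" "K \<in> J" "elt t" "ty t = vhom (tcat T) x y"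
    then show "cmp C (fob (RD T A) (x, K)) (fob (RD T A) (y, K)) (fob D' (y, K)) (gl ((\<lambda>(x, K) \<in> J \<times> J. g x K) (y, K))) (app (fhom (FR T (CT T A) (RD T A) K) x y) t)
        = cmp C (fob (RD T A) (x, K)) (fob D' (x, K)) (fob D' (y, K)) (app (fhom (FR T' U' D' K) x y) (app (fhom M x y) t)) (gl ((\<lambda>(x, K) \<in> J \<times> J. g x K) (x, K)))"
      using gnat[of x y K t] by (simp add: fix_right_RD)
  next
    fix x K L u assume [simp]: "x \<in> J" "K \<in> J" "L \<in> J" "elt u" "ty u = vhom (tcat U') K L"
    let ?w = "cmp C (?P K x) (?D x K) (?D x L) (app (fhom (?F x) K L) u) (gl (g x K))"
    have "cmp C (?P K x) (?P L x) (?D x L) (gl (g x L)) (cmp C (?P K x) (?D x L) (?P L x) (gl (?i x L)) ?w) = ?w"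
      by (rule uinv_cancel(2)[OF gi]) simp_all
    then show "cmp C (fob (RD T A) (x, K)) (fob (RD T A) (x, L)) (fob D' (x, L)) (gl ((\<lambda>(x, K) \<in> J \<times> J. g x K) (x, L))) (app (fhom (FL T (CT T A) (RD T A) x) K L) (app (fhom N K L) u))
        = cmp C (fob (RD T A) (x, K)) (fob D' (x, K)) (fob D' (x, L)) (app (fhom (FL T' U' D' x) K L) u) (gl ((\<lambda>(x, K) \<in> J \<times> J. g x K) (x, K)))"
      by (simp add: fix_left_RD_fhom nx)
  qed (simp_all add: Nt smorD(1)[OF f])
  then show ?thesis using g1 by (intro exI[of _ N] exI[of _ "\<lambda>(x, K) \<in> J \<times> J. g x K"]) simp
qed

lemma RD_obj:
  assumes "Th T" "alg T A"
  shows "(T, CT T A, RD T A) \<in> Obj (BAlg_sc V J C)" "left_face V (T, CT T A, RD T A) = (T, A)"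
    "right_face V (T, CT T A, RD T A) = commutant V J C ct (T, A)"
  using assms is_bialgebra_RD fix_right_RD[of T A \<one>] fix_left_RD[of T A] by (simp_all add: commutant_def)

text \<open>\<open>L\<close> remembers \<open>M\<close> and the components of \<open>g\<close> at
  \<open>\<one>\<close>, and these determine the morphism by \<open>extension_unique\<close>.
  Existence is \<open>extension_exists\<close>, whose components at \<open>\<one>\<close> are those
  of the given \<open>f\<close>.\<close>

lemma left_face_universal:
  assumes X: "X \<in> Obj (Alg_s V J C)" and Y: "Y \<in> Obj (BAlg_sc V J C)" and m: "m \<in> Hom (Alg_s V J C) X (left_face V Y)"
  shows "\<exists>!g. g \<in> Hom (BAlg_sc V J C) (fst X, CT (fst X) (snd X), RD (fst X) (snd X)) Y \<and> onArr (L_functor V J) g = m"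
proof -
  obtain T A where X': "X = (T, A)" and [simp]: "Th T" "alg T A" using X by (auto simp: Alg_obj)
  obtain T' U' D' where Y': "Y = (T', U', D')" and [simp]: "Th T'" "Th U'" and D: "balg T' U' D'" using Y by (auto simp: BAlg_obj)
  obtain M f where m': "m = \<lparr>src = (T, A), tgt = (T', FR T' U' D' \<one>), dat = (M, f)\<rparr>" and f: "smor T A T' (FR T' U' D' \<one>) M f"
    using m by (auto simp: X' Y' in_Hom Alg_arr_iff)
  have lf: "FR T (CT T A) (RD T A) \<one> = A" using fix_right_RD[of T A \<one>] by simp
  obtain N g where g: "scmor T (CT T A) (RD T A) T' U' D' M N g" and gf: "\<forall>x \<in> J. g (x, \<one>) = f x"
    using extension_exists[OF _ _ _ _ D f] by auto
  let ?g = "\<lparr>src = (T, CT T A, RD T A), tgt = (T', U', D'), dat = (M, N, g)\<rparr>"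
  show ?thesis
  proof (rule ex1I[of _ ?g])
    have "(\<lambda>X \<in> J. g (X, \<one>)) = f" by (rule ext_eqI[OF _ smorD(2)[OF f]]) (simp_all add: gf)
    then show "?g \<in> Hom (BAlg_sc V J C) (fst X, CT (fst X) (snd X), RD (fst X) (snd X)) Y \<and> onArr (L_functor V J) ?g = m"
      using g D by (simp add: in_Hom BAlg_arr_iff X' Y' m' L_functor_def lf is_bialgebra_RD del: tcat_CT)
  next
    fix h assume h: "h \<in> Hom (BAlg_sc V J C) (fst X, CT (fst X) (snd X), RD (fst X) (snd X)) Y \<and> onArr (L_functor V J) h = m"
    then obtain M' N' g' where h': "h = \<lparr>src = (T, CT T A, RD T A), tgt = (T', U', D'), dat = (M', N', g')\<rparr>"
      and g': "scmor T (CT T A) (RD T A) T' U' D' M' N' g'"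
      by (auto simp: in_Hom BAlg_arr_iff X' Y')
    have "M' = M" "(\<lambda>X \<in> J. g' (X, \<one>)) = f" using h by (auto simp: h' m' L_functor_def)
    moreover have "g' (x, \<one>) = f x" if "x \<in> J" for x using fun_cong[OF calculation(2), of x] that by simp
    ultimately show "h = ?g" using extension_unique[OF _ _ _ _ D, of T A M N' g' N g] g g' gf by (simp add: h')
  qed
qed

end

section \<open>Adjunctions from universal arrows\<close>

lemma op_cat_simps [simp]:
  "Obj (op_cat C) = Obj C" "Arr (op_cat C) = Arr C" "Dom (op_cat C) = Cod C" "Cod (op_cat C) = Dom C"
  "Id (op_cat C) = Id C" "Comp (op_cat C) g f = Comp C f g" "Hom (op_cat C) X Y = Hom C Y X"
  by (auto simp: op_cat_def Hom_def)

lemma op_op_cat [simp]: "op_cat (op_cat C) = C"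
  by (simp add: op_cat_def)

lemma category_op:
  assumes "category C"
  shows "category (op_cat C)"
proof -
  interpret category C by (rule assms)
  show ?thesis
    by standard (auto simp: in_Hom)
qed

lemma is_functor_op: "is_functor A B F \<Longrightarrow> is_functor (op_cat A) (op_cat B) F"
  by (auto simp: is_functor_def category_op)

lemma is_functor_comp: "is_functor A B F \<Longrightarrow> is_functor B C G \<Longrightarrow> is_functor A C (comp_fnctr G F)"
  unfolding is_functor_def comp_fnctr_def by simp metis

lemma is_functor_cong:
  assumes F: "is_functor A B F" and o: "\<And>X. X \<in> Obj A \<Longrightarrow> onObj G X = onObj F X" and a: "\<And>f. f \<in> Arr A \<Longrightarrow> onArr G f = onArr F f"
  shows "is_functor A B G"
proof -
  interpret A: category A using F by (simp add: is_functor_def)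
  have 1: "f \<in> Arr A" "X \<in> Obj A" "Y \<in> Obj A" if "f \<in> Hom A X Y" for f X Y using that by (auto simp: in_Hom)
  have 2: "Comp A g f \<in> Arr A" if "f \<in> Hom A X Y" "g \<in> Hom A Y Z" for f g X Y Z
    using A.Comp_in[OF that] by (simp add: in_Hom)
  show ?thesis
    using F 1 2 A.id_arr(1) unfolding is_functor_def by (simp add: o a)
qed

lemma functorD:
  assumes "is_functor A B F"
  shows "category A" "category B" "\<And>X. X \<in> Obj A \<Longrightarrow> onObj F X \<in> Obj B"
    "\<And>X Y f. f \<in> Hom A X Y \<Longrightarrow> onArr F f \<in> Hom B (onObj F X) (onObj F Y)"
    "\<And>X. X \<in> Obj A \<Longrightarrow> onArr F (Id A X) = Id B (onObj F X)"
    "\<And>X Y Z f g. f \<in> Hom A X Y \<Longrightarrow> g \<in> Hom A Y Z \<Longrightarrow> onArr F (Comp A g f) = Comp B (onArr F g) (onArr F f)"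
  using assms unfolding is_functor_def by blast+

text \<open>Reversing arrows interchanges the axioms for unit and counit. The adjunction for the
  right face is obtained in this way from a left adjoint into an opposite category.\<close>

lemma adjunction_op:
  assumes "adjunction A B F G \<eta> \<epsilon>"
  shows "adjunction (op_cat B) (op_cat A) G F \<epsilon> \<eta>"
  using assms unfolding adjunction_def is_nat_trans_def comp_fnctr_def id_fnctr_def
  by (auto simp: is_functor_op)

text \<open>Universal arrows to \<open>L\<close> whose unit is the identity:
  \<open>onObj L (R0 X) = X\<close> is an equality, so an arrow from \<open>X\<close> to
  \<open>onObj L Y\<close> can be compared with \<open>onArr L g\<close> directly. Only the objects
  \<open>R0 X\<close> are given; functoriality is derived.\<close>

locale strict_universal =
  fixes A :: "('o, 'a) cat" and B :: "('p, 'b) cat" and L :: "('p, 'b, 'o, 'a) fnctr" and R0 :: "'o \<Rightarrow> 'p"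
  assumes L: "is_functor B A L"
    and R0: "X \<in> Obj A \<Longrightarrow> R0 X \<in> Obj B"
    and LR0: "X \<in> Obj A \<Longrightarrow> onObj L (R0 X) = X"
    and universal: "\<lbrakk>X \<in> Obj A; Y \<in> Obj B; f \<in> Hom A X (onObj L Y)\<rbrakk> \<Longrightarrow>
      \<exists>!g. g \<in> Hom B (R0 X) Y \<and> onArr L g = f"
begin

definition ladj :: "('o, 'a, 'p, 'b) fnctr" where
  "ladj = \<lparr>onObj = R0, onArr = (\<lambda>f. THE g. g \<in> Hom B (R0 (Dom A f)) (R0 (Cod A f)) \<and> onArr L g = f)\<rparr>"

sublocale A: category A by (rule functorD(2)[OF L])
sublocale B: category B by (rule functorD(1)[OF L])

lemma Hom_obj: "f \<in> Hom A X Y \<Longrightarrow> X \<in> Obj A \<and> Y \<in> Obj A" "g \<in> Hom B Z W \<Longrightarrow> Z \<in> Obj B \<and> W \<in> Obj B"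
  by (auto simp: in_Hom)

lemma unique:
  assumes "X \<in> Obj A" "g \<in> Hom B (R0 X) Y" "h \<in> Hom B (R0 X) Y" "onArr L g = onArr L h"
  shows "g = h"
proof -
  have "onArr L h \<in> Hom A X (onObj L Y)" using functorD(4)[OF L assms(3)] LR0 assms(1) by simp
  then have "\<exists>!k. k \<in> Hom B (R0 X) Y \<and> onArr L k = onArr L h"
    using universal[of X Y] assms Hom_obj by blast
  then show ?thesis using assms by blast
qed

lemma ladj:
  assumes f: "f \<in> Hom A X Y"
  shows "onArr ladj f \<in> Hom B (R0 X) (R0 Y)" "onArr L (onArr ladj f) = f"
proof -
  have e: "Dom A f = X" "Cod A f = Y" using f by (auto simp: in_Hom)
  have "\<exists>!g. g \<in> Hom B (R0 X) (R0 Y) \<and> onArr L g = f"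
    by (rule universal) (use f Hom_obj(1)[OF f] R0 LR0 in auto)
  from theI'[OF this] show "onArr ladj f \<in> Hom B (R0 X) (R0 Y)" "onArr L (onArr ladj f) = f"
    by (auto simp: ladj_def e)
qed

text \<open>\<open>L\<close> is injective on arrows out of \<open>R0 X\<close>, so any arrow lying
  over \<open>f\<close> is the value of \<open>ladj\<close> at \<open>f\<close>. Functor laws are
  checked by applying \<open>L\<close>.\<close>

lemma ladj_eqI:
  assumes "g \<in> Hom B (R0 X) (R0 Y)" "X \<in> Obj A" "Y \<in> Obj A" "onArr L g = f"
  shows "onArr ladj f = g"
proof -
  have f: "f \<in> Hom A X Y" using functorD(4)[OF L assms(1)] LR0 assms by simp
  show ?thesis by (rule unique[OF assms(2) ladj(1)[OF f] assms(1)]) (simp add: ladj(2)[OF f] assms(4))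
qed

lemma onObj_ladj [simp]: "onObj ladj = R0"
  by (simp add: ladj_def)

lemma is_functor_ladj: "is_functor A B ladj"
  unfolding is_functor_def onObj_ladj
proof (intro conjI ballI allI A.category_axioms B.category_axioms R0 ladj(1))
  fix X assume X: "X \<in> Obj A"
  show "onArr ladj (Id A X) = Id B (R0 X)"
    by (rule ladj_eqI[OF B.Id_in[OF R0[OF X]] X X]) (simp add: functorD(5)[OF L R0[OF X]] LR0[OF X])
next
  fix X Y Z f g assume f: "f \<in> Hom A X Y" and g: "g \<in> Hom A Y Z"
  show "onArr ladj (Comp A g f) = Comp B (onArr ladj g) (onArr ladj f)"
    by (rule ladj_eqI[OF B.Comp_in[OF ladj(1)[OF f] ladj(1)[OF g]]])
      (use Hom_obj(1)[OF f] Hom_obj(1)[OF g] in \<open>auto simp: functorD(6)[OF L ladj(1)[OF f] ladj(1)[OF g]] ladj(2)[OF f] ladj(2)[OF g]\<close>)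
qed

text \<open>Since the unit is an identity, \<open>L\<close> itself is the inverse on homs.\<close>

lemma fully_faithful_ladj: "fully_faithful A B ladj"
  unfolding fully_faithful_def onObj_ladj
proof (intro conjI ballI is_functor_ladj)
  fix X Y assume X: "X \<in> Obj A" "Y \<in> Obj A"
  show "bij_betw (onArr ladj) (Hom A X Y) (Hom B (R0 X) (R0 Y))"
  proof (rule bij_betw_byWitness[where f' = "onArr L"])
    show "\<forall>f \<in> Hom A X Y. onArr L (onArr ladj f) = f" using ladj(2) by blast
    show "\<forall>g \<in> Hom B (R0 X) (R0 Y). onArr ladj (onArr L g) = g" using ladj_eqI X by blast
    show "onArr ladj ` Hom A X Y \<subseteq> Hom B (R0 X) (R0 Y)" using ladj(1) by blast
    show "onArr L ` Hom B (R0 X) (R0 Y) \<subseteq> Hom A X Y" using functorD(4)[OF L] LR0 X by force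
  qed
qed

lemma section_ladj: "fnctr_eq A A (comp_fnctr L ladj) id_fnctr"
proof -
  have a: "onArr L (onArr ladj f) = f" if "f \<in> Arr A" for f
    using ladj(2)[of f "Dom A f" "Cod A f"] that by (simp add: in_Hom)
  have i: "is_functor A A id_fnctr"
    by (auto simp: is_functor_def id_fnctr_def A.category_axioms)
  show ?thesis
    unfolding fnctr_eq_def using is_functor_comp[OF is_functor_ladj L] i
    by (simp add: comp_fnctr_def id_fnctr_def a LR0)
qed

text \<open>The counit at \<open>Y\<close> is the unique arrow out of \<open>R0 (onObj L Y)\<close>
  over the identity. Its naturality and its value at \<open>R0 X\<close> are then checked after
  applying \<open>L\<close>.\<close>

lemma adjunction_ladj: "\<exists>\<epsilon>. adjunction A B ladj L (Id A) \<epsilon>"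
proof -
  have ex: "\<exists>!g. g \<in> Hom B (R0 (onObj L Y)) Y \<and> onArr L g = Id A (onObj L Y)" if "Y \<in> Obj B" for Y
    by (rule universal) (use that functorD(3)[OF L] A.Id_in in auto)
  define \<epsilon> where "\<epsilon> Y = (THE g. g \<in> Hom B (R0 (onObj L Y)) Y \<and> onArr L g = Id A (onObj L Y))" for Y
  have \<epsilon>: "\<epsilon> Y \<in> Hom B (R0 (onObj L Y)) Y" "onArr L (\<epsilon> Y) = Id A (onObj L Y)" if "Y \<in> Obj B" for Y
    using theI'[OF ex[OF that]] unfolding \<epsilon>_def by blast+
  have o: "onObj L Y \<in> Obj A" if "Y \<in> Obj B" for Y using functorD(3)[OF L that] .
  have "adjunction A B ladj L (Id A) \<epsilon>"
    unfolding adjunction_def is_nat_trans_def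
  proof (intro conjI ballI allI is_functor_ladj L)
    fix X assume "X \<in> Obj A"
    then show "Id A X \<in> Hom A (onObj id_fnctr X) (onObj (comp_fnctr L ladj) X)"
      using A.Id_in by (simp add: id_fnctr_def comp_fnctr_def LR0)
  next
    fix X Y f assume f: "f \<in> Hom A X Y"
    show "Comp A (Id A Y) (onArr id_fnctr f) = Comp A (onArr (comp_fnctr L ladj) f) (Id A X)"
      using A.Id_left[OF f] A.Id_right[OF f] ladj(2)[OF f] by (simp add: id_fnctr_def comp_fnctr_def)
  next
    fix Y assume "Y \<in> Obj B"
    then show "\<epsilon> Y \<in> Hom B (onObj (comp_fnctr ladj L) Y) (onObj id_fnctr Y)"
      using \<epsilon> by (simp add: id_fnctr_def comp_fnctr_def)
  next
    fix Y Z g assume g: "g \<in> Hom B Y Z"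
    then have Y: "Y \<in> Obj B" and Z: "Z \<in> Obj B" using Hom_obj by blast+
    note Lg = functorD(4)[OF L g]
    have "Comp B (\<epsilon> Z) (onArr ladj (onArr L g)) = Comp B g (\<epsilon> Y)"
    proof (rule unique[OF o[OF Y]])
      show "Comp B (\<epsilon> Z) (onArr ladj (onArr L g)) \<in> Hom B (R0 (onObj L Y)) Z"
        by (rule B.Comp_in[OF ladj(1)[OF Lg] \<epsilon>(1)[OF Z]])
      show "Comp B g (\<epsilon> Y) \<in> Hom B (R0 (onObj L Y)) Z"
        by (rule B.Comp_in[OF \<epsilon>(1)[OF Y] g])
      show "onArr L (Comp B (\<epsilon> Z) (onArr ladj (onArr L g))) = onArr L (Comp B g (\<epsilon> Y))"
        by (simp add: functorD(6)[OF L ladj(1)[OF Lg] \<epsilon>(1)[OF Z]] functorD(6)[OF L \<epsilon>(1)[OF Y] g] \<epsilon>(2) Y Z ladj(2)[OF Lg]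
          A.Id_left[OF Lg] A.Id_right[OF Lg])
    qed
    then show "Comp B (\<epsilon> Z) (onArr (comp_fnctr ladj L) g) = Comp B (onArr id_fnctr g) (\<epsilon> Y)"
      by (simp add: id_fnctr_def comp_fnctr_def)
  next
    fix X assume X: "X \<in> Obj A"
    have "\<epsilon> (R0 X) = Id B (R0 X)"
      by (rule unique[OF X _ B.Id_in[OF R0[OF X]]]) (use \<epsilon>[OF R0[OF X]] X in \<open>simp_all add: LR0 functorD(5)[OF L R0[OF X]]\<close>)
    then show "Comp B (\<epsilon> (onObj ladj X)) (onArr ladj (Id A X)) = Id B (onObj ladj X)"
      using functorD(5)[OF is_functor_ladj X] B.Id_left[OF B.Id_in[OF R0[OF X]]] by simp
  next
    fix Y assume Y: "Y \<in> Obj B"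
    show "Comp A (onArr L (\<epsilon> Y)) (Id A (onObj L Y)) = Id A (onObj L Y)"
      by (simp add: \<epsilon>(2)[OF Y] A.Id_left[OF A.Id_in[OF o[OF Y]]])
  qed
  then show ?thesis by blast
qed

text \<open>Since \<open>R\<close> is \<open>L\<close> after the involution \<open>S\<close>, an
  arrow from \<open>X\<close> to \<open>R(Y)\<close> is one from \<open>X\<close> to
  \<open>L(S(Y))\<close>. Its unique extension from \<open>R0 X\<close> to \<open>S(Y)\<close> is
  carried by \<open>S\<close> to an arrow from \<open>Y\<close> to \<open>S(R0 X)\<close>, that is,
  in the other direction in \<open>op_cat B\<close>.\<close>

lemma strict_universal_dual:
  assumes S: "is_functor B (op_cat B) S" and SS: "\<And>Y. Y \<in> Obj B \<Longrightarrow> onObj S (onObj S Y) = Y" "\<And>g. g \<in> Arr B \<Longrightarrow> onArr S (onArr S g) = g"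
    and R: "\<And>Y. Y \<in> Obj B \<Longrightarrow> onObj R Y = onObj L (onObj S Y)" "\<And>g. g \<in> Arr B \<Longrightarrow> onArr R g = onArr L (onArr S g)"
  shows "strict_universal A (op_cat B) R (\<lambda>X. onObj S (R0 X))"
proof
  have "is_functor B (op_cat A) (comp_fnctr L S)" by (rule is_functor_comp[OF S is_functor_op[OF L]])
  then have "is_functor B (op_cat A) R" by (rule is_functor_cong) (simp_all add: R comp_fnctr_def)
  from is_functor_op[OF this] show "is_functor (op_cat B) A R" by simp
next
  have So: "onObj S Y \<in> Obj B" if "Y \<in> Obj B" for Y using functorD(3)[OF S that] by simp
  have Sa: "onArr S g \<in> Hom B (onObj S Z) (onObj S Y)" if "g \<in> Hom B Y Z" for g Y Z using functorD(4)[OF S that] by simp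
  fix X assume X: "X \<in> Obj A"
  show "onObj S (R0 X) \<in> Obj (op_cat B)" using So[OF R0[OF X]] by simp
  show "onObj R (onObj S (R0 X)) = X" by (simp add: R(1)[OF So[OF R0[OF X]]] SS(1)[OF R0[OF X]] LR0[OF X])
  fix Y f assume "Y \<in> Obj (op_cat B)" and f: "f \<in> Hom A X (onObj R Y)"
  then have Y: "Y \<in> Obj B" by simp
  have "f \<in> Hom A X (onObj L (onObj S Y))" using f by (simp add: R(1)[OF Y])
  from universal[OF X So[OF Y] this] obtain g where g: "g \<in> Hom B (R0 X) (onObj S Y)" "onArr L g = f"
    by blast
  have ga: "g \<in> Arr B" using g by (simp add: in_Hom)
  have Sg: "onArr S g \<in> Hom B Y (onObj S (R0 X))" using Sa[OF g(1)] by (simp add: SS(1)[OF Y])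
  show "\<exists>!h. h \<in> Hom (op_cat B) (onObj S (R0 X)) Y \<and> onArr R h = f"
  proof (rule ex1I[of _ "onArr S g"])
    have "onArr S g \<in> Arr B" using Sg by (simp add: in_Hom)
    then show "onArr S g \<in> Hom (op_cat B) (onObj S (R0 X)) Y \<and> onArr R (onArr S g) = f"
      using Sg g(2) by (simp add: R(2) SS(2)[OF ga])
  next
    fix h assume "h \<in> Hom (op_cat B) (onObj S (R0 X)) Y \<and> onArr R h = f"
    then have h: "h \<in> Hom B Y (onObj S (R0 X))" "onArr R h = f" by simp_all
    have ha: "h \<in> Arr B" using h by (simp add: in_Hom)
    have "onArr S h \<in> Hom B (R0 X) (onObj S Y)" using Sa[OF h(1)] by (simp add: SS(1)[OF R0[OF X]])
    then have "onArr S h = g" by (rule unique[OF X _ g(1)]) (use h(2) g(2) in \<open>simp add: R(2)[OF ha]\<close>)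
    then show "h = onArr S g" using SS(2)[OF ha] by simp
  qed
qed

end

section \<open>The face functors\<close>

lemma swap_fob [simp]: "k \<in> vob C \<Longrightarrow> j \<in> vob B \<Longrightarrow> fob (swap_vfun V B C D) (k, j) = fob D (j, k)"
  by (simp add: swap_vfun_def)

lemma swap_ext [simp]: "vfun_ext (vob C \<times> vob B) (swap_vfun V B C D)"
  by (simp add: vfun_ext_def swap_vfun_def)

context symmetric_monoidal_closed
begin

lemma swap_fhom:
  assumes D: "vfunctor V (vtensor V B B') C D" and [simp]: "vcategory V B" "vcategory V B'" "vcategory V C"
    and [simp]: "x \<in> vob B" "y \<in> vob B" "k \<in> vob B'" "l \<in> vob B'"
  shows "fhom (swap_vfun V B B' D) (k, x) (l, y) \<in> Arr V"
    "Dom V (fhom (swap_vfun V B B' D) (k, x) (l, y)) = vhom B' k l \<otimes> vhom B x y"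
    "Cod V (fhom (swap_vfun V B B' D) (k, x) (l, y)) = vhom C (fob D (x, k)) (fob D (y, l))"
    "\<lbrakk>elt u; ty u = vhom B' k l; elt t; ty t = vhom B x y; dj u t; dj t u\<rbrakk> \<Longrightarrow>
      app (fhom (swap_vfun V B B' D) (k, x) (l, y)) (pr u t) = app (fhom D (x, k) (y, l)) (pr t u)"
  using vfunD2(2-4)[OF assms(1-4), of x y k l] by (simp_all add: swap_vfun_def)

lemma vfunctor_swap:
  assumes D: "vfunctor V (vtensor V B B') C D" and [simp]: "vcategory V B" "vcategory V B'" "vcategory V C"
  shows "vfunctor V (vtensor V B' B) C (swap_vfun V B B' D)"
proof -
  note [simp] = vfunD2[OF assms] swap_fhom[OF assms]
  show ?thesis by (rule vfunctorI2) (simp_all add: in_Hom)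
qed

text \<open>These are equalities and not just isomorphisms of partial functors, which makes the
  right face literally the left face after the exchange.\<close>

lemma fix_swap:
  assumes D: "vfunctor V (vtensor V B B') C D" and [simp]: "vcategory V B" "vcategory V B'" "vcategory V C"
  shows "x \<in> vob B \<Longrightarrow> fix_right V B' B (swap_vfun V B B' D) x = fix_left V B B' D x"
    "k \<in> vob B' \<Longrightarrow> fix_left V B' B (swap_vfun V B B' D) k = fix_right V B B' D k"
proof -
  note [simp] = vfunD2(1-4)[OF assms] swap_fhom[OF assms] fix_fhom[OF assms] fix_fhom[OF vfunctor_swap[OF assms]]
  show "fix_right V B' B (swap_vfun V B B' D) x = fix_left V B B' D x" if [simp]: "x \<in> vob B"
  proof (rule vfun_eqI[of "vob B'"])
    fix k l assume [simp]: "k \<in> vob B'" "l \<in> vob B'"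
    show "fhom (fix_right V B' B (swap_vfun V B B' D) x) k l = fhom (fix_left V B B' D x) k l"
      by (rule arr_eqI[of _ _ "vhom B' k l"]) simp_all
  qed simp_all
  show "fix_left V B' B (swap_vfun V B B' D) k = fix_right V B B' D k" if [simp]: "k \<in> vob B'"
  proof (rule vfun_eqI[of "vob B"])
    fix x y assume [simp]: "x \<in> vob B" "y \<in> vob B"
    show "fhom (fix_left V B' B (swap_vfun V B B' D) k) x y = fhom (fix_right V B B' D k) x y"
      by (rule arr_eqI[of _ _ "vhom B x y"]) simp_all
  qed simp_all
qed

lemma swap_swap:
  assumes D: "vfunctor V (vtensor V B B') C D" and [simp]: "vcategory V B" "vcategory V B'" "vcategory V C"
  shows "swap_vfun V B' B (swap_vfun V B B' D) = D"
proof (rule vfun_eqI)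
  show "vfun_ext (vob B \<times> vob B') D" using vfunctor_ext[OF D] by simp
  show "vfun_ext (vob B \<times> vob B') (swap_vfun V B' B (swap_vfun V B B' D))" by simp
  fix p assume p: "p \<in> vob B \<times> vob B'"
  then show "fob (swap_vfun V B' B (swap_vfun V B B' D)) p = fob D p" by auto
  fix q assume q: "q \<in> vob B \<times> vob B'"
  show "fhom (swap_vfun V B' B (swap_vfun V B B' D)) p q = fhom D p q"
    using p q vfunD2(2-3)[OF assms] by (auto simp: swap_vfun_def)
qed

end

context admissible
begin

abbreviation SW where "SW T U D \<equiv> swap_vfun V (tcat T) (tcat U) D"

lemma swap_balg_simps [simp]: "swap_balg V (T, U, D) = (U, T, SW T U D)"
  by (simp add: swap_balg_def)

lemma SW_simps:
  assumes D: "balg T U D" and [simp]: "Th T" "Th U"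
  shows "balg U T (SW T U D)" "\<And>k x. k \<in> J \<Longrightarrow> x \<in> J \<Longrightarrow> fob (SW T U D) (k, x) = fob D (x, k)"
    "\<And>x. x \<in> J \<Longrightarrow> FR U T (SW T U D) x = FL T U D x" "\<And>k. k \<in> J \<Longrightarrow> FL U T (SW T U D) k = FR T U D k"
    "SW U T (SW T U D) = D"
proof -
  note F = balgD(1)[OF D \<open>Th T\<close> \<open>Th U\<close>]
  show "\<And>k x. k \<in> J \<Longrightarrow> x \<in> J \<Longrightarrow> fob (SW T U D) (k, x) = fob D (x, k)" by simp
  show 1: "\<And>x. x \<in> J \<Longrightarrow> FR U T (SW T U D) x = FL T U D x" "\<And>k. k \<in> J \<Longrightarrow> FL U T (SW T U D) k = FR T U D k"
    using fix_swap[OF F] by simp_all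
  show "SW U T (SW T U D) = D" by (rule swap_swap[OF F]) simp_all
  show "balg U T (SW T U D)"
    using D vfunctor_swap[OF F] by (simp add: is_bialgebra_def 1)
qed

text \<open>The third component of the involution on arrows, with the identity-on-objects maps of
  \<open>M\<close> and \<open>N\<close> already simplified away.\<close>

definition circ_nat where
  "circ_nat D E f = (\<lambda>(K, X) \<in> J \<times> J. uinv V C (fob D (X, K)) (fob E (X, K)) (f (X, K)))"

lemma circ_arr:
  assumes M: "tmor T T' M" and N: "tmor U' U N" and [simp]: "Th T" "Th T'" "Th U" "Th U'"
  shows "onArr (circ_functor V J C) \<lparr>src = (T, U, D), tgt = (T', U', E), dat = (M, N, f)\<rparr>
    = \<lparr>src = (U', T', SW T' U' E), tgt = (U, T, SW T U D), dat = (N, M, circ_nat D E f)\<rparr>"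
proof -
  note [simp] = tmorD(2)[OF M] tmorD(2)[OF N]
  show ?thesis by (auto simp: circ_functor_def circ_nat_def restrict_def fun_eq_iff)
qed

text \<open>Both naturality conditions pass to the inverse components by \<open>inv_nat\<close>, and
  the exchange of variables turns each condition into the other.\<close>

lemma scmor_swap:
  assumes f: "scmor T U D T' U' E M N f" and [simp]: "Th T" "Th T'" "Th U" "Th U'" and D: "balg T U D" and E: "balg T' U' E"
  shows "scmor U' T' (SW T' U' E) U T (SW T U D) N M (circ_nat D E f)"
proof -
  note [simp] = balgD(4-12)[OF D] balgD(4-12)[OF E] tmorD(2-5)[OF scmorD(1)[OF f]] tmorD(2-5)[OF scmorD(2)[OF f]]
  note [simp] = SW_simps(2-4)[OF D] SW_simps(2-4)[OF E]
  have [simp]: "circ_nat D E f (K, X) = uinv V C (fob D (X, K)) (fob E (X, K)) (f (X, K))" if "K \<in> J" "X \<in> J" for K X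
    using that by (simp add: circ_nat_def)
  show ?thesis
    unfolding scmor_def
  proof (intro conjI ballI allI impI)
    show "circ_nat D E f \<in> extensional (J \<times> J)" by (simp add: circ_nat_def)
    fix K X assume "K \<in> J" "X \<in> J"
    then show "ciso C (fob (SW T' U' E) (K, X)) (fob (SW T U D) (K, X)) (circ_nat D E f (K, X))"
      using uinv(7)[OF scmorD(4)[OF f]] by simp
  next
    fix K L X u assume [simp]: "K \<in> J" "L \<in> J" "X \<in> J" "elt u" "ty u = vhom (tcat U') K L"
    have "cmp C (fob E (X, K)) (fob E (X, L)) (fob D (X, L)) (gl (uinv V C (fob D (X, L)) (fob E (X, L)) (f (X, L)))) (app (fhom (FL T' U' E X) K L) u)
      = cmp C (fob E (X, K)) (fob D (X, K)) (fob D (X, L)) (app (fhom (FL T U D X) K L) (app (fhom N K L) u)) (gl (uinv V C (fob D (X, K)) (fob E (X, K)) (f (X, K))))"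
      by (rule inv_nat[OF scmorD(4)[OF f] scmorD(4)[OF f]]) (simp_all add: scmorD(6)[OF f])
    then show "cmp C (fob (SW T' U' E) (K, X)) (fob (SW T' U' E) (L, X)) (fob (SW T U D) (L, X)) (gl (circ_nat D E f (L, X))) (app (fhom (FR U' T' (SW T' U' E) X) K L) u)
      = cmp C (fob (SW T' U' E) (K, X)) (fob (SW T U D) (K, X)) (fob (SW T U D) (L, X)) (app (fhom (FR U T (SW T U D) X) K L) (app (fhom N K L) u)) (gl (circ_nat D E f (K, X)))"
      by simp
  next
    fix K X Y t assume [simp]: "K \<in> J" "X \<in> J" "Y \<in> J" "elt t" "ty t = vhom (tcat T) X Y"
    have "cmp C (fob E (X, K)) (fob E (Y, K)) (fob D (Y, K)) (gl (uinv V C (fob D (Y, K)) (fob E (Y, K)) (f (Y, K)))) (app (fhom (FR T' U' E K) X Y) (app (fhom M X Y) t))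
      = cmp C (fob E (X, K)) (fob D (X, K)) (fob D (Y, K)) (app (fhom (FR T U D K) X Y) t) (gl (uinv V C (fob D (X, K)) (fob E (X, K)) (f (X, K))))"
      by (rule inv_nat[OF scmorD(4)[OF f] scmorD(4)[OF f]]) (simp_all add: scmorD(5)[OF f])
    then show "cmp C (fob (SW T' U' E) (K, X)) (fob (SW T' U' E) (K, Y)) (fob (SW T U D) (K, Y)) (gl (circ_nat D E f (K, Y))) (app (fhom (FL U' T' (SW T' U' E) K) X Y) (app (fhom M X Y) t))
      = cmp C (fob (SW T' U' E) (K, X)) (fob (SW T U D) (K, X)) (fob (SW T U D) (K, Y)) (app (fhom (FL U T (SW T U D) K) X Y) t) (gl (circ_nat D E f (K, X)))"
      by simp
  qed (use scmorD(1,2)[OF f] in simp_all)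
qed

lemma onObj_circ [simp]: "onObj (circ_functor V J C) = swap_balg V"
  by (simp add: circ_functor_def)

lemma is_functor_circ: "is_functor (BAlg_sc V J C) (op_cat (BAlg_sc V J C)) (circ_functor V J C)"
  unfolding is_functor_def onObj_circ
proof (intro conjI ballI allI category_BAlg category_op)
  fix X assume "X \<in> Obj (BAlg_sc V J C)"
  then obtain T U D where X: "X = (T, U, D)" and [simp]: "Th T" "Th U" and D: "balg T U D" by (auto simp: BAlg_obj)
  note [simp] = balgD(6)[OF D] SW_simps(2)[OF D]
  show "swap_balg V X \<in> Obj (op_cat (BAlg_sc V J C))" by (simp add: X SW_simps(1)[OF D])
  have "circ_nat D D (\<lambda>p \<in> J \<times> J. vid C (fob D p)) = (\<lambda>p \<in> J \<times> J. vid C (fob (SW T U D) p))"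
    unfolding circ_nat_def by (rule restrict_ext) (auto simp: uinv_id)
  then show "onArr (circ_functor V J C) (Id (BAlg_sc V J C) X) = Id (op_cat (BAlg_sc V J C)) (swap_balg V X)"
    by (simp add: X circ_arr tmor_id)
next
  fix X Y m assume "m \<in> Hom (BAlg_sc V J C) X Y"
  then obtain T U D T' U' D' M N f where X: "X = (T, U, D)" "Y = (T', U', D')"
    "m = \<lparr>src = (T, U, D), tgt = (T', U', D'), dat = (M, N, f)\<rparr>"
    and [simp]: "Th T" "Th T'" "Th U" "Th U'" and D: "balg T U D" "balg T' U' D'" and f: "scmor T U D T' U' D' M N f"
    by (auto simp: in_Hom BAlg_arr_iff)
  show "onArr (circ_functor V J C) m \<in> Hom (op_cat (BAlg_sc V J C)) (swap_balg V X) (swap_balg V Y)"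
    using scmor_swap[OF f _ _ _ _ D] SW_simps(1)[OF D(1)] SW_simps(1)[OF D(2)]
    by (simp add: X circ_arr[OF scmorD(1)[OF f] scmorD(2)[OF f]] in_Hom BAlg_arr_iff)
next
  fix X Y Z m n assume "m \<in> Hom (BAlg_sc V J C) X Y" "n \<in> Hom (BAlg_sc V J C) Y Z"
  then obtain T U D T' U' D' T'' U'' D'' M N f M' N' g where X:
    "m = \<lparr>src = (T, U, D), tgt = (T', U', D'), dat = (M, N, f)\<rparr>" "n = \<lparr>src = (T', U', D'), tgt = (T'', U'', D''), dat = (M', N', g)\<rparr>"
    and T [simp]: "Th T" "Th T'" "Th T''" "Th U" "Th U'" "Th U''" and D: "balg T U D" "balg T' U' D'" "balg T'' U'' D''"
    and f: "scmor T U D T' U' D' M N f" and g: "scmor T' U' D' T'' U'' D'' M' N' g"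
    by (auto simp: in_Hom BAlg_arr_iff)
  note t = scmorD(1)[OF f] scmorD(1)[OF g] and u = scmorD(2)[OF f] scmorD(2)[OF g]
  note [simp] = balgD(6)[OF D(1)] balgD(6)[OF D(2)] balgD(6)[OF D(3)] SW_simps(2)[OF D(1)] SW_simps(2)[OF D(2)] SW_simps(2)[OF D(3)]
  have "circ_nat D D'' (\<lambda>p \<in> J \<times> J. ucomp V C (fob D p) (fob D' p) (fob D'' p) (g p) (f p))
    = (\<lambda>p \<in> J \<times> J. ucomp V C (fob (SW T'' U'' D'') p) (fob (SW T' U' D') p) (fob (SW T U D) p) (circ_nat D D' f p) (circ_nat D' D'' g p))"
    unfolding circ_nat_def by (rule restrict_ext) (auto simp: ciso_comp(2)[OF scmorD(4)[OF f] scmorD(4)[OF g]])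
  then show "onArr (circ_functor V J C) (Comp (BAlg_sc V J C) n m)
    = Comp (op_cat (BAlg_sc V J C)) (onArr (circ_functor V J C) n) (onArr (circ_functor V J C) m)"
    by (simp add: X BAlg_comp[OF t u] BAlg_comp[OF u(2,1) t(2,1)] circ_arr[OF t(1) u(1)] circ_arr[OF t(2) u(2)]
      circ_arr[OF tmor_comp[OF t] tmor_comp[OF u(2,1)]])
qed

lemma circ_circ:
  assumes "m \<in> Arr (BAlg_sc V J C)"
  shows "onArr (circ_functor V J C) (onArr (circ_functor V J C) m) = m"
proof -
  obtain T U D T' U' D' M N f where X: "m = \<lparr>src = (T, U, D), tgt = (T', U', D'), dat = (M, N, f)\<rparr>"
    and [simp]: "Th T" "Th T'" "Th U" "Th U'" and D: "balg T U D" "balg T' U' D'" and f: "scmor T U D T' U' D' M N f"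
    using assms by (auto simp: BAlg_arr_iff)
  note [simp] = balgD(6)[OF D(1)] balgD(6)[OF D(2)] SW_simps(2,5)[OF D(1)] SW_simps(2,5)[OF D(2)]
  have "circ_nat (SW T' U' D') (SW T U D) (circ_nat D D' f) = f"
  proof (rule ext_eqI[OF _ scmorD(3)[OF f]])
    fix p assume "p \<in> J \<times> J"
    then show "circ_nat (SW T' U' D') (SW T U D) (circ_nat D D' f) p = f p"
      by (auto simp: circ_nat_def uinv_uinv[OF scmorD(4)[OF f]])
  qed (simp add: circ_nat_def)
  then show ?thesis
    by (simp add: X circ_arr[OF scmorD(1,2)[OF f]] circ_arr[OF scmorD(2,1)[OF f]])
qed

text \<open>Inverting all components and then fixing one variable at \<open>\<one>\<close> is the
  same as fixing it first. So the right face needs no extension argument of its own.\<close>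

lemma right_face_arr:
  assumes "m \<in> Arr (BAlg_sc V J C)"
  shows "onArr (R_functor V J C) m = onArr (L_functor V J) (onArr (circ_functor V J C) m)"
proof -
  obtain T U D T' U' D' M N f where X: "m = \<lparr>src = (T, U, D), tgt = (T', U', D'), dat = (M, N, f)\<rparr>"
    and [simp]: "Th T" "Th T'" "Th U" "Th U'" and D: "balg T U D" "balg T' U' D'" and f: "scmor T U D T' U' D' M N f"
    using assms by (auto simp: BAlg_arr_iff)
  note [simp] = tmorD(2)[OF scmorD(1)[OF f]] tmorD(2)[OF scmorD(2)[OF f]]
  show ?thesis
    using SW_simps(3)[OF D(1)] SW_simps(3)[OF D(2)]
    by (simp add: X circ_arr[OF scmorD(1,2)[OF f]] L_functor_def R_functor_def circ_nat_def cong: restrict_cong)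
qed

lemma right_face_swap:
  assumes "Y \<in> Obj (BAlg_sc V J C)"
  shows "right_face V Y = left_face V (swap_balg V Y)" "left_face V Y = right_face V (swap_balg V Y)" "swap_balg V (swap_balg V Y) = Y"
  using assms by (auto simp: BAlg_obj SW_simps)

end

section \<open>Both adjunctions from the universal property of the left face\<close>

theorem theorem8p1:
  fixes V :: "('v, 'm) smc"
    and J :: "'v set"
    and C :: "('v, 'm, 'c) vcat"
    and ct :: "'v \<Rightarrow> 'c \<Rightarrow> 'c \<times> 'm"
  assumes "symmetric_monoidal_closed V"
    and "system_of_arities V J"
    and "has_pullbacks V"
    and "J_admissible V J C ct"
  shows "\<exists>RCom LCom.
    (\<exists>\<epsilon>. adjunction (Alg_s V J C) (BAlg_sc V J C) RCom (L_functor V J) (Id (Alg_s V J C)) \<epsilon>) \<and>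
    fully_faithful (Alg_s V J C) (BAlg_sc V J C) RCom \<and>
    (\<exists>\<eta>. adjunction (BAlg_sc V J C) (op_cat (Alg_s V J C)) (R_functor V J C) LCom
           \<eta> (Id (op_cat (Alg_s V J C)))) \<and>
    fully_faithful (op_cat (Alg_s V J C)) (BAlg_sc V J C) LCom \<and>
    (\<forall>A \<in> Obj (Alg_s V J C).
       left_face V (onObj RCom A) = A \<and>
       right_face V (onObj RCom A) = commutant V J C ct A \<and>
       left_face V (onObj LCom A) = commutant V J C ct A \<and>
       right_face V (onObj LCom A) = A) \<and>
    fnctr_eq (Alg_s V J C) (Alg_s V J C) (comp_fnctr (L_functor V J) RCom) id_fnctr \<and>
    fnctr_eq (op_cat (Alg_s V J C)) (op_cat (Alg_s V J C))
      (comp_fnctr (R_functor V J C) LCom) id_fnctr \<and>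
    fnctr_eq (Alg_s V J C) (op_cat (BAlg_sc V J C))
      (comp_fnctr (circ_functor V J C) RCom) (op_fnctr LCom)"
proof -
  interpret admissible V J C ct
    using assms by (simp add: admissible_def arity_system_def arity_system_axioms_def admissible_axioms_def)
  let ?A = "Alg_s V J C" and ?B = "BAlg_sc V J C" and ?S = "circ_functor V J C"
  \<comment> \<open>The object part of \<open>RCom\<close>; its action on arrows is
    \<open>L.ladj\<close>, obtained from the universal property.\<close>
  define R0 where "R0 X = (fst X, CT (fst X) (snd X), RD (fst X) (snd X))" for X
  have R0: "R0 X \<in> Obj ?B" "left_face V (R0 X) = X" "right_face V (R0 X) = commutant V J C ct X" if X: "X \<in> Obj ?A" for X
  proof -
    obtain T A where "X = (T, A)" "Th T" "alg T A" using X by (auto simp: Alg_obj)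
    then show "R0 X \<in> Obj ?B" "left_face V (R0 X) = X" "right_face V (R0 X) = commutant V J C ct X"
      unfolding R0_def using RD_obj[of T A] by simp_all
  qed
  have oL: "onObj (L_functor V J) = left_face V" and oR: "onObj (R_functor V J C) = right_face V"
    by (simp_all add: L_functor_def R_functor_def)
  interpret L: strict_universal ?A ?B "L_functor V J" R0
  proof
    fix X Y f assume "X \<in> Obj ?A" "Y \<in> Obj ?B" "f \<in> Hom ?A X (onObj (L_functor V J) Y)"
    then show "\<exists>!g. g \<in> Hom ?B (R0 X) Y \<and> onArr (L_functor V J) g = f"
      unfolding R0_def oL by (rule left_face_universal)
  qed (simp_all add: is_functor_L R0 oL del: Alg_simps BAlg_simps)
  \<comment> \<open>The involution transports the universal arrows of \<open>L\<close> to universal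
    arrows of the right face functor in the opposite of \<open>?B\<close>. The functor
    \<open>R.ladj\<close> serves as \<open>LCom\<close>.\<close>
  interpret R: strict_universal ?A "op_cat ?B" "R_functor V J C" "\<lambda>X. onObj ?S (R0 X)"
    by (rule L.strict_universal_dual[OF is_functor_circ])
      (simp_all add: circ_circ right_face_arr oL oR right_face_swap del: Alg_simps BAlg_simps)
  obtain \<epsilon> where \<epsilon>: "adjunction ?A ?B L.ladj (L_functor V J) (Id ?A) \<epsilon>" using L.adjunction_ladj by blast
  obtain \<eta> where "adjunction ?A (op_cat ?B) R.ladj (R_functor V J C) (Id ?A) \<eta>" using R.adjunction_ladj by blast
  \<comment> \<open>\<open>R.ladj\<close> is a left adjoint into the opposite of \<open>?B\<close>.
    Reversing arrows makes it the right adjoint of the right face functor, and its identity unit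
    becomes the counit.\<close>
  from adjunction_op[OF this] have \<eta>: "adjunction ?B (op_cat ?A) (R_functor V J C) R.ladj \<eta> (Id (op_cat ?A))" by simp
  have ffR: "fully_faithful (op_cat ?A) ?B R.ladj"
    using R.fully_faithful_ladj is_functor_op[OF R.is_functor_ladj] unfolding fully_faithful_def by auto
  have secR: "fnctr_eq (op_cat ?A) (op_cat ?A) (comp_fnctr (R_functor V J C) R.ladj) id_fnctr"
    using R.section_ladj is_functor_op[of ?A ?A] unfolding fnctr_eq_def by auto
  \<comment> \<open>Applying the involution twice does nothing, so both arrows lie over
    \<open>f\<close> under the right face functor, and universality identifies them.\<close>
  have arr: "onArr ?S (onArr L.ladj f) = onArr R.ladj f" if "f \<in> Arr ?A" for f
  proof (rule R.ladj_eqI[symmetric])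
    have f: "f \<in> Hom ?A (Dom ?A f) (Cod ?A f)" using that by (simp add: in_Hom del: Alg_simps)
    note lf = L.ladj[OF f]
    show "onArr ?S (onArr L.ladj f) \<in> Hom (op_cat ?B) (onObj ?S (R0 (Dom ?A f))) (onObj ?S (R0 (Cod ?A f)))"
      by (rule functorD(4)[OF is_functor_circ lf(1)])
    show "Dom ?A f \<in> Obj ?A" "Cod ?A f \<in> Obj ?A" using L.Hom_obj(1)[OF f] by blast+
    have a: "onArr L.ladj f \<in> Arr ?B" "onArr ?S (onArr L.ladj f) \<in> Arr ?B"
      using lf(1) functorD(4)[OF is_functor_circ lf(1)] by (auto simp: in_Hom)
    show "onArr (R_functor V J C) (onArr ?S (onArr L.ladj f)) = f"
      by (simp add: right_face_arr[OF a(2)] circ_circ[OF a(1)] lf(2))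
  qed
  have circ: "fnctr_eq ?A (op_cat ?B) (comp_fnctr ?S L.ladj) (op_fnctr R.ladj)"
    unfolding fnctr_eq_def op_fnctr_def
    using is_functor_comp[OF L.is_functor_ladj is_functor_circ] R.is_functor_ladj
    by (simp add: comp_fnctr_def arr del: Alg_simps BAlg_simps onObj_circ)
  have oS: "onObj R.ladj A = swap_balg V (R0 A)" for A by (subst R.onObj_ladj) simp
  have faces: "left_face V (onObj L.ladj A) = A \<and> right_face V (onObj L.ladj A) = commutant V J C ct A \<and>
       left_face V (onObj R.ladj A) = commutant V J C ct A \<and> right_face V (onObj R.ladj A) = A" if "A \<in> Obj ?A" for A
    unfolding oS L.onObj_ladj using R0[OF that] right_face_swap[OF R0(1)[OF that]] by simp
  show ?thesis
    by (intro exI[of _ L.ladj] exI[of _ R.ladj] conjI ballI faces exI[of _ \<epsilon>] exI[of _ \<eta>])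
      (rule \<epsilon> L.fully_faithful_ladj \<eta> ffR L.section_ladj secR circ | assumption)+
qed

end
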